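(* Let $1\le a\le5$, $0\le\beta\le1$, $s\ge0$. Suppose that one of the following holds: (i) $\beta>\frac{a-1}{4}$; (ii) $s<4\beta+3-\frac a2$; (iii) $s=4\beta+3-\frac a2$ and $\beta=\frac{a-1}{4}$. Then there exists an initial datum $f_0\in L^\infty_s$ such that for no $T>0$ does there exist a strong solution $f\in C([0,T];L^\infty_s)$ of $\partial_tf=\mathcal C[f]$ on $[0,T]$ with $f(0)=f_0$.
   Context: Notation: $\langle x\rangle=(1+|x|^2)^{1/2}$, and $L^\infty_s=\{f\in C(\mathbb R^3):\|f\|_{L^\infty_s}:=\sup_{x}\langle x\rangle^s|f(x)|<\infty\}$. The collision operator is, with $f=f(p)$ and $f_i=f(p_i)$, $$\mathcal C[f](p)=|p|^{2\beta}\iiint_{\mathbb R^9}|p_1|^{2\beta}|p_2|^{2\beta}|p_3|^{2\beta}\,\big(f_1f_2f_3+f f_2f_3-f f_1f_2-f f_1f_3\big)\,\delta(p+p_1-p_2-p_3)\,\delta\big(|p|^a+|p_1|^a-|p_2|^a-|p_3|^a\big)\,dp_1dp_2dp_3,$$ where the gain and loss terms are integrated together. Meaning of the delta functions: for $p,p_1\in\mathbb R^3$ put $p_3=p+p_1-p_2$, $\Phi(p_2)=|p+p_1-p_2|^a+|p_2|^a-|p|^a-|p_1|^a$, $\mathcal S_{p,p_1}=\{p_2:\Phi(p_2)=0\}$, and let $\mu$ be surface measure on $\mathcal S_{p,p_1}$. Then $\iiint F\,\delta(p+p_1-p_2-p_3)\delta(\cdots)\,dp_1dp_2dp_3$ means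 $\int_{\mathbb R^3}\Big(\int_{\mathcal S_{p,p_1}}F\,\frac{d\mu(p_2)}{|\nabla_{p_2}\Phi(p_2)|}\Big)dp_1$. Strong solution: $f\in C([0,T];L^\infty_s)$ is a strong solution on $[0,T]$ with initial datum $f_0\in L^\infty_s$ if $f(t)=f_0+\int_0^t\mathcal C[f(\tau)]\,d\tau$ for all $t\in[0,T]$ (in particular the right-hand side is required to make sense). *)

theory Defs
  imports "HOL-Analysis.Analysis"
begin

section \<open>Weighted spaces\<close>

definition japanese :: "real^3 \<Rightarrow> real" where
  "japanese x = sqrt (1 + (norm x)\<^sup>2)"

definition Linf_norm :: "real \<Rightarrow> (real^3 \<Rightarrow> real) \<Rightarrow> real" where
  "Linf_norm s f = (SUP x. japanese x powr s * \<bar>f x\<bar>)"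

text \<open>The supremum in \<^const>\<open>Linf_norm\<close> is a real one, so finiteness of the norm has to be
  stated as boundedness.\<close>

definition Linf :: "real \<Rightarrow> (real^3 \<Rightarrow> real) set" where
  "Linf s = {f. continuous_on UNIV f \<and> bdd_above (range (\<lambda>x. japanese x powr s * \<bar>f x\<bar>))}"

definition C_Linf :: "real \<Rightarrow> real \<Rightarrow> (real \<Rightarrow> real^3 \<Rightarrow> real) set" where
  "C_Linf T s = {f. (\<forall>t\<in>{0..T}. f t \<in> Linf s) \<and>
     (\<forall>t\<in>{0..T}. ((\<lambda>u. Linf_norm s (\<lambda>x. f u x - f t x)) \<longlongrightarrow> 0) (at t within {0..T}))}"


section \<open>Surface measure\<close>

text \<open>Surface measure is the two-dimensional Hausdorff measure, normalised by the factor
  \<open>pi/4\<close> so that it agrees with the usual area on smooth surfaces.  Its outer measure is a metric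
  outer measure, hence (Caratheodory) countably additive on the Borel sets, so that
  \<open>measure_of\<close> does not degenerate here.  Boundedness of the covering sets is required because
  \<^const>\<open>diameter\<close> is 0 on unbounded sets.\<close>

definition hausdorff2_content :: "real \<Rightarrow> 'a::metric_space set \<Rightarrow> ennreal" where
  "hausdorff2_content d A =
     (INF U \<in> {U :: nat \<Rightarrow> 'a set. A \<subseteq> (\<Union>i. U i) \<and> (\<forall>i. bounded (U i) \<and> diameter (U i) \<le> d)}.
        \<Sum>i. ennreal (pi / 4 * (diameter (U i))\<^sup>2))"

definition hausdorff2_outer :: "'a::metric_space set \<Rightarrow> ennreal" where
  "hausdorff2_outer A = (SUP d \<in> {0<..}. hausdorff2_content d A)"

definition hausdorff2 :: "'a::metric_space measure" where
  "hausdorff2 = measure_of UNIV (sets borel) hausdorff2_outer"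

definition gradient :: "('a::real_inner \<Rightarrow> real) \<Rightarrow> 'a \<Rightarrow> 'a" where
  "gradient F x = (THE D. GDERIV F x :> D)"


section \<open>The collision operator\<close>

text \<open>Since \<open>0 powr 0 = 0\<close> in the library, while \<open>|p|\<close> to the power \<open>2\<beta>\<close> means the constant 1
  when \<open>\<beta> = 0\<close>, the kernel needs a power with the convention \<open>0^0 = 1\<close>.\<close>

definition rpow :: "real \<Rightarrow> real \<Rightarrow> real" where
  "rpow r e = (if e = 0 then 1 else r powr e)"

definition resonance :: "real \<Rightarrow> real^3 \<Rightarrow> real^3 \<Rightarrow> real^3 \<Rightarrow> real" where
  "resonance a p p1 p2 =
     norm (p + p1 - p2) powr a + norm p2 powr a - norm p powr a - norm p1 powr a"

definition resonant_set :: "real \<Rightarrow> real^3 \<Rightarrow> real^3 \<Rightarrow> (real^3) set" where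
  "resonant_set a p p1 = {p2. resonance a p p1 p2 = 0}"

definition integrand :: "real \<Rightarrow> (real^3 \<Rightarrow> real) \<Rightarrow> real^3 \<Rightarrow> real^3 \<Rightarrow> real^3 \<Rightarrow> real" where
  "integrand \<beta> f p p1 p2 =
     (let p3 = p + p1 - p2 in
        rpow (norm p1) (2*\<beta>) * rpow (norm p2) (2*\<beta>) * rpow (norm p3) (2*\<beta>) *
        (f p1 * f p2 * f p3 + f p * f p2 * f p3 - f p * f p1 * f p2 - f p * f p1 * f p3))"

definition density :: "real \<Rightarrow> real \<Rightarrow> (real^3 \<Rightarrow> real) \<Rightarrow> real^3 \<Rightarrow> real^3 \<Rightarrow> real^3 \<Rightarrow> real" where
  "density a \<beta> f p p1 p2 = integrand \<beta> f p p1 p2 / norm (gradient (resonance a p p1) p2)"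

definition inner_integral :: "real \<Rightarrow> real \<Rightarrow> (real^3 \<Rightarrow> real) \<Rightarrow> real^3 \<Rightarrow> real^3 \<Rightarrow> real" where
  "inner_integral a \<beta> f p p1 = (LINT p2:resonant_set a p p1|hausdorff2. density a \<beta> f p p1 p2)"

definition collision :: "real \<Rightarrow> real \<Rightarrow> (real^3 \<Rightarrow> real) \<Rightarrow> real^3 \<Rightarrow> real" where
  "collision a \<beta> f p = rpow (norm p) (2*\<beta>) * (LINT p1|lebesgue. inner_integral a \<beta> f p p1)"

text \<open>Integrals of non-integrable functions are 0 in the library, so that the collision integral
  makes sense at \<open>p\<close> is a separate condition: both iterated integrals of the combined gain and
  loss terms exist.\<close>

definition collision_defined :: "real \<Rightarrow> real \<Rightarrow> (real^3 \<Rightarrow> real) \<Rightarrow> real^3 \<Rightarrow> bool" where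
  "collision_defined a \<beta> f p \<longleftrightarrow>
     (AE p1 in lebesgue. set_integrable hausdorff2 (resonant_set a p p1) (density a \<beta> f p p1)) \<and>
     integrable lebesgue (inner_integral a \<beta> f p)"


section \<open>Strong solutions\<close>

text \<open>The equation is read in the least demanding way: for each time, pointwise at almost every
  momentum \<open>p\<close> (both \<open>f t\<close> and \<open>f0\<close> are continuous), with the collision integral defined at
  almost every time.  A solution in any stricter sense, such as one with an integral taken in the
  Banach space, is a solution in this sense, so non-existence here is the strongest reading.
  Excluding a null set of momenta also disregards \<open>p = 0\<close>, where for \<open>a = 1\<close> all the resonant
  sets degenerate to segments.\<close>

definition strong_solution ::
  "real \<Rightarrow> real \<Rightarrow> real \<Rightarrow> real \<Rightarrow> (real^3 \<Rightarrow> real) \<Rightarrow> (real \<Rightarrow> real^3 \<Rightarrow> real) \<Rightarrow> bool" where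
  "strong_solution a \<beta> s T f0 f \<longleftrightarrow>
     f0 \<in> Linf s \<and> f \<in> C_Linf T s \<and>
     (\<forall>t\<in>{0..T}. AE p in lebesgue.
        (AE \<tau>\<in>{0..t} in lebesgue. collision_defined a \<beta> (f \<tau>) p) \<and>
        set_integrable lebesgue {0..t} (\<lambda>\<tau>. collision a \<beta> (f \<tau>) p) \<and>
        f t p = f0 p + (LINT \<tau>:{0..t}|lebesgue. collision a \<beta> (f \<tau>) p))"

end

theory Submission
  imports Defs
begin

text \<open>Write \<open>x\<close> for \<open>p2\<close>, \<open>y = p + p1 - x\<close> for \<open>p3\<close> and \<open>w(x)\<close> for the weight \<open>\<langle>x\<rangle>\<close> to the power \<open>-s\<close>.  The
gain part of the collision operator does not see how small \<open>f(p)\<close> is, whereas every loss term carries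
a factor \<open>f(p) f(p1)\<close>.  The datum is chosen such that the loss cannot compensate the gain at certain
momenta, and the choice is stable: there are \<open>f0\<close> and \<open>\<epsilon> > 0\<close> such that for every \<open>M\<close> some ball of
momenta \<open>p\<close> has the property that each \<open>g\<close> with \<open>|g - f0| \<le> \<epsilon> w\<close> satisfies \<open>C[g](p) \<ge> M w(p)\<close> wherever
the integrals exist.  A solution starting at \<open>f0\<close> stays within \<open>\<epsilon> w\<close> of it up to some time \<open>\<delta>\<close>, but
integrating the equation gives \<open>f(\<delta>,p) - f0(p) \<ge> \<delta> M w(p)\<close>, which is absurd for large \<open>M\<close>
(\<open>no_strong_solution\<close>).

There are two mechanisms.  If \<open>s \<le> 4\<beta> + 4 - a\<close> or \<open>2s \<le> 6\<beta> + 6 - a\<close>, the integral over large \<open>p1\<close> can be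
made to diverge.  The datum is \<open>w(x)\<close> times the square of \<open>sin |x|^a\<close>.  On the shells where \<open>|p1|^a\<close> is
close to a multiple of \<open>\<pi>\<close> the factor \<open>f(p1)\<close> nearly vanishes, and with it all terms except
\<open>f(p) f(x) f(y)\<close>; this one is bounded below, because conservation of energy turns the sine at \<open>y\<close> into
a cosine at \<open>x\<close> when \<open>|p|^a\<close> is close to \<open>\<pi>/2\<close>.  The inner integral is then at least \<open>c |p1|^(-3)\<close> on these
shells, and summing over the shells produces a harmonic series (\<open>collision_undefined\<close>).

In the opposite range the integrals over large \<open>p1\<close> converge, and the datum is \<open>w\<close> except in tiny balls
(holes) around a lacunary sequence of momenta, where it is \<open>\<eta> w\<close> with a small constant \<open>\<eta>\<close>.  Let
\<open>|p| = R\<close> in a hole.  For \<open>|p1| \<lesssim> R\<close> the balance of gain and loss is non-negative because \<open>f(p)\<close> is much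
smaller than \<open>f(x)\<close> and \<open>f(y)\<close>, except when \<open>x\<close> or \<open>y\<close> is in the same hole, which costs an amount
proportional to the radius of the hole.  For \<open>|p1| \<sim> 2^j\<close> much smaller than \<open>R\<close> and \<open>|x|\<close> comparable to
\<open>|p1|\<close>, the gain contributes \<open>R^(4\<beta>+1-a) 2^(j(4\<beta>+5-2s)) w(p)\<close>.  For \<open>|p1|\<close> much larger than \<open>R\<close> the loss
contributes at most a multiple of \<open>\<eta>\<close> times the sum of these terms (\<open>far_loss_bound\<close>).  The sum over \<open>2^j \<le> R\<close> of the
main terms is unbounded as \<open>R\<close> tends to infinity exactly under one of the three hypotheses
(\<open>main_term_unbounded\<close>, \<open>collision_growth\<close>).

The estimates on the resonant surfaces rest on convexity: for \<open>a \<ge> 1\<close> the resonance function is convex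
in \<open>x\<close>, so that the surface bounds a convex body.  Areas are bounded above by projecting the boundary of
a box onto this body, and below by mapping the surface into the plane by functions with Lipschitz constant 1.\<close>

section \<open>Two-dimensional Hausdorff measure\<close>

lemma hausdorff2_content_antimono:
 assumes "d \<le> d'" shows "hausdorff2_content d' A \<le> hausdorff2_content d A"
 unfolding hausdorff2_content_def using assms
 by (intro INF_superset_mono) (auto intro: order_trans)

lemma hausdorff2_content_le:
 fixes U :: "nat \<Rightarrow> 'a::metric_space set"
 assumes "A \<subseteq> (\<Union>i. U i)" "\<And>i. bounded (U i)" "\<And>i. diameter (U i) \<le> d"
 shows "hausdorff2_content d A \<le> (\<Sum>i. ennreal (pi / 4 * (diameter (U i))\<^sup>2))"
 unfolding hausdorff2_content_def by (intro INF_lower) (use assms in auto)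

lemma hausdorff2_content_le_outer: "0 < d \<Longrightarrow> hausdorff2_content d A \<le> hausdorff2_outer A"
 unfolding hausdorff2_outer_def by (intro SUP_upper) auto

lemma hausdorff2_outer_leI:
 assumes "\<And>d. 0 < d \<Longrightarrow> hausdorff2_content d A \<le> c"
 shows "hausdorff2_outer A \<le> c"
 unfolding hausdorff2_outer_def by (intro SUP_least) (use assms in auto)

lemma hausdorff2_content_mono:
 assumes "A \<subseteq> B" shows "hausdorff2_content d A \<le> hausdorff2_content d B"
 unfolding hausdorff2_content_def using assms
 by (intro INF_superset_mono) auto

lemma hausdorff2_outer_mono:
 assumes "A \<subseteq> B" shows "hausdorff2_outer A \<le> hausdorff2_outer B"
proof (rule hausdorff2_outer_leI)
 fix d :: real assume "0 < d"
 then show "hausdorff2_content d A \<le> hausdorff2_outer B"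
  by (intro order_trans[OF hausdorff2_content_mono[OF assms] hausdorff2_content_le_outer])
qed

lemma hausdorff2_outer_empty [simp]: "hausdorff2_outer {} = 0"
proof -
 have "hausdorff2_outer ({}::'a set) \<le> 0"
 proof (rule hausdorff2_outer_leI)
  fix d :: real assume "0 < d"
  then show "hausdorff2_content d ({}::'a set) \<le> 0"
   using hausdorff2_content_le[of "{}" "\<lambda>_. {}" d] by simp
 qed
 then show ?thesis by simp
qed

lemma hausdorff2_content_subadditive:
 fixes A :: "nat \<Rightarrow> 'a::metric_space set"
 shows "hausdorff2_content d (\<Union>n. A n) \<le> (\<Sum>n. hausdorff2_content d (A n))"
proof (rule ennreal_le_epsilon)
 fix \<epsilon> :: real assume fin: "(\<Sum>n. hausdorff2_content d (A n)) < top" and \<epsilon>: "0 < \<epsilon>"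
 define C where "C U = (\<Sum>i. ennreal (pi / 4 * (diameter (U i))\<^sup>2))" for U :: "nat \<Rightarrow> 'a set"
 have "\<exists>U. A n \<subseteq> (\<Union>i. U i) \<and> (\<forall>i. bounded (U i) \<and> diameter (U i) \<le> d) \<and>
   C U \<le> hausdorff2_content d (A n) + ennreal (\<epsilon> * (1/2)^Suc n)" for n
 proof -
  have "hausdorff2_content d (A n) < top"
   using fin ennreal_suminf_lessD by fastforce
  then have "hausdorff2_content d (A n) < hausdorff2_content d (A n) + ennreal (\<epsilon> * (1/2)^Suc n)"
   using \<epsilon> ennreal_add_left_cancel_less[of "hausdorff2_content d (A n)" 0 "ennreal (\<epsilon> * (1/2)^Suc n)"]
   by (auto simp: less_top)
  then show ?thesis
   unfolding hausdorff2_content_def C_def INF_less_iff by (auto intro: less_imp_le)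
 qed
 then obtain U where U: "\<And>n. A n \<subseteq> (\<Union>i. U n i)" "\<And>n i. bounded (U n i)" "\<And>n i. diameter (U n i) \<le> d"
   "\<And>n. C (U n) \<le> hausdorff2_content d (A n) + ennreal (\<epsilon> * (1/2)^Suc n)"
  by metis
 define V where "V k = (case prod_decode k of (n, i) \<Rightarrow> U n i)" for k
 have cov: "(\<Union>n. A n) \<subseteq> (\<Union>k. V k)"
 proof
  fix x assume "x \<in> (\<Union>n. A n)"
  then obtain n i where "x \<in> U n i" using U(1) by blast
  then have "x \<in> V (prod_encode (n, i))" by (simp add: V_def)
  then show "x \<in> (\<Union>k. V k)" by blast
 qed
 have "hausdorff2_content d (\<Union>n. A n) \<le> C V"
  unfolding C_def using cov U(2,3)
  by (intro hausdorff2_content_le) (auto simp: V_def split: prod.split)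
 also have "C V = (\<Sum>n. C (U n))"
 proof -
  have "(\<Sum>k. case prod_decode k of (n, i) \<Rightarrow> ennreal (pi / 4 * (diameter (U n i))\<^sup>2)) = (\<Sum>n. C (U n))"
   unfolding C_def
   using suminf_ennreal_2dimen[where f = "\<lambda>(n,i). ennreal (pi / 4 * (diameter (U n i))\<^sup>2)"]
   by (simp add: o_def)
  then show ?thesis unfolding C_def V_def by (simp add: case_prod_unfold)
 qed
 also have "\<dots> \<le> (\<Sum>n. hausdorff2_content d (A n) + ennreal (\<epsilon> * (1/2)^Suc n))"
  by (intro suminf_le U(4)) auto
 also have "\<dots> = (\<Sum>n. hausdorff2_content d (A n)) + (\<Sum>n. ennreal (\<epsilon> * (1/2)^Suc n))"
  by (subst suminf_add) auto
 also have "(\<Sum>n. ennreal (\<epsilon> * (1/2)^Suc n)) = ennreal \<epsilon>"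
  using sums_mult[OF power_half_series, of \<epsilon>] \<epsilon>
  by (intro suminf_ennreal_eq) auto
 finally show "hausdorff2_content d (\<Union>n. A n) \<le> (\<Sum>n. hausdorff2_content d (A n)) + ennreal \<epsilon>" .
qed

lemma hausdorff2_outer_subadditive:
 fixes A :: "nat \<Rightarrow> 'a::metric_space set"
 shows "hausdorff2_outer (\<Union>n. A n) \<le> (\<Sum>n. hausdorff2_outer (A n))"
proof (rule hausdorff2_outer_leI)
 fix d :: real assume "0 < d"
 have "hausdorff2_content d (\<Union>n. A n) \<le> (\<Sum>n. hausdorff2_content d (A n))"
  by (rule hausdorff2_content_subadditive)
 also have "\<dots> \<le> (\<Sum>n. hausdorff2_outer (A n))"
  using \<open>0 < d\<close> by (intro suminf_le hausdorff2_content_le_outer) auto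
 finally show "hausdorff2_content d (\<Union>n. A n) \<le> (\<Sum>n. hausdorff2_outer (A n))" .
qed

lemma hausdorff2_outer_Un:
 fixes A B :: "'a::metric_space set"
 shows "hausdorff2_outer (A \<union> B) \<le> hausdorff2_outer A + hausdorff2_outer B"
proof -
 have "hausdorff2_outer (A \<union> B) = hausdorff2_outer (\<Union>n. binaryset A B n)"
  by (simp add: UN_binaryset_eq)
 also have "\<dots> \<le> (\<Sum>n. hausdorff2_outer (binaryset A B n))"
  by (rule hausdorff2_outer_subadditive)
 also have "\<dots> = hausdorff2_outer A + hausdorff2_outer B"
  by (rule suminf_binaryset_eq) simp
 finally show ?thesis .
qed

text \<open>Coverings by sets of diameter below \<open>\<delta>\<close> split into a covering of \<open>A\<close> and one of \<open>B\<close>.\<close>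

lemma hausdorff2_outer_separated:
 fixes A B :: "'a::metric_space set"
 assumes \<delta>: "0 < \<delta>" and sep: "\<And>x y. x \<in> A \<Longrightarrow> y \<in> B \<Longrightarrow> \<delta> \<le> dist x y"
 shows "hausdorff2_outer A + hausdorff2_outer B \<le> hausdorff2_outer (A \<union> B)"
proof -
 have small: "hausdorff2_content d A + hausdorff2_content d B \<le> hausdorff2_outer (A \<union> B)"
  if d: "0 < d" "d < \<delta>" for d
 proof -
  have "hausdorff2_content d A + hausdorff2_content d B \<le> hausdorff2_content d (A \<union> B)"
   unfolding hausdorff2_content_def[of d "A \<union> B"]
  proof (rule INF_greatest, clarify)
   fix U :: "nat \<Rightarrow> 'a set"
   assume U: "A \<union> B \<subseteq> (\<Union>i. U i)" "\<forall>i. bounded (U i) \<and> diameter (U i) \<le> d"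
   define UA where "UA i = (if U i \<inter> A = {} then {} else U i)" for i
   define UB where "UB i = (if U i \<inter> A = {} then U i else {})" for i
   have disj: "U i \<inter> B = {}" if "U i \<inter> A \<noteq> {}" for i
   proof (rule ccontr)
    assume "U i \<inter> B \<noteq> {}"
    then obtain x y where "x \<in> U i" "x \<in> A" "y \<in> U i" "y \<in> B" using \<open>U i \<inter> A \<noteq> {}\<close> by blast
    then have "\<delta> \<le> dist x y" "dist x y \<le> diameter (U i)"
     using sep U(2) diameter_bounded_bound by blast+
    then show False using U(2) d by (smt (verit))
   qed
   have "A \<subseteq> (\<Union>i. UA i)" using U(1) by (fastforce simp: UA_def)
   then have A: "hausdorff2_content d A \<le> (\<Sum>i. ennreal (pi / 4 * (diameter (UA i))\<^sup>2))"
    using U(2) d by (intro hausdorff2_content_le) (auto simp: UA_def)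
   have "B \<subseteq> (\<Union>i. UB i)"
   proof
    fix x assume "x \<in> B"
    then obtain i where "x \<in> U i" using U(1) by blast
    then have "x \<in> UB i" using disj[of i] \<open>x \<in> B\<close> by (auto simp: UB_def)
    then show "x \<in> (\<Union>i. UB i)" by blast
   qed
   then have B: "hausdorff2_content d B \<le> (\<Sum>i. ennreal (pi / 4 * (diameter (UB i))\<^sup>2))"
    using U(2) d by (intro hausdorff2_content_le) (auto simp: UB_def)
   have "hausdorff2_content d A + hausdorff2_content d B \<le>
     (\<Sum>i. ennreal (pi / 4 * (diameter (UA i))\<^sup>2)) + (\<Sum>i. ennreal (pi / 4 * (diameter (UB i))\<^sup>2))"
    using A B by (rule add_mono)
   also have "\<dots> = (\<Sum>i. ennreal (pi / 4 * (diameter (UA i))\<^sup>2) + ennreal (pi / 4 * (diameter (UB i))\<^sup>2))"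
    by (rule suminf_add) auto
   also have "\<dots> = (\<Sum>i. ennreal (pi / 4 * (diameter (U i))\<^sup>2))"
    by (intro suminf_cong) (auto simp: UA_def UB_def)
   finally show "hausdorff2_content d A + hausdorff2_content d B \<le>
    (\<Sum>i. ennreal (pi / 4 * (diameter (U i))\<^sup>2))" .
  qed
  also have "\<dots> \<le> hausdorff2_outer (A \<union> B)" using d by (intro hausdorff2_content_le_outer)
  finally show ?thesis .
 qed
 have *: "hausdorff2_content d A + hausdorff2_content d' B \<le> hausdorff2_outer (A \<union> B)"
  if "0 < d" "0 < d'" for d d'
 proof -
  define d0 where "d0 = min (min d d') (\<delta>/2)"
  have "hausdorff2_content d A + hausdorff2_content d' B \<le> hausdorff2_content d0 A + hausdorff2_content d0 B"
   by (intro add_mono hausdorff2_content_antimono) (auto simp: d0_def)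
  also have "\<dots> \<le> hausdorff2_outer (A \<union> B)"
   using that \<delta> by (intro small) (auto simp: d0_def)
  finally show ?thesis .
 qed
 have "hausdorff2_content d A + (SUP d\<in>{0<..}. hausdorff2_content d B) \<le> hausdorff2_outer (A \<union> B)"
  if "0 < d" for d
  by (subst ennreal_SUP_add_right) (use * that in \<open>auto intro!: SUP_least\<close>)
 then show ?thesis
  unfolding hausdorff2_outer_def[of A] hausdorff2_outer_def[of B]
  by (subst ennreal_SUP_add_left[symmetric]) (auto intro!: SUP_least)
qed

lemma tendsto_zero_suminf_ennreal_tail:
 fixes f :: "nat \<Rightarrow> ennreal"
 assumes "(\<Sum>i. f i) \<noteq> top"
 shows "(\<lambda>n. \<Sum>i. f (i + n)) \<longlonglongrightarrow> 0"
proof -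
 have fin: "f i \<noteq> top" for i
  using assms ennreal_suminf_lessD[of f top i] by (auto simp: less_top)
 define g where "g i = enn2real (f i)" for i
 have fg: "f = (\<lambda>i. ennreal (g i))" using fin by (auto simp: g_def less_top)
 have "g i \<ge> 0" for i by (simp add: g_def)
 then have "summable g" using assms unfolding fg by (intro summable_suminf_not_top) auto
 have "(\<Sum>i. f (i + n)) = ennreal (\<Sum>i. g (i + n))" for n
  unfolding fg using \<open>summable g\<close> \<open>\<And>i. g i \<ge> 0\<close>
  by (intro suminf_ennreal2) (auto simp: summable_iff_shift)
 then show ?thesis
  using suminf_exist_split2[OF \<open>summable g\<close>] by (simp add: ennreal_0[symmetric] del: ennreal_0)
qed

text \<open>The Caratheodory criterion for a metric outer measure.  The set \<open>A - F\<close> is exhausted by its parts at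
distance at least \<open>1/n\<close> from \<open>F\<close>; the rings between consecutive parts are pairwise separated when
every other one is taken, so that their measures are summable and the exhaustion converges.\<close>

lemma hausdorff2_outer_closed_split:
 fixes A F :: "'a::metric_space set"
 assumes F: "closed F"
 shows "hausdorff2_outer (A \<inter> F) + hausdorff2_outer (A - F) \<le> hausdorff2_outer A"
proof (cases "F = {} \<or> hausdorff2_outer A = top")
 case True then show ?thesis by auto
next
 case False
 define B where "B n = {x \<in> A. inverse (real (Suc n)) \<le> infdist x F}" for n
 define D where "D n = B (Suc n) - B n" for n
 have Bmono: "B m \<subseteq> B n" if "m \<le> n" for m n
  using that by (auto simp: B_def intro: order_trans[rotated] le_imp_inverse_le)
 have Bsub: "B n \<subseteq> A - F" for n
  by (auto simp: B_def)
 have AF: "hausdorff2_outer (A \<inter> F) + hausdorff2_outer (B n) \<le> hausdorff2_outer A" for n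
 proof -
  have "hausdorff2_outer (A \<inter> F) + hausdorff2_outer (B n) \<le> hausdorff2_outer ((A \<inter> F) \<union> B n)"
  proof (rule hausdorff2_outer_separated)
   fix x y assume "x \<in> A \<inter> F" "y \<in> B n"
   then show "inverse (real (Suc n)) \<le> dist x y"
    using infdist_le[of x F y] by (simp add: B_def dist_commute)
  qed simp
  also have "\<dots> \<le> hausdorff2_outer A" using Bsub by (intro hausdorff2_outer_mono) blast
  finally show ?thesis .
 qed
 have Dsep: "inverse (real (Suc (Suc m))) - inverse (real (Suc n)) \<le> dist x y"
  if "x \<in> D m" "y \<in> D n" "m < n" for x y m n
 proof -
  have "inverse (real (Suc (Suc m))) \<le> infdist x F" "infdist y F < inverse (real (Suc n))"
   using that by (auto simp: D_def B_def)
  moreover have "infdist x F \<le> infdist y F + dist x y" by (rule infdist_triangle)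
  ultimately show ?thesis by linarith
 qed
 have fin: "(\<Sum>i. hausdorff2_outer (D (2*i + j))) \<le> hausdorff2_outer A" for j
 proof -
  have part: "(\<Sum>i<N. hausdorff2_outer (D (2*i+j))) \<le> hausdorff2_outer (\<Union>i<N. D (2*i+j))" for N
  proof (induction N)
   case (Suc N)
   show ?case
   proof (cases N)
    case 0
    have "{..<Suc 0} = {0}" by auto
    with 0 show ?thesis by simp
   next
    case (Suc M)
    define \<delta> where "\<delta> = inverse (real (Suc (Suc (2*M+j)))) - inverse (real (Suc (2*N+j)))"
    have "Suc (Suc (2*M+j)) < Suc (2*N+j)" using Suc by simp
    then have "\<delta> > 0" unfolding \<delta>_def by (subst diff_gt_0_iff_gt, intro less_imp_inverse_less) (simp, linarith)
    have sepN: "hausdorff2_outer (\<Union>i<N. D (2*i+j)) + hausdorff2_outer (D (2*N+j)) \<le>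
      hausdorff2_outer ((\<Union>i<N. D (2*i+j)) \<union> D (2*N+j))"
    proof (rule hausdorff2_outer_separated[OF \<open>\<delta> > 0\<close>])
     fix x y assume "x \<in> (\<Union>i<N. D (2*i+j))" and y: "y \<in> D (2*N+j)"
     then obtain i where i: "i < N" "x \<in> D (2*i+j)" by blast
     have "inverse (real (Suc (Suc (2*M+j)))) \<le> inverse (real (Suc (Suc (2*i+j))))"
      using i Suc by (intro le_imp_inverse_le) auto
     moreover have "inverse (real (Suc (Suc (2*i+j)))) - inverse (real (Suc (2*N+j))) \<le> dist x y"
      using i by (intro Dsep[OF i(2) y]) simp
     ultimately show "\<delta> \<le> dist x y" unfolding \<delta>_def by linarith
    qed
    have UnN: "(\<Union>i<N. D (2*i+j)) \<union> D (2*N+j) = (\<Union>i<Suc N. D (2*i+j))"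
     by (auto simp: less_Suc_eq)
    have "(\<Sum>i<Suc N. hausdorff2_outer (D (2*i+j))) \<le>
      hausdorff2_outer (\<Union>i<N. D (2*i+j)) + hausdorff2_outer (D (2*N+j))"
     using Suc.IH by (simp add: add_right_mono)
    also have "\<dots> \<le> hausdorff2_outer (\<Union>i<Suc N. D (2*i+j))"
     using sepN unfolding UnN .
    finally show ?thesis .
   qed
  qed simp
  have "(\<Union>i<N. D (2*i+j)) \<subseteq> A" for N by (auto simp: D_def B_def)
  then have "(\<Sum>i<N. hausdorff2_outer (D (2*i+j))) \<le> hausdorff2_outer A" for N
   by (rule order_trans[OF part hausdorff2_outer_mono])
  then show ?thesis by (intro suminf_le_const) auto
 qed
 have cover: "A - F \<subseteq> B (2*n) \<union> (\<Union>i. D (2*(i+n))) \<union> (\<Union>i. D (2*(i+n)+1))" for n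
 proof
  fix x assume x: "x \<in> A - F"
  then have "infdist x F > 0"
   using False in_closed_iff_infdist_zero[OF F, of x] infdist_nonneg[of x F] by (simp add: less_le)
  then obtain m where "inverse (real (Suc m)) < infdist x F" using reals_Archimedean by blast
  then have ex: "x \<in> B m" using x by (auto simp: B_def)
  define k where "k = (LEAST k. x \<in> B k)"
  have k: "x \<in> B k" "\<And>j. j < k \<Longrightarrow> x \<notin> B j"
   unfolding k_def using ex by (auto intro: LeastI dest: not_less_Least)
  show "x \<in> B (2*n) \<union> (\<Union>i. D (2*(i+n))) \<union> (\<Union>i. D (2*(i+n)+1))"
  proof (cases "k \<le> 2*n")
   case True then show ?thesis using k(1) Bmono by blast
  next
   case False
   then have "x \<in> D (k-1)" using k by (cases k) (auto simp: D_def)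
   show ?thesis
   proof (cases "even (k-1)")
    case True
    then obtain l where "k - 1 = 2*l" by (elim evenE)
    moreover from this have "l = (l - n) + n" using False by auto
    ultimately have "x \<in> D (2 * ((l - n) + n))" using \<open>x \<in> D (k-1)\<close> by simp
    then show ?thesis by blast
   next
    case odd: False
    then obtain l where "k - 1 = 2*l+1" by (elim oddE)
    moreover from this have "l = (l - n) + n" using False by auto
    ultimately have "x \<in> D (2 * ((l - n) + n) + 1)" using \<open>x \<in> D (k-1)\<close> by simp
    then show ?thesis by blast
   qed
  qed
 qed
 define t where "t j n = (\<Sum>i. hausdorff2_outer (D (2*(i+n)+j)))" for j n
 have t0: "t j \<longlonglongrightarrow> 0" for j
 proof -
  have "(\<Sum>i. hausdorff2_outer (D (2*i+j))) \<noteq> top"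
   using fin[of j] False by (auto simp: top_unique)
  then show ?thesis unfolding t_def
   using tendsto_zero_suminf_ennreal_tail[of "\<lambda>i. hausdorff2_outer (D (2*i+j))"] by simp
 qed
 have "hausdorff2_outer (A \<inter> F) + hausdorff2_outer (A - F) \<le> hausdorff2_outer A + (t 0 n + t 1 n)" for n
 proof -
  have "hausdorff2_outer (A - F) \<le> hausdorff2_outer (B (2*n)) + t 0 n + t 1 n"
  proof -
   have "hausdorff2_outer (A - F) \<le>
     hausdorff2_outer (B (2*n) \<union> (\<Union>i. D (2*(i+n)))) + hausdorff2_outer (\<Union>i. D (2*(i+n)+1))"
    by (rule order_trans[OF hausdorff2_outer_mono[OF cover[of n]] hausdorff2_outer_Un])
   also have "\<dots> \<le> hausdorff2_outer (B (2*n)) + hausdorff2_outer (\<Union>i. D (2*(i+n)))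
     + hausdorff2_outer (\<Union>i. D (2*(i+n)+1))"
    by (intro add_right_mono hausdorff2_outer_Un)
   also have "\<dots> \<le> hausdorff2_outer (B (2*n)) + t 0 n + t 1 n"
    unfolding t_def add_0_right by (intro add_mono order_refl hausdorff2_outer_subadditive)
   finally show ?thesis .
  qed
  then have "hausdorff2_outer (A \<inter> F) + hausdorff2_outer (A - F) \<le>
    (hausdorff2_outer (A \<inter> F) + hausdorff2_outer (B (2*n))) + (t 0 n + t 1 n)"
   by (simp add: add.assoc add_left_mono)
  also have "\<dots> \<le> hausdorff2_outer A + (t 0 n + t 1 n)" using AF by (intro add_right_mono)
  finally show ?thesis .
 qed
 moreover have "(\<lambda>n. hausdorff2_outer A + (t 0 n + t 1 n)) \<longlonglongrightarrow> hausdorff2_outer A + (0 + 0)"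
  by (intro tendsto_intros t0)
 ultimately have "hausdorff2_outer (A \<inter> F) + hausdorff2_outer (A - F) \<le> hausdorff2_outer A + (0 + 0)"
  by (intro LIMSEQ_le_const[where X = "\<lambda>n. hausdorff2_outer A + (t 0 n + t 1 n)"]) auto
 then show ?thesis by simp
qed

text \<open>Borel sets are measurable in the sense of Caratheodory, because closed sets are.\<close>

lemma emeasure_hausdorff2:
 fixes A :: "'a::metric_space set"
 assumes "A \<in> sets borel"
 shows "emeasure hausdorff2 A = hausdorff2_outer A"
proof -
 let ?L = "lambda_system UNIV (Pow UNIV) (hausdorff2_outer :: 'a set \<Rightarrow> ennreal)"
 interpret P: sigma_algebra UNIV "Pow UNIV :: 'a set set" by (rule sigma_algebra_Pow)
 have oms: "outer_measure_space (Pow UNIV) (hausdorff2_outer :: 'a set \<Rightarrow> ennreal)"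
  unfolding outer_measure_space_def positive_def increasing_def countably_subadditive_def
  by (auto intro: hausdorff2_outer_mono hausdorff2_outer_subadditive)
 have L: "measure_space UNIV ?L (hausdorff2_outer :: 'a set \<Rightarrow> ennreal)"
  by (rule P.caratheodory_lemma[OF oms])
 then interpret L: sigma_algebra UNIV ?L by (simp add: measure_space_def)
 have closed: "F \<in> ?L" if "closed F" for F :: "'a set"
 proof -
  have "hausdorff2_outer (A \<inter> F) + hausdorff2_outer (A - F) = hausdorff2_outer A" for A
  proof (rule antisym)
   show "hausdorff2_outer A \<le> hausdorff2_outer (A \<inter> F) + hausdorff2_outer (A - F)"
    using hausdorff2_outer_Un[of "A \<inter> F" "A - F"] by (simp add: Un_Diff_Int Int_Diff_Un)
  qed (rule hausdorff2_outer_closed_split[OF that])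
  then show ?thesis unfolding P.lambda_system_eq by auto
 qed
 have sub: "sets (borel :: 'a measure) \<subseteq> ?L"
 proof -
  have "sets (borel :: 'a measure) = sigma_sets UNIV (Collect closed)"
   by (simp add: borel_eq_closed)
  also have "\<dots> \<subseteq> ?L" using closed by (intro L.sigma_sets_subset subsetI) blast
  finally show ?thesis .
 qed
 have "countably_additive (sets borel) (hausdorff2_outer :: 'a set \<Rightarrow> ennreal)"
  unfolding countably_additive_def
 proof (intro allI impI)
  fix A :: "nat \<Rightarrow> 'a set"
  assume A: "range A \<subseteq> sets borel" "disjoint_family A" "\<Union> (range A) \<in> sets borel"
  have "range A \<subseteq> ?L" "\<Union> (range A) \<in> ?L" using A sub by blast+
  then show "(\<Sum>i. hausdorff2_outer (A i)) = hausdorff2_outer (\<Union> (range A))"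
   using L A(2) unfolding measure_space_def countably_additive_def by blast
 qed
 moreover have "positive (sets borel) (hausdorff2_outer :: 'a set \<Rightarrow> ennreal)"
  by (simp add: positive_def)
 ultimately show ?thesis
  using assms sets.sigma_algebra_axioms[of "borel :: 'a measure"]
  unfolding hausdorff2_def by (intro emeasure_measure_of_sigma) auto
qed

lemma sets_hausdorff2 [measurable_cong, simp]: "sets hausdorff2 = sets borel"
 unfolding hausdorff2_def using sets.sigma_sets_eq[of "borel :: 'a measure"] by simp

lemma space_hausdorff2 [simp]: "space hausdorff2 = UNIV"
 unfolding hausdorff2_def by (simp add: space_measure_of_conv)

lemma diameter_leI:
 fixes S :: "'a::metric_space set"
 assumes "0 \<le> c" "\<And>x y. x \<in> S \<Longrightarrow> y \<in> S \<Longrightarrow> dist x y \<le> c"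
 shows "diameter S \<le> c"
 using assms unfolding diameter_def by (auto intro!: cSUP_least)

lemma hausdorff2_outer_contraction:
 fixes g :: "'a::metric_space \<Rightarrow> 'b::metric_space"
 assumes g: "\<And>x y. x \<in> A \<Longrightarrow> y \<in> A \<Longrightarrow> dist (g x) (g y) \<le> dist x y"
 shows "hausdorff2_outer (g ` A) \<le> hausdorff2_outer A"
proof (rule hausdorff2_outer_leI)
 fix d :: real assume "0 < d"
 have "hausdorff2_content d (g ` A) \<le> hausdorff2_content d A"
  unfolding hausdorff2_content_def[of d A]
 proof (rule INF_greatest, clarify)
  fix U :: "nat \<Rightarrow> 'a set"
  assume U: "A \<subseteq> (\<Union>i. U i)" "\<forall>i. bounded (U i) \<and> diameter (U i) \<le> d"
  define V where "V i = g ` (U i \<inter> A)" for i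
  have dV: "dist y z \<le> diameter (U i)" if yz: "y \<in> V i" "z \<in> V i" for i y z
  proof -
   obtain y' z' where "y' \<in> U i \<inter> A" "z' \<in> U i \<inter> A" "y = g y'" "z = g z'"
    using yz unfolding V_def by blast
   then show ?thesis using g[of y' z'] diameter_bounded_bound[of "U i" y' z'] U(2) by fastforce
  qed
  have bV: "bounded (V i)" for i using dV unfolding bounded_two_points by blast
  have dmV: "diameter (V i) \<le> diameter (U i)" for i
   using dV diameter_ge_0[of "U i"] U(2) by (intro diameter_leI) auto
  have "hausdorff2_content d (g ` A) \<le> (\<Sum>i. ennreal (pi / 4 * (diameter (V i))\<^sup>2))"
  proof (rule hausdorff2_content_le)
   show "g ` A \<subseteq> (\<Union>i. V i)"
   proof
    fix y assume "y \<in> g ` A"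
    then obtain x where x: "x \<in> A" "y = g x" by blast
    then obtain i where "x \<in> U i" using U(1) by blast
    then have "y \<in> V i" using x by (simp add: V_def)
    then show "y \<in> (\<Union>i. V i)" by blast
   qed
   show "diameter (V i) \<le> d" for i using order_trans[OF dmV[of i], of d] U(2) by simp
  qed (rule bV)
  also have "\<dots> \<le> (\<Sum>i. ennreal (pi / 4 * (diameter (U i))\<^sup>2))"
   by (intro suminf_le ennreal_leI mult_left_mono power_mono dmV diameter_ge_0 bV) auto
  finally show "hausdorff2_content d (g ` A) \<le> (\<Sum>i. ennreal (pi / 4 * (diameter (U i))\<^sup>2))" .
 qed
 also have "\<dots> \<le> hausdorff2_outer A" by (rule hausdorff2_content_le_outer) fact
 finally show "hausdorff2_content d (g ` A) \<le> hausdorff2_outer A" .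
qed

text \<open>The source of all lower bounds on area: a set of diameter \<open>d\<close> is mapped into a square of side \<open>2d\<close>,
whence the factor \<open>16/\<pi>\<close> between \<open>4d^2\<close> and \<open>\<pi>d^2/4\<close>.\<close>

lemma area_le_hausdorff2_outer:
 fixes f g :: "'a::metric_space \<Rightarrow> real"
 assumes f: "\<And>x y. x \<in> A \<Longrightarrow> y \<in> A \<Longrightarrow> \<bar>f x - f y\<bar> \<le> dist x y"
  and g: "\<And>x y. x \<in> A \<Longrightarrow> y \<in> A \<Longrightarrow> \<bar>g x - g y\<bar> \<le> dist x y"
  and Z: "Z \<in> sets (borel :: (real \<times> real) measure)" "Z \<subseteq> (\<lambda>x. (f x, g x)) ` A"
 shows "emeasure lborel Z \<le> ennreal (16 / pi) * hausdorff2_outer A"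
proof -
 have "ennreal (pi / 16) * emeasure lborel Z \<le> hausdorff2_content 1 A"
  unfolding hausdorff2_content_def
 proof (rule INF_greatest, clarify)
  fix U :: "nat \<Rightarrow> 'a set"
  assume U: "A \<subseteq> (\<Union>i. U i)" "\<forall>i. bounded (U i) \<and> diameter (U i) \<le> 1"
  define c where "c i = (SOME x. x \<in> U i \<inter> A)" for i
  define \<delta> where "\<delta> i = diameter (U i)" for i
  define B where "B i = {f (c i) - \<delta> i .. f (c i) + \<delta> i} \<times> {g (c i) - \<delta> i .. g (c i) + \<delta> i}" for i
  have \<delta>0: "0 \<le> \<delta> i" for i using U(2) diameter_ge_0 by (auto simp: \<delta>_def)
  have "Z \<subseteq> (\<Union>i. B i)"
  proof
   fix z assume "z \<in> Z"
   then obtain x where x: "x \<in> A" "z = (f x, g x)" using Z(2) by blast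
   then obtain i where i: "x \<in> U i" using U(1) by blast
   then have c: "c i \<in> U i \<inter> A" unfolding c_def using x i someI[of "\<lambda>x. x \<in> U i \<inter> A" x] by simp
   have "dist x (c i) \<le> \<delta> i" unfolding \<delta>_def using U(2) c i by (intro diameter_bounded_bound) auto
   then have "z \<in> B i" using f[of x "c i"] g[of x "c i"] x c by (auto simp: B_def abs_le_iff)
   then show "z \<in> (\<Union>i. B i)" by blast
  qed
  then have "emeasure lborel Z \<le> emeasure lborel (\<Union>i. B i)"
   by (intro emeasure_mono) (auto simp: B_def borel_Times)
  also have "\<dots> \<le> (\<Sum>i. emeasure lborel (B i))"
   by (intro emeasure_subadditive_countably) (auto simp: B_def borel_Times)
  also have "\<dots> = (\<Sum>i. ennreal (4 * (\<delta> i)\<^sup>2))"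
  proof (rule suminf_cong)
   fix i
   have "emeasure lborel (B i) = emeasure (lborel \<Otimes>\<^sub>M lborel) (B i)" by (simp add: lborel_prod)
   also have "\<dots> = ennreal (2 * \<delta> i) * ennreal (2 * \<delta> i)"
    unfolding B_def using \<delta>0[of i] by (subst lborel.emeasure_pair_measure_Times) auto
   also have "\<dots> = ennreal (4 * (\<delta> i)\<^sup>2)"
    using \<delta>0[of i] by (subst ennreal_mult[symmetric]) (auto simp: power2_eq_square algebra_simps)
   finally show "emeasure lborel (B i) = ennreal (4 * (\<delta> i)\<^sup>2)" .
  qed
  finally have "ennreal (pi / 16) * emeasure lborel Z \<le> ennreal (pi/16) * (\<Sum>i. ennreal (4 * (\<delta> i)\<^sup>2))"
   by (intro mult_left_mono) auto
  also have "\<dots> = (\<Sum>i. ennreal (pi/16) * ennreal (4 * (\<delta> i)\<^sup>2))"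
   by (rule ennreal_suminf_cmult[symmetric])
  also have "\<dots> = (\<Sum>i. ennreal (pi / 4 * (\<delta> i)\<^sup>2))"
   by (intro suminf_cong, subst ennreal_mult[symmetric]) auto
  finally show "ennreal (pi / 16) * emeasure lborel Z \<le> (\<Sum>i. ennreal (pi / 4 * (diameter (U i))\<^sup>2))"
   by (simp add: \<delta>_def)
 qed
 also have "\<dots> \<le> hausdorff2_outer A" by (rule hausdorff2_content_le_outer) simp
 finally have "ennreal (16/pi) * (ennreal (pi / 16) * emeasure lborel Z) \<le> ennreal (16/pi) * hausdorff2_outer A"
  by (intro mult_left_mono) auto
 moreover have "ennreal (16/pi) * (ennreal (pi / 16) * emeasure lborel Z) = emeasure lborel Z"
  by (subst mult.assoc[symmetric], subst ennreal_mult[symmetric]) auto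
 ultimately show ?thesis by simp
qed

text \<open>The parameter square is cut into rectangles adapted to \<open>L1\<close> and \<open>L2\<close>, so that the images of all of
them have diameter of the same order.\<close>

lemma hausdorff2_outer_param_le:
 fixes g :: "real \<Rightarrow> real \<Rightarrow> 'a::metric_space"
 assumes L: "0 \<le> L1" "0 \<le> L2"
  and g: "\<And>s t s' t'. dist (g s t) (g s' t') \<le> L1 * \<bar>s - s'\<bar> + L2 * \<bar>t - t'\<bar>"
  and A: "A \<subseteq> {g s t | s t. s \<in> {0..<1} \<and> t \<in> {0..<1}}"
 shows "hausdorff2_outer A \<le> ennreal (pi * L1 * L2)"
proof (rule hausdorff2_outer_leI)
 fix d :: real assume d: "0 < d"
 have main: "hausdorff2_content d A \<le> ennreal (pi * (L1 + \<delta>) * (L2 + \<delta>))" if \<delta>: "0 < \<delta>" "2 * \<delta> \<le> d" for \<delta>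
 proof -
  define n1 where "n1 = nat \<lfloor>L1/\<delta>\<rfloor> + 1"
  define n2 where "n2 = nat \<lfloor>L2/\<delta>\<rfloor> + 1"
  have n: "n1 > 0" "n2 > 0" by (auto simp: n1_def n2_def)
  have "0 \<le> L1/\<delta>" "0 \<le> L2/\<delta>" using L \<delta> by auto
  then have fl: "real n1 = of_int \<lfloor>L1/\<delta>\<rfloor> + 1" "real n2 = of_int \<lfloor>L2/\<delta>\<rfloor> + 1"
   by (auto simp: n1_def n2_def)
  have nb: "L1 / \<delta> \<le> real n1" "real n1 \<le> L1 / \<delta> + 1" "L2 / \<delta> \<le> real n2" "real n2 \<le> L2 / \<delta> + 1"
   unfolding fl by linarith+
  define cell where "cell i j = {g s t | s t. s \<in> {real i / n1..<(real i + 1) / n1} \<and> t \<in> {real j / n2..<(real j + 1) / n2}}" for i j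
  have dcell: "dist x y \<le> 2 * \<delta>" if xy: "x \<in> cell i j" "y \<in> cell i j" for x y i j
  proof -
   obtain s t s' t' where st: "x = g s t" "y = g s' t'"
    "s \<in> {real i / n1..<(real i + 1) / n1}" "t \<in> {real j / n2..<(real j + 1) / n2}"
    "s' \<in> {real i / n1..<(real i + 1) / n1}" "t' \<in> {real j / n2..<(real j + 1) / n2}"
    using xy unfolding cell_def by blast
   have "\<bar>s - s'\<bar> \<le> 1 / n1" "\<bar>t - t'\<bar> \<le> 1 / n2"
    using st by (auto simp: add_divide_distrib abs_le_iff)
   then have "L1 * \<bar>s - s'\<bar> + L2 * \<bar>t - t'\<bar> \<le> L1 * (1/n1) + L2 * (1/n2)"
    using L by (intro add_mono mult_left_mono)
   also have "\<dots> \<le> \<delta> + \<delta>"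
    using nb n \<delta> by (intro add_mono) (auto simp: field_simps)
   finally show ?thesis using g[of s t s' t'] st by simp
  qed
  have bcell: "bounded (cell i j)" for i j using dcell unfolding bounded_two_points by blast
  have dmcell: "diameter (cell i j) \<le> 2 * \<delta>" for i j
   using dcell \<delta> by (intro diameter_leI) auto
  define U where "U k = (if k < n1 * n2 then cell (k div n2) (k mod n2) else {})" for k
  have "hausdorff2_content d A \<le> (\<Sum>k. ennreal (pi / 4 * (diameter (U k))\<^sup>2))"
  proof (rule hausdorff2_content_le)
   show "A \<subseteq> (\<Union>k. U k)"
   proof
    fix x assume "x \<in> A"
    then obtain s t where st: "x = g s t" "s \<in> {0..<1}" "t \<in> {0..<1}" using A by blast
    define i where "i = nat \<lfloor>s * n1\<rfloor>"
    define j where "j = nat \<lfloor>t * n2\<rfloor>"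
    have ij: "real i = of_int \<lfloor>s * n1\<rfloor>" "real j = of_int \<lfloor>t * n2\<rfloor>" using st n by (auto simp: i_def j_def)
    have b: "real i \<le> s * n1" "s * n1 < real i + 1" "real j \<le> t * n2" "t * n2 < real j + 1"
     unfolding ij by linarith+
    have "s * n1 < 1 * real n1" "t * n2 < 1 * real n2"
     using st n by (intro mult_strict_right_mono; simp)+
    then have lt: "i < n1" "j < n2" using b by linarith+
    have "x \<in> cell i j" unfolding cell_def using st b n by (auto simp: field_simps)
    moreover have "i * n2 + j < n1 * n2"
    proof -
     have "i * n2 + j < (i + 1) * n2" using lt by simp
     also have "\<dots> \<le> n1 * n2" using lt by (intro mult_right_mono) auto
     finally show ?thesis .
    qed
    ultimately have "x \<in> U (i * n2 + j)" using lt by (simp add: U_def)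
    then show "x \<in> (\<Union>k. U k)" by blast
   qed
   show "diameter (U k) \<le> d" for k using dmcell \<delta> d by (auto simp: U_def intro: order_trans)
  qed (auto simp: U_def bcell)
  also have "\<dots> = (\<Sum>k<n1*n2. ennreal (pi / 4 * (diameter (U k))\<^sup>2))"
   by (rule suminf_finite) (auto simp: U_def)
  also have "\<dots> \<le> (\<Sum>k<n1*n2. ennreal (pi / 4 * (2*\<delta>)\<^sup>2))"
   by (intro sum_mono ennreal_leI mult_left_mono power_mono diameter_ge_0) (auto simp: U_def bcell dmcell)
  also have "\<dots> = ennreal (real (n1*n2) * (pi * \<delta>\<^sup>2))"
   by (simp add: ennreal_mult[symmetric] ennreal_of_nat_eq_real_of_nat power_mult_distrib)
  also have "\<dots> \<le> ennreal (pi * (L1 + \<delta>) * (L2 + \<delta>))"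
  proof (rule ennreal_leI)
   have "real n1 * real n2 \<le> (L1/\<delta> + 1) * (L2/\<delta> + 1)"
    using nb n L \<delta> by (intro mult_mono) (auto intro: add_nonneg_nonneg)
   then have "real (n1*n2) * (pi * \<delta>\<^sup>2) \<le> ((L1/\<delta> + 1) * (L2/\<delta> + 1)) * (pi * \<delta>\<^sup>2)"
    by (intro mult_right_mono) auto
   also have "\<dots> = pi * (L1 + \<delta>) * (L2 + \<delta>)" using \<delta> by (simp add: field_simps power2_eq_square)
   finally show "real (n1*n2) * (pi * \<delta>\<^sup>2) \<le> pi * (L1 + \<delta>) * (L2 + \<delta>)" .
  qed
  finally show ?thesis .
 qed
 have "((\<lambda>\<delta>. ennreal (pi * (L1 + \<delta>) * (L2 + \<delta>))) \<longlongrightarrow> ennreal (pi * (L1 + 0) * (L2 + 0))) (at_right 0)"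
  by (intro tendsto_intros tendsto_ennrealI)
 moreover have "\<forall>\<^sub>F \<delta> in at_right 0. hausdorff2_content d A \<le> ennreal (pi * (L1 + \<delta>) * (L2 + \<delta>))"
  using eventually_at_right_less[of 0] eventually_at_right_real[of 0 "d/2"] d
  by (auto elim!: eventually_elim2 intro!: main)
 ultimately show "hausdorff2_content d A \<le> ennreal (pi * L1 * L2)"
  by (intro tendsto_lowerbound[of _ _ "at_right (0::real)"]) auto
qed

section \<open>Area of convex surfaces\<close>

definition orthonormal_frame :: "real^3 \<Rightarrow> real^3 \<Rightarrow> real^3 \<Rightarrow> bool" where
 "orthonormal_frame u v w \<longleftrightarrow> norm u = 1 \<and> norm v = 1 \<and> norm w = 1 \<and>
   u \<bullet> v = 0 \<and> u \<bullet> w = 0 \<and> v \<bullet> w = 0 \<and>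
   (\<forall>x. x = (x \<bullet> u) *\<^sub>R u + (x \<bullet> v) *\<^sub>R v + (x \<bullet> w) *\<^sub>R w)"

lemma orthonormal_frame_exists:
 fixes u :: "real^3"
 assumes "norm u = 1"
 obtains v w where "orthonormal_frame u v w"
proof -
 obtain S where S: "u \<in> S" "pairwise orthogonal S" "\<And>x. x \<in> S \<Longrightarrow> norm x = 1"
  "independent S" "card S = DIM(real^3)" "span S = (UNIV :: (real^3) set)"
  using vector_in_orthonormal_basis[OF assms] by metis
 have fin: "finite S" using S(4) by (rule independent_imp_finite)
 have "card (S - {u}) = 2" using S(1,5) fin by simp
 then obtain v w where vw: "S - {u} = {v, w}" "v \<noteq> w" by (auto simp: card_2_iff)
 then have SS: "S = {u, v, w}" and ne: "u \<noteq> v" "u \<noteq> w" using S(1) by auto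
 have orth: "u \<bullet> v = 0" "u \<bullet> w = 0" "v \<bullet> w = 0"
  using S(2) ne vw(2) unfolding SS pairwise_def orthogonal_def by auto
 have "x = (x \<bullet> u) *\<^sub>R u + (x \<bullet> v) *\<^sub>R v + (x \<bullet> w) *\<^sub>R w" for x
 proof -
  have "(\<Sum>i\<in>S. (x \<bullet> i) *\<^sub>R i) = x"
   by (rule orthonormal_basis_expand[OF S(2,3)]) (use S(6) fin in auto)
  then show ?thesis unfolding SS using ne vw(2) by (simp add: add.assoc)
 qed
 then have "orthonormal_frame u v w"
  unfolding orthonormal_frame_def using S(3) SS orth by auto
 then show ?thesis by (rule that)
qed

lemma orthonormal_frame_rotate: "orthonormal_frame u v w \<Longrightarrow> orthonormal_frame v w u"
 unfolding orthonormal_frame_def by (auto simp: inner_commute add.commute add.left_commute)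

lemma orthonormal_frame_norm_sq:
 assumes "orthonormal_frame u v w"
 shows "(norm x)\<^sup>2 = (x \<bullet> u)\<^sup>2 + (x \<bullet> v)\<^sup>2 + (x \<bullet> w)\<^sup>2"
proof -
 have x: "x = (x \<bullet> u) *\<^sub>R u + (x \<bullet> v) *\<^sub>R v + (x \<bullet> w) *\<^sub>R w"
  using assms unfolding orthonormal_frame_def by blast
 have "x \<bullet> x = x \<bullet> ((x \<bullet> u) *\<^sub>R u + (x \<bullet> v) *\<^sub>R v + (x \<bullet> w) *\<^sub>R w)"
  using x by simp
 then show ?thesis unfolding power2_norm_eq_inner by (simp add: inner_add_right power2_eq_square)
qed

definition frame_box :: "real^3 \<Rightarrow> real^3 \<Rightarrow> real^3 \<Rightarrow> real^3 \<Rightarrow> real \<Rightarrow> real \<Rightarrow> real \<Rightarrow> (real^3) set" where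
 "frame_box c u v w h1 h2 h3 =
   {x. \<bar>(x - c) \<bullet> u\<bar> \<le> h1 \<and> \<bar>(x - c) \<bullet> v\<bar> \<le> h2 \<and> \<bar>(x - c) \<bullet> w\<bar> \<le> h3}"

lemma closed_frame_box: "closed (frame_box c u v w h1 h2 h3)"
 unfolding frame_box_def
 by (intro closed_Collect_conj closed_Collect_le continuous_intros)

lemma convex_frame_box: "convex (frame_box c u v w h1 h2 h3)"
proof -
 have slab: "convex {x. \<bar>(x - c) \<bullet> u\<bar> \<le> h}" for u :: "real^3" and h
 proof -
  have "{x. \<bar>(x - c) \<bullet> u\<bar> \<le> h} = {x. u \<bullet> x \<le> h + u \<bullet> c} \<inter> {x. u \<bullet> x \<ge> u \<bullet> c - h}"
   by (auto simp: inner_diff_right inner_commute abs_le_iff)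
  then show ?thesis by (simp add: convex_Int convex_halfspace_le convex_halfspace_ge)
 qed
 have "frame_box c u v w h1 h2 h3 = {x. \<bar>(x - c) \<bullet> u\<bar> \<le> h1} \<inter> {x. \<bar>(x - c) \<bullet> v\<bar> \<le> h2} \<inter> {x. \<bar>(x - c) \<bullet> w\<bar> \<le> h3}"
  by (auto simp: frame_box_def)
 then show ?thesis using slab by (simp add: convex_Int)
qed

text \<open>The nearest-point projection onto a closed convex set is a contraction; it cannot increase the area
of a face of a box.\<close>

lemma hausdorff2_outer_projected_face:
 fixes K :: "(real^3) set"
 assumes K: "closed K" "convex K" "K \<noteq> {}" and fr: "orthonormal_frame u v w"
  and h: "0 \<le> h1" "0 \<le> h2"
  and A: "\<And>x. x \<in> A \<Longrightarrow> \<exists>q. (q - c) \<bullet> w = l \<and> \<bar>(q - c) \<bullet> u\<bar> \<le> h1 \<and> \<bar>(q - c) \<bullet> v\<bar> \<le> h2 \<and> closest_point K q = x"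
 shows "hausdorff2_outer A \<le> ennreal (pi * (4*h1) * (4*h2))"
proof (rule hausdorff2_outer_param_le)
 define G where "G s t = c + (4*h1 * s - h1) *\<^sub>R u + (4*h2 * t - h2) *\<^sub>R v + l *\<^sub>R w" for s t
 show "dist (closest_point K (G s t)) (closest_point K (G s' t')) \<le> 4*h1 * \<bar>s - s'\<bar> + 4*h2 * \<bar>t - t'\<bar>" for s t s' t'
 proof -
  have "dist (closest_point K (G s t)) (closest_point K (G s' t')) \<le> dist (G s t) (G s' t')"
   by (rule closest_point_lipschitz[OF K(2,1,3)])
  also have "\<dots> = norm ((4*h1 * (s - s')) *\<^sub>R u + (4*h2 * (t - t')) *\<^sub>R v)"
   by (simp add: G_def dist_norm algebra_simps)
  also have "\<dots> \<le> norm ((4*h1 * (s - s')) *\<^sub>R u) + norm ((4*h2 * (t - t')) *\<^sub>R v)"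
   by (rule norm_triangle_ineq)
  also have "\<dots> = 4*h1 * \<bar>s - s'\<bar> + 4*h2 * \<bar>t - t'\<bar>"
   using fr h by (simp add: orthonormal_frame_def abs_mult)
  finally show ?thesis .
 qed
 show "A \<subseteq> {closest_point K (G s t) | s t. s \<in> {0..<1} \<and> t \<in> {0..<1}}"
 proof
  fix x assume "x \<in> A"
  then obtain q where q: "(q - c) \<bullet> w = l" "\<bar>(q - c) \<bullet> u\<bar> \<le> h1" "\<bar>(q - c) \<bullet> v\<bar> \<le> h2" "closest_point K q = x"
   using A by blast
  define s where "s = (if h1 = 0 then 0 else ((q - c) \<bullet> u + h1) / (4*h1))"
  define t where "t = (if h2 = 0 then 0 else ((q - c) \<bullet> v + h2) / (4*h2))"
  have s: "4*h1 * s - h1 = (q - c) \<bullet> u" "0 \<le> s" "s < 1" using q(2) h by (auto simp: s_def field_simps abs_le_iff)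
  have t: "4*h2 * t - h2 = (q - c) \<bullet> v" "0 \<le> t" "t < 1" using q(3) h by (auto simp: t_def field_simps abs_le_iff)
  have "q - c = ((q - c) \<bullet> u) *\<^sub>R u + ((q - c) \<bullet> v) *\<^sub>R v + ((q - c) \<bullet> w) *\<^sub>R w"
   using fr unfolding orthonormal_frame_def by blast
  then have "q = G s t" unfolding G_def s(1) t(1) using q(1) by (simp add: algebra_simps)
  then show "x \<in> {closest_point K (G s t) | s t. s \<in> {0..<1} \<and> t \<in> {0..<1}}"
   unfolding mem_Collect_eq using q(4) s t by (intro exI[of _ s] exI[of _ t]) auto
 qed
qed (use h in auto)

lemma closest_point_outward_normal:
 fixes K :: "'a::euclidean_space set"
 assumes K: "closed K" "convex K" and x: "x \<in> K" and n: "\<And>y. y \<in> K \<Longrightarrow> n \<bullet> (y - x) \<le> 0" and \<tau>: "0 \<le> \<tau>"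
 shows "closest_point K (x + \<tau> *\<^sub>R n) = x"
proof -
 have "dist (x + \<tau> *\<^sub>R n) x \<le> dist (x + \<tau> *\<^sub>R n) y" if "y \<in> K" for y
 proof -
  have "(norm (\<tau> *\<^sub>R n))\<^sup>2 \<le> (norm (\<tau> *\<^sub>R n))\<^sup>2 + (norm (y - x))\<^sup>2 - 2 * \<tau> * (n \<bullet> (y - x))"
   using mult_nonneg_nonpos[OF \<tau> n[OF that]] zero_le_power2[of "norm (y - x)"] by linarith
  also have "\<dots> = (norm (\<tau> *\<^sub>R n - (y - x)))\<^sup>2"
   unfolding power2_norm_eq_inner by (simp add: inner_diff_left inner_diff_right inner_commute algebra_simps)
  finally have "norm (\<tau> *\<^sub>R n) \<le> norm (\<tau> *\<^sub>R n - (y - x))" by (rule power2_le_imp_le) simp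
  then show ?thesis by (simp add: dist_norm algebra_simps)
 qed
 then show ?thesis using closest_point_unique[OF K(2,1) x] by metis
qed

text \<open>A ray that starts in a box leaves it through one of the faces.\<close>

lemma ray_hits_box_face:
 assumes x: "x \<in> frame_box c u v w h1 h2 h3" and fr: "orthonormal_frame u v w" and n: "n \<noteq> 0"
 obtains \<tau> where "0 \<le> \<tau>" "x + \<tau> *\<^sub>R n \<in> frame_box c u v w h1 h2 h3"
  "\<bar>(x + \<tau> *\<^sub>R n - c) \<bullet> u\<bar> = h1 \<or> \<bar>(x + \<tau> *\<^sub>R n - c) \<bullet> v\<bar> = h2 \<or> \<bar>(x + \<tau> *\<^sub>R n - c) \<bullet> w\<bar> = h3"
proof -
 let ?B = "frame_box c u v w h1 h2 h3"
 let ?R = "(\<lambda>\<tau>. x + \<tau> *\<^sub>R n) ` {0..}"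
 have "connected ?R"
  by (intro connected_continuous_image continuous_intros) (simp add: is_interval_connected)
 moreover have "?R \<inter> ?B \<noteq> {}" using x by force
 moreover have "?R - ?B \<noteq> {}"
 proof -
  have "n \<bullet> u \<noteq> 0 \<or> n \<bullet> v \<noteq> 0 \<or> n \<bullet> w \<noteq> 0"
   using orthonormal_frame_norm_sq[OF fr, of n] n by auto
  then obtain e h where e: "n \<bullet> e \<noteq> 0" and B: "\<And>y. y \<in> ?B \<Longrightarrow> \<bar>(y - c) \<bullet> e\<bar> \<le> h"
   unfolding frame_box_def by blast
  define \<tau> where "\<tau> = (\<bar>h\<bar> + \<bar>(x - c) \<bullet> e\<bar> + 1) / \<bar>n \<bullet> e\<bar>"
  have "\<tau> \<ge> 0" by (simp add: \<tau>_def)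
  have "\<bar>\<tau> * (n \<bullet> e)\<bar> = \<bar>h\<bar> + \<bar>(x - c) \<bullet> e\<bar> + 1"
   using e by (simp add: \<tau>_def abs_mult)
  moreover have "(x + \<tau> *\<^sub>R n - c) \<bullet> e = (x - c) \<bullet> e + \<tau> * (n \<bullet> e)"
   by (simp add: inner_diff_left inner_add_left)
  ultimately have "\<bar>(x + \<tau> *\<^sub>R n - c) \<bullet> e\<bar> > h" by linarith
  then have "x + \<tau> *\<^sub>R n \<notin> ?B" using B[of "x + \<tau> *\<^sub>R n"] by linarith
  then show ?thesis using \<open>\<tau> \<ge> 0\<close> by blast
 qed
 ultimately obtain \<tau> where \<tau>: "0 \<le> \<tau>" "x + \<tau> *\<^sub>R n \<in> frontier ?B"
  using connected_Int_frontier[of ?R ?B] by blast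
 define q where "q = x + \<tau> *\<^sub>R n"
 have qB: "q \<in> ?B" using \<tau>(2) closed_frame_box[of c u v w h1 h2 h3] frontier_subset_closed unfolding q_def by blast
 let ?I = "{y. \<bar>(y - c) \<bullet> u\<bar> < h1 \<and> \<bar>(y - c) \<bullet> v\<bar> < h2 \<and> \<bar>(y - c) \<bullet> w\<bar> < h3}"
 have "open ?I" by (intro open_Collect_conj open_Collect_less continuous_intros)
 then have "?I \<subseteq> interior ?B" by (intro interior_maximal) (auto simp: frame_box_def)
 then have "q \<notin> ?I" using \<tau>(2) unfolding frontier_def q_def by blast
 then have "\<bar>(q - c) \<bullet> u\<bar> = h1 \<or> \<bar>(q - c) \<bullet> v\<bar> = h2 \<or> \<bar>(q - c) \<bullet> w\<bar> = h3"
  using qB by (auto simp: frame_box_def)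
 then show ?thesis using that[of \<tau>] \<tau>(1) qB unfolding q_def by blast
qed

text \<open>The area of the boundary of a convex body is at most a multiple of that of a box around it: the point
where an outward normal ray leaves the box is mapped back to its origin by the nearest-point projection.\<close>

lemma support_area_le:
 fixes K A :: "(real^3) set"
 assumes K: "closed K" "convex K" "K \<subseteq> frame_box c u v w h1 h2 h3" and fr: "orthonormal_frame u v w"
  and A: "A \<subseteq> K" "\<And>x. x \<in> A \<Longrightarrow> \<exists>n. n \<noteq> 0 \<and> (\<forall>y\<in>K. n \<bullet> (y - x) \<le> 0)"
  and h: "0 \<le> h1" "0 \<le> h2" "0 \<le> h3"
 shows "hausdorff2_outer A \<le> ennreal (32 * pi * (h1 * h2 + h2 * h3 + h3 * h1))"
proof (cases "A = {}")
 case False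
 then have Kne: "K \<noteq> {}" using A(1) by blast
 define F where "F e h = {x \<in> A. \<exists>q \<in> frame_box c u v w h1 h2 h3. (q - c) \<bullet> e = h \<and> closest_point K q = x}" for e h
 have cov: "A \<subseteq> (F u h1 \<union> F u (-h1)) \<union> ((F v h2 \<union> F v (-h2)) \<union> (F w h3 \<union> F w (-h3)))"
 proof
  fix x assume x: "x \<in> A"
  then obtain n where n: "n \<noteq> 0" "\<And>y. y \<in> K \<Longrightarrow> n \<bullet> (y - x) \<le> 0" using A(2) by blast
  have "x \<in> frame_box c u v w h1 h2 h3" "x \<in> K" using A(1) K(3) x by blast+
  then obtain \<tau> where \<tau>: "0 \<le> \<tau>" "x + \<tau> *\<^sub>R n \<in> frame_box c u v w h1 h2 h3"
   "\<bar>(x + \<tau> *\<^sub>R n - c) \<bullet> u\<bar> = h1 \<or> \<bar>(x + \<tau> *\<^sub>R n - c) \<bullet> v\<bar> = h2 \<or> \<bar>(x + \<tau> *\<^sub>R n - c) \<bullet> w\<bar> = h3"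
   using ray_hits_box_face[OF _ fr n(1)] by metis
  define q where "q = x + \<tau> *\<^sub>R n"
  have "closest_point K q = x" unfolding q_def
   using closest_point_outward_normal[OF K(1,2) \<open>x \<in> K\<close> n(2) \<tau>(1)] by blast
  moreover have "((q - c) \<bullet> u = h1 \<or> (q - c) \<bullet> u = -h1) \<or> ((q - c) \<bullet> v = h2 \<or> (q - c) \<bullet> v = -h2)
    \<or> ((q - c) \<bullet> w = h3 \<or> (q - c) \<bullet> w = -h3)"
   using \<tau>(3) unfolding q_def[symmetric] by linarith
  ultimately show "x \<in> (F u h1 \<union> F u (-h1)) \<union> ((F v h2 \<union> F v (-h2)) \<union> (F w h3 \<union> F w (-h3)))"
   unfolding F_def using x \<tau>(2)[folded q_def] by blast
 qed
 have fw: "hausdorff2_outer (F w h) \<le> ennreal (pi * (4*h1) * (4*h2))" for h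
  by (rule hausdorff2_outer_projected_face[OF K(1,2) Kne fr assms(7,8), where c = c and l = h])
    (auto simp: F_def frame_box_def)
 have fu: "hausdorff2_outer (F u h) \<le> ennreal (pi * (4*h2) * (4*h3))" for h
  by (rule hausdorff2_outer_projected_face[OF K(1,2) Kne orthonormal_frame_rotate[OF fr] assms(8,9), where c = c and l = h])
    (auto simp: F_def frame_box_def)
 have fv: "hausdorff2_outer (F v h) \<le> ennreal (pi * (4*h3) * (4*h1))" for h
  by (rule hausdorff2_outer_projected_face[OF K(1,2) Kne orthonormal_frame_rotate[OF orthonormal_frame_rotate[OF fr]] assms(9,7), where c = c and l = h])
    (auto simp: F_def frame_box_def)
 have "hausdorff2_outer A \<le> (hausdorff2_outer (F u h1) + hausdorff2_outer (F u (-h1))) +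
   ((hausdorff2_outer (F v h2) + hausdorff2_outer (F v (-h2))) + (hausdorff2_outer (F w h3) + hausdorff2_outer (F w (-h3))))"
  by (rule order_trans[OF hausdorff2_outer_mono[OF cov] order_trans[OF hausdorff2_outer_Un
     add_mono[OF hausdorff2_outer_Un order_trans[OF hausdorff2_outer_Un add_mono[OF hausdorff2_outer_Un hausdorff2_outer_Un]]]]])
 also have "\<dots> \<le> (ennreal (pi * (4*h2) * (4*h3)) + ennreal (pi * (4*h2) * (4*h3))) +
   ((ennreal (pi * (4*h3) * (4*h1)) + ennreal (pi * (4*h3) * (4*h1))) + (ennreal (pi * (4*h1) * (4*h2)) + ennreal (pi * (4*h1) * (4*h2))))"
  by (intro add_mono fu fv fw)
 also have "\<dots> = ennreal (32 * pi * (h1 * h2 + h2 * h3 + h3 * h1))"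
  using h by (simp add: ennreal_plus[symmetric] algebra_simps del: ennreal_plus)
 finally show ?thesis .
qed simp

lemma emeasure_hausdorff2_singleton [simp]: "emeasure hausdorff2 {x :: 'a::metric_space} = 0"
proof -
 have "hausdorff2_outer {x} \<le> ennreal (pi * 0 * 0)"
  by (rule hausdorff2_outer_param_le[where g = "\<lambda>_ _. x"]) (auto intro!: exI[of _ 0])
 then show ?thesis by (simp add: emeasure_hausdorff2)
qed

section \<open>Convexity of the energy and the resonant surfaces\<close>

text \<open>The gradient of \<open>|x|^a/a\<close>.\<close>

definition flux :: "real \<Rightarrow> 'a::real_inner \<Rightarrow> 'a" where
 "flux a x = norm x powr (a - 2) *\<^sub>R x"

lemma weighted_young:
 fixes u v a :: real
 assumes "1 \<le> a" "0 \<le> u" "0 \<le> v"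
 shows "a * (u powr (a - 1) * v) \<le> (a - 1) * u powr a + v powr a"
proof (cases "u = 0 \<or> v = 0")
 case True then show ?thesis using assms by auto
next
 case False
 then have uv: "0 < u" "0 < v" using assms by auto
 have "(v powr a) powr (1/a) * (u powr a) powr (1 - 1/a) \<le> (1/a) * v powr a + (1 - 1/a) * u powr a"
  using assms uv by (intro Youngs_inequality_0) (auto simp: field_simps)
 moreover have "(v powr a) powr (1/a) = v" using assms uv by (simp add: powr_powr)
 moreover have "(u powr a) powr (1 - 1/a) = u powr (a - 1)"
  using assms by (simp add: powr_powr algebra_simps)
 ultimately have "a * (v * u powr (a - 1)) \<le> a * ((1/a) * v powr a + (1 - 1/a) * u powr a)"
  using assms by (intro mult_left_mono) auto
 also have "\<dots> = v powr a + (a - 1) * u powr a" using assms by (simp add: field_simps)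
 finally show ?thesis by (simp add: algebra_simps)
qed

lemma inner_flux_self: "x \<noteq> 0 \<Longrightarrow> flux a x \<bullet> x = norm x powr a"
proof -
 assume "x \<noteq> 0"
 have "flux a x \<bullet> x = norm x powr (a - 2) * (norm x)\<^sup>2"
  by (simp add: flux_def power2_norm_eq_inner)
 also have "\<dots> = norm x powr (a - 2) * norm x powr 2" using \<open>x \<noteq> 0\<close> by (simp add: powr_numeral)
 also have "\<dots> = norm x powr a" unfolding powr_add[symmetric] by simp
 finally show ?thesis .
qed

lemma inner_flux_le:
 assumes "x \<noteq> 0" shows "flux a x \<bullet> z \<le> norm x powr (a - 1) * norm z"
proof -
 have "flux a x \<bullet> z \<le> norm x powr (a - 2) * (norm x * norm z)"
  unfolding flux_def inner_scaleR_left
  by (intro mult_left_mono) (auto intro: order_trans[OF abs_ge_self Cauchy_Schwarz_ineq2])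
 also have "\<dots> = (norm x powr (a - 2) * norm x powr 1) * norm z" using assms by simp
 also have "norm x powr (a - 2) * norm x powr 1 = norm x powr (a - 1)"
  unfolding powr_add[symmetric] by simp
 finally show ?thesis .
qed

lemma norm_flux:
 assumes "x \<noteq> 0" shows "norm (flux a x) = norm x powr (a - 1)"
proof -
 have "norm (flux a x) = norm x powr (a - 2) * norm x powr 1" using assms by (simp add: flux_def)
 also have "\<dots> = norm x powr (a - 1)" unfolding powr_add[symmetric] by simp
 finally show ?thesis .
qed

lemma norm_powr_above_tangent:
 fixes x z :: "'a::real_inner"
 assumes "1 \<le> a" "x \<noteq> 0"
 shows "norm x powr a + a * (flux a x \<bullet> (z - x)) \<le> norm z powr a"
proof -
 have "a * (flux a x \<bullet> z) \<le> a * (norm x powr (a - 1) * norm z)"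
  using inner_flux_le[OF assms(2), of a z] assms(1) by (intro mult_left_mono) auto
 also have "\<dots> \<le> (a - 1) * norm x powr a + norm z powr a"
  using weighted_young[of a "norm x" "norm z"] assms by simp
 finally show ?thesis
  using inner_flux_self[OF assms(2), of a] by (simp add: inner_diff_right algebra_simps)
qed

lemma convex_on_norm_powr:
 assumes "1 \<le> a" shows "convex_on UNIV (\<lambda>x::'a::real_inner. norm x powr a)"
proof (intro convex_onI)
 fix t :: real and x y :: 'a assume t: "0 < t" "t < 1"
 define m where "m = (1 - t) *\<^sub>R x + t *\<^sub>R y"
 show "norm ((1 - t) *\<^sub>R x + t *\<^sub>R y) powr a \<le> (1 - t) * norm x powr a + t * norm y powr a"
 proof (cases "m = 0")
  case True
  then have "norm ((1 - t) *\<^sub>R x + t *\<^sub>R y) powr a = 0" by (simp add: m_def)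
  also have "\<dots> \<le> (1 - t) * norm x powr a + t * norm y powr a"
   using t by (intro add_nonneg_nonneg mult_nonneg_nonneg) auto
  finally show ?thesis .
 next
  case False
  have "(1 - t) * (norm m powr a + a * (flux a m \<bullet> (x - m))) + t * (norm m powr a + a * (flux a m \<bullet> (y - m)))
    \<le> (1 - t) * norm x powr a + t * norm y powr a"
   using norm_powr_above_tangent[OF assms False] t by (intro add_mono mult_left_mono) auto
  also have "(1 - t) * (norm m powr a + a * (flux a m \<bullet> (x - m))) + t * (norm m powr a + a * (flux a m \<bullet> (y - m)))
    = norm m powr a + a * (flux a m \<bullet> ((1 - t) *\<^sub>R (x - m) + t *\<^sub>R (y - m)))"
   by (simp add: inner_add_right algebra_simps)
  also have "(1 - t) *\<^sub>R (x - m) + t *\<^sub>R (y - m) = 0" by (simp add: m_def algebra_simps)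
  finally show ?thesis by (simp add: m_def)
 qed
qed auto

lemma GDERIV_norm_powr:
 assumes "x \<noteq> 0" shows "GDERIV (\<lambda>x. norm x powr a) x :> a *\<^sub>R flux a x"
proof -
 have "DERIV (\<lambda>r. r powr a) (norm x) :> a * norm x powr (a - 1)"
  using assms by (intro has_real_derivative_powr) auto
 then have "GDERIV (\<lambda>x. norm x powr a) x :> (a * norm x powr (a - 1)) *\<^sub>R sgn x"
  by (intro GDERIV_DERIV_compose GDERIV_norm assms)
 moreover have "norm x powr (a - 1) = norm x powr (a - 2) * norm x powr 1"
  unfolding powr_add[symmetric] by simp
 then have "(a * norm x powr (a - 1)) *\<^sub>R sgn x = a *\<^sub>R flux a x"
  using assms by (simp add: flux_def sgn_div_norm)
 ultimately show ?thesis by simp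
qed

lemma gradient_eqI: "GDERIV F x :> D \<Longrightarrow> gradient F x = D"
 unfolding gradient_def
proof (rule the_equality)
 fix D' assume "GDERIV F x :> D" "GDERIV F x :> D'"
 then have "(\<lambda>h. h \<bullet> D) = (\<lambda>h. h \<bullet> D')" unfolding gderiv_def by (rule has_derivative_unique)
 then have "h \<bullet> D = h \<bullet> D'" for h by meson
 then have "(D' - D) \<bullet> (D' - D) = 0" by (simp add: inner_diff_right)
 then show "D' = D" by simp
qed

lemma gradient_resonance:
 assumes "x \<noteq> 0" "x \<noteq> p + p1"
 shows "gradient (resonance a p p1) x = a *\<^sub>R (flux a x - flux a (p + p1 - x))"
proof (rule gradient_eqI)
 have 1: "((\<lambda>x. norm x powr a) has_derivative (\<lambda>h. h \<bullet> (a *\<^sub>R flux a x))) (at x)"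
  using GDERIV_norm_powr[OF assms(1)] by (simp add: gderiv_def)
 have "p + p1 - x \<noteq> 0" using assms(2) by auto
 then have shift: "((\<lambda>x. norm x powr a) has_derivative (\<lambda>h. h \<bullet> (a *\<^sub>R flux a (p + p1 - x)))) (at (p + p1 - x))"
  by (intro GDERIV_norm_powr[unfolded gderiv_def])
 have "((\<lambda>x. p + p1 - x) has_derivative (\<lambda>h. 0 - h)) (at x)"
  by (intro has_derivative_diff has_derivative_const has_derivative_ident)
 from has_derivative_compose[OF this shift]
 have 2: "((\<lambda>x. norm (p + p1 - x) powr a) has_derivative (\<lambda>h. (0 - h) \<bullet> (a *\<^sub>R flux a (p + p1 - x)))) (at x)"
  .
 have "(resonance a p p1 has_derivative (\<lambda>h. (0 - h) \<bullet> (a *\<^sub>R flux a (p + p1 - x)) + h \<bullet> (a *\<^sub>R flux a x) - 0 - 0)) (at x)"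
  unfolding resonance_def by (intro has_derivative_diff has_derivative_add 1 2 has_derivative_const)
 moreover have "(\<lambda>h. (0 - h) \<bullet> (a *\<^sub>R flux a (p + p1 - x)) + h \<bullet> (a *\<^sub>R flux a x) - 0 - 0)
   = (\<lambda>h. h \<bullet> (a *\<^sub>R (flux a x - flux a (p + p1 - x))))"
  by (simp add: fun_eq_iff inner_diff_right algebra_simps)
 ultimately show "GDERIV (resonance a p p1) x :> a *\<^sub>R (flux a x - flux a (p + p1 - x))"
  by (simp add: gderiv_def)
qed

text \<open>Convexity of the resonance function, in the form used for supporting planes of its sublevel set.\<close>

lemma resonance_above_tangent:
 assumes "1 \<le> a" "x \<noteq> 0" "x \<noteq> p + p1"
 shows "resonance a p p1 x + gradient (resonance a p p1) x \<bullet> (z - x) \<le> resonance a p p1 z"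
proof -
 have "p + p1 - x \<noteq> 0" using assms(3) by auto
 have "norm x powr a + a * (flux a x \<bullet> (z - x)) \<le> norm z powr a"
  by (rule norm_powr_above_tangent[OF assms(1,2)])
 moreover have "norm (p + p1 - x) powr a + a * (flux a (p + p1 - x) \<bullet> ((p + p1 - z) - (p + p1 - x))) \<le> norm (p + p1 - z) powr a"
  by (rule norm_powr_above_tangent[OF assms(1)]) fact
 moreover have "(p + p1 - z) - (p + p1 - x) = - (z - x)" by simp
 ultimately show ?thesis
  unfolding gradient_resonance[OF assms(2,3)] resonance_def
  by (simp add: inner_diff_left algebra_simps)
qed

lemma continuous_on_norm_powr [continuous_intros]:
 fixes f :: "'b::topological_space \<Rightarrow> 'a::real_normed_vector"
 assumes "0 < a" "continuous_on S f" shows "continuous_on S (\<lambda>x. norm (f x) powr a)"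
 using assms by (intro continuous_on_powr' continuous_intros) auto

lemma continuous_on_resonance: "1 \<le> a \<Longrightarrow> continuous_on UNIV (resonance a p p1)"
 unfolding resonance_def by (intro continuous_intros) auto

lemma convex_resonance_sublevel:
 assumes "1 \<le> a" shows "convex {x. resonance a p p1 x \<le> 0}"
proof -
 have "convex_on UNIV (resonance a p p1)"
 proof (intro convex_onI)
  fix t :: real and x y :: "real^3" assume t: "0 < t" "t < 1"
  have "norm ((1 - t) *\<^sub>R x + t *\<^sub>R y) powr a \<le> (1 - t) * norm x powr a + t * norm y powr a"
   using convex_onD[OF convex_on_norm_powr[OF assms], of t x y] t by simp
  moreover have "norm ((1 - t) *\<^sub>R (p+p1-x) + t *\<^sub>R (p+p1-y)) powr a \<le> (1 - t) * norm (p+p1-x) powr a + t * norm (p+p1-y) powr a"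
   using convex_onD[OF convex_on_norm_powr[OF assms], of t "p+p1-x" "p+p1-y"] t by simp
  moreover have "(1 - t) *\<^sub>R (p+p1-x) + t *\<^sub>R (p+p1-y) = p + p1 - ((1 - t) *\<^sub>R x + t *\<^sub>R y)"
   by (simp add: algebra_simps)
  ultimately show "resonance a p p1 ((1 - t) *\<^sub>R x + t *\<^sub>R y) \<le> (1 - t) * resonance a p p1 x + t * resonance a p p1 y"
   unfolding resonance_def by (simp add: algebra_simps)
 qed auto
 note conv = this
 show ?thesis unfolding convex_alt
 proof (intro ballI allI impI)
  fix x y and t :: real
  assume xy: "x \<in> {x. resonance a p p1 x \<le> 0}" "y \<in> {x. resonance a p p1 x \<le> 0}" and t: "0 \<le> t \<and> t \<le> 1"
  have "resonance a p p1 ((1 - t) *\<^sub>R x + t *\<^sub>R y) \<le> (1 - t) * resonance a p p1 x + t * resonance a p p1 y"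
   using convex_onD[OF conv, of t x y] t by simp
  also have "\<dots> \<le> (1 - t) * 0 + t * 0" using xy t by (intro add_mono mult_left_mono) auto
  finally show "(1 - t) *\<^sub>R x + t *\<^sub>R y \<in> {x. resonance a p p1 x \<le> 0}" by simp
 qed
qed

lemma closed_resonance_sublevel: "1 \<le> a \<Longrightarrow> closed {x. resonance a p p1 x \<le> 0}"
 using continuous_on_resonance by (intro closed_Collect_le continuous_intros) auto

lemma closed_resonant_set: "1 \<le> a \<Longrightarrow> closed (resonant_set a p p1)"
 unfolding resonant_set_def using continuous_on_resonance by (intro closed_Collect_eq continuous_intros) auto

lemma resonant_set_commute: "resonant_set a p p1 = resonant_set a p1 p"
 by (auto simp: resonant_set_def resonance_def algebra_simps)

lemma resonance_commute: "resonance a p p1 = resonance a p1 p"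
 by (auto simp: resonance_def algebra_simps)

lemma resonant_set_sum: "x \<in> resonant_set a p p1 \<longleftrightarrow> norm x powr a + norm (p + p1 - x) powr a = norm p powr a + norm p1 powr a"
 by (auto simp: resonant_set_def resonance_def)

text \<open>The gradient is an outward normal of the convex set where the resonance function is non-positive;
the two points where it may not exist carry no area.\<close>

lemma resonant_area_box:
 assumes "1 \<le> a" "orthonormal_frame u v w" "A \<subseteq> resonant_set a p p1 \<inter> frame_box c u v w h1 h2 h3"
  and "\<And>x. x \<in> A \<Longrightarrow> x \<noteq> 0 \<Longrightarrow> x \<noteq> p + p1 \<Longrightarrow> gradient (resonance a p p1) x \<noteq> 0"
  and "0 \<le> h1" "0 \<le> h2" "0 \<le> h3"
 shows "hausdorff2_outer A \<le> ennreal (32 * pi * (h1 * h2 + h2 * h3 + h3 * h1))"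
proof -
 let ?K = "{x. resonance a p p1 x \<le> 0} \<inter> frame_box c u v w h1 h2 h3"
 let ?A = "A - {0, p + p1}"
 have Abound: "hausdorff2_outer ?A \<le> ennreal (32 * pi * (h1 * h2 + h2 * h3 + h3 * h1))"
 proof (rule support_area_le[where K = ?K])
  show "closed ?K" by (intro closed_Int closed_resonance_sublevel closed_frame_box assms)
  show "convex ?K" by (intro convex_Int convex_resonance_sublevel convex_frame_box assms)
  show "?A \<subseteq> ?K" using assms(3) by (auto simp: resonant_set_def)
  show "\<exists>n. n \<noteq> 0 \<and> (\<forall>y\<in>?K. n \<bullet> (y - x) \<le> 0)" if "x \<in> ?A" for x
  proof (intro exI conjI ballI)
   show "gradient (resonance a p p1) x \<noteq> 0" using that assms(4) by auto
   fix y assume "y \<in> ?K"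
   moreover have "resonance a p p1 x = 0" using that assms(3) by (auto simp: resonant_set_def)
   ultimately show "gradient (resonance a p p1) x \<bullet> (y - x) \<le> 0"
    using resonance_above_tangent[OF assms(1), of x p p1 y] that by auto
  qed
 qed (use assms in auto)
 have "hausdorff2_outer A \<le> hausdorff2_outer (?A \<union> ({0} \<union> {p + p1}))"
  by (rule hausdorff2_outer_mono) blast
 also have "\<dots> \<le> hausdorff2_outer ?A + hausdorff2_outer ({0} \<union> {p + p1})"
  by (rule hausdorff2_outer_Un)
 also have "\<dots> \<le> hausdorff2_outer ?A + (hausdorff2_outer {0::real^3} + hausdorff2_outer {p + p1})"
  by (rule add_left_mono[OF hausdorff2_outer_Un])
 finally have "hausdorff2_outer A \<le> hausdorff2_outer ?A + (hausdorff2_outer {0::real^3} + hausdorff2_outer {p + p1})" .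
 moreover have "hausdorff2_outer {0::real^3} = 0" "hausdorff2_outer {p + p1} = 0"
  by (simp_all add: emeasure_hausdorff2[symmetric])
 ultimately have "hausdorff2_outer A \<le> hausdorff2_outer ?A" by simp
 also have "\<dots> \<le> ennreal (32 * pi * (h1 * h2 + h2 * h3 + h3 * h1))" by (rule Abound)
 finally show ?thesis .
qed

lemma resonant_area_ball:
 assumes "1 \<le> a" "A \<subseteq> resonant_set a p p1 \<inter> cball c r"
  and "\<And>x. x \<in> A \<Longrightarrow> x \<noteq> 0 \<Longrightarrow> x \<noteq> p + p1 \<Longrightarrow> gradient (resonance a p p1) x \<noteq> 0"
  and "0 \<le> r"
 shows "hausdorff2_outer A \<le> ennreal (96 * pi * r\<^sup>2)"
proof -
 obtain v w :: "real^3" where fr: "orthonormal_frame (axis 1 1) v w"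
  using orthonormal_frame_exists[of "axis 1 1"] by (metis norm_axis_1)
 have "\<bar>(x - c) \<bullet> e\<bar> \<le> r" if "x \<in> cball c r" "norm e = 1" for x e :: "real^3"
  using that Cauchy_Schwarz_ineq2[of "x - c" e] by (simp add: dist_norm norm_minus_commute)
 then have "cball c r \<subseteq> frame_box c (axis 1 1) v w r r r"
  using fr by (auto simp: frame_box_def orthonormal_frame_def)
 then have "hausdorff2_outer A \<le> ennreal (32 * pi * (r * r + r * r + r * r))"
  using assms by (intro resonant_area_box[OF assms(1) fr, of A p p1 c r r r]) auto
 then show ?thesis by (simp add: power2_eq_square algebra_simps)
qed

lemma powr_diff_ge:
 fixes X Y a :: real
 assumes "1 < a" "0 < Y" "Y \<le> X"
 shows "min 1 (a - 1) * X powr (a - 2) * (X - Y) \<le> X powr (a - 1) - Y powr (a - 1)"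
proof -
 have X: "0 < X" using assms by simp
 have XX: "X powr (a - 1) = X powr (a - 2) * X"
  using powr_add[of X "a - 2" 1] X by simp
 show ?thesis
 proof (cases "a \<ge> 2")
  case True
  have "Y powr (a - 1) = Y powr (a - 2) * Y"
   using powr_add[of Y "a - 2" 1] assms by simp
  also have "\<dots> \<le> X powr (a - 2) * Y"
   using assms True by (intro mult_right_mono powr_mono2) auto
  finally have "X powr (a - 2) * (X - Y) \<le> X powr (a - 1) - Y powr (a - 1)"
   unfolding XX by (simp add: algebra_simps)
  then show ?thesis using True by (simp add: min_def)
 next
  case False
  have "Y powr (a - 1) * X powr (1 - (a - 1)) \<le> (a - 1) * Y + (1 - (a - 1)) * X"
   using assms False X by (intro Youngs_inequality_0) auto
  then have le: "X powr (a - 2) * (Y powr (a - 1) * X powr (2 - a)) \<le> X powr (a - 2) * ((a - 1) * Y + (2 - a) * X)"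
   by (intro mult_left_mono) (auto simp: algebra_simps)
  have eq: "X powr (a - 2) * (Y powr (a - 1) * X powr (2 - a)) = Y powr (a - 1)"
  proof -
   have "X powr (a - 2) * X powr (2 - a) = 1"
    using powr_add[of X "a - 2" "2 - a"] X by simp
   then show ?thesis by (metis mult.commute mult.left_commute mult_1)
  qed
  have "(a - 1) * X powr (a - 2) * (X - Y) \<le> X powr (a - 1) - Y powr (a - 1)"
   using le unfolding XX eq by (simp add: algebra_simps)
  then show ?thesis using False assms by (simp add: min_def)
 qed
qed

text \<open>Both factors are split into the radial part, controlled by \<open>powr_diff_ge\<close>, and the angular part.
This is the quantitative convexity of \<open>|x|^a\<close> that fails for \<open>a = 1\<close>, where the resonant surfaces are
ellipsoids and are treated by explicit formulas.\<close>

lemma flux_strongly_monotone: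
 fixes x y :: "'a::real_inner"
 assumes "1 < a" "x \<noteq> 0" "y \<noteq> 0"
 shows "min (1/2) (a - 1) * max (norm x) (norm y) powr (a - 2) * (norm (x - y))\<^sup>2 \<le> (flux a x - flux a y) \<bullet> (x - y)"
proof -
 have *: "min (1/2) (a - 1) * norm x powr (a - 2) * (norm (x - y))\<^sup>2 \<le> (flux a x - flux a y) \<bullet> (x - y)"
  if xy: "x \<noteq> 0" "y \<noteq> 0" "norm y \<le> norm x" for x y :: 'a
 proof -
  define X Y g where "X = norm x" and "Y = norm y" and "g = X * Y - x \<bullet> y"
  have XY: "0 < Y" "Y \<le> X" "0 < X" using xy by (auto simp: X_def Y_def)
  have g: "0 \<le> g" using norm_cauchy_schwarz[of x y] by (simp add: g_def X_def Y_def)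
  have sq: "(norm (x - y))\<^sup>2 = (X - Y)\<^sup>2 + 2 * g"
   unfolding g_def X_def Y_def power2_diff power2_norm_eq_inner
   by (simp add: inner_diff_left inner_diff_right inner_commute)
  have pw: "Z powr (a - 1) = Z powr (a - 2) * Z" if "Z > 0" for Z :: real
   using powr_add[of Z "a - 2" 1] that by simp
  have "(flux a x - flux a y) \<bullet> (x - y) = X powr (a - 2) * (x \<bullet> x) + Y powr (a - 2) * (y \<bullet> y) - (X powr (a - 2) + Y powr (a - 2)) * (x \<bullet> y)"
   by (simp add: flux_def X_def Y_def inner_diff_left inner_diff_right inner_commute algebra_simps)
  also have "\<dots> = X powr (a - 2) * (X * X) + Y powr (a - 2) * (Y * Y) - (X powr (a - 2) + Y powr (a - 2)) * (X * Y - g)"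
   by (simp add: X_def Y_def g_def dot_square_norm power2_eq_square)
  also have "X powr (a - 2) * (X * X) + Y powr (a - 2) * (Y * Y) - (X powr (a - 2) + Y powr (a - 2)) * (X * Y - g)
    = (X powr (a - 1) - Y powr (a - 1)) * (X - Y) + (X powr (a - 2) + Y powr (a - 2)) * g"
   unfolding pw[OF XY(1)] pw[OF XY(3)] by (simp add: algebra_simps)
  finally have eq: "(flux a x - flux a y) \<bullet> (x - y) = (X powr (a - 1) - Y powr (a - 1)) * (X - Y) + (X powr (a - 2) + Y powr (a - 2)) * g" .
  have "min (1/2) (a - 1) * X powr (a - 2) * (X - Y)\<^sup>2 \<le> min 1 (a - 1) * X powr (a - 2) * (X - Y)\<^sup>2"
   by (intro mult_right_mono) auto
  also have "\<dots> = (min 1 (a - 1) * X powr (a - 2) * (X - Y)) * (X - Y)" by (simp add: power2_eq_square)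
  also have "\<dots> \<le> (X powr (a - 1) - Y powr (a - 1)) * (X - Y)"
   using powr_diff_ge[OF assms(1) XY(1,2)] XY by (intro mult_right_mono) auto
  finally have 1: "min (1/2) (a - 1) * X powr (a - 2) * (X - Y)\<^sup>2 \<le> (X powr (a - 1) - Y powr (a - 1)) * (X - Y)" .
  have "(2 * min (1/2) (a - 1)) * (X powr (a - 2) * g) \<le> 1 * (X powr (a - 2) * g)"
   using g by (intro mult_right_mono) (auto simp: min_def)
  also have "\<dots> \<le> (X powr (a - 2) + Y powr (a - 2)) * g" using g by (simp add: algebra_simps)
  finally show ?thesis using 1 unfolding sq eq X_def[symmetric] by (simp add: algebra_simps)
 qed
 show ?thesis
 proof (cases "norm y \<le> norm x")
  case True then show ?thesis using *[of x y] assms by (simp add: max_def)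
 next
  case False
  have "(flux a x - flux a y) \<bullet> (x - y) = (flux a y - flux a x) \<bullet> (y - x)"
   by (simp add: inner_diff_left inner_diff_right)
  then show ?thesis using *[of y x] False assms by (simp add: max_def norm_minus_commute)
 qed
qed

section \<open>Gradient and area bounds on resonant surfaces\<close>

lemma norm_gradient_resonance_le:
 assumes "1 \<le> a" "x \<noteq> 0" "x \<noteq> p + p1"
 shows "norm (gradient (resonance a p p1) x) \<le> a * (norm x powr (a - 1) + norm (p + p1 - x) powr (a - 1))"
proof -
 have "p + p1 - x \<noteq> 0" using assms(3) by auto
 then have "norm (flux a x - flux a (p + p1 - x)) \<le> norm x powr (a - 1) + norm (p + p1 - x) powr (a - 1)"
  using norm_triangle_ineq4[of "flux a x" "flux a (p + p1 - x)"] assms(2) by (simp add: norm_flux)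
 then show ?thesis using assms by (simp add: gradient_resonance mult_left_mono)
qed

lemma norm_gradient_resonance_ge:
 assumes "1 \<le> a" "x \<noteq> 0" "x \<noteq> p + p1"
 shows "norm (p + p1 - x) powr (a - 1) - norm x powr (a - 1) \<le> norm (gradient (resonance a p p1) x)"
proof -
 have "p + p1 - x \<noteq> 0" using assms(3) by auto
 then have *: "norm (p + p1 - x) powr (a - 1) - norm x powr (a - 1) \<le> norm (flux a x - flux a (p + p1 - x))"
  using norm_triangle_ineq2[of "flux a (p + p1 - x)" "flux a x"] assms(2) by (simp add: norm_flux norm_minus_commute)
 also have "\<dots> \<le> a * norm (flux a x - flux a (p + p1 - x))"
  using assms(1) mult_right_mono[of 1 a "norm (flux a x - flux a (p + p1 - x))"] by simp
 finally show ?thesis using assms by (simp add: gradient_resonance)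
qed

text \<open>The minimum of the resonance function is attained at the midpoint of \<open>0\<close> and \<open>p + p1\<close>, by symmetry and
convexity.  The tangent at \<open>x\<close> has to descend to this minimum over the distance from \<open>x\<close> to the midpoint.\<close>

lemma norm_gradient_resonance_depth:
 assumes "1 \<le> a" "x \<in> resonant_set a p p1" "x \<noteq> 0" "x \<noteq> p + p1"
 shows "norm p powr a + norm p1 powr a - 2 * norm ((1/2) *\<^sub>R (p + p1)) powr a
   \<le> norm (gradient (resonance a p p1) x) * norm (x - (1/2) *\<^sub>R (p + p1))"
proof -
 let ?h = "(1/2) *\<^sub>R (p + p1)"
 have "?h + ?h = (1/2) *\<^sub>R ((p + p1) + (p + p1))" by (rule scaleR_right_distrib[symmetric])
 then have "?h + ?h = p + p1" by (simp only: scaleR_half_double)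
 then have half: "p + p1 - ?h = ?h" by (metis add_diff_cancel_left')
 have "gradient (resonance a p p1) x \<bullet> (?h - x) \<le> resonance a p p1 ?h"
  using resonance_above_tangent[OF assms(1,3,4), of ?h] assms(2) by (simp add: resonant_set_def)
 also have "resonance a p p1 ?h = 2 * norm ?h powr a - norm p powr a - norm p1 powr a"
  unfolding resonance_def half by simp
 finally have "norm p powr a + norm p1 powr a - 2 * norm ?h powr a \<le> gradient (resonance a p p1) x \<bullet> (x - ?h)"
  by (simp add: inner_diff_right)
 also have "\<dots> \<le> norm (gradient (resonance a p p1) x) * norm (x - ?h)"
  by (rule norm_cauchy_schwarz)
 finally show ?thesis .
qed

lemma norm_gradient_resonance_1:
 assumes "x \<in> resonant_set 1 p p1" "x \<noteq> 0" "x \<noteq> p + p1"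
 shows "(norm (gradient (resonance 1 p p1) x))\<^sup>2 =
  ((norm p + norm p1)\<^sup>2 - (norm (p + p1))\<^sup>2) / (norm x * norm (p + p1 - x))"
proof -
 define y where "y = p + p1 - x"
 have y: "y \<noteq> 0" "p + p1 = x + y" using assms(3) by (auto simp: y_def)
 have E: "norm x + norm y = norm p + norm p1"
  using assms(1) unfolding resonant_set_sum y_def by simp
 have flux: "flux 1 z = z /\<^sub>R norm z" if "z \<noteq> 0" for z :: "real^3"
  using that by (simp add: flux_def powr_minus)
 have "gradient (resonance 1 p p1) x = 1 *\<^sub>R (flux 1 x - flux 1 y)"
  unfolding y_def by (rule gradient_resonance[OF assms(2,3)])
 then have gr: "gradient (resonance 1 p p1) x = x /\<^sub>R norm x - y /\<^sub>R norm y"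
  using flux[OF assms(2)] flux[OF y(1)] by simp
 have unit: "(z /\<^sub>R norm z) \<bullet> (z /\<^sub>R norm z) = 1" if "z \<noteq> 0" for z :: "real^3"
  using that by (simp add: dot_square_norm power2_eq_square)
 have "(norm (gradient (resonance 1 p p1) x))\<^sup>2 = 2 - 2 * ((x /\<^sub>R norm x) \<bullet> (y /\<^sub>R norm y))"
  unfolding gr power2_norm_eq_inner inner_diff_left inner_diff_right unit[OF assms(2)] unit[OF y(1)]
  by (simp add: inner_commute)
 also have "(x /\<^sub>R norm x) \<bullet> (y /\<^sub>R norm y) = (x \<bullet> y) / (norm x * norm y)"
  by (simp add: divide_inverse)
 also have "2 - 2 * ((x \<bullet> y) / (norm x * norm y)) = 2 - 2 * (x \<bullet> y) / (norm x * norm y)" by simp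
 also have "\<dots> = ((norm x + norm y)\<^sup>2 - (norm (x + y))\<^sup>2) / (norm x * norm y)"
 proof -
  have "(norm x + norm y)\<^sup>2 - (norm (x + y))\<^sup>2 = 2 * (norm x * norm y) - 2 * (x \<bullet> y)"
   unfolding power2_sum power2_norm_eq_inner by (simp add: inner_add_left inner_add_right inner_commute)
  then show ?thesis using assms(2) y(1) by (simp add: diff_divide_distrib)
 qed
 finally show ?thesis unfolding E y(2)[symmetric] by (simp only: y_def)
qed

text \<open>The surface is rotationally symmetric about \<open>p + p1\<close>, so the norm and one coordinate orthogonal to this
axis take all pairs of values in the product of \<open>T\<close> and \<open>[0, h]\<close>; both are 1-Lipschitz.  The condition on \<open>h\<close> says that the circle at radius \<open>\<rho>\<close> has radius at least \<open>h\<close>.\<close>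

lemma resonant_shell_area:
 assumes a: "1 \<le> a" and P: "p + p1 \<noteq> 0" and T: "T \<in> sets borel" and h: "0 \<le> h"
  and T0: "\<And>\<rho>. \<rho> \<in> T \<Longrightarrow> 0 \<le> \<rho> \<and> \<rho> powr a \<le> norm p powr a + norm p1 powr a \<and>
   (((norm (p + p1))\<^sup>2 + \<rho>\<^sup>2 - (norm p powr a + norm p1 powr a - \<rho> powr a) powr (2/a)) / (2 * norm (p + p1)))\<^sup>2 + h\<^sup>2 \<le> \<rho>\<^sup>2"
 shows "ennreal (pi / 16 * h) * emeasure lborel T \<le> emeasure hausdorff2 {x \<in> resonant_set a p p1. norm x \<in> T}"
proof -
 define E where "E = norm p powr a + norm p1 powr a"
 define t where "t \<rho> = ((norm (p + p1))\<^sup>2 + \<rho>\<^sup>2 - (E - \<rho> powr a) powr (2/a)) / (2 * norm (p + p1))" for \<rho>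
 let ?P = "norm (p + p1)"
 let ?A = "{x \<in> resonant_set a p p1. norm x \<in> T}"
 have P0: "?P > 0" using P by simp
 obtain v w where fr: "orthonormal_frame (sgn (p + p1)) v w"
  using orthonormal_frame_exists[of "sgn (p + p1)"] P by (metis norm_sgn)
 define u where "u = sgn (p + p1)"
 have Pu: "p + p1 = ?P *\<^sub>R u" using P by (simp add: u_def sgn_div_norm)
 note fr = fr[folded u_def]
 have on: "u \<bullet> u = 1" "v \<bullet> v = 1" "w \<bullet> w = 1" "u \<bullet> v = 0" "u \<bullet> w = 0" "v \<bullet> w = 0" "v \<bullet> u = 0" "w \<bullet> u = 0" "w \<bullet> v = 0"
  using fr by (auto simp: orthonormal_frame_def norm_eq_1 inner_commute)
 have sub: "T \<times> {0..h} \<subseteq> (\<lambda>x. (norm x, x \<bullet> v)) ` ?A"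
 proof
  fix z assume "z \<in> T \<times> {0..h}"
  then obtain \<rho> \<zeta> where z: "z = (\<rho>, \<zeta>)" "\<rho> \<in> T" "0 \<le> \<zeta>" "\<zeta> \<le> h" by auto
  note \<rho> = T0[OF z(2), folded E_def, folded t_def]
  have "\<zeta>\<^sup>2 \<le> h\<^sup>2" using z by (intro power_mono) auto
  then have rad: "0 \<le> \<rho>\<^sup>2 - (t \<rho>)\<^sup>2 - \<zeta>\<^sup>2" using \<rho> by linarith
  define x where "x = t \<rho> *\<^sub>R u + \<zeta> *\<^sub>R v + sqrt (\<rho>\<^sup>2 - (t \<rho>)\<^sup>2 - \<zeta>\<^sup>2) *\<^sub>R w"
  have xi: "x \<bullet> u = t \<rho>" "x \<bullet> v = \<zeta>" "x \<bullet> w = sqrt (\<rho>\<^sup>2 - (t \<rho>)\<^sup>2 - \<zeta>\<^sup>2)"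
   by (simp_all add: x_def inner_add_left on)
  have "(norm x)\<^sup>2 = \<rho>\<^sup>2" unfolding orthonormal_frame_norm_sq[OF fr] xi using rad by simp
  then have nx: "norm x = \<rho>" using \<rho> by (simp add: power2_eq_iff_nonneg)
  have "(norm (p + p1 - x))\<^sup>2 = ?P\<^sup>2 + \<rho>\<^sup>2 - 2 * ?P * t \<rho>"
  proof -
   have "(norm (p + p1 - x))\<^sup>2 = (norm (p + p1))\<^sup>2 + (norm x)\<^sup>2 - 2 * ((p + p1) \<bullet> x)"
    unfolding power2_norm_eq_inner by (simp add: inner_diff_left inner_diff_right inner_commute)
   also have "(p + p1) \<bullet> x = ?P * t \<rho>" by (subst Pu) (simp add: inner_commute[of u x] xi)
   finally show ?thesis by (simp add: nx)
  qed
  also have "\<dots> = (E - \<rho> powr a) powr (2/a)" unfolding t_def using P0 by simp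
  finally have sq: "(norm (p + p1 - x))\<^sup>2 = (E - \<rho> powr a) powr (2/a)" .
  have "norm (p + p1 - x) powr a = ((norm (p + p1 - x))\<^sup>2) powr (a/2)"
  proof (cases "norm (p + p1 - x) = 0")
   case False
   then have "((norm (p + p1 - x))\<^sup>2) powr (a/2) = (norm (p + p1 - x) powr 2) powr (a/2)"
    by (simp add: powr_numeral)
   then show ?thesis by (simp only: powr_powr) simp
  qed (use a in auto)
  also have "\<dots> = E - \<rho> powr a" unfolding sq using \<rho> a by (simp add: powr_powr)
  finally have "x \<in> ?A" using z nx by (simp add: resonant_set_sum E_def)
  moreover have "z = (norm x, x \<bullet> v)" using z nx xi by simp
  ultimately show "z \<in> (\<lambda>x. (norm x, x \<bullet> v)) ` ?A" by blast
 qed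
 have TB: "T \<times> {0..h} \<in> sets (borel :: (real \<times> real) measure)"
  using T by (intro borel_Times) auto
 have A: "?A \<in> sets borel"
 proof -
  have "norm -` T \<inter> space borel \<in> sets (borel :: (real^3) measure)"
   by (rule measurable_sets[OF _ T]) simp
  moreover have "?A = resonant_set a p p1 \<inter> (norm -` T \<inter> space borel)" by auto
  ultimately show ?thesis using closed_resonant_set[OF a] by (simp add: borel_closed sets.Int)
 qed
 have "emeasure lborel (T \<times> {0..h}) \<le> ennreal (16 / pi) * hausdorff2_outer ?A"
 proof (rule area_le_hausdorff2_outer[OF _ _ TB sub])
  show "\<bar>norm x - norm y\<bar> \<le> dist x y" for x y :: "real^3" by (simp add: dist_norm norm_triangle_ineq3)
  show "\<bar>x \<bullet> v - y \<bullet> v\<bar> \<le> dist x y" for x y :: "real^3"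
   using Cauchy_Schwarz_ineq2[of "x - y" v] fr by (simp add: dist_norm inner_diff_left orthonormal_frame_def)
 qed
 also have "emeasure lborel (T \<times> {0..h}) = emeasure lborel T * ennreal h"
  unfolding lborel_prod[symmetric] using T h by (subst lborel.emeasure_pair_measure_Times) auto
 finally have "ennreal (pi/16) * (emeasure lborel T * ennreal h) \<le> ennreal (pi/16) * (ennreal (16 / pi) * hausdorff2_outer ?A)"
  by (intro mult_left_mono) auto
 also have "\<dots> = hausdorff2_outer ?A"
  by (subst mult.assoc[symmetric], subst ennreal_mult[symmetric]) auto
 also have "\<dots> = emeasure hausdorff2 ?A" using A by (simp add: emeasure_hausdorff2)
 also have "ennreal (pi/16) * (emeasure lborel T * ennreal h) = ennreal (pi / 16 * h) * emeasure lborel T"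
  using h by (subst ennreal_mult) (auto simp: ac_simps)
 finally show ?thesis .
qed

lemma min_exponent_threshold:
 fixes a \<delta> :: real
 assumes "1 < a" "0 < \<delta>"
 obtains L where "1 \<le> L" "(2/L) powr (a - 1) \<le> \<delta>"
proof
 define L where "L = max 1 (2 * (1/\<delta>) powr (1 / (a - 1)))"
 show "1 \<le> L" by (simp add: L_def)
 have pos: "0 < (1/\<delta>) powr (1/(a-1))" using assms by simp
 have "2 / L \<le> 2 / (2 * (1/\<delta>) powr (1/(a-1)))"
  using pos by (intro divide_left_mono) (auto simp: L_def)
 also have "\<dots> = \<delta> powr (1/(a-1))" using assms by (simp add: powr_divide)
 finally have "2 / L \<le> \<delta> powr (1/(a-1))" .
 then have "(2/L) powr (a - 1) \<le> (\<delta> powr (1/(a-1))) powr (a - 1)"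
  using assms \<open>1 \<le> L\<close> by (intro powr_mono2) auto
 also have "\<dots> = \<delta>" using assms by (simp add: powr_powr)
 finally show "(2/L) powr (a - 1) \<le> \<delta>" .
qed

text \<open>Between \<open>|p|\<close> and \<open>|p1|\<close> a shell \<open>r \<le> |x| \<le> 2r\<close> meets the surface close to the plane orthogonal to \<open>p + p1\<close>,
and there \<open>x\<close> can be neglected against \<open>y\<close> in the gradient.\<close>

lemma resonant_shell_lower_superlinear:
 fixes a :: real
 assumes a: "1 < a"
 obtains L where "1 \<le> L" "\<And>p p1 r T. \<lbrakk>p1 \<noteq> 0; L * norm p \<le> r; L * r \<le> norm p1; 0 < r; T \<in> sets borel; T \<subseteq> {r..2*r}\<rbrakk> \<Longrightarrow>
  \<exists>G>0. (\<forall>x\<in>resonant_set a p p1. norm x \<in> T \<longrightarrow> x \<noteq> 0 \<and> x \<noteq> p + p1 \<and>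
    0 < norm (gradient (resonance a p p1) x) \<and> norm (gradient (resonance a p p1) x) \<le> G) \<and>
   ennreal (pi / (64 * a) * r * norm p1 powr (1 - a) * G) * emeasure lborel T \<le> emeasure hausdorff2 {x \<in> resonant_set a p p1. norm x \<in> T}"
proof -
 obtain L0 where L0: "1 \<le> L0" "(2/L0) powr (a - 1) \<le> 1/8"
  using min_exponent_threshold[OF a, of "1/8"] by auto
 define L where "L = max 20 L0"
 have L: "20 \<le> L" "(2/L) powr (a - 1) \<le> 1/8"
 proof -
  have "(2/L) powr (a - 1) \<le> (2/L0) powr (a - 1)"
   using L0(1) a by (intro powr_mono2 divide_left_mono) (auto simp: L_def)
  then show "(2/L) powr (a - 1) \<le> 1/8" using L0(2) by linarith
 qed (simp add: L_def)
 show ?thesis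
 proof (rule that)
  show "1 \<le> L" using L by simp
  fix p p1 :: "real^3" and r :: real and T
  assume A: "p1 \<noteq> 0" "L * norm p \<le> r" "L * r \<le> norm p1" "0 < r" "T \<in> sets borel" "T \<subseteq> {r..2*r}"
  define k Q where "k = norm p" and "Q = norm p1"
  have k0: "0 \<le> k" and Q0: "0 < Q" using A by (auto simp: k_def Q_def)
  have kr: "k \<le> r / 20"
  proof -
   have "20 * k \<le> L * k" using L k0 by (intro mult_right_mono) auto
   then show ?thesis using A(2) unfolding k_def by linarith
  qed
  have rQ: "r \<le> Q / 20"
  proof -
   have "20 * r \<le> L * r" using L A by (intro mult_right_mono) auto
   then show ?thesis using A(3) unfolding Q_def by linarith
  qed
  have PQ: "Q / 2 \<le> norm (p + p1)"
   using norm_triangle_ineq4[of "p + p1" p] kr rQ A by (simp add: k_def Q_def)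
  then have P0: "p + p1 \<noteq> 0" using Q0 by auto
  have rhos: "k \<le> \<rho> \<and> 0 < \<rho> \<and> \<rho> \<le> 2 * r \<and> \<rho> < Q" if "\<rho> \<in> T" for \<rho>
   using that A(4,6) kr rQ by force
  have small: "\<rho> powr a \<le> Q powr (a - 1) * \<rho> / 8" if "\<rho> \<in> T" for \<rho>
  proof -
   note \<rho> = rhos[OF that]
   have "\<rho> powr a = \<rho> powr (a - 1) * \<rho>" using powr_add[of \<rho> "a - 1" 1] \<rho> by simp
   also have "\<rho> powr (a - 1) \<le> (2 / L * Q) powr (a - 1)"
   proof (rule powr_mono2)
    have "\<rho> \<le> 2 * r" using \<rho> by simp
    also have "\<dots> \<le> 2 / L * Q" using A(3) L by (simp add: field_simps Q_def)
    finally show "\<rho> \<le> 2 / L * Q" .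
   qed (use a \<rho> in auto)
   also have "\<dots> = (2/L) powr (a - 1) * Q powr (a - 1)" by (rule powr_mult)
   also have "\<dots> \<le> 1/8 * Q powr (a - 1)" using L by (intro mult_right_mono) auto
   finally show ?thesis using \<rho> by (simp add: mult_right_mono algebra_simps)
  qed
  define E where "E = k powr a + Q powr a"
  define y where "y \<rho> = (E - \<rho> powr a) powr (1/a)" for \<rho>
  have QQ: "Q powr a = Q powr (a - 1) * Q" using powr_add[of Q "a - 1" 1] Q0 by simp
  have yb: "0 \<le> E - \<rho> powr a \<and> y \<rho> \<le> Q \<and> Q - \<rho> / 8 \<le> y \<rho>" if "\<rho> \<in> T" for \<rho>
  proof -
   note \<rho> = rhos[OF that]
   have 1: "k powr a \<le> \<rho> powr a" "\<rho> powr a \<le> Q powr a" using \<rho> k0 a by (auto intro!: powr_mono2)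
   then have E0: "0 \<le> E - \<rho> powr a" using powr_ge_zero[of k a] unfolding E_def by linarith
   have "y \<rho> \<le> (Q powr a) powr (1/a)" unfolding y_def using E0 1 a by (intro powr_mono2) (auto simp: E_def)
   then have yQ: "y \<rho> \<le> Q" using Q0 a by (simp add: powr_powr)
   have ya: "y \<rho> powr a = E - \<rho> powr a" unfolding y_def using E0 a by (simp add: powr_powr)
   have y0: "0 \<le> y \<rho>" by (simp add: y_def)
   have "y \<rho> powr a \<le> Q powr (a - 1) * y \<rho>"
   proof (cases "y \<rho> = 0")
    case False
    then have "y \<rho> powr a = y \<rho> powr (a - 1) * y \<rho>" using powr_add[of "y \<rho>" "a - 1" 1] y0 by simp
    also have "\<dots> \<le> Q powr (a - 1) * y \<rho>" using y0 yQ a by (intro mult_right_mono powr_mono2) auto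
    finally show ?thesis .
   qed (use a in auto)
   then have "Q powr (a - 1) * Q \<le> Q powr (a - 1) * y \<rho> + \<rho> powr a"
    using ya QQ powr_ge_zero[of k a] unfolding E_def by linarith
   also have "\<dots> \<le> Q powr (a - 1) * (y \<rho> + \<rho> / 8)" using small[OF that] by (simp add: algebra_simps)
   finally have "Q \<le> y \<rho> + \<rho> / 8" using Q0 by simp
   then show ?thesis using E0 yQ by simp
  qed
  define G where "G = 2 * a * Q powr (a - 1)"
  have G0: "0 < G" using a Q0 by (simp add: G_def)
  have grad: "x \<noteq> 0 \<and> x \<noteq> p + p1 \<and> 0 < norm (gradient (resonance a p p1) x) \<and> norm (gradient (resonance a p p1) x) \<le> G"
   if x: "x \<in> resonant_set a p p1" "norm x \<in> T" for x
  proof -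
   note \<rho> = rhos[OF x(2)] and yb = yb[OF x(2)]
   have na: "norm (p + p1 - x) powr a = E - norm x powr a"
    using x(1) by (simp add: resonant_set_sum E_def k_def Q_def)
   have ny: "norm (p + p1 - x) = y (norm x)"
    unfolding y_def na[symmetric] powr_powr using a by simp
   have gt: "norm x < norm (p + p1 - x)" unfolding ny using yb \<rho> rQ A(4) by linarith
   have nz: "x \<noteq> 0" "x \<noteq> p + p1" using \<rho> gt by auto
   have "norm x powr (a - 1) < norm (p + p1 - x) powr (a - 1)"
    using gt a by (intro powr_less_mono2) auto
   then have "0 < norm (gradient (resonance a p p1) x)"
    using norm_gradient_resonance_ge[OF less_imp_le[OF a] nz] by linarith
   moreover have "norm (gradient (resonance a p p1) x) \<le> a * (Q powr (a - 1) + Q powr (a - 1))"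
   proof (rule order_trans[OF norm_gradient_resonance_le])
    show "a * (norm x powr (a - 1) + norm (p + p1 - x) powr (a - 1)) \<le> a * (Q powr (a - 1) + Q powr (a - 1))"
     using \<rho> yb a ny by (intro mult_left_mono add_mono powr_mono2) auto
   qed (use nz a in auto)
   ultimately show ?thesis using nz by (simp add: G_def)
  qed
  have area: "ennreal (pi / 16 * (r/2)) * emeasure lborel T \<le> emeasure hausdorff2 {x \<in> resonant_set a p p1. norm x \<in> T}"
  proof (rule resonant_shell_area)
   fix \<rho> assume "\<rho> \<in> T"
   note \<rho> = rhos[OF this] and yb = yb[OF this]
   have r: "r \<le> \<rho>" using \<open>\<rho> \<in> T\<close> A(6) by auto
   define t where "t = ((norm (p + p1))\<^sup>2 + \<rho>\<^sup>2 - (y \<rho>)\<^sup>2) / (2 * norm (p + p1))"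
   have y2: "(E - \<rho> powr a) powr (2/a) = (y \<rho>)\<^sup>2"
   proof -
    have "(y \<rho>)\<^sup>2 = y \<rho> * y \<rho>" by (simp add: power2_eq_square)
    also have "\<dots> = (E - \<rho> powr a) powr (2/a)" unfolding y_def powr_add[symmetric] by simp
    finally show ?thesis by simp
   qed
   have P2: "(norm (p + p1))\<^sup>2 = Q\<^sup>2 + 2 * (p \<bullet> p1) + k\<^sup>2"
    unfolding Q_def k_def power2_norm_eq_inner by (simp add: inner_add_left inner_add_right inner_commute)
   have cs: "\<bar>p \<bullet> p1\<bar> \<le> k * Q" unfolding k_def Q_def by (rule Cauchy_Schwarz_ineq2)
   have num: "\<bar>(norm (p + p1))\<^sup>2 + \<rho>\<^sup>2 - (y \<rho>)\<^sup>2\<bar> \<le> \<rho> * Q / 2"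
   proof -
    have "(y \<rho>)\<^sup>2 \<le> Q\<^sup>2" using yb by (intro power_mono) (auto simp: y_def)
    moreover have "Q\<^sup>2 - (y \<rho>)\<^sup>2 \<le> \<rho> * Q / 4"
    proof -
     have "Q\<^sup>2 - (y \<rho>)\<^sup>2 = (Q - y \<rho>) * (Q + y \<rho>)" by (simp add: power2_eq_square algebra_simps)
     also have "\<dots> \<le> (\<rho> / 8) * (2 * Q)" using yb \<rho> by (intro mult_mono) (auto simp: y_def)
     finally show ?thesis by (simp add: mult.commute)
    qed
    moreover have "k\<^sup>2 \<le> \<rho> * Q / 400"
    proof -
     have "k * k \<le> (\<rho> / 20) * (Q / 20)" using kr rQ r k0 A(4) by (intro mult_mono) auto
     then show ?thesis by (simp add: power2_eq_square)
    qed
    moreover have "k * Q \<le> \<rho> * Q / 20"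
     using kr r Q0 by (simp add: mult_right_mono)
    moreover have "\<rho>\<^sup>2 \<le> \<rho> * Q / 10"
    proof -
     have "\<rho> * \<rho> \<le> \<rho> * (Q / 10)" using \<rho> rQ by (intro mult_left_mono) auto
     then show ?thesis by (simp add: power2_eq_square)
    qed
    ultimately show ?thesis unfolding P2 using cs zero_le_power2[of k] zero_le_power2[of \<rho>] by linarith
   qed
   have "\<bar>t\<bar> \<le> \<rho> / 2"
   proof -
    have "\<bar>t\<bar> = \<bar>(norm (p + p1))\<^sup>2 + \<rho>\<^sup>2 - (y \<rho>)\<^sup>2\<bar> / (2 * norm (p + p1))" by (simp add: t_def)
    also have "\<dots> \<le> (\<rho> * Q / 2) / Q" using num PQ Q0 \<rho> by (intro frac_le) auto
    also have "\<dots> = \<rho> / 2" using Q0 by simp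
    finally show ?thesis .
   qed
   then have t2: "t\<^sup>2 \<le> (\<rho>/2)\<^sup>2" using abs_le_square_iff[of t "\<rho>/2"] \<rho> by simp
   have r2: "(r/2)\<^sup>2 \<le> (\<rho>/2)\<^sup>2" using r A(4) by (intro power_mono) auto
   have "(\<rho>/2)\<^sup>2 + (\<rho>/2)\<^sup>2 \<le> \<rho>\<^sup>2" by (simp add: power_divide)
   then have "t\<^sup>2 + (r/2)\<^sup>2 \<le> \<rho>\<^sup>2" using t2 r2 by linarith
   then show "0 \<le> \<rho> \<and> \<rho> powr a \<le> norm p powr a + norm p1 powr a \<and>
    (((norm (p + p1))\<^sup>2 + \<rho>\<^sup>2 - (norm p powr a + norm p1 powr a - \<rho> powr a) powr (2/a)) / (2 * norm (p + p1)))\<^sup>2 + (r/2)\<^sup>2 \<le> \<rho>\<^sup>2"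
    unfolding k_def[symmetric] Q_def[symmetric] E_def[symmetric] y2 t_def[symmetric] using yb \<rho> by auto
  qed (use a P0 A in auto)
  have eq: "pi / (64 * a) * r * norm p1 powr (1 - a) * G = pi / 16 * (r/2)"
  proof -
   have "Q powr (1 - a) * Q powr (a - 1) = 1" using Q0 by (simp add: powr_add[symmetric])
   then show ?thesis using a by (simp add: G_def Q_def[symmetric] field_simps)
  qed
  show "\<exists>G>0. (\<forall>x\<in>resonant_set a p p1. norm x \<in> T \<longrightarrow> x \<noteq> 0 \<and> x \<noteq> p + p1 \<and>
    0 < norm (gradient (resonance a p p1) x) \<and> norm (gradient (resonance a p p1) x) \<le> G) \<and>
   ennreal (pi / (64 * a) * r * norm p1 powr (1 - a) * G) * emeasure lborel T \<le> emeasure hausdorff2 {x \<in> resonant_set a p p1. norm x \<in> T}"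
  proof (intro exI conjI ballI impI)
   show "0 < G" by (rule G0)
   show "ennreal (pi / (64 * a) * r * norm p1 powr (1 - a) * G) * emeasure lborel T \<le> emeasure hausdorff2 {x \<in> resonant_set a p p1. norm x \<in> T}"
    unfolding eq by (rule area)
  qed (use grad in auto)
 qed
qed

lemma norm_add_sq_defect:
 fixes p p1 :: "'a::real_inner"
 shows "(norm p + norm p1)\<^sup>2 - (norm (p + p1))\<^sup>2 = 2 * (norm p * norm p1 - p \<bullet> p1)"
 unfolding power2_sum power2_norm_eq_inner by (simp add: inner_add_left inner_add_right inner_commute)

text \<open>For \<open>a = 1\<close> the surface is an ellipsoid with foci \<open>0\<close> and \<open>p + p1\<close>, which is thin if \<open>p\<close> and \<open>p1\<close> are nearly
parallel; the sign of the inner product excludes this.\<close>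

lemma resonant_shell_lower_linear:
 fixes p p1 :: "real^3"
 assumes A: "p \<bullet> p1 \<le> 0" "p \<noteq> 0" "20 * norm p \<le> r" "20 * r \<le> norm p1" "T \<in> sets borel" "T \<subseteq> {r..2*r}"
 shows "\<exists>G>0. (\<forall>x\<in>resonant_set 1 p p1. norm x \<in> T \<longrightarrow> x \<noteq> 0 \<and> x \<noteq> p + p1 \<and>
    0 < norm (gradient (resonance 1 p p1) x) \<and> norm (gradient (resonance 1 p p1) x) \<le> G) \<and>
   ennreal (pi / 128 * r * G) * emeasure lborel T \<le> emeasure hausdorff2 {x \<in> resonant_set 1 p p1. norm x \<in> T}"
proof -
 define k Q P E b2 where "k = norm p" and "Q = norm p1" and "P = norm (p + p1)" and "E = k + Q" and "b2 = E\<^sup>2 - P\<^sup>2"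
 have k0: "0 < k" using A by (simp add: k_def)
 have kr: "k \<le> r / 20" and rQ: "r \<le> Q / 20" using A by (auto simp: k_def Q_def)
 have r0: "0 < r" and Q0: "0 < Q" using k0 kr rQ by linarith+
 have cs: "\<bar>p \<bullet> p1\<bar> \<le> k * Q" unfolding k_def Q_def by (rule Cauchy_Schwarz_ineq2)
 have b2: "2 * k * Q \<le> b2" "b2 \<le> 4 * k * Q"
  using norm_add_sq_defect[of p p1] A(1) cs by (auto simp: b2_def E_def k_def Q_def P_def abs_le_iff)
 have P: "Q / 2 \<le> P" "P \<le> E"
  using norm_triangle_ineq4[of "p + p1" p] norm_triangle_ineq[of p p1] kr rQ r0 by (auto simp: k_def Q_def P_def E_def)
 then have P0: "0 < P" using Q0 by linarith
 have rhos: "r \<le> \<rho> \<and> \<rho> \<le> 2 * r" if "\<rho> \<in> T" for \<rho> using that A(6) by auto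
 define G where "G = 4 * sqrt (k / r)"
 have G0: "0 < G" using k0 r0 by (simp add: G_def)
 have grad: "x \<noteq> 0 \<and> x \<noteq> p + p1 \<and> 0 < norm (gradient (resonance 1 p p1) x) \<and> norm (gradient (resonance 1 p p1) x) \<le> G"
   if x: "x \<in> resonant_set 1 p p1" "norm x \<in> T" for x
 proof -
  note \<rho> = rhos[OF x(2)]
  have ny: "norm (p + p1 - x) = E - norm x" using x(1) unfolding resonant_set_sum by (simp add: E_def k_def Q_def)
  have yQ: "Q / 2 \<le> norm (p + p1 - x)" unfolding ny E_def using \<rho> rQ k0 by linarith
  have nz: "x \<noteq> 0" "x \<noteq> p + p1" using \<rho> r0 yQ Q0 by auto
  have g2: "(norm (gradient (resonance 1 p p1) x))\<^sup>2 = b2 / (norm x * norm (p + p1 - x))"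
   unfolding norm_gradient_resonance_1[OF x(1) nz] by (simp add: b2_def E_def k_def Q_def P_def)
  have "0 < b2 / (norm x * norm (p + p1 - x))"
   using b2 k0 Q0 nz by (intro divide_pos_pos mult_pos_pos) (auto intro: less_le_trans[OF _ b2(1)])
  then have pos: "0 < norm (gradient (resonance 1 p p1) x)" using g2 by (cases "norm (gradient (resonance 1 p p1) x) = 0") auto
  have "(norm (gradient (resonance 1 p p1) x))\<^sup>2 \<le> (4 * k * Q) / (r * (Q / 2))"
   unfolding g2 using b2 \<rho> yQ k0 Q0 r0 by (intro frac_le mult_mono) auto
  also have "\<dots> \<le> G\<^sup>2" using Q0 r0 k0 by (simp add: G_def power_mult_distrib field_simps)
  finally have "norm (gradient (resonance 1 p p1) x) \<le> G" using power2_le_imp_le less_imp_le[OF G0] by blast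
  then show ?thesis using nz pos by simp
 qed
 define h where "h = sqrt (k * r) / 2"
 have h2: "h\<^sup>2 = k * r / 4" using k0 r0 by (simp add: h_def power_divide)
 have area: "ennreal (pi / 16 * h) * emeasure lborel T \<le> emeasure hausdorff2 {x \<in> resonant_set 1 p p1. norm x \<in> T}"
 proof (rule resonant_shell_area)
  fix \<rho> assume "\<rho> \<in> T"
  note \<rho> = rhos[OF this]
  have \<rho>E: "0 \<le> \<rho>" "\<rho> < E" using \<rho> r0 rQ k0 by (auto simp: E_def)
  define t where "t = (P\<^sup>2 + \<rho>\<^sup>2 - (E - \<rho>)\<^sup>2) / (2 * P)"
  have gap: "\<rho> - t = (b2 - 2 * (E - P) * \<rho>) / (2 * P)"
   using P0 by (simp add: t_def b2_def field_simps power2_eq_square)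
  have EP: "(E - P) * Q \<le> b2"
  proof -
   have "(E - P) * Q \<le> (E - P) * (E + P)" using P P0 k0 by (intro mult_left_mono) (auto simp: E_def)
   then show ?thesis by (simp add: b2_def power2_eq_square algebra_simps)
  qed
  have "2 * (E - P) * \<rho> \<le> k * Q"
  proof -
   have EPk: "E - P \<le> 4 * k"
   proof -
    have "(E - P) * Q \<le> (4 * k) * Q" using EP b2 by linarith
    then show ?thesis using Q0 by simp
   qed
   have "2 * (E - P) * \<rho> \<le> 2 * (4 * k) * (Q / 10)"
    using EPk \<rho> rQ k0 P \<rho>E by (intro mult_mono) auto
   also have "\<dots> \<le> k * Q" using k0 Q0 by simp
   finally show ?thesis .
  qed
  then have "k * Q / (2 * P) \<le> \<rho> - t"
   unfolding gap using b2 P0 by (intro divide_right_mono) auto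
  moreover have "k / 4 \<le> k * Q / (2 * P)"
  proof -
   have "P \<le> 2 * Q" using P(2) kr rQ r0 by (simp add: E_def)
   then have "k * P \<le> k * (2 * Q)" using k0 by (intro mult_left_mono) auto
   then show ?thesis using P0 by (simp add: field_simps)
  qed
  ultimately have low: "k / 4 \<le> \<rho> - t" by linarith
  have "\<rho> - t \<le> b2 / (2 * P)"
   unfolding gap using P P0 \<rho>E by (intro divide_right_mono) auto
  also have "\<dots> \<le> (4 * k * Q) / Q" using b2 P Q0 k0 by (intro frac_le) auto
  also have "\<dots> = 4 * k" using Q0 by simp
  finally have "\<rho> - t \<le> \<rho>" using kr \<rho> r0 by linarith
  then have up: "r \<le> \<rho> + t" using \<rho> by linarith
  have "k / 4 * r \<le> (\<rho> - t) * (\<rho> + t)" using low up k0 r0 by (intro mult_mono) auto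
  then have "t\<^sup>2 + h\<^sup>2 \<le> \<rho>\<^sup>2" unfolding h2 by (simp add: power2_eq_square algebra_simps)
  moreover have "(E - \<rho>) powr (2/1) = (E - \<rho>)\<^sup>2" using \<rho>E by (simp add: powr_numeral)
  ultimately show "0 \<le> \<rho> \<and> \<rho> powr 1 \<le> norm p powr 1 + norm p1 powr 1 \<and>
    (((norm (p + p1))\<^sup>2 + \<rho>\<^sup>2 - (norm p powr 1 + norm p1 powr 1 - \<rho> powr 1) powr (2/1)) / (2 * norm (p + p1)))\<^sup>2 + h\<^sup>2 \<le> \<rho>\<^sup>2"
   using \<rho>E by (simp add: t_def E_def k_def Q_def P_def)
 qed (use P0 A k0 r0 in \<open>auto simp: P_def h_def\<close>)
 have eq: "pi / 128 * r * G = pi / 16 * h"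
 proof -
  have "r * sqrt (k / r) = sqrt (k * r)"
   using r0 k0 by (simp add: real_sqrt_divide real_sqrt_mult real_div_sqrt field_simps)
  then show ?thesis by (simp add: G_def h_def)
 qed
 show ?thesis
 proof (intro exI conjI ballI impI)
  show "0 < G" by (rule G0)
  show "ennreal (pi / 128 * r * G) * emeasure lborel T \<le> emeasure hausdorff2 {x \<in> resonant_set 1 p p1. norm x \<in> T}"
   unfolding eq by (rule area)
 qed (use grad in auto)
qed

text \<open>The bound \<open>G\<close> on the gradient and the area are stated together, as only their quotient is independent
of the shape of the surface.\<close>

lemma resonant_shell_lower:
 fixes a :: real
 assumes a: "1 \<le> a"
 obtains L c where "1 \<le> L" "0 < c" "\<And>p p1 r T. \<lbrakk>p \<bullet> p1 \<le> 0; p \<noteq> 0; L * norm p \<le> r; L * r \<le> norm p1; T \<in> sets borel; T \<subseteq> {r..2*r}\<rbrakk> \<Longrightarrow>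
  \<exists>G>0. (\<forall>x\<in>resonant_set a p p1. norm x \<in> T \<longrightarrow> x \<noteq> 0 \<and> x \<noteq> p + p1 \<and>
    0 < norm (gradient (resonance a p p1) x) \<and> norm (gradient (resonance a p p1) x) \<le> G) \<and>
   ennreal (c * r * norm p1 powr (1 - a) * G) * emeasure lborel T \<le> emeasure hausdorff2 {x \<in> resonant_set a p p1. norm x \<in> T}"
proof (cases "a = 1")
 case True
 show ?thesis
 proof (rule that[of 20 "pi/128"])
  fix p p1 :: "real^3" and r :: real and T :: "real set"
  assume A: "p \<bullet> p1 \<le> 0" "p \<noteq> 0" "20 * norm p \<le> r" "20 * r \<le> norm p1" "T \<in> sets borel" "T \<subseteq> {r..2*r}"
  have "0 < norm p" using A(2) by simp
  then have "0 < norm p1" using A(3,4) by linarith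
  then have "p1 \<noteq> 0" by simp
  then show "\<exists>G>0. (\<forall>x\<in>resonant_set a p p1. norm x \<in> T \<longrightarrow> x \<noteq> 0 \<and> x \<noteq> p + p1 \<and>
    0 < norm (gradient (resonance a p p1) x) \<and> norm (gradient (resonance a p p1) x) \<le> G) \<and>
   ennreal (pi/128 * r * norm p1 powr (1 - a) * G) * emeasure lborel T \<le> emeasure hausdorff2 {x \<in> resonant_set a p p1. norm x \<in> T}"
   using resonant_shell_lower_linear[OF A] True by simp
 qed auto
next
 case False
 then have "1 < a" using a by simp
 show ?thesis
 proof (rule resonant_shell_lower_superlinear[OF \<open>1 < a\<close>])
 fix L :: real assume L: "1 \<le> L"
  "\<And>p p1 r T. \<lbrakk>p1 \<noteq> 0; L * norm p \<le> r; L * r \<le> norm p1; 0 < r; T \<in> sets borel; T \<subseteq> {r..2*r}\<rbrakk> \<Longrightarrow>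
  \<exists>G>0. (\<forall>x\<in>resonant_set a p p1. norm x \<in> T \<longrightarrow> x \<noteq> 0 \<and> x \<noteq> p + p1 \<and>
    0 < norm (gradient (resonance a p p1) x) \<and> norm (gradient (resonance a p p1) x) \<le> G) \<and>
   ennreal (pi / (64 * a) * r * norm p1 powr (1 - a) * G) * emeasure lborel T \<le> emeasure hausdorff2 {x \<in> resonant_set a p p1. norm x \<in> T}"
 show thesis
 proof (rule that[OF L(1), of "pi / (64 * a)"])
  fix p p1 :: "real^3" and r :: real and T :: "real set"
  assume A: "p \<bullet> p1 \<le> 0" "p \<noteq> 0" "L * norm p \<le> r" "L * r \<le> norm p1" "T \<in> sets borel" "T \<subseteq> {r..2*r}"
  have "0 < L * norm p" using L(1) A(2) by simp
  then have "0 < r" using A(3) by linarith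
  then have "0 < L * r" using L(1) by simp
  then have "p1 \<noteq> 0" using A(4) by auto
  from L(2)[OF this A(3,4) \<open>0 < r\<close> A(5,6)]
  show "\<exists>G>0. (\<forall>x\<in>resonant_set a p p1. norm x \<in> T \<longrightarrow> x \<noteq> 0 \<and> x \<noteq> p + p1 \<and>
    0 < norm (gradient (resonance a p p1) x) \<and> norm (gradient (resonance a p p1) x) \<le> G) \<and>
   ennreal (pi / (64 * a) * r * norm p1 powr (1 - a) * G) * emeasure lborel T \<le> emeasure hausdorff2 {x \<in> resonant_set a p p1. norm x \<in> T}" .
 qed (use \<open>1 < a\<close> in auto)
 qed
qed

lemma resonant_norm_le:
 assumes a: "1 \<le> a" and x: "x \<in> resonant_set a p p1" and M: "norm p \<le> M" "norm p1 \<le> M"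
 shows "norm x \<le> 2 * M" "norm (p + p1 - x) \<le> 2 * M"
proof -
 have M0: "0 \<le> M" using M(1) norm_ge_zero order_trans by blast
 have "norm p powr a \<le> M powr a" "norm p1 powr a \<le> M powr a" using M a by (auto intro!: powr_mono2)
 then have "norm x powr a + norm (p + p1 - x) powr a \<le> 2 * M powr a"
  using x by (simp add: resonant_set_sum)
 also have "\<dots> \<le> 2 powr a * M powr a"
  using powr_mono[of 1 a "2::real"] a by (intro mult_right_mono) auto
 also have "\<dots> = (2 * M) powr a" using M0 by (simp add: powr_mult)
 finally have s: "norm x powr a + norm (p + p1 - x) powr a \<le> (2 * M) powr a" .
 have *: "z \<le> 2 * M" if "z powr a \<le> (2 * M) powr a" for z :: real
 proof (rule ccontr)
  assume "\<not> z \<le> 2 * M"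
  then have "(2 * M) powr a < z powr a" using M0 a by (intro powr_less_mono2) auto
  then show False using that by simp
 qed
 show "norm x \<le> 2 * M" using s powr_ge_zero[of "norm (p + p1 - x)" a] by (intro *) linarith
 show "norm (p + p1 - x) \<le> 2 * M" using s powr_ge_zero[of "norm x" a] by (intro *) linarith
qed

lemma resonant_set_reflect: "x \<in> resonant_set a p p1 \<Longrightarrow> p + p1 - x \<in> resonant_set a p p1"
 by (simp add: resonant_set_sum add.commute)

lemma closed_min_norm_le: "closed {x :: real^3. min (norm x) (norm (c - x)) \<le> r}"
 by (intro closed_Collect_le continuous_intros)

lemma resonant_min_borel:
 assumes "1 \<le> a"
 shows "{x \<in> resonant_set a p p1. min (norm x) (norm (p + p1 - x)) \<le> r} \<in> sets borel"
proof -
 have "{x \<in> resonant_set a p p1. min (norm x) (norm (p + p1 - x)) \<le> r} =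
  resonant_set a p p1 \<inter> {x. min (norm x) (norm (p + p1 - x)) \<le> r}" by auto
 then show ?thesis using closed_Int[OF closed_resonant_set[OF assms] closed_min_norm_le]
  by (simp add: borel_closed)
qed

text \<open>For \<open>a > 1\<close> the larger of \<open>|x|\<close> and \<open>|y|\<close> dominates the gradient, and the part of the surface near a
focus is the part of a convex surface in a ball.\<close>

lemma resonant_far_upper_superlinear:
 fixes a :: real
 assumes a: "1 < a"
 obtains L C where "2 \<le> L" "0 \<le> C" "\<And>(p::real^3) p1 r. \<lbrakk>L * norm p \<le> norm p1; p1 \<noteq> 0; 0 < r\<rbrakk> \<Longrightarrow>
  \<exists>G\<ge>0. (\<forall>x\<in>resonant_set a p p1. x \<noteq> 0 \<longrightarrow> x \<noteq> p + p1 \<longrightarrow> min (norm x) (norm (p + p1 - x)) \<le> r \<longrightarrow>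
    inverse (norm (gradient (resonance a p p1) x)) \<le> G) \<and>
   emeasure hausdorff2 {x \<in> resonant_set a p p1. min (norm x) (norm (p + p1 - x)) \<le> r} * ennreal G
    \<le> ennreal (C * r\<^sup>2 * norm p1 powr (1 - a))"
proof -
 define d where "d = 1 - 2 powr ((1 - a) / 2)"
 have "2 powr ((1 - a) / 2) < 2 powr 0" using a by (intro powr_less_mono) auto
 then have d0: "0 < d" by (simp add: d_def)
 define B where "B = 2 powr ((a - 1) / (2 * a))"
 have "2 powr 0 < B" unfolding B_def using a by (intro powr_less_mono) auto
 then have B: "1 < B" by simp
 define L where "L = max 2 (1 / (B - 1))"
 have L2: "2 \<le> L" by (simp add: L_def)
 have LB: "1 + 1 / L \<le> B"
 proof -
  have "1 / L \<le> 1 / (1 / (B - 1))" using B by (intro divide_left_mono) (auto simp: L_def)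
  then show ?thesis using B by simp
 qed
 define C where "C = 2 * (96 * pi) * (3 / d)"
 have C0: "0 \<le> C" using d0 by (simp add: C_def)
 show ?thesis
 proof (rule that[OF L2 C0])
  fix p p1 :: "real^3" and r :: real
  assume A: "L * norm p \<le> norm p1" "p1 \<noteq> 0" "0 < r"
  define Q where "Q = norm p1"
  have Q0: "0 < Q" using A by (simp add: Q_def)
  have kL: "norm p \<le> Q * (1 / L)" using A(1) L2 by (simp add: Q_def field_simps)
  have "1 / L \<le> 1 / 2" using L2 by (intro divide_left_mono) auto
  then have "Q * (1 / L) \<le> Q * (1/2)" using Q0 by (intro mult_left_mono) auto
  then have k2: "norm p \<le> Q / 2" using kL by linarith
  then have kQ: "norm p \<le> Q" using Q0 by linarith
  let ?h = "(1/2) *\<^sub>R (p + p1)"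
  have "norm (p + p1) \<le> Q * (1 + 1 / L)"
   using norm_triangle_ineq[of p p1] kL by (simp add: Q_def distrib_left)
  also have "\<dots> \<le> Q * B" using LB Q0 by (intro mult_left_mono) auto
  finally have hb: "norm ?h \<le> (1/2) * (Q * B)" by simp
  have "norm ?h powr a \<le> ((1/2) * (Q * B)) powr a" using hb a by (intro powr_mono2) auto
  also have "\<dots> = (1/2) powr a * (Q powr a * B powr a)" by (simp only: powr_mult)
  also have "(1/2::real) powr a = 2 powr (-a)" by (simp add: powr_divide powr_minus_divide)
  also have "B powr a = 2 powr ((a - 1) / 2)" using a by (simp add: B_def powr_powr)
  finally have "2 * norm ?h powr a \<le> 2 powr 1 * (2 powr (-a) * (Q powr a * 2 powr ((a - 1) / 2)))" by simp
  also have "\<dots> = 2 powr (1 + (-a) + (a - 1) / 2) * Q powr a" by (simp only: powr_add ac_simps)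
  also have "1 + (-a) + (a - 1) / 2 = (1 - a) / 2" by (simp add: field_simps)
  finally have h2: "2 * norm ?h powr a \<le> 2 powr ((1 - a) / 2) * Q powr a" .
  have D: "d * Q powr a \<le> norm p powr a + norm p1 powr a - 2 * norm ?h powr a"
   using h2 powr_ge_zero[of "norm p" a] unfolding d_def Q_def[symmetric] left_diff_distrib by linarith
  have D0: "0 < d * Q powr a" using d0 Q0 by simp
  have grad: "norm (gradient (resonance a p p1) x) \<noteq> 0 \<and> inverse (norm (gradient (resonance a p p1) x)) \<le> 3 / d * Q powr (1 - a)"
   if x: "x \<in> resonant_set a p p1" "x \<noteq> 0" "x \<noteq> p + p1" for x
  proof -
   let ?g = "norm (gradient (resonance a p p1) x)"
   have "norm (x - ?h) \<le> norm x + norm ?h" by (rule norm_triangle_ineq4)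
   also have "norm x \<le> 2 * Q" using resonant_norm_le(1)[OF less_imp_le[OF a] x(1), of Q] kQ by (simp add: Q_def)
   also have "norm ?h \<le> Q" using norm_triangle_ineq[of p p1] kQ by (simp add: Q_def)
   finally have xh: "norm (x - ?h) \<le> 3 * Q" by simp
   have "d * Q powr a \<le> ?g * norm (x - ?h)"
    using D norm_gradient_resonance_depth[OF less_imp_le[OF a] x] by linarith
   also have "\<dots> \<le> ?g * (3 * Q)" using xh by (intro mult_left_mono) auto
   finally have g: "d * Q powr a \<le> ?g * (3 * Q)" .
   then have g0: "0 < ?g" using D0 Q0 by (cases "?g = 0") auto
   have "inverse ?g \<le> (3 * Q) / (d * Q powr a)"
    using g g0 D0 by (simp add: field_simps)
   also have "\<dots> = 3 / d * (Q powr 1 / Q powr a)" using Q0 by simp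
   also have "\<dots> = 3 / d * Q powr (1 - a)" by (simp only: powr_diff)
   finally show ?thesis using g0 by simp
  qed
  define G where "G = 3 / d * Q powr (1 - a)"
  have G0: "0 \<le> G" using d0 by (simp add: G_def)
  let ?A = "{x \<in> resonant_set a p p1. min (norm x) (norm (p + p1 - x)) \<le> r}"
  have nz: "gradient (resonance a p p1) x \<noteq> 0" if "x \<in> resonant_set a p p1" "x \<noteq> 0" "x \<noteq> p + p1" for x
   using grad[OF that] by simp
  have "?A \<subseteq> (resonant_set a p p1 \<inter> cball 0 r) \<union> (resonant_set a p p1 \<inter> cball (p + p1) r)"
   by (auto simp: dist_norm min_le_iff_disj)
  then have "hausdorff2_outer ?A \<le> hausdorff2_outer (resonant_set a p p1 \<inter> cball 0 r) + hausdorff2_outer (resonant_set a p p1 \<inter> cball (p + p1) r)"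
   by (rule order_trans[OF hausdorff2_outer_mono hausdorff2_outer_Un])
  also have "\<dots> \<le> ennreal (96 * pi * r\<^sup>2) + ennreal (96 * pi * r\<^sup>2)"
   using a A nz by (intro add_mono resonant_area_ball[OF less_imp_le[OF a] subset_refl]) auto
  also have "\<dots> = ennreal (2 * (96 * pi) * r\<^sup>2)" by (simp add: ennreal_plus[symmetric] del: ennreal_plus)
  finally have area: "hausdorff2_outer ?A \<le> ennreal (2 * (96 * pi) * r\<^sup>2)" .
  have "emeasure hausdorff2 ?A * ennreal G \<le> ennreal (2 * (96 * pi) * r\<^sup>2) * ennreal G"
   unfolding emeasure_hausdorff2[OF resonant_min_borel[OF less_imp_le[OF a]]] using area by (rule mult_right_mono) simp
  also have "\<dots> = ennreal (2 * (96 * pi) * r\<^sup>2 * G)" using G0 by (subst ennreal_mult) auto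
  also have "2 * (96 * pi) * r\<^sup>2 * G = C * r\<^sup>2 * norm p1 powr (1 - a)" by (simp add: C_def G_def Q_def)
  finally have fin: "emeasure hausdorff2 ?A * ennreal G \<le> ennreal (C * r\<^sup>2 * norm p1 powr (1 - a))" .
  show "\<exists>G\<ge>0. (\<forall>x\<in>resonant_set a p p1. x \<noteq> 0 \<longrightarrow> x \<noteq> p + p1 \<longrightarrow> min (norm x) (norm (p + p1 - x)) \<le> r \<longrightarrow>
    inverse (norm (gradient (resonance a p p1) x)) \<le> G) \<and>
   emeasure hausdorff2 ?A * ennreal G \<le> ennreal (C * r\<^sup>2 * norm p1 powr (1 - a))"
  proof (intro exI conjI ballI impI)
   show "0 \<le> G" by (rule G0)
   show "emeasure hausdorff2 ?A * ennreal G \<le> ennreal (C * r\<^sup>2 * norm p1 powr (1 - a))" by (rule fin)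
   fix x assume "x \<in> resonant_set a p p1" "x \<noteq> 0" "x \<noteq> p + p1"
   then show "inverse (norm (gradient (resonance a p p1) x)) \<le> G" using grad unfolding G_def by blast
  qed
 qed
qed

text \<open>On the ellipsoid the gradient is explicit; \<open>b2\<close> is four times the square of the minor semi-axis.\<close>

lemma inverse_gradient_resonance_1:
 assumes x: "x \<in> resonant_set 1 p p1" "x \<noteq> 0" "x \<noteq> p + p1" and b: "b2 = (norm p + norm p1)\<^sup>2 - (norm (p + p1))\<^sup>2"
 shows "b2 = 0 \<Longrightarrow> gradient (resonance 1 p p1) x = 0"
  and "0 < b2 \<Longrightarrow> gradient (resonance 1 p p1) x \<noteq> 0"
  and "0 < b2 \<Longrightarrow> inverse (norm (gradient (resonance 1 p p1) x)) = sqrt (norm x * norm (p + p1 - x) / b2)"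
proof -
 have g2: "(norm (gradient (resonance 1 p p1) x))\<^sup>2 = b2 / (norm x * norm (p + p1 - x))"
  unfolding b by (rule norm_gradient_resonance_1[OF x])
 have nz: "norm x * norm (p + p1 - x) > 0" using x by auto
 show "b2 = 0 \<Longrightarrow> gradient (resonance 1 p p1) x = 0" using g2 by simp
 show "gradient (resonance 1 p p1) x \<noteq> 0" if "0 < b2"
 proof
  assume "gradient (resonance 1 p p1) x = 0"
  then have "b2 / (norm x * norm (p + p1 - x)) = 0" using g2 by simp
  then show False using that nz by (simp only: divide_eq_0_iff) linarith
 qed
 show "inverse (norm (gradient (resonance 1 p p1) x)) = sqrt (norm x * norm (p + p1 - x) / b2)" if "0 < b2"
 proof -
  have "norm (gradient (resonance 1 p p1) x) = sqrt (b2 / (norm x * norm (p + p1 - x)))"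
   unfolding g2[symmetric] by simp
  then show ?thesis by (simp add: real_sqrt_inverse[symmetric] del: real_sqrt_mult)
 qed
qed

lemma resonant_1_coordinates:
 assumes x: "x \<in> resonant_set 1 p p1" and u: "p + p1 = norm (p + p1) *\<^sub>R u" and fr: "orthonormal_frame u v w"
  and b: "b2 = (norm p + norm p1)\<^sup>2 - (norm (p + p1))\<^sup>2"
 shows "2 * norm (p + p1) * (x \<bullet> u) = 2 * (norm p + norm p1) * norm x - b2"
  and "(x \<bullet> v)\<^sup>2 \<le> (norm x)\<^sup>2 - (x \<bullet> u)\<^sup>2" "(x \<bullet> w)\<^sup>2 \<le> (norm x)\<^sup>2 - (x \<bullet> u)\<^sup>2"
  and "\<bar>x \<bullet> u\<bar> \<le> norm x"
proof -
 have E: "norm (p + p1 - x) = norm p + norm p1 - norm x" using x unfolding resonant_set_sum by simp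
 have "(p + p1) \<bullet> x = norm (p + p1) * (x \<bullet> u)" by (subst u) (simp add: inner_commute)
 moreover have "(norm (p + p1 - x))\<^sup>2 = (norm (p + p1))\<^sup>2 + (norm x)\<^sup>2 - 2 * ((p + p1) \<bullet> x)"
  unfolding power2_norm_eq_inner by (simp add: inner_diff_left inner_diff_right inner_commute)
 ultimately have "(norm p + norm p1 - norm x)\<^sup>2 = (norm (p + p1))\<^sup>2 + (norm x)\<^sup>2 - 2 * (norm (p + p1) * (x \<bullet> u))"
  unfolding E by simp
 then show "2 * norm (p + p1) * (x \<bullet> u) = 2 * (norm p + norm p1) * norm x - b2"
  unfolding b by (simp add: power2_eq_square algebra_simps)
 show "(x \<bullet> v)\<^sup>2 \<le> (norm x)\<^sup>2 - (x \<bullet> u)\<^sup>2" "(x \<bullet> w)\<^sup>2 \<le> (norm x)\<^sup>2 - (x \<bullet> u)\<^sup>2"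
  using orthonormal_frame_norm_sq[OF fr, of x] zero_le_power2[of "x \<bullet> v"] zero_le_power2[of "x \<bullet> w"] by linarith+
 show "\<bar>x \<bullet> u\<bar> \<le> norm x"
  using Cauchy_Schwarz_ineq2[of x u] fr by (simp add: orthonormal_frame_def)
qed

text \<open>The gradient of a thin ellipsoid is small and so is its area; the box in which the cap near a focus
lies is chosen to match the factor \<open>b2\<close> in the gradient.\<close>

lemma resonant_far_upper_linear:
 fixes p p1 :: "real^3"
 assumes A: "2 * norm p \<le> norm p1" "p1 \<noteq> 0" "0 < r"
 shows "\<exists>G\<ge>0. (\<forall>x\<in>resonant_set 1 p p1. x \<noteq> 0 \<longrightarrow> x \<noteq> p + p1 \<longrightarrow> min (norm x) (norm (p + p1 - x)) \<le> r \<longrightarrow>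
    inverse (norm (gradient (resonance 1 p p1) x)) \<le> G) \<and>
   emeasure hausdorff2 {x \<in> resonant_set 1 p p1. min (norm x) (norm (p + p1 - x)) \<le> r} * ennreal G
    \<le> ennreal (384 * pi * r\<^sup>2)"
proof -
 define E P b2 where "E = norm p + norm p1" and "P = norm (p + p1)" and "b2 = (norm p + norm p1)\<^sup>2 - (norm (p + p1))\<^sup>2"
 have bE: "b2 = E\<^sup>2 - P\<^sup>2" by (simp add: b2_def E_def P_def)
 have PE: "P \<le> E" unfolding P_def E_def by (rule norm_triangle_ineq)
 have b0: "0 \<le> b2" using PE power_mono[of P E 2] by (simp add: bE P_def)
 have Q0: "0 < norm p1" using A by simp
 have PQ: "norm p1 / 2 \<le> P" using norm_triangle_ineq4[of "p + p1" p] A unfolding P_def by simp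
 then have P0: "0 < P" using Q0 by linarith
 have E4: "E \<le> 4 * P" using PQ A norm_ge_zero[of p1] unfolding E_def by linarith
 show ?thesis
 proof (cases "b2 = 0")
  case True
  show ?thesis
  proof (intro exI[of _ 0] conjI ballI impI)
   fix x assume "x \<in> resonant_set 1 p p1" "x \<noteq> 0" "x \<noteq> p + p1"
   from inverse_gradient_resonance_1(1)[OF this b2_def True]
   show "inverse (norm (gradient (resonance 1 p p1) x)) \<le> 0" by simp
  qed auto
 next
  case False
  then have bp: "0 < b2" using b0 by simp
  define h where "h = sqrt (b2 * r / P)"
  define m where "m = min h r"
  have h0: "0 \<le> h" using bp A P0 by (simp add: h_def)
  have m0: "0 \<le> m" using h0 A by (simp add: m_def)
  have h2: "h\<^sup>2 = b2 * r / P" using bp A P0 by (simp add: h_def)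
  define u where "u = sgn (p + p1)"
  have Pu: "p + p1 = norm (p + p1) *\<^sub>R u" using P0 by (simp add: u_def sgn_div_norm P_def)
  have "norm u = 1" unfolding u_def norm_sgn using P0 by (simp add: P_def)
  from orthonormal_frame_exists[OF this] obtain v w where fr: "orthonormal_frame u v w" by blast
  have box: "\<bar>x \<bullet> u\<bar> \<le> r \<and> \<bar>x \<bullet> v\<bar> \<le> m \<and> \<bar>x \<bullet> w\<bar> \<le> m" if x: "x \<in> resonant_set 1 p p1" "norm x \<le> r" for x
  proof -
   note co = resonant_1_coordinates[OF x(1) Pu fr b2_def, folded E_def, folded P_def]
   have "2 * P * (norm x - x \<bullet> u) = b2 - 2 * (E - P) * norm x" using co(1) by (simp add: algebra_simps)
   moreover have "0 \<le> 2 * (E - P) * norm x" using PE by simp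
   ultimately have "2 * P * (norm x - x \<bullet> u) \<le> b2" by linarith
   then have "norm x - x \<bullet> u \<le> b2 / (2 * P)" using P0 by (simp add: field_simps)
   then have "(norm x - x \<bullet> u) * (norm x + x \<bullet> u) \<le> (b2 / (2 * P)) * (2 * r)"
    using co(4) x(2) bp P0 by (intro mult_mono) auto
   also have "\<dots> = h\<^sup>2" unfolding h2 using P0 by simp
   finally have hh: "(norm x)\<^sup>2 - (x \<bullet> u)\<^sup>2 \<le> h\<^sup>2" by (simp add: power2_eq_square algebra_simps)
   have "(norm x)\<^sup>2 \<le> r\<^sup>2" using x(2) by (intro power_mono) auto
   then have rr: "(norm x)\<^sup>2 - (x \<bullet> u)\<^sup>2 \<le> r\<^sup>2" using zero_le_power2[of "x \<bullet> u"] by linarith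
   have "\<bar>e\<bar> \<le> m" if "e\<^sup>2 \<le> (norm x)\<^sup>2 - (x \<bullet> u)\<^sup>2" for e
   proof -
    have "e\<^sup>2 \<le> h\<^sup>2" "e\<^sup>2 \<le> r\<^sup>2" using that hh rr by linarith+
    then have "\<bar>e\<bar> \<le> \<bar>h\<bar>" "\<bar>e\<bar> \<le> \<bar>r\<bar>" by (simp_all add: abs_le_square_iff)
    then show ?thesis using h0 A by (simp add: m_def)
   qed
   then show ?thesis using co(2,3,4) x(2) by auto
  qed
  define B where "B = {x \<in> resonant_set 1 p p1. norm x \<le> r}"
  have nz: "gradient (resonance 1 p p1) x \<noteq> 0" if "x \<in> resonant_set 1 p p1" "x \<noteq> 0" "x \<noteq> p + p1" for x
   using inverse_gradient_resonance_1(2)[OF that b2_def bp] .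
  have "hausdorff2_outer B \<le> ennreal (32 * pi * (r * m + m * m + m * r))"
  proof (rule resonant_area_box[OF order_refl fr])
   show "B \<subseteq> resonant_set 1 p p1 \<inter> frame_box 0 u v w r m m" using box by (auto simp: B_def frame_box_def)
   show "gradient (resonance 1 p p1) x \<noteq> 0" if "x \<in> B" "x \<noteq> 0" "x \<noteq> p + p1" for x
    using that nz by (auto simp: B_def)
  qed (use A m0 in auto)
  also have "\<dots> \<le> ennreal (96 * pi * (r * h))"
  proof (rule ennreal_leI)
   have "m * m \<le> r * m" using m0 by (intro mult_right_mono) (auto simp: m_def)
   then have "r * m + m * m + m * r \<le> 3 * (r * m)" by (simp add: mult.commute)
   also have "\<dots> \<le> 3 * (r * h)" using A by (intro mult_left_mono) (auto simp: m_def)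
   finally show "32 * pi * (r * m + m * m + m * r) \<le> 96 * pi * (r * h)" by simp
  qed
  finally have areaB: "hausdorff2_outer B \<le> ennreal (96 * pi * (r * h))" .
  have "hausdorff2_outer ((\<lambda>x. p + p1 - x) ` B) \<le> hausdorff2_outer B"
   by (rule hausdorff2_outer_contraction) (simp add: dist_norm norm_minus_commute)
  then have areaB': "hausdorff2_outer ((\<lambda>x. p + p1 - x) ` B) \<le> ennreal (96 * pi * (r * h))"
   using areaB by (rule order_trans)
  let ?A = "{x \<in> resonant_set 1 p p1. min (norm x) (norm (p + p1 - x)) \<le> r}"
  have "?A \<subseteq> B \<union> (\<lambda>x. p + p1 - x) ` B"
  proof
   fix x assume x: "x \<in> ?A"
   show "x \<in> B \<union> (\<lambda>x. p + p1 - x) ` B"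
   proof (cases "norm x \<le> r")
    case True then show ?thesis using x by (simp add: B_def)
   next
    case False
    then have "p + p1 - x \<in> B" using x resonant_set_reflect[of x 1 p p1] by (simp add: B_def min_le_iff_disj)
    then have "p + p1 - (p + p1 - x) \<in> (\<lambda>x. p + p1 - x) ` B" by (rule imageI)
    then show ?thesis by simp
   qed
  qed
  then have "hausdorff2_outer ?A \<le> hausdorff2_outer B + hausdorff2_outer ((\<lambda>x. p + p1 - x) ` B)"
   by (rule order_trans[OF hausdorff2_outer_mono hausdorff2_outer_Un])
  also have "\<dots> \<le> ennreal (96 * pi * (r * h)) + ennreal (96 * pi * (r * h))"
   by (intro add_mono areaB areaB')
  also have "\<dots> = ennreal (192 * pi * (r * h))"
   using A h0 by (simp add: ennreal_plus[symmetric] del: ennreal_plus)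
  finally have area: "hausdorff2_outer ?A \<le> ennreal (192 * pi * (r * h))" .
  define G where "G = sqrt (r * E / b2)"
  have E0: "0 < E" using P0 PE by linarith
  have G0: "0 \<le> G" using A E0 bp by (simp add: G_def)
  have grad: "inverse (norm (gradient (resonance 1 p p1) x)) \<le> G"
   if x: "x \<in> resonant_set 1 p p1" "x \<noteq> 0" "x \<noteq> p + p1" "min (norm x) (norm (p + p1 - x)) \<le> r" for x
  proof -
   have e: "norm x + norm (p + p1 - x) = E" using x(1) unfolding resonant_set_sum by (simp add: E_def)
   have "norm x * norm (p + p1 - x) = min (norm x) (norm (p + p1 - x)) * max (norm x) (norm (p + p1 - x))"
    by (simp add: min_def max_def)
   also have "\<dots> \<le> r * E"
   proof (rule mult_mono)
    show "max (norm x) (norm (p + p1 - x)) \<le> E" using e norm_ge_zero[of x] norm_ge_zero[of "p + p1 - x"] by linarith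
   qed (use x A in \<open>auto simp: le_max_iff_disj\<close>)
   finally have "norm x * norm (p + p1 - x) / b2 \<le> r * E / b2" using bp by (intro divide_right_mono) auto
   then show ?thesis unfolding inverse_gradient_resonance_1(3)[OF x(1,2,3) b2_def bp] G_def by simp
  qed
  have hG: "h * G \<le> 2 * r"
  proof -
   have "h * G = sqrt (r\<^sup>2 * (E / P))" unfolding h_def G_def real_sqrt_mult[symmetric] using bp by (simp add: power2_eq_square mult.commute)
   also have "\<dots> \<le> sqrt (r\<^sup>2 * 4)" using E4 P0 by (intro real_sqrt_le_mono mult_left_mono) (auto simp: field_simps)
   also have "\<dots> = 2 * r" using A by (simp add: real_sqrt_mult)
   finally show ?thesis .
  qed
  have "emeasure hausdorff2 ?A * ennreal G \<le> ennreal (192 * pi * (r * h)) * ennreal G"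
   unfolding emeasure_hausdorff2[OF resonant_min_borel[OF order_refl]] using area by (rule mult_right_mono) simp
  also have "\<dots> = ennreal (192 * pi * (r * h) * G)" using G0 A h0 by (subst ennreal_mult) auto
  also have "\<dots> \<le> ennreal (384 * pi * r\<^sup>2)"
  proof (rule ennreal_leI)
   have "192 * pi * (r * h) * G = (192 * pi * r) * (h * G)" by simp
   also have "\<dots> \<le> (192 * pi * r) * (2 * r)" using hG A by (intro mult_left_mono) auto
   finally show "192 * pi * (r * h) * G \<le> 384 * pi * r\<^sup>2" by (simp add: power2_eq_square)
  qed
  finally have fin: "emeasure hausdorff2 ?A * ennreal G \<le> ennreal (384 * pi * r\<^sup>2)" .
  show ?thesis
  proof (intro exI conjI ballI impI)
   show "0 \<le> G" by (rule G0)
   show "emeasure hausdorff2 ?A * ennreal G \<le> ennreal (384 * pi * r\<^sup>2)" by (rule fin)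
  qed (rule grad)
 qed
qed

lemma resonant_far_upper:
 fixes a :: real
 assumes a: "1 \<le> a"
 obtains L C where "2 \<le> L" "0 \<le> C" "\<And>(p::real^3) p1 r. \<lbrakk>L * norm p \<le> norm p1; p1 \<noteq> 0; 0 < r\<rbrakk> \<Longrightarrow>
  \<exists>G\<ge>0. (\<forall>x\<in>resonant_set a p p1. x \<noteq> 0 \<longrightarrow> x \<noteq> p + p1 \<longrightarrow> min (norm x) (norm (p + p1 - x)) \<le> r \<longrightarrow>
    inverse (norm (gradient (resonance a p p1) x)) \<le> G) \<and>
   emeasure hausdorff2 {x \<in> resonant_set a p p1. min (norm x) (norm (p + p1 - x)) \<le> r} * ennreal G
    \<le> ennreal (C * r\<^sup>2 * norm p1 powr (1 - a))"
proof (cases "a = 1")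
 case True
 show ?thesis
 proof (rule that[of 2 "384 * pi"])
  fix p p1 :: "real^3" and r :: real
  assume A: "2 * norm p \<le> norm p1" "p1 \<noteq> 0" "0 < r"
  have e: "384 * pi * r\<^sup>2 * norm p1 powr (1 - 1) = 384 * pi * r\<^sup>2" using A by simp
  show "\<exists>G\<ge>0. (\<forall>x\<in>resonant_set a p p1. x \<noteq> 0 \<longrightarrow> x \<noteq> p + p1 \<longrightarrow> min (norm x) (norm (p + p1 - x)) \<le> r \<longrightarrow>
    inverse (norm (gradient (resonance a p p1) x)) \<le> G) \<and>
   emeasure hausdorff2 {x \<in> resonant_set a p p1. min (norm x) (norm (p + p1 - x)) \<le> r} * ennreal G
    \<le> ennreal (384 * pi * r\<^sup>2 * norm p1 powr (1 - a))"
   unfolding True e by (rule resonant_far_upper_linear[OF A])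
 qed auto
next
 case False
 then have "1 < a" using a by simp
 then show ?thesis by (rule resonant_far_upper_superlinear) (rule that)
qed

text \<open>The chord through \<open>x\<close> and its reflection \<open>y\<close> passes through the midpoint.  Strong monotonicity of the
flux gives a quadratic growth of the resonance function along it, provided that a point of the chord is
used at which neither focus is close.\<close>

lemma resonant_depth_ge:
 fixes p p1 :: "real^3"
 assumes a: "1 < a" and x: "x \<in> resonant_set a p p1" and R: "0 < R0" "R0 \<le> norm p" "norm p \<le> R1" "norm p1 \<le> R1"
 shows "a / 3 * min (1/2) (a - 1) * min ((2 * R1) powr (a - 2)) ((R0 / 8) powr (a - 2)) * (norm (x - (1/2) *\<^sub>R (p + p1)))\<^sup>2
  \<le> norm p powr a + norm p1 powr a - 2 * norm ((1/2) *\<^sub>R (p + p1)) powr a"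
proof -
 define c where "c = (1/2) *\<^sub>R (p + p1)"
 define w where "w = x - c"
 define D where "D = norm p powr a + norm p1 powr a - 2 * norm c powr a"
 have cc: "c + c = p + p1"
 proof -
  have "c + c = (1/2) *\<^sub>R ((p + p1) + (p + p1))" unfolding c_def by (rule scaleR_right_distrib[symmetric])
  then show ?thesis by (simp only: scaleR_half_double)
 qed
 have a1: "1 \<le> a" using a by simp
 have R1: "0 < R1" using R by linarith
 have D_ge: "- D \<le> resonance a p p1 z" for z
 proof -
  have "norm ((1 - 1/2) *\<^sub>R z + (1/2) *\<^sub>R (p + p1 - z)) powr a \<le> (1 - 1/2) * norm z powr a + (1/2) * norm (p + p1 - z) powr a"
   using convex_onD[OF convex_on_norm_powr[OF a1], of "1/2" z "p + p1 - z"] by simp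
  moreover have "(1 - 1/2) *\<^sub>R z + (1/2) *\<^sub>R (p + p1 - z) = c" by (simp add: c_def scaleR_right_diff_distrib)
  ultimately show ?thesis unfolding D_def resonance_def by simp
 qed
 show ?thesis
 proof (cases "w = 0")
  case True
  have "p + p1 - c = c" by (metis cc add_diff_cancel_left')
  then have "resonance a p p1 c = - D" by (simp add: resonance_def D_def)
  moreover have "x = c" using True by (simp add: w_def)
  ultimately have "D = 0" using x by (simp add: resonant_set_def)
  then show ?thesis using True unfolding w_def c_def D_def by simp
 next
  case False
  then have w0: "0 < norm w" by simp
  \<comment> \<open>one of two interior points of the chord avoids both foci\<close>
  have "\<exists>\<theta>\<in>{1/2, 1/3::real}. c + \<theta> *\<^sub>R w \<noteq> 0 \<and> c - \<theta> *\<^sub>R w \<noteq> 0"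
  proof (rule ccontr)
   assume "\<not> ?thesis"
   then have h: "c + (1/2) *\<^sub>R w = 0 \<or> c - (1/2) *\<^sub>R w = 0" "c + (1/3) *\<^sub>R w = 0 \<or> c - (1/3) *\<^sub>R w = 0" by auto
   have "norm c = 1/2 * norm w" using h(1)
   proof
    assume "c + (1/2) *\<^sub>R w = 0"
    then have "c = - ((1/2) *\<^sub>R w)" by (simp add: add_eq_0_iff2)
    then show ?thesis by simp
   next
    assume "c - (1/2) *\<^sub>R w = 0"
    then have "c = (1/2) *\<^sub>R w" by simp
    then show ?thesis by simp
   qed
   moreover have "norm c = 1/3 * norm w" using h(2)
   proof
    assume "c + (1/3) *\<^sub>R w = 0"
    then have "c = - ((1/3) *\<^sub>R w)" by (simp add: add_eq_0_iff2)
    then show ?thesis by simp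
   next
    assume "c - (1/3) *\<^sub>R w = 0"
    then have "c = (1/3) *\<^sub>R w" by simp
    then show ?thesis by simp
   qed
   ultimately show False using w0 by simp
  qed
  then obtain \<theta> :: real where mem: "\<theta> \<in> {1/2, 1/3}" and nz: "c + \<theta> *\<^sub>R w \<noteq> 0" "c - \<theta> *\<^sub>R w \<noteq> 0" by blast
  then have th: "\<theta> = 1/2 \<or> \<theta> = 1/3" by blast
  have thb: "1/3 \<le> \<theta>" "\<theta> \<le> 1/2" "0 \<le> \<theta>" "1/6 \<le> \<theta> * (1 - \<theta>)"
   using th by (elim disjE; hypsubst; simp)+
  define x' where "x' = c + \<theta> *\<^sub>R w"
  define y' where "y' = c - \<theta> *\<^sub>R w"
  have y'P: "p + p1 - x' = y'" unfolding cc[symmetric] by (simp add: x'_def y'_def)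
  have x'P: "x' \<noteq> p + p1" using nz(2) y'P unfolding y'_def[symmetric] by auto
  have x'0: "x' \<noteq> 0" using nz(1) by (simp add: x'_def)
  have y'0: "y' \<noteq> 0" using nz(2) by (simp add: y'_def)
  have dxy: "x' - y' = (2 * \<theta>) *\<^sub>R w" by (simp add: x'_def y'_def scaleR_left_distrib[symmetric])
  define M where "M = max (norm x') (norm y')"
  define F where "F = (flux a x' - flux a y') \<bullet> w"
  have "min (1/2) (a - 1) * M powr (a - 2) * (norm (x' - y'))\<^sup>2 \<le> (flux a x' - flux a y') \<bullet> (x' - y')"
   unfolding M_def by (rule flux_strongly_monotone[OF a x'0 y'0])
  then have "2 * \<theta> * (min (1/2) (a - 1) * M powr (a - 2) * (2 * \<theta>) * (norm w)\<^sup>2) \<le> 2 * \<theta> * F"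
   unfolding dxy F_def using thb by (simp add: power_mult_distrib power2_eq_square algebra_simps)
  then have F: "min (1/2) (a - 1) * M powr (a - 2) * (2 * \<theta>) * (norm w)\<^sup>2 \<le> F"
   using thb by (simp only: mult_le_cancel_left)
  have tang: "resonance a p p1 x' + gradient (resonance a p p1) x' \<bullet> (x - x') \<le> resonance a p p1 x"
   by (rule resonance_above_tangent[OF a1 x'0 x'P])
  have "x - x' = (1 - \<theta>) *\<^sub>R w" by (simp add: x'_def w_def scaleR_left_diff_distrib)
  then have "gradient (resonance a p p1) x' \<bullet> (x - x') = a * (1 - \<theta>) * F"
   unfolding gradient_resonance[OF x'0 x'P] y'P F_def by simp
  then have "a * (1 - \<theta>) * F \<le> D" using tang D_ge[of x'] x by (simp add: resonant_set_def)
  moreover have "a * (1 - \<theta>) * (min (1/2) (a - 1) * M powr (a - 2) * (2 * \<theta>) * (norm w)\<^sup>2) \<le> a * (1 - \<theta>) * F"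
   using F a thb by (intro mult_left_mono) auto
  ultimately have low: "2 * (\<theta> * (1 - \<theta>)) * (a * min (1/2) (a - 1) * M powr (a - 2) * (norm w)\<^sup>2) \<le> D"
   by (simp add: algebra_simps)
  have nn: "0 \<le> a * min (1/2) (a - 1) * M powr (a - 2) * (norm w)\<^sup>2" using a by simp
  have "1/3 * (a * min (1/2) (a - 1) * M powr (a - 2) * (norm w)\<^sup>2) \<le> 2 * (\<theta> * (1 - \<theta>)) * (a * min (1/2) (a - 1) * M powr (a - 2) * (norm w)\<^sup>2)"
   using thb nn by (intro mult_right_mono) auto
  then have low': "1/3 * (a * min (1/2) (a - 1) * M powr (a - 2) * (norm w)\<^sup>2) \<le> D" using low by linarith
  have xb: "norm x \<le> 2 * R1" "norm (p + p1 - x) \<le> 2 * R1" by (rule resonant_norm_le[OF a1 x R(3,4)])+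
  have xw: "x = c + w" "p + p1 - x = c - w" unfolding cc[symmetric] by (simp_all add: w_def)
  have Mup: "M \<le> 2 * R1"
  proof -
   define \<alpha> \<gamma> where "\<alpha> = (1 + \<theta>) / 2" and "\<gamma> = (1 - \<theta>) / 2"
   have ag: "\<alpha> + \<gamma> = 1" "\<alpha> - \<gamma> = \<theta>" "0 \<le> \<alpha>" "0 \<le> \<gamma>"
    using thb by (auto simp: \<alpha>_def \<gamma>_def field_simps)
   have "x' = (\<alpha> + \<gamma>) *\<^sub>R c + (\<alpha> - \<gamma>) *\<^sub>R w" unfolding ag x'_def by simp
   also have "\<dots> = \<alpha> *\<^sub>R x + \<gamma> *\<^sub>R (p + p1 - x)"
    unfolding xw(2) by (subst xw(1)) (simp add: algebra_simps)
   finally have "norm x' \<le> \<alpha> * norm x + \<gamma> * norm (p + p1 - x)"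
    using norm_triangle_ineq[of "\<alpha> *\<^sub>R x" "\<gamma> *\<^sub>R (p + p1 - x)"] ag(3,4) by simp
   also have "\<dots> \<le> \<alpha> * (2 * R1) + \<gamma> * (2 * R1)"
    using xb ag by (intro add_mono mult_left_mono) auto
   also have "\<dots> = 2 * R1" using ag(1) by (simp add: distrib_right[symmetric])
   finally have 1: "norm x' \<le> 2 * R1" .
   have "y' = (\<alpha> + \<gamma>) *\<^sub>R c - (\<alpha> - \<gamma>) *\<^sub>R w" unfolding ag y'_def by simp
   also have "\<dots> = \<gamma> *\<^sub>R x + \<alpha> *\<^sub>R (p + p1 - x)"
    unfolding xw(2) by (subst xw(1)) (simp add: algebra_simps)
   finally have "norm y' \<le> \<gamma> * norm x + \<alpha> * norm (p + p1 - x)"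
    using norm_triangle_ineq[of "\<gamma> *\<^sub>R x" "\<alpha> *\<^sub>R (p + p1 - x)"] ag(3,4) by simp
   also have "\<dots> \<le> \<gamma> * (2 * R1) + \<alpha> * (2 * R1)"
    using xb ag by (intro add_mono mult_left_mono) auto
   also have "\<dots> = 2 * R1" using ag(1) by (simp add: distrib_right[symmetric] add.commute)
   finally have 2: "norm y' \<le> 2 * R1" .
   show ?thesis using 1 2 by (simp add: M_def)
  qed
  have Mlow: "R0 / 8 \<le> M"
  proof (rule ccontr)
   assume "\<not> ?thesis"
   then have M8: "M < R0 / 8" by simp
   have "norm (c + c) = norm (x' + y')" by (simp add: x'_def y'_def)
   also have "\<dots> \<le> 2 * M" using norm_triangle_ineq[of x' y'] by (simp add: M_def)
   finally have cM: "norm c \<le> M" using norm_scaleR[of 2 c] by (simp add: scaleR_2)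
   have "2 * \<theta> * norm w = norm (x' - y')" unfolding dxy using thb by simp
   also have "\<dots> \<le> 2 * M" using norm_triangle_ineq4[of x' y'] by (simp add: M_def)
   finally have "2 * \<theta> * norm w \<le> 2 * M" .
   moreover have "2 * (1/3) * norm w \<le> 2 * \<theta> * norm w" using thb by (intro mult_right_mono) auto
   ultimately have wM: "norm w \<le> 3 * M" by linarith
   have "norm (p + p1 - x) \<le> 4 * M"
    using norm_triangle_ineq4[of c w] cM wM unfolding xw(2) by linarith
   moreover have "norm x \<le> 4 * M"
    using norm_triangle_ineq[of c w] cM wM by (subst xw(1)) linarith
   ultimately have "norm x \<le> 4 * M" "norm (p + p1 - x) \<le> 4 * M" by simp_all
   then have lt: "norm x \<le> R0 / 2" "norm (p + p1 - x) \<le> R0 / 2" "0 < R0" using M8 R by linarith+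
   have s: "norm x < R0/2" "norm (p + p1 - x) < R0/2"
    using \<open>norm x \<le> 4 * M\<close> \<open>norm (p + p1 - x) \<le> 4 * M\<close> M8 by linarith+
   have "norm x powr a + norm (p + p1 - x) powr a < (R0/2) powr a + (R0/2) powr a"
    using s a by (intro add_strict_mono powr_less_mono2) auto
   also have "\<dots> = 2 * ((1/2) powr a * R0 powr a)" by (simp add: powr_divide)
   also have "\<dots> \<le> 2 * ((1/2) powr 1 * R0 powr a)"
    using a by (intro mult_left_mono mult_right_mono powr_mono') auto
   also have "\<dots> = R0 powr a" by simp
   also have "\<dots> \<le> norm p powr a" using R a by (intro powr_mono2) auto
   also have "\<dots> \<le> norm p powr a + norm p1 powr a" by simp
   finally show False using x by (simp add: resonant_set_sum)
  qed
  have M0: "0 < M" using Mlow R by linarith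
  have mM: "min ((2 * R1) powr (a - 2)) ((R0 / 8) powr (a - 2)) \<le> M powr (a - 2)"
  proof (cases "a \<ge> 2")
   case True
   then have "(R0 / 8) powr (a - 2) \<le> M powr (a - 2)" using Mlow R by (intro powr_mono2) auto
   then show ?thesis by (simp add: min_le_iff_disj)
  next
   case False
   then have "(2 * R1) powr (a - 2) \<le> M powr (a - 2)" using Mup M0 by (intro powr_mono2') auto
   then show ?thesis by (simp add: min_le_iff_disj)
  qed
  have "a / 3 * min (1/2) (a - 1) * min ((2 * R1) powr (a - 2)) ((R0 / 8) powr (a - 2)) * (norm w)\<^sup>2
   \<le> a / 3 * min (1/2) (a - 1) * M powr (a - 2) * (norm w)\<^sup>2"
   using mM a by (intro mult_right_mono mult_left_mono) auto
  also have "\<dots> = 1/3 * (a * min (1/2) (a - 1) * M powr (a - 2) * (norm w)\<^sup>2)" by simp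
  also have "\<dots> \<le> D" by (rule low')
  finally show ?thesis unfolding w_def c_def D_def .
 qed
qed

text \<open>The gradient degenerates when the surface does, but the area inside a small ball degenerates at the
same rate; the product of the area and the inverse gradient is linear in the radius of the ball.\<close>

lemma resonant_near_upper:
 fixes a :: real
 assumes a: "1 \<le> a" and R0: "0 < R0"
 obtains C where "0 \<le> C" "\<And>(p::real^3) p1 c \<rho>. \<lbrakk>R0 \<le> norm p; norm p \<le> R1; norm p1 \<le> R1; 0 < \<rho>\<rbrakk> \<Longrightarrow>
  \<exists>G\<ge>0. (\<forall>x\<in>resonant_set a p p1. x \<noteq> 0 \<longrightarrow> x \<noteq> p + p1 \<longrightarrow>
    inverse (norm (gradient (resonance a p p1) x)) \<le> G) \<and>
   emeasure hausdorff2 (resonant_set a p p1 \<inter> cball c \<rho>) * ennreal G \<le> ennreal (C * \<rho>)"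
proof (cases "a = 1")
 case True
 show ?thesis
 proof (rule that[of "96 * pi * (2 * \<bar>R1\<bar>)"])
  fix p p1 c :: "real^3" and \<rho> :: real
  assume A: "R0 \<le> norm p" "norm p \<le> R1" "norm p1 \<le> R1" "0 < \<rho>"
  define E P b2 where "E = norm p + norm p1" and "P = norm (p + p1)" and "b2 = (norm p + norm p1)\<^sup>2 - (norm (p + p1))\<^sup>2"
  have bE: "b2 = E\<^sup>2 - P\<^sup>2" by (simp add: b2_def E_def P_def)
  have PE: "P \<le> E" unfolding P_def E_def by (rule norm_triangle_ineq)
  have b0: "0 \<le> b2" using PE power_mono[of P E 2] by (simp add: bE P_def)
  have E0: "0 < E" using A R0 norm_ge_zero[of p1] unfolding E_def by linarith
  have ER: "E \<le> 2 * \<bar>R1\<bar>" using A unfolding E_def by linarith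
  let ?A = "resonant_set 1 p p1 \<inter> cball c \<rho>"
  have AB: "?A \<in> sets borel" using closed_resonant_set[of 1 p p1] by (simp add: borel_closed closed_Int)
  show "\<exists>G\<ge>0. (\<forall>x\<in>resonant_set a p p1. x \<noteq> 0 \<longrightarrow> x \<noteq> p + p1 \<longrightarrow>
    inverse (norm (gradient (resonance a p p1) x)) \<le> G) \<and>
   emeasure hausdorff2 (resonant_set a p p1 \<inter> cball c \<rho>) * ennreal G \<le> ennreal (96 * pi * (2 * \<bar>R1\<bar>) * \<rho>)"
  proof (cases "b2 = 0")
   case b: True
   show ?thesis unfolding True
   proof (intro exI[of _ 0] conjI ballI impI)
    fix x assume "x \<in> resonant_set 1 p p1" "x \<noteq> 0" "x \<noteq> p + p1"
    from inverse_gradient_resonance_1(1)[OF this b2_def b]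
    show "inverse (norm (gradient (resonance 1 p p1) x)) \<le> 0" by simp
   qed auto
  next
   case False
   then have bp: "0 < b2" using b0 by simp
   define b where "b = sqrt b2"
   have bb: "0 < b" "b\<^sup>2 = b2" using bp by (auto simp: b_def)
   have nz: "gradient (resonance 1 p p1) x \<noteq> 0" if "x \<in> resonant_set 1 p p1" "x \<noteq> 0" "x \<noteq> p + p1" for x
    using inverse_gradient_resonance_1(2)[OF that b2_def bp] .
   have area: "hausdorff2_outer ?A \<le> ennreal (96 * pi * (\<rho> * b))"
   proof (cases "\<rho> \<le> b")
    case True
    have "hausdorff2_outer ?A \<le> ennreal (96 * pi * \<rho>\<^sup>2)"
     using A nz by (intro resonant_area_ball[OF order_refl subset_refl]) auto
    also have "\<dots> \<le> ennreal (96 * pi * (\<rho> * b))"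
     using True A by (intro ennreal_leI) (simp add: power2_eq_square mult_left_mono)
    finally show ?thesis .
   next
    case False
    define u where "u = (if P = 0 then axis 1 1 else sgn (p + p1))"
    have "norm u = 1" by (auto simp: u_def P_def norm_sgn)
    from orthonormal_frame_exists[OF this] obtain v w where fr: "orthonormal_frame u v w" by blast
    have Pu: "p + p1 = norm (p + p1) *\<^sub>R u" by (auto simp: u_def sgn_div_norm P_def)
    have box: "(norm x)\<^sup>2 - (x \<bullet> u)\<^sup>2 \<le> b2" if x: "x \<in> resonant_set 1 p p1" for x
    proof (cases "P = 0")
     case True
     have "norm x + norm (p + p1 - x) = E" using x unfolding resonant_set_sum by (simp add: E_def)
     then have "norm x \<le> E" using norm_ge_zero[of "p + p1 - x"] by linarith
     then have "(norm x)\<^sup>2 \<le> E\<^sup>2" by (intro power_mono) auto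
     moreover have "b2 = E\<^sup>2" using True bE by simp
     ultimately show ?thesis using zero_le_power2[of "x \<bullet> u"] by linarith
    next
     case False
     then have P0: "0 < P" by (simp add: P_def)
     note co = resonant_1_coordinates(1)[OF x Pu fr b2_def, folded E_def, folded P_def]
     have "4 * P\<^sup>2 * ((norm x)\<^sup>2 - (x \<bullet> u)\<^sup>2) = 4 * P\<^sup>2 * (norm x)\<^sup>2 - (2 * P * (x \<bullet> u))\<^sup>2"
      by (simp add: power_mult_distrib algebra_simps)
     also have "\<dots> = 4 * (E\<^sup>2 - b2) * (norm x)\<^sup>2 - (2 * E * norm x - b2)\<^sup>2" unfolding co bE by simp
     also have "\<dots> = b2 * (P\<^sup>2 - (E - 2 * norm x)\<^sup>2)"
      unfolding bE by (simp add: power2_eq_square algebra_simps)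
     also have "\<dots> \<le> b2 * (4 * P\<^sup>2)" using b0 zero_le_power2[of "E - 2 * norm x"] zero_le_power2[of P] by (intro mult_left_mono) linarith+
     finally have "(4 * P\<^sup>2) * ((norm x)\<^sup>2 - (x \<bullet> u)\<^sup>2) \<le> (4 * P\<^sup>2) * b2" by (simp add: algebra_simps)
     then show ?thesis using P0 by (simp only: mult_le_cancel_left) simp
    qed
    have le: "\<bar>e\<bar> \<le> b" if "e\<^sup>2 \<le> b2" for e
    proof -
     have "\<bar>e\<bar> \<le> \<bar>b\<bar>" using that unfolding bb(2)[symmetric] by (simp add: abs_le_square_iff)
     then show ?thesis using bb by simp
    qed
    have "?A \<subseteq> resonant_set 1 p p1 \<inter> frame_box ((c \<bullet> u) *\<^sub>R u) u v w \<rho> b b"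
    proof
     fix x assume x: "x \<in> ?A"
     then have xr: "x \<in> resonant_set 1 p p1" by simp
     have on: "u \<bullet> u = 1" "u \<bullet> v = 0" "u \<bullet> w = 0" using fr by (auto simp: orthonormal_frame_def norm_eq_1)
     note co = resonant_1_coordinates(2,3)[OF xr Pu fr b2_def]
     have "\<bar>x \<bullet> v\<bar> \<le> b" "\<bar>x \<bullet> w\<bar> \<le> b" using le[of "x \<bullet> v"] le[of "x \<bullet> w"] co box[OF xr] by linarith+
     moreover have "\<bar>(x - c) \<bullet> u\<bar> \<le> \<rho>"
      using x Cauchy_Schwarz_ineq2[of "x - c" u] \<open>norm u = 1\<close> by (simp add: dist_norm norm_minus_commute)
     ultimately show "x \<in> resonant_set 1 p p1 \<inter> frame_box ((c \<bullet> u) *\<^sub>R u) u v w \<rho> b b"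
      using xr on by (simp add: frame_box_def inner_diff_left)
    qed
    then have "hausdorff2_outer ?A \<le> ennreal (32 * pi * (\<rho> * b + b * b + b * \<rho>))"
     using nz bb A by (intro resonant_area_box[OF order_refl fr]) auto
    also have "\<dots> \<le> ennreal (96 * pi * (\<rho> * b))"
    proof (rule ennreal_leI)
     have "b * b \<le> \<rho> * b" using False bb by (intro mult_right_mono) auto
     then show "32 * pi * (\<rho> * b + b * b + b * \<rho>) \<le> 96 * pi * (\<rho> * b)" by (simp add: mult.commute)
    qed
    finally show ?thesis .
   qed
   define G where "G = E / b"
   have G0: "0 \<le> G" using E0 bb by (simp add: G_def)
   have grad: "inverse (norm (gradient (resonance 1 p p1) x)) \<le> G"
    if x: "x \<in> resonant_set 1 p p1" "x \<noteq> 0" "x \<noteq> p + p1" for x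
   proof -
    have e: "norm x + norm (p + p1 - x) = E" using x(1) unfolding resonant_set_sum by (simp add: E_def)
    have "norm x * norm (p + p1 - x) \<le> E * E"
     using e norm_ge_zero[of x] norm_ge_zero[of "p + p1 - x"] by (intro mult_mono) linarith+
    then have "norm x * norm (p + p1 - x) / b2 \<le> E\<^sup>2 / b2" using bp by (intro divide_right_mono) (auto simp: power2_eq_square)
    then have "sqrt (norm x * norm (p + p1 - x) / b2) \<le> sqrt (E\<^sup>2 / b2)" by (rule real_sqrt_le_mono)
    also have "\<dots> = G" using E0 by (simp add: G_def b_def real_sqrt_divide)
    finally show ?thesis unfolding inverse_gradient_resonance_1(3)[OF x b2_def bp] .
   qed
   have "emeasure hausdorff2 ?A * ennreal G \<le> ennreal (96 * pi * (\<rho> * b)) * ennreal G"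
    unfolding emeasure_hausdorff2[OF AB] using area by (rule mult_right_mono) simp
   also have "\<dots> = ennreal (96 * pi * (\<rho> * b) * G)" using G0 A bb by (subst ennreal_mult) auto
   also have "\<dots> \<le> ennreal (96 * pi * (2 * \<bar>R1\<bar>) * \<rho>)"
   proof (rule ennreal_leI)
    have "96 * pi * (\<rho> * b) * G = 96 * pi * E * \<rho>" using bb by (simp add: G_def)
    also have "\<dots> \<le> 96 * pi * (2 * \<bar>R1\<bar>) * \<rho>" using ER A by (intro mult_right_mono mult_left_mono) auto
    finally show "96 * pi * (\<rho> * b) * G \<le> 96 * pi * (2 * \<bar>R1\<bar>) * \<rho>" .
   qed
   finally have fin: "emeasure hausdorff2 ?A * ennreal G \<le> ennreal (96 * pi * (2 * \<bar>R1\<bar>) * \<rho>)" .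
   show ?thesis unfolding True
   proof (intro exI conjI ballI impI)
    show "0 \<le> G" by (rule G0)
    show "emeasure hausdorff2 ?A * ennreal G \<le> ennreal (96 * pi * (2 * \<bar>R1\<bar>) * \<rho>)" by (rule fin)
   qed (rule grad)
  qed
 qed auto
next
 case False
 then have a1: "1 < a" using a by simp
 define K where "K = a / 3 * min (1/2) (a - 1) * min ((2 * R1) powr (a - 2)) ((R0 / 8) powr (a - 2))"
 show ?thesis
 proof (cases "R0 \<le> R1")
  case False
  show ?thesis by (rule that[of 0]) (use False in auto)
 next
  case True
  have K0: "0 < K" unfolding K_def using a1 R0 True by (intro mult_pos_pos) (auto simp: min_def)
  show ?thesis
  proof (rule that[of "96 * pi / K"])
   show "0 \<le> 96 * pi / K" using K0 by simp
   fix p p1 c :: "real^3" and \<rho> :: real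
   assume A: "R0 \<le> norm p" "norm p \<le> R1" "norm p1 \<le> R1" "0 < \<rho>"
   let ?h = "(1/2) *\<^sub>R (p + p1)"
   define D where "D = norm p powr a + norm p1 powr a - 2 * norm ?h powr a"
   have KD: "K * (norm (x - ?h))\<^sup>2 \<le> D" if "x \<in> resonant_set a p p1" for x
    unfolding K_def D_def by (rule resonant_depth_ge[OF a1 that R0 A(1-3)])
   have dep: "D \<le> norm (gradient (resonance a p p1) x) * norm (x - ?h)" if "x \<in> resonant_set a p p1" "x \<noteq> 0" "x \<noteq> p + p1" for x
    unfolding D_def by (rule norm_gradient_resonance_depth[OF a that])
   let ?A = "resonant_set a p p1 \<inter> cball c \<rho>"
   have AB: "?A \<in> sets borel" using closed_resonant_set[OF a, of p p1] by (simp add: borel_closed closed_Int)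
   show "\<exists>G\<ge>0. (\<forall>x\<in>resonant_set a p p1. x \<noteq> 0 \<longrightarrow> x \<noteq> p + p1 \<longrightarrow>
     inverse (norm (gradient (resonance a p p1) x)) \<le> G) \<and>
    emeasure hausdorff2 ?A * ennreal G \<le> ennreal (96 * pi / K * \<rho>)"
   proof (cases "0 < D")
    case False
    have "gradient (resonance a p p1) x = 0" if x: "x \<in> resonant_set a p p1" "x \<noteq> 0" "x \<noteq> p + p1" for x
    proof -
     have "K * (norm (x - ?h))\<^sup>2 \<le> 0" using KD[OF x(1)] False by linarith
     then have "x - ?h = 0" using K0 by (simp add: mult_le_0_iff)
     then have xh: "x = ?h" by simp
     have "?h + ?h = (1/2) *\<^sub>R ((p + p1) + (p + p1))" by (rule scaleR_right_distrib[symmetric])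
     then have "x + x = p + p1" unfolding xh by (simp only: scaleR_half_double)
     then have "p + p1 - x = x" by (metis add_diff_cancel_left')
     then show ?thesis unfolding gradient_resonance[OF x(2,3)] by simp
    qed
    then show ?thesis by (intro exI[of _ 0]) auto
   next
    case True
    define V where "V = sqrt (D / K)"
    have V: "0 < V" "V\<^sup>2 = D / K" using True K0 by (auto simp: V_def)
    have xV: "norm (x - ?h) \<le> V" if "x \<in> resonant_set a p p1" for x
    proof -
     have "(norm (x - ?h))\<^sup>2 \<le> D / K" using KD[OF that] K0 by (simp add: field_simps)
     then have "(norm (x - ?h))\<^sup>2 \<le> V\<^sup>2" by (simp add: V)
     then show ?thesis by (rule power2_le_imp_le) (use V in simp)
    qed
    have grad: "gradient (resonance a p p1) x \<noteq> 0 \<and> inverse (norm (gradient (resonance a p p1) x)) \<le> V / D"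
     if x: "x \<in> resonant_set a p p1" "x \<noteq> 0" "x \<noteq> p + p1" for x
    proof -
     let ?g = "norm (gradient (resonance a p p1) x)"
     have "D \<le> ?g * V" using dep[OF x] mult_left_mono[OF xV[OF x(1)], of ?g] by simp
     then have "0 < ?g" using True by (cases "?g = 0") auto
     then show ?thesis using \<open>D \<le> ?g * V\<close> True by (simp add: field_simps)
    qed
    have nz: "gradient (resonance a p p1) x \<noteq> 0" if "x \<in> resonant_set a p p1" "x \<noteq> 0" "x \<noteq> p + p1" for x
     using grad[OF that] by simp
    have area: "hausdorff2_outer ?A \<le> ennreal (96 * pi * (\<rho> * V))"
    proof (cases "\<rho> \<le> V")
     case True
     have "hausdorff2_outer ?A \<le> ennreal (96 * pi * \<rho>\<^sup>2)"
      using A nz by (intro resonant_area_ball[OF a subset_refl]) auto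
     also have "\<dots> \<le> ennreal (96 * pi * (\<rho> * V))"
      using True A by (intro ennreal_leI) (simp add: power2_eq_square mult_left_mono)
     finally show ?thesis .
    next
     case False
     have "?A \<subseteq> resonant_set a p p1 \<inter> cball ?h V" using xV by (auto simp: dist_norm norm_minus_commute)
     then have "hausdorff2_outer ?A \<le> ennreal (96 * pi * V\<^sup>2)"
      using V nz by (intro resonant_area_ball[OF a]) auto
     also have "\<dots> \<le> ennreal (96 * pi * (\<rho> * V))"
      using False V(1) by (intro ennreal_leI) (simp add: power2_eq_square mult_right_mono)
     finally show ?thesis .
    qed
    have "emeasure hausdorff2 ?A * ennreal (V / D) \<le> ennreal (96 * pi * (\<rho> * V)) * ennreal (V / D)"
     unfolding emeasure_hausdorff2[OF AB] using area by (rule mult_right_mono) simp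
    also have "\<dots> = ennreal (96 * pi * (\<rho> * V) * (V / D))" using A V True by (subst ennreal_mult) auto
    also have "96 * pi * (\<rho> * V) * (V / D) = 96 * pi * \<rho> * V\<^sup>2 / D" by (simp add: power2_eq_square)
    also have "\<dots> = 96 * pi / K * \<rho>" unfolding V using True by simp
    finally have fin: "emeasure hausdorff2 ?A * ennreal (V / D) \<le> ennreal (96 * pi / K * \<rho>)" .
    show ?thesis
    proof (intro exI conjI ballI impI)
     show "0 \<le> V / D" using V True by simp
     show "emeasure hausdorff2 ?A * ennreal (V / D) \<le> ennreal (96 * pi / K * \<rho>)" by (rule fin)
    qed (use grad in auto)
   qed
  qed
 qed
qed

section \<open>Weights and the collision kernel\<close>

definition wt :: "real \<Rightarrow> real^3 \<Rightarrow> real" where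
 "wt s x = japanese x powr (- s)"

lemma japanese_ge: "1 \<le> japanese x" "norm x \<le> japanese x"
 by (auto simp: japanese_def intro: real_le_rsqrt)

lemma japanese_pos [simp]: "0 < japanese x"
 using japanese_ge(1)[of x] by linarith

lemma japanese_neq_0 [simp]: "japanese x \<noteq> 0"
 using japanese_pos[of x] by linarith

lemma japanese_le:
 assumes "norm x \<le> r" "1 \<le> r" shows "japanese x \<le> 2 * r"
proof -
 have "(norm x)\<^sup>2 \<le> r\<^sup>2" "1 \<le> r\<^sup>2" using assms by (auto intro: power_mono simp: one_le_power)
 then have "1 + (norm x)\<^sup>2 \<le> (2 * r)\<^sup>2" by (simp add: power_mult_distrib)
 then show ?thesis unfolding japanese_def using assms by (intro real_le_lsqrt) auto
qed

lemma wt_pos [simp]: "0 < wt s x" "0 \<le> wt s x"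
 by (auto simp: wt_def less_imp_le)

lemma wt_le_1: "0 \<le> s \<Longrightarrow> wt s x \<le> 1"
 unfolding wt_def using japanese_ge(1)[of x] powr_mono2'[of "-s" 1 "japanese x"] by simp

lemma wt_le:
 assumes "0 \<le> s" "0 < r" "r \<le> japanese x" shows "wt s x \<le> r powr (-s)"
 unfolding wt_def using assms by (intro powr_mono2') auto

lemma wt_ge:
 assumes "0 \<le> s" "japanese x \<le> r" shows "r powr (-s) \<le> wt s x"
 unfolding wt_def using assms by (intro powr_mono2') auto

lemma wt_compare:
 assumes "0 \<le> s" "1 \<le> c" "norm x \<le> c * norm z"
 shows "wt s z \<le> c powr s * wt s x"
proof -
 have "1 + (norm x)\<^sup>2 \<le> c\<^sup>2 * (1 + (norm z)\<^sup>2)"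
 proof -
  have "(norm x)\<^sup>2 \<le> (c * norm z)\<^sup>2" using assms by (intro power_mono) auto
  moreover have "1 \<le> c\<^sup>2" using assms by (simp add: one_le_power)
  ultimately show ?thesis by (simp add: power_mult_distrib distrib_left)
 qed
 then have "sqrt (1 + (norm x)\<^sup>2) \<le> sqrt (c\<^sup>2 * (1 + (norm z)\<^sup>2))" by (rule real_sqrt_le_mono)
 then have "japanese x \<le> c * japanese z" unfolding japanese_def using assms by (simp add: real_sqrt_mult)
 then have "(c * japanese z) powr (-s) \<le> wt s x" by (intro wt_ge assms)
 then have "c powr (-s) * wt s z \<le> wt s x" by (simp add: wt_def powr_mult)
 then have "c powr s * (c powr (-s) * wt s z) \<le> c powr s * wt s x" by (intro mult_left_mono) auto
 then show ?thesis using assms by (simp add: mult.assoc[symmetric] powr_add[symmetric])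
qed

lemma continuous_on_japanese [continuous_intros]: "continuous_on S japanese"
 unfolding japanese_def by (intro continuous_intros)

lemma continuous_on_wt: "continuous_on S (wt s)"
 unfolding wt_def by (intro continuous_on_powr continuous_intros) simp

lemma rpow_nonneg [simp]: "0 \<le> r \<Longrightarrow> 0 \<le> rpow r e"
 by (simp add: rpow_def)

lemma rpow_mono: "0 \<le> r \<Longrightarrow> r \<le> r' \<Longrightarrow> 0 \<le> e \<Longrightarrow> rpow r e \<le> rpow r' e"
 by (auto simp: rpow_def intro: powr_mono2)

lemma rpow_pos: "0 < r \<Longrightarrow> rpow r e = r powr e"
 by (simp add: rpow_def)

text \<open>The majorants of the negative part and the minorants of the positive part may be arbitrary functions;
this avoids all questions of measurability of the inner integral in its parameters.\<close>

lemma integral_lower_bound: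
 fixes f :: "'a \<Rightarrow> real"
 assumes f: "integrable M f"
  and neg: "AE x in M. ennreal (- f x) \<le> B x" "(\<integral>\<^sup>+x. B x \<partial>M) \<le> ennreal u" "0 \<le> u"
  and pos: "AE x in M. A x \<le> ennreal (f x)" "ennreal l \<le> (\<integral>\<^sup>+x. A x \<partial>M)"
 shows "l - u \<le> (\<integral>x. f x \<partial>M)"
proof -
 have "(\<integral>\<^sup>+x. ennreal (- f x) \<partial>M) \<le> (\<integral>\<^sup>+x. B x \<partial>M)" by (rule nn_integral_mono_AE[OF neg(1)])
 then have "(\<integral>\<^sup>+x. ennreal (- f x) \<partial>M) \<le> ennreal u" using neg(2) by (rule order_trans)
 then have n: "enn2real (\<integral>\<^sup>+x. ennreal (- f x) \<partial>M) \<le> u" using neg(3) by (intro enn2real_leI)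
 have "(\<integral>\<^sup>+x. A x \<partial>M) \<le> (\<integral>\<^sup>+x. ennreal (f x) \<partial>M)" by (rule nn_integral_mono_AE[OF pos(1)])
 then have p: "ennreal l \<le> (\<integral>\<^sup>+x. ennreal (f x) \<partial>M)" using pos(2) by (rule order_trans[rotated])
 have fin: "(\<integral>\<^sup>+x. ennreal (f x) \<partial>M) \<noteq> top"
  using f unfolding real_integrable_def by simp
 have "l \<le> enn2real (\<integral>\<^sup>+x. ennreal (f x) \<partial>M)"
 proof (cases "0 \<le> l")
  case True
  have "enn2real (ennreal l) \<le> enn2real (\<integral>\<^sup>+x. ennreal (f x) \<partial>M)"
   using p fin by (intro enn2real_mono) (auto simp: less_top)
  then show ?thesis using True by simp
 qed (use enn2real_nonneg order_trans in \<open>smt (verit)\<close>)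
 then show ?thesis using n real_lebesgue_integral_def[OF f] by linarith
qed

lemma AE_hausdorff2_neq: "AE x in hausdorff2. x \<noteq> (c :: 'a::metric_space)"
 by (rule AE_I'[of "{c}"]) (auto simp: null_sets_def)

text \<open>The kernel times \<open>w(p1) (w(x) + w(y))\<close>, without the factor \<open>w(p)\<close>: the size of the loss terms.\<close>

definition loss_weight :: "real \<Rightarrow> real \<Rightarrow> real \<Rightarrow> real^3 \<Rightarrow> real^3 \<Rightarrow> real^3 \<Rightarrow> real" where
 "loss_weight a \<beta> s p p1 x =
   rpow (norm p1) (2*\<beta>) * rpow (norm x) (2*\<beta>) * rpow (norm (p + p1 - x)) (2*\<beta>) *
   (wt s p1 * (wt s x + wt s (p + p1 - x))) * inverse (norm (gradient (resonance a p p1) x))"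

lemma loss_weight_nonneg [simp]: "0 \<le> loss_weight a \<beta> s p p1 x"
 by (auto simp: loss_weight_def intro!: mult_nonneg_nonneg add_nonneg_nonneg)

lemma dyadic_level:
 fixes t :: real
 assumes "0 \<le> t"
 obtains k :: nat where "t \<le> 2 ^ k" "k = 0 \<or> 2 ^ k < 2 * t"
proof -
 define k where "k = (LEAST k. t \<le> 2 ^ k)"
 have "\<exists>k. t \<le> 2 ^ k" using real_arch_pow[of 2 t] by (auto intro: less_imp_le)
 then have 1: "t \<le> 2 ^ k" unfolding k_def by (rule LeastI_ex)
 have 2: "k = 0 \<or> 2 ^ k < 2 * t"
 proof (cases k)
  case (Suc j)
  then have "\<not> t \<le> 2 ^ j" using not_less_Least[of j "\<lambda>k. t \<le> 2 ^ k"] unfolding k_def by simp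
  then show ?thesis using Suc by simp
 qed simp
 show ?thesis by (rule that[OF 1 2])
qed

text \<open>By conservation of energy only the smaller of \<open>|x|\<close> and \<open>|y|\<close> is free; the larger one is at most of order \<open>|p1|\<close>.\<close>

lemma kernel_weight_upper:
 fixes p p1 x :: "real^3"
 assumes a: "1 \<le> a" and \<beta>: "0 \<le> \<beta>" and s: "0 \<le> s" and p: "norm p \<le> norm p1" "1 \<le> norm p1"
  and x: "x \<in> resonant_set a p p1"
  and k: "min (norm x) (norm (p + p1 - x)) \<le> 2 ^ k" "k = 0 \<or> 2 ^ k < 2 * min (norm x) (norm (p + p1 - x))"
 shows "rpow (norm p1) (2*\<beta>) * rpow (norm x) (2*\<beta>) * rpow (norm (p + p1 - x)) (2*\<beta>) *
   (wt s p1 * (wt s x + wt s (p + p1 - x))) \<le> (2 powr (2*\<beta>) * 2 * 2 powr s) * norm p1 powr (4*\<beta> - s) * 2 powr (k * (2*\<beta> - s))"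
proof -
 define y where "y = p + p1 - x"
 define lo hi where "lo = min (norm x) (norm y)" and "hi = max (norm x) (norm y)"
 have Q0: "0 < norm p1" using p by linarith
 have hi: "hi \<le> 2 * norm p1"
  using resonant_norm_le[OF a x p(1) order_refl] by (simp add: hi_def y_def)
 have lk: "lo \<le> 2 ^ k" using k by (simp add: lo_def y_def)
 have pw: "(2::real) ^ k = 2 powr k" by (simp add: powr_realpow)
 have "rpow (norm x) (2*\<beta>) * rpow (norm y) (2*\<beta>) = rpow lo (2*\<beta>) * rpow hi (2*\<beta>)"
  by (simp add: lo_def hi_def min_def max_def)
 also have "\<dots> \<le> rpow (2 ^ k) (2*\<beta>) * rpow (2 * norm p1) (2*\<beta>)"
  using lk hi \<beta> by (intro mult_mono rpow_mono) (auto simp: lo_def hi_def le_max_iff_disj)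
 also have "\<dots> = 2 powr (k * (2*\<beta>)) * (2 powr (2*\<beta>) * norm p1 powr (2*\<beta>))"
  using Q0 by (simp add: rpow_pos pw powr_powr powr_mult)
 finally have A: "rpow (norm x) (2*\<beta>) * rpow (norm y) (2*\<beta>) \<le> 2 powr (k * (2*\<beta>)) * (2 powr (2*\<beta>) * norm p1 powr (2*\<beta>))" .
 have wlo: "wt s z \<le> 2 powr s * 2 powr (- (k * s))" if "lo \<le> norm z" for z :: "real^3"
 proof (cases "k = 0")
  case True
  have "wt s z \<le> 1" by (rule wt_le_1[OF s])
  also have "\<dots> \<le> 2 powr s * 2 powr (- (k * s))" using True s powr_mono[of 0 s 2] by simp
  finally show ?thesis .
 next
  case False
  then have "2 ^ k < 2 * lo" using k by (simp add: lo_def y_def)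
  then have "2 powr k / 2 \<le> japanese z" using that japanese_ge(2)[of z] pw by linarith
  then have "wt s z \<le> (2 powr k / 2) powr (-s)" using s by (intro wt_le) auto
  also have "\<dots> = 2 powr s * 2 powr (- (k * s))"
   by (simp add: powr_divide powr_powr powr_minus_divide)
  finally show ?thesis .
 qed
 have W: "wt s x + wt s y \<le> 2 * (2 powr s * 2 powr (- (k * s)))"
  using wlo[of x] wlo[of y] by (simp add: lo_def)
 have W1: "wt s p1 \<le> norm p1 powr (-s)" using s Q0 japanese_ge(2) by (intro wt_le) auto
 have "rpow (norm p1) (2*\<beta>) * (rpow (norm x) (2*\<beta>) * rpow (norm y) (2*\<beta>)) * (wt s p1 * (wt s x + wt s y))
  \<le> norm p1 powr (2*\<beta>) * (2 powr (k * (2*\<beta>)) * (2 powr (2*\<beta>) * norm p1 powr (2*\<beta>))) *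
    (norm p1 powr (-s) * (2 * (2 powr s * 2 powr (- (k * s)))))"
  by (rule mult_mono[OF mult_mono[OF _ A] mult_mono[OF W1 W]])
    (use Q0 in \<open>auto simp: rpow_pos intro!: add_nonneg_nonneg mult_nonneg_nonneg\<close>)
 also have "\<dots> = (2 powr (2*\<beta>) * 2 * 2 powr s) * (norm p1 powr (2*\<beta>) * norm p1 powr (2*\<beta>) * norm p1 powr (-s)) * (2 powr (k * (2*\<beta>)) * 2 powr (- (k * s)))"
  by (simp add: ac_simps)
 also have "norm p1 powr (2*\<beta>) * norm p1 powr (2*\<beta>) * norm p1 powr (-s) = norm p1 powr (4*\<beta> - s)"
  by (simp add: powr_add[symmetric])
 also have "2 powr (k * (2*\<beta>)) * 2 powr (- (k * s)) = 2 powr (k * (2*\<beta> - s))"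
  by (simp add: powr_add[symmetric] algebra_simps)
 finally show ?thesis by (simp add: y_def mult.assoc)
qed

text \<open>Only the dyadic levels \<open>2^k\<close> that the smaller of \<open>|x|\<close> and \<open>|y|\<close> attains enter the sum.  The restriction is
kept because for given \<open>k\<close> it confines \<open>p1\<close> to a set of small volume.\<close>

lemma loss_weight_integral_upper:
 fixes a \<beta> s :: real
 assumes a: "1 \<le> a" and \<beta>: "0 \<le> \<beta>" and s: "0 \<le> s"
 obtains L C where "2 \<le> L" "0 < C" "\<And>(p::real^3) p1. \<lbrakk>L * norm p \<le> norm p1; 1 \<le> norm p1\<rbrakk> \<Longrightarrow>
  (\<integral>\<^sup>+x\<in>resonant_set a p p1. ennreal (loss_weight a \<beta> s p p1 x) \<partial>hausdorff2) \<le>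
   ennreal (C * norm p1 powr (4*\<beta> - s + 1 - a) *
    (\<Sum>k\<in>{k::nat. 2 ^ k \<le> 4 * norm p1 \<and> (\<exists>x\<in>resonant_set a p p1. min (norm x) (norm (p + p1 - x)) \<le> 2 ^ k)}. 2 powr (k * (2*\<beta> + 2 - s))))"
proof (rule resonant_far_upper[OF a])
 fix L C :: real
 assume L: "2 \<le> L" and C: "0 \<le> C" and U: "\<And>(p::real^3) p1 r. \<lbrakk>L * norm p \<le> norm p1; p1 \<noteq> 0; 0 < r\<rbrakk> \<Longrightarrow>
  \<exists>G\<ge>0. (\<forall>x\<in>resonant_set a p p1. x \<noteq> 0 \<longrightarrow> x \<noteq> p + p1 \<longrightarrow> min (norm x) (norm (p + p1 - x)) \<le> r \<longrightarrow>
    inverse (norm (gradient (resonance a p p1) x)) \<le> G) \<and>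
   emeasure hausdorff2 {x \<in> resonant_set a p p1. min (norm x) (norm (p + p1 - x)) \<le> r} * ennreal G
    \<le> ennreal (C * r\<^sup>2 * norm p1 powr (1 - a))"
 define c where "c = 2 powr (2*\<beta>) * 2 * 2 powr s"
 have c0: "0 < c" by (simp add: c_def)
 show thesis
 proof (rule that[OF L])
  show "0 < c * C + 1" using c0 C by (simp add: add_nonneg_pos)
  fix p p1 :: "real^3"
  assume A: "L * norm p \<le> norm p1" "1 \<le> norm p1"
  have p10: "p1 \<noteq> 0" using A by auto
  have "1 * norm p \<le> L * norm p" using L by (intro mult_right_mono) auto
  then have pp1: "norm p \<le> norm p1" using A by linarith
  define lo where "lo x = min (norm x) (norm (p + p1 - x))" for x
  define Ks where "Ks = {k::nat. 2 ^ k \<le> 4 * norm p1 \<and> (\<exists>x\<in>resonant_set a p p1. lo x \<le> 2 ^ k)}"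
  have finK: "finite Ks"
  proof -
   obtain N where N: "4 * norm p1 < 2 ^ N" using real_arch_pow[of 2 "4 * norm p1"] by auto
   have "Ks \<subseteq> {..N}"
   proof
    fix k assume "k \<in> Ks"
    then have "2 ^ k \<le> 4 * norm p1" by (simp add: Ks_def)
    then have "(2::real) ^ k < 2 ^ N" using N by linarith
    then show "k \<in> {..N}" by simp
   qed
   then show ?thesis by (rule finite_subset) simp
  qed
  have "\<forall>k::nat. \<exists>G\<ge>0. (\<forall>x\<in>resonant_set a p p1. x \<noteq> 0 \<longrightarrow> x \<noteq> p + p1 \<longrightarrow> lo x \<le> 2 ^ k \<longrightarrow>
    inverse (norm (gradient (resonance a p p1) x)) \<le> G) \<and>
   emeasure hausdorff2 {x \<in> resonant_set a p p1. lo x \<le> 2 ^ k} * ennreal G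
    \<le> ennreal (C * (2 ^ k)\<^sup>2 * norm p1 powr (1 - a))"
   unfolding lo_def using U[OF A(1) p10] by simp
  then obtain G where G: "\<And>k::nat. 0 \<le> G k"
   "\<And>(k::nat) x. x \<in> resonant_set a p p1 \<Longrightarrow> x \<noteq> 0 \<Longrightarrow> x \<noteq> p + p1 \<Longrightarrow> lo x \<le> 2 ^ k \<Longrightarrow>
    inverse (norm (gradient (resonance a p p1) x)) \<le> G k"
   "\<And>k::nat. emeasure hausdorff2 {x \<in> resonant_set a p p1. lo x \<le> 2 ^ k} * ennreal (G k)
    \<le> ennreal (C * (2 ^ k)\<^sup>2 * norm p1 powr (1 - a))"
   using choice[of "\<lambda>k G. G\<ge>0 \<and> (\<forall>x\<in>resonant_set a p p1. x \<noteq> 0 \<longrightarrow> x \<noteq> p + p1 \<longrightarrow> lo x \<le> 2 ^ k \<longrightarrow>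
    inverse (norm (gradient (resonance a p p1) x)) \<le> G) \<and>
   emeasure hausdorff2 {x \<in> resonant_set a p p1. lo x \<le> 2 ^ k} * ennreal G
    \<le> ennreal (C * (2 ^ k)\<^sup>2 * norm p1 powr (1 - a))"] by blast
  define m where "m k = c * norm p1 powr (4*\<beta> - s) * 2 powr (k * (2*\<beta> - s))" for k :: nat
  have m0: "0 \<le> m k" for k using c0 by (simp add: m_def)
  define I where "I k x = ennreal (m k * G k) * indicator {x \<in> resonant_set a p p1. lo x \<le> 2 ^ k} x" for k :: nat and x :: "real^3"
  have SB: "{x \<in> resonant_set a p p1. lo x \<le> 2 ^ k} \<in> sets borel" for k :: nat
   unfolding lo_def by (rule resonant_min_borel[OF a])
  have "AE x in hausdorff2. x \<noteq> (0::real^3) \<and> x \<noteq> p + p1"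
   using AE_hausdorff2_neq[of "0::real^3"] AE_hausdorff2_neq[of "p + p1"] by eventually_elim simp
  then have "AE x in hausdorff2. ennreal (loss_weight a \<beta> s p p1 x) * indicator (resonant_set a p p1) x \<le> (\<Sum>k\<in>Ks. I k x)"
  proof eventually_elim
   case (elim x)
   show ?case
   proof (cases "x \<in> resonant_set a p p1")
    case True
    have l0: "0 \<le> lo x" by (simp add: lo_def)
    from dyadic_level[OF l0] obtain k :: nat where k: "lo x \<le> 2 ^ k" "k = 0 \<or> 2 ^ k < 2 * lo x" by blast
    have "lo x \<le> 2 * norm p1"
     using resonant_norm_le(1)[OF a True pp1 order_refl] by (simp add: lo_def min_le_iff_disj)
    then have "2 ^ k \<le> 4 * norm p1" using k(2) A(2) by auto
    then have kK: "k \<in> Ks" using True k(1) unfolding Ks_def by blast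
    have "loss_weight a \<beta> s p p1 x \<le> m k * G k"
     unfolding loss_weight_def m_def c_def
     by (rule mult_mono[OF kernel_weight_upper[OF a \<beta> s pp1 A(2) True k[unfolded lo_def]] G(2)[OF True _ _ k(1)]])
       (use elim in \<open>auto intro!: mult_nonneg_nonneg add_nonneg_nonneg\<close>)
    then have "ennreal (loss_weight a \<beta> s p p1 x) * indicator (resonant_set a p p1) x \<le> I k x"
     using True k(1) by (simp add: I_def ennreal_leI)
    also have "\<dots> \<le> (\<Sum>k\<in>Ks. I k x)" by (rule member_le_sum[OF kK _ finK]) simp
    finally show ?thesis .
   qed simp
  qed
  then have "(\<integral>\<^sup>+x\<in>resonant_set a p p1. ennreal (loss_weight a \<beta> s p p1 x) \<partial>hausdorff2) \<le> (\<integral>\<^sup>+x. (\<Sum>k\<in>Ks. I k x) \<partial>hausdorff2)"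
   by (rule nn_integral_mono_AE)
  also have "\<dots> = (\<Sum>k\<in>Ks. \<integral>\<^sup>+x. I k x \<partial>hausdorff2)"
   unfolding I_def using SB by (intro nn_integral_sum) simp
  also have "\<dots> \<le> (\<Sum>k\<in>Ks. ennreal (c * C * norm p1 powr (4*\<beta> - s + 1 - a) * 2 powr (k * (2*\<beta> + 2 - s))))"
  proof (rule sum_mono)
   fix k assume "k \<in> Ks"
   have "(\<integral>\<^sup>+x. I k x \<partial>hausdorff2) = ennreal (m k * G k) * emeasure hausdorff2 {x \<in> resonant_set a p p1. lo x \<le> 2 ^ k}"
    unfolding I_def using SB by (intro nn_integral_cmult_indicator) simp
   also have "\<dots> = ennreal (m k) * (emeasure hausdorff2 {x \<in> resonant_set a p p1. lo x \<le> 2 ^ k} * ennreal (G k))"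
    using m0 G(1) by (simp add: ennreal_mult ac_simps)
   also have "\<dots> \<le> ennreal (m k) * ennreal (C * (2 ^ k)\<^sup>2 * norm p1 powr (1 - a))"
    by (rule mult_left_mono[OF G(3)]) simp
   also have "\<dots> = ennreal (m k * (C * (2 ^ k)\<^sup>2 * norm p1 powr (1 - a)))"
    using m0 C by (subst ennreal_mult) auto
   also have "m k * (C * (2 ^ k)\<^sup>2 * norm p1 powr (1 - a)) = c * C * (norm p1 powr (4*\<beta> - s) * norm p1 powr (1 - a)) * (2 powr (k * (2*\<beta> - s)) * (2 ^ k)\<^sup>2)"
    by (simp add: m_def)
   also have "norm p1 powr (4*\<beta> - s) * norm p1 powr (1 - a) = norm p1 powr (4*\<beta> - s + 1 - a)"
    by (simp add: powr_add[symmetric] algebra_simps)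
   also have "((2::real) ^ k)\<^sup>2 = 2 powr (k * 2)"
   proof -
    have "((2::real) ^ k)\<^sup>2 = 2 ^ (k * 2)" by (simp add: power_mult)
    also have "\<dots> = 2 powr real (k * 2)" by (rule powr_realpow[symmetric]) simp
    finally show ?thesis by simp
   qed
   also have "2 powr (k * (2*\<beta> - s)) * 2 powr (k * 2) = 2 powr (k * (2*\<beta> + 2 - s))"
    by (simp add: powr_add[symmetric] algebra_simps)
   finally show "(\<integral>\<^sup>+x. I k x \<partial>hausdorff2) \<le> ennreal (c * C * norm p1 powr (4*\<beta> - s + 1 - a) * 2 powr (k * (2*\<beta> + 2 - s)))" .
  qed
  also have "\<dots> = ennreal (\<Sum>k\<in>Ks. c * C * norm p1 powr (4*\<beta> - s + 1 - a) * 2 powr (k * (2*\<beta> + 2 - s)))"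
   using c0 C by (intro sum_ennreal) auto
  also have "\<dots> \<le> ennreal ((c * C + 1) * norm p1 powr (4*\<beta> - s + 1 - a) * (\<Sum>k\<in>Ks. 2 powr (k * (2*\<beta> + 2 - s))))"
   unfolding sum_distrib_left[symmetric] by (intro ennreal_leI mult_right_mono sum_nonneg) auto
  finally show "(\<integral>\<^sup>+x\<in>resonant_set a p p1. ennreal (loss_weight a \<beta> s p p1 x) \<partial>hausdorff2) \<le>
   ennreal ((c * C + 1) * norm p1 powr (4*\<beta> - s + 1 - a) *
    (\<Sum>k\<in>{k::nat. 2 ^ k \<le> 4 * norm p1 \<and> (\<exists>x\<in>resonant_set a p p1. min (norm x) (norm (p + p1 - x)) \<le> 2 ^ k)}. 2 powr (k * (2*\<beta> + 2 - s))))"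
   unfolding Ks_def lo_def .
 qed
qed

section \<open>Slowly decaying data: divergence of the collision integral\<close>

lemma loss_weight_shell_lower:
 fixes a \<beta> s :: real
 assumes a: "1 \<le> a" and \<beta>: "0 \<le> \<beta>" and s: "0 \<le> s"
 obtains L c where "5 \<le> L" "0 < c" "\<And>p p1 r T. \<lbrakk>p \<bullet> p1 \<le> 0; 1 \<le> norm p; L * norm p \<le> r; L * r \<le> norm p1; T \<in> sets borel; T \<subseteq> {r..2*r}\<rbrakk> \<Longrightarrow>
  \<exists>m\<ge>0. (\<forall>x\<in>resonant_set a p p1. norm x \<in> T \<longrightarrow> m \<le> loss_weight a \<beta> s p p1 x) \<and>
   ennreal (c * norm p1 powr (4*\<beta> - s + 1 - a) * r powr (2*\<beta> - s + 1)) * emeasure lborel T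
    \<le> ennreal m * emeasure hausdorff2 {x \<in> resonant_set a p p1. norm x \<in> T}"
proof (rule resonant_shell_lower[OF a])
 fix L0 c0 :: real
 assume L0: "1 \<le> L0" and c0: "0 < c0" and LL: "\<And>p p1 r T. \<lbrakk>p \<bullet> p1 \<le> 0; p \<noteq> 0; L0 * norm p \<le> r; L0 * r \<le> norm p1; T \<in> sets borel; T \<subseteq> {r..2*r}\<rbrakk> \<Longrightarrow>
  \<exists>G>0. (\<forall>x\<in>resonant_set a p p1. norm x \<in> T \<longrightarrow> x \<noteq> 0 \<and> x \<noteq> p + p1 \<and>
    0 < norm (gradient (resonance a p p1) x) \<and> norm (gradient (resonance a p p1) x) \<le> G) \<and>
   ennreal (c0 * r * norm p1 powr (1 - a) * G) * emeasure lborel T \<le> emeasure hausdorff2 {x \<in> resonant_set a p p1. norm x \<in> T}"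
 define L where "L = max 5 L0"
 define c1 where "c1 = (1/2) powr (2*\<beta>) * (2 powr (-s) * 4 powr (-s))"
 have c1: "0 < c1" by (simp add: c1_def)
 show thesis
 proof (rule that)
  show "5 \<le> L" by (simp add: L_def)
  show "0 < c1 * c0" using c1 c0 by simp
  fix p p1 :: "real^3" and r :: real and T :: "real set"
  assume A: "p \<bullet> p1 \<le> 0" "1 \<le> norm p" "L * norm p \<le> r" "L * r \<le> norm p1" "T \<in> sets borel" "T \<subseteq> {r..2*r}"
  have "5 * norm p \<le> L * norm p" "L0 * norm p \<le> L * norm p" by (intro mult_right_mono; simp add: L_def)+
  then have r: "5 * norm p \<le> r" "L0 * norm p \<le> r" using A(3) by linarith+
  have r1: "1 \<le> r" using r A(2) by linarith
  have "5 * r \<le> L * r" "L0 * r \<le> L * r" using r1 by (intro mult_right_mono; simp add: L_def)+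
  then have Q: "5 * r \<le> norm p1" "L0 * r \<le> norm p1" using A(4) by linarith+
  have p0: "p \<noteq> 0" using A(2) by auto
  define q where "q = norm p1"
  have q1: "1 \<le> q" using Q r1 by (simp add: q_def)
  from LL[OF A(1) p0 r(2) Q(2) A(5,6)] obtain G where G: "0 < G"
   "\<And>x. x \<in> resonant_set a p p1 \<Longrightarrow> norm x \<in> T \<Longrightarrow> 0 < norm (gradient (resonance a p p1) x) \<and> norm (gradient (resonance a p p1) x) \<le> G"
   "ennreal (c0 * r * q powr (1 - a) * G) * emeasure lborel T \<le> emeasure hausdorff2 {x \<in> resonant_set a p p1. norm x \<in> T}"
   unfolding q_def by blast
  define m where "m = c1 * q powr (4*\<beta> - s) * r powr (2*\<beta> - s) * (1 / G)"
  have m0: "0 \<le> m" using c1 G(1) by (simp add: m_def)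
  have low: "m \<le> loss_weight a \<beta> s p p1 x" if x: "x \<in> resonant_set a p p1" "norm x \<in> T" for x
  proof -
   have nx: "r \<le> norm x" "norm x \<le> 2 * r" using x(2) A(6) by auto
   have "norm p1 \<le> norm (p + p1 - x) + norm x + norm p"
    using norm_triangle_ineq4[of "(p + p1 - x) + x" p] norm_triangle_ineq[of "p + p1 - x" x] by simp
   then have ny: "q / 2 \<le> norm (p + p1 - x)" using nx r Q r1 norm_ge_zero[of p] unfolding q_def by linarith
   have 1: "q powr (2*\<beta>) \<le> rpow (norm p1) (2*\<beta>)" using q1 unfolding q_def by (subst rpow_pos) linarith+
   have 2: "r powr (2*\<beta>) \<le> rpow (norm x) (2*\<beta>)" using rpow_mono[of r "norm x" "2*\<beta>"] r1 nx \<beta> by (simp add: rpow_pos)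
   have 3: "(1/2) powr (2*\<beta>) * q powr (2*\<beta>) \<le> rpow (norm (p + p1 - x)) (2*\<beta>)"
   proof -
    have "(1/2) powr (2*\<beta>) * q powr (2*\<beta>) = rpow (q / 2) (2*\<beta>)" using q1 by (simp add: rpow_pos powr_mult[symmetric])
    also have "\<dots> \<le> rpow (norm (p + p1 - x)) (2*\<beta>)" using ny q1 \<beta> by (intro rpow_mono) auto
    finally show ?thesis .
   qed
   have 4: "2 powr (-s) * q powr (-s) \<le> wt s p1"
    using wt_ge[OF s japanese_le[of p1 q]] q1 by (simp add: q_def powr_mult)
   have "japanese x \<le> 2 * (2 * r)" using nx r1 by (intro japanese_le) auto
   then have "(4 * r) powr (-s) \<le> wt s x" using s by (intro wt_ge) auto
   then have 5: "4 powr (-s) * r powr (-s) \<le> wt s x + wt s (p + p1 - x)" using wt_pos(2)[of s "p + p1 - x"] unfolding powr_mult by linarith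
   have 6: "1 / G \<le> inverse (norm (gradient (resonance a p p1) x))"
    using G(2)[OF x] by (simp add: inverse_eq_divide frac_le)
   have "m = q powr (2*\<beta>) * r powr (2*\<beta>) * ((1/2) powr (2*\<beta>) * q powr (2*\<beta>)) * ((2 powr (-s) * q powr (-s)) * (4 powr (-s) * r powr (-s))) * (1 / G)"
   proof -
    have "q powr (4*\<beta> - s) = q powr (2*\<beta>) * q powr (2*\<beta>) * q powr (-s)" by (simp add: powr_add[symmetric])
    moreover have "r powr (2*\<beta> - s) = r powr (2*\<beta>) * r powr (-s)" by (simp add: powr_add[symmetric])
    ultimately show ?thesis by (simp only: m_def c1_def ac_simps)
   qed
   also have "\<dots> \<le> loss_weight a \<beta> s p p1 x"
    unfolding loss_weight_def
    by (rule mult_mono[OF mult_mono[OF mult_mono[OF mult_mono[OF 1 2] 3] mult_mono[OF 4 5]] 6])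
      (use G(1) in \<open>auto intro!: mult_nonneg_nonneg add_nonneg_nonneg\<close>)
   finally show ?thesis .
  qed
  show "\<exists>m\<ge>0. (\<forall>x\<in>resonant_set a p p1. norm x \<in> T \<longrightarrow> m \<le> loss_weight a \<beta> s p p1 x) \<and>
   ennreal (c1 * c0 * norm p1 powr (4*\<beta> - s + 1 - a) * r powr (2*\<beta> - s + 1)) * emeasure lborel T
    \<le> ennreal m * emeasure hausdorff2 {x \<in> resonant_set a p p1. norm x \<in> T}"
  proof (intro exI conjI ballI impI)
   show "0 \<le> m" by (rule m0)
   have "ennreal m * (ennreal (c0 * r * q powr (1 - a) * G) * emeasure lborel T) \<le> ennreal m * emeasure hausdorff2 {x \<in> resonant_set a p p1. norm x \<in> T}"
    by (rule mult_left_mono[OF G(3)]) simp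
   moreover have "ennreal m * (ennreal (c0 * r * q powr (1 - a) * G) * emeasure lborel T) = ennreal (m * (c0 * r * q powr (1 - a) * G)) * emeasure lborel T"
    using m0 c0 r1 G(1) by (subst ennreal_mult) (auto simp: mult.assoc)
   moreover have "m * (c0 * r * q powr (1 - a) * G) = c1 * c0 * norm p1 powr (4*\<beta> - s + 1 - a) * r powr (2*\<beta> - s + 1)"
   proof -
    have "q powr (4*\<beta> - s + 1 - a) = q powr (4*\<beta> - s) * q powr (1 - a)" by (simp add: powr_add[symmetric] algebra_simps)
    moreover have "r powr (2*\<beta> - s + 1) = r powr (2*\<beta> - s) * r" using r1 by (simp add: powr_add)
    ultimately show ?thesis using G(1) by (simp add: m_def q_def[symmetric])
   qed
   ultimately show "ennreal (c1 * c0 * norm p1 powr (4*\<beta> - s + 1 - a) * r powr (2*\<beta> - s + 1)) * emeasure lborel T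
    \<le> ennreal m * emeasure hausdorff2 {x \<in> resonant_set a p p1. norm x \<in> T}" by simp
  qed (use low in blast)
 qed
qed

text \<open>In the variable \<open>\<rho>^a\<close> the sine oscillates with a fixed period, and its mean square is computed by
integrating a derivative.\<close>

lemma oscillating_shell_measure:
 fixes a r :: real
 assumes a: "1 \<le> a" and r: "1 \<le> r"
 shows "ennreal (r / (8 * a)) \<le> emeasure lborel {\<rho> \<in> {r..<2*r}. 1 / (8 * a) \<le> (sin (2 * \<rho> powr a))\<^sup>2}"
proof -
 define T where "T = {\<rho> \<in> {r..<2*r}. 1 / (8 * a) \<le> (sin (2 * \<rho> powr a))\<^sup>2}"
 have TB: "T \<in> sets borel" unfolding T_def by measurable
 define F where "F \<rho> = (\<rho> powr a / 2 - sin (4 * \<rho> powr a) / 8) / a" for \<rho> :: real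
 define h where "h \<rho> = (sin (2 * \<rho> powr a))\<^sup>2 * \<rho> powr (a - 1)" for \<rho> :: real
 have DF: "DERIV F \<rho> :> h \<rho>" if "0 < \<rho>" for \<rho>
 proof -
  have c: "cos (4 * \<rho> powr a) = 1 - 2 * (sin (2 * \<rho> powr a))\<^sup>2"
   using cos_double_sin[of "2 * \<rho> powr a"] by simp
  have "DERIV F \<rho> :> ((a * \<rho> powr (a - 1)) / 2 - cos (4 * \<rho> powr a) * (4 * (a * \<rho> powr (a - 1))) / 8) / a"
   unfolding F_def using that a
   by (auto intro!: derivative_eq_intros has_real_derivative_powr simp: field_simps)
  also have "((a * \<rho> powr (a - 1)) / 2 - cos (4 * \<rho> powr a) * (4 * (a * \<rho> powr (a - 1))) / 8) / a = h \<rho>"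
   unfolding c h_def using a by (simp add: field_simps)
  finally show ?thesis .
 qed
 have "(\<integral>\<^sup>+\<rho>. ennreal (h \<rho>) * indicator {r..2*r} \<rho> \<partial>lborel) = ennreal (F (2*r) - F r)"
  using r DF by (intro nn_integral_FTC_Icc) (auto simp: h_def)
 moreover have "(\<integral>\<^sup>+\<rho>. ennreal (h \<rho>) * indicator {r..2*r} \<rho> \<partial>lborel) \<le>
   (\<integral>\<^sup>+\<rho>. ennreal ((2*r) powr (a - 1)) * (indicator T \<rho> + ennreal (1/(8*a)) * indicator {r..2*r} \<rho>) \<partial>lborel)"
 proof (rule nn_integral_mono_AE)
  have "AE \<rho> in lborel. \<rho> \<noteq> 2 * r" by (rule AE_lborel_singleton)
  then show "AE \<rho> in lborel. ennreal (h \<rho>) * indicator {r..2*r} \<rho> \<le> ennreal ((2*r) powr (a - 1)) * (indicator T \<rho> + ennreal (1/(8*a)) * indicator {r..2*r} \<rho>)"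
  proof eventually_elim
   case (elim \<rho>)
   show ?case
   proof (cases "\<rho> \<in> {r..2*r}")
    case True
    define j :: real where "j = (if \<rho> \<in> T then 1 else 0)"
    have pw: "\<rho> powr (a - 1) \<le> (2*r) powr (a - 1)" using True r a by (intro powr_mono2) auto
    have sn: "(sin (2 * \<rho> powr a))\<^sup>2 \<le> j + 1/(8*a)"
    proof (cases "\<rho> \<in> T")
     case True
     have "(sin (2 * \<rho> powr a))\<^sup>2 \<le> 1" by (simp add: abs_square_le_1)
     also have "\<dots> \<le> 1 + 1/(8*a)" using a by simp
     finally show ?thesis using True by (simp add: j_def)
    next
     case False
     then show ?thesis using True elim unfolding T_def j_def by auto
    qed
    have "h \<rho> \<le> (2*r) powr (a - 1) * (j + 1/(8*a))"
     using mult_mono[OF sn pw] True a by (simp add: h_def mult.commute j_def)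
    then have "ennreal (h \<rho>) * indicator {r..2*r} \<rho> \<le> ennreal ((2*r) powr (a - 1) * (j + 1/(8*a)))"
     using True by (simp add: ennreal_leI)
    also have "\<dots> = ennreal ((2*r) powr (a - 1)) * (ennreal j + ennreal (1/(8*a)))"
     using a by (subst ennreal_mult, simp, simp add: j_def, subst ennreal_plus) (auto simp: j_def)
    also have "ennreal j = indicator T \<rho>" by (simp add: j_def)
    finally show ?thesis using True by simp
   qed simp
  qed
 qed
 moreover have "(\<integral>\<^sup>+\<rho>. ennreal ((2*r) powr (a - 1)) * (indicator T \<rho> + ennreal (1/(8*a)) * indicator {r..2*r} \<rho>) \<partial>lborel)
   = ennreal ((2*r) powr (a - 1)) * (emeasure lborel T + ennreal (1/(8*a) * r))"
 proof -
  have "(\<integral>\<^sup>+\<rho>. ennreal ((2*r) powr (a - 1)) * (indicator T \<rho> + ennreal (1/(8*a)) * indicator {r..2*r} \<rho>) \<partial>lborel)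
   = ennreal ((2*r) powr (a - 1)) * (emeasure lborel T + ennreal (1/(8*a)) * emeasure lborel {r..2*r})"
   using TB by (simp add: nn_integral_cmult nn_integral_add)
  also have "ennreal (1/(8*a)) * emeasure lborel {r..2*r} = ennreal (1/(8*a) * r)"
   using r a by (simp add: ennreal_mult[symmetric])
  finally show ?thesis .
 qed
 ultimately have main: "ennreal (F (2*r) - F r) \<le> ennreal ((2*r) powr (a - 1)) * (emeasure lborel T + ennreal (1/(8*a) * r))"
  by simp
 have Tfin: "emeasure lborel T \<noteq> top"
 proof -
  have "emeasure lborel T \<le> emeasure lborel {r..2*r}" by (intro emeasure_mono) (auto simp: T_def)
  then show ?thesis using r by (auto simp: top_unique)
 qed
 define t where "t = measure lborel T"
 have t: "emeasure lborel T = ennreal t" "0 \<le> t" unfolding t_def using Tfin by (auto simp: emeasure_eq_ennreal_measure)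
 have "ennreal (F (2*r) - F r) \<le> ennreal ((2*r) powr (a - 1) * (t + 1/(8*a) * r))"
  using main a r t(2) unfolding t(1) by (simp add: ennreal_mult ennreal_plus[symmetric] del: ennreal_plus)
 then have m2: "F (2*r) - F r \<le> (2*r) powr (a - 1) * (t + 1/(8*a) * r)"
  using t a r by (subst (asm) ennreal_le_iff) (auto intro!: mult_nonneg_nonneg add_nonneg_nonneg)
 have half: "r powr a \<le> (2*r) powr a / 2"
 proof -
  have "(2::real) powr 1 * r powr a \<le> 2 powr a * r powr a" using a by (intro mult_right_mono powr_mono) auto
  then show ?thesis by (simp add: powr_mult)
 qed
 have lin: "X / 4 - 1/4 \<le> (X / 2 - u / 8) - (Y / 2 - v / 8)" if "Y \<le> X / 2" "u \<le> 1" "-1 \<le> v" for X Y u v :: real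
  using that by linarith
 have Fl: "((2*r) powr a / 4 - 1/4) / a \<le> F (2*r) - F r"
 proof -
  have "F (2*r) - F r = (((2*r) powr a / 2 - sin (4 * (2*r) powr a) / 8) - (r powr a / 2 - sin (4 * r powr a) / 8)) / a"
   unfolding F_def by (rule diff_divide_distrib[symmetric])
  moreover have "((2*r) powr a / 4 - 1/4) / a \<le> (((2*r) powr a / 2 - sin (4 * (2*r) powr a) / 8) - (r powr a / 2 - sin (4 * r powr a) / 8)) / a"
   by (rule divide_right_mono[OF lin[OF half]]) (use a in auto)
  ultimately show ?thesis by simp
 qed
 have pa: "(2*r) powr a = (2*r) powr (a - 1) * (2 * r)" using powr_add[of "2*r" "a - 1" 1] r by simp
 have p1: "1 \<le> (2*r) powr (a - 1)" using r a by (intro ge_one_powr_ge_zero) auto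
 have "1 * 1 \<le> (2*r) powr (a - 1) * r" using r p1 by (intro mult_mono) auto
 then have "(2*r) powr (a - 1) * r / 4 \<le> (2*r) powr a / 4 - 1/4" unfolding pa by (simp add: mult.commute)
 then have "((2*r) powr (a - 1) * r / 4) / a \<le> ((2*r) powr a / 4 - 1/4) / a" using a by (intro divide_right_mono) auto
 then have "(2*r) powr (a - 1) * (r / (4 * a)) \<le> F (2*r) - F r" using Fl by simp
 then have "(2*r) powr (a - 1) * (r / (4 * a)) \<le> (2*r) powr (a - 1) * (t + 1/(8*a) * r)" using m2 by linarith
 moreover have pp: "0 < (2*r) powr (a - 1)" using p1 by linarith
 ultimately have "r / (4 * a) \<le> t + 1/(8*a) * r" unfolding mult_le_cancel_left_pos[OF pp] by simp
 then have "r / (8 * a) \<le> t" using a by (simp add: field_simps)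
 then show ?thesis unfolding T_def[symmetric] t(1) by (rule ennreal_leI)
qed

lemma density_ge_loss_weight:
 assumes "\<kappa> * (wt s p1 * (wt s x + wt s (p + p1 - x))) \<le>
  g p1 * g x * g (p + p1 - x) + g p * g x * g (p + p1 - x) - g p * g p1 * g x - g p * g p1 * g (p + p1 - x)"
 shows "\<kappa> * loss_weight a \<beta> s p p1 x \<le> density a \<beta> g p p1 x"
proof -
 define K where "K = rpow (norm p1) (2*\<beta>) * rpow (norm x) (2*\<beta>) * rpow (norm (p + p1 - x)) (2*\<beta>) * inverse (norm (gradient (resonance a p p1) x))"
 have K: "0 \<le> K" by (simp add: K_def)
 have "\<kappa> * loss_weight a \<beta> s p p1 x = K * (\<kappa> * (wt s p1 * (wt s x + wt s (p + p1 - x))))"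
  by (simp add: loss_weight_def K_def)
 also have "\<dots> \<le> K * (g p1 * g x * g (p + p1 - x) + g p * g x * g (p + p1 - x) - g p * g p1 * g x - g p * g p1 * g (p + p1 - x))"
  using assms K by (rule mult_left_mono)
 also have "\<dots> = density a \<beta> g p p1 x"
  by (simp add: density_def integrand_def Let_def K_def divide_inverse)
 finally show ?thesis .
qed

lemma product_ge_neg:
 fixes G2 G3 W2 W3 \<epsilon> :: real
 assumes "0 \<le> W2" "0 \<le> W3" "0 \<le> \<epsilon>" "- (\<epsilon> * W2) \<le> G2" "G2 \<le> 2 * W2" "- (\<epsilon> * W3) \<le> G3" "G3 \<le> 2 * W3"
 shows "- (2 * \<epsilon> * (W2 * W3)) \<le> G2 * G3"
proof -
 consider "0 \<le> G2" "0 \<le> G3" | "G2 \<le> 0" "G3 \<le> 0" | "0 \<le> G2" "G3 \<le> 0" | "G2 \<le> 0" "0 \<le> G3" by linarith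
 then show ?thesis
 proof cases
  case 1
  have "0 \<le> 2 * \<epsilon> * (W2 * W3)" using assms by (intro mult_nonneg_nonneg) auto
  moreover have "0 \<le> G2 * G3" using 1 by simp
  ultimately show ?thesis by linarith
 next
  case 2
  have "0 \<le> 2 * \<epsilon> * (W2 * W3)" using assms by (intro mult_nonneg_nonneg) auto
  moreover have "0 \<le> G2 * G3" using 2 by (rule mult_nonpos_nonpos)
  ultimately show ?thesis by linarith
 next
  case 3
  have "G2 * (- G3) \<le> (2 * W2) * (\<epsilon> * W3)" using 3 assms by (intro mult_mono) auto
  then show ?thesis by (simp add: algebra_simps)
 next
  case 4
  have "(- G2) * G3 \<le> (\<epsilon> * W2) * (2 * W3)" using 4 assms by (intro mult_mono) auto
  then show ?thesis by (simp add: algebra_simps)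
 qed
qed

lemma small_factor_terms:
 fixes G G1 G2 G3 W1 W2 W3 \<epsilon> :: real
 assumes W: "0 \<le> W1" "0 \<le> W2" "0 \<le> W3" "W3 \<le> 1" and e: "0 \<le> \<epsilon>"
  and G: "\<bar>G\<bar> \<le> 2" "\<bar>G1\<bar> \<le> 2 * \<epsilon> * W1" "\<bar>G2\<bar> \<le> 2 * W2" "\<bar>G3\<bar> \<le> 2 * W3"
 shows "- (16 * \<epsilon> * (W1 * (W2 + W3))) \<le> G1 * G2 * G3 - G * G1 * G2 - G * G1 * G3"
proof -
 have "\<bar>G1 * G2 * G3\<bar> \<le> (2 * \<epsilon> * W1) * (2 * W2) * 2"
  unfolding abs_mult using assms by (intro mult_mono) auto
 moreover have "\<bar>G * G1 * G2\<bar> \<le> 2 * (2 * \<epsilon> * W1) * (2 * W2)"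
  unfolding abs_mult using assms by (intro mult_mono) auto
 moreover have "\<bar>G * G1 * G3\<bar> \<le> 2 * (2 * \<epsilon> * W1) * (2 * W3)"
  unfolding abs_mult using assms by (intro mult_mono) auto
 moreover have "0 \<le> \<epsilon> * (W1 * W3)" using assms by simp
 ultimately show ?thesis by (simp add: algebra_simps abs_le_iff)
qed

lemma dyadic_sum_compare:
 fixes e :: real and i c :: nat
 obtains C where "1 \<le> C" "\<And>K. i \<le> K \<Longrightarrow> (\<Sum>k\<le>K + c. 2 powr (k * e)) \<le> C * (\<Sum>k=i..K. 2 powr (k * e))"
proof
 define A where "A = (\<Sum>k<i. 2 powr (k * e)) / 2 powr (i * e)"
 define B where "B = (\<Sum>j\<in>{1..c}. 2 powr (j * e))"
 have AB: "0 \<le> A" "0 \<le> B" by (auto simp: A_def B_def sum_nonneg)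
 show "1 \<le> 1 + A + B" using AB by simp
 fix K assume K: "i \<le> K"
 define S where "S = (\<Sum>k=i..K. 2 powr (k * e))"
 have S1: "2 powr (i * e) \<le> S" unfolding S_def using K by (intro member_le_sum) auto
 have S2: "2 powr (K * e) \<le> S" unfolding S_def using K by (intro member_le_sum) auto
 have "{..K + c} = {..<i} \<union> ({i..K} \<union> {K+1..K+c})" using K by auto
 then have "(\<Sum>k\<le>K + c. 2 powr (k * e)) = (\<Sum>k\<in>{..<i} \<union> ({i..K} \<union> {K+1..K+c}). 2 powr (k * e))" by simp
 also have "\<dots> = (\<Sum>k<i. 2 powr (k * e)) + (\<Sum>k\<in>{i..K} \<union> {K+1..K+c}. 2 powr (k * e))"
  using K by (intro sum.union_disjoint) auto
 also have "(\<Sum>k\<in>{i..K} \<union> {K+1..K+c}. 2 powr (k * e)) = S + (\<Sum>k\<in>{K+1..K+c}. 2 powr (k * e))"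
  unfolding S_def by (intro sum.union_disjoint) auto
 also have "(\<Sum>k\<in>{K+1..K+c}. 2 powr (k * e)) = (\<Sum>j\<in>{1..c}. 2 powr ((K + j) * e))"
  by (rule sum.reindex_bij_witness[of _ "\<lambda>j. K + j" "\<lambda>k. k - K"]) auto
 also have "\<dots> = 2 powr (K * e) * B"
  unfolding B_def sum_distrib_left by (intro sum.cong refl) (simp add: powr_add[symmetric] algebra_simps)
 also have "(\<Sum>k<i. 2 powr (k * e)) = A * 2 powr (i * e)" by (simp add: A_def)
 finally have "(\<Sum>k\<le>K + c. 2 powr (k * e)) = A * 2 powr (i * e) + (S + 2 powr (K * e) * B)" .
 also have "\<dots> \<le> A * S + (S + S * B)"
  using S1 S2 AB by (intro add_mono mult_left_mono mult_right_mono) auto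
 also have "\<dots> = (1 + A + B) * S" by (simp add: algebra_simps)
 finally show "(\<Sum>k\<le>K + c. 2 powr (k * e)) \<le> (1 + A + B) * S" .
qed

lemma dyadic_floor:
 fixes t :: real
 assumes "2 ^ k0 \<le> t"
 obtains K where "k0 \<le> K" "2 ^ K \<le> t" "t < 2 ^ Suc K"
proof -
 obtain N where N: "t < 2 ^ N" using real_arch_pow[of 2 t] by auto
 define M where "M = (LEAST n. t < 2 ^ n)"
 have M: "t < 2 ^ M" unfolding M_def using N by (rule LeastI)
 have "k0 < M"
 proof (rule ccontr)
  assume "\<not> k0 < M"
  then have "(2::real) ^ M \<le> 2 ^ k0" by (intro power_increasing) auto
  then show False using M assms by linarith
 qed
 then obtain K where K: "M = Suc K" "k0 \<le> K" by (cases M) auto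
 then have "\<not> t < 2 ^ K" using not_less_Least[of K "\<lambda>n. t < 2 ^ n"] unfolding M_def by simp
 then show ?thesis using that[of K] K M by simp
qed

lemma sin_squared_near_multiple:
 assumes "\<bar>t - pi * real n\<bar> \<le> \<theta>" shows "(sin t)\<^sup>2 \<le> \<theta>\<^sup>2"
proof -
 define d where "d = t - pi * real n"
 have "sin t = sin (d + pi * real n)" by (simp add: d_def)
 also have "\<dots> = sin d * cos (pi * real n)" by (simp add: sin_add sin_npi2)
 finally have "(sin t)\<^sup>2 = (sin d)\<^sup>2 * (cos (pi * real n))\<^sup>2" by (simp add: power_mult_distrib)
 also have "(cos (pi * real n))\<^sup>2 = 1" using sin_cos_squared_add[of "pi * real n"] by (simp add: sin_npi2)
 also have "(sin d)\<^sup>2 * 1 \<le> \<theta>\<^sup>2"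
 proof -
  have "\<bar>sin d\<bar> \<le> \<bar>d\<bar>" by (rule abs_sin_x_le_abs_x)
  then have "\<bar>sin d\<bar> \<le> \<bar>\<theta>\<bar>" using assms unfolding d_def by linarith
  then show ?thesis by (simp add: abs_le_square_iff)
 qed
 finally show ?thesis .
qed

text \<open>Energy conservation shifts the phase of the fourth momentum by a quarter period.\<close>

lemma phase_shift:
 assumes e1: "\<bar>e1 - pi * real n\<bar> \<le> \<theta>" and e0: "\<bar>e0 - pi / 2\<bar> \<le> \<theta>" and \<theta>: "4 * \<theta> \<le> \<delta>"
  and \<delta>: "\<delta> \<le> \<bar>cos ex\<bar>"
 shows "(\<delta> / 2)\<^sup>2 \<le> (sin (e0 + e1 - ex))\<^sup>2"
proof -
 define d where "d = (e0 - pi/2) + (e1 - pi * real n)"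
 have "sin (e0 + e1 - ex) = sin ((pi/2 - (ex - d)) + pi * real n)" by (simp add: d_def algebra_simps)
 also have "\<dots> = sin (pi/2 - (ex - d)) * cos (pi * real n)" by (simp add: sin_add sin_npi2)
 also have "\<dots> = cos (ex - d) * cos (pi * real n)" by (simp only: sin_cos_eq[symmetric] cos_sin_eq) (simp add: cos_sin_eq)
 finally have "(sin (e0 + e1 - ex))\<^sup>2 = (cos (ex - d))\<^sup>2 * (cos (pi * real n))\<^sup>2" by (simp add: power_mult_distrib)
 also have "(cos (pi * real n))\<^sup>2 = 1" using sin_cos_squared_add[of "pi * real n"] by (simp add: sin_npi2)
 finally have eq: "(sin (e0 + e1 - ex))\<^sup>2 = (cos (ex - d))\<^sup>2" by simp
 have "\<bar>cos ex - cos (ex - d)\<bar> \<le> \<bar>d\<bar>"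
 proof -
  have "cos ex - cos (ex - d) = 2 * sin ((ex + (ex - d)) / 2) * sin (((ex - d) - ex) / 2)" by (rule cos_diff_cos)
  then have "\<bar>cos ex - cos (ex - d)\<bar> = 2 * \<bar>sin ((ex + (ex - d)) / 2)\<bar> * \<bar>sin (((ex - d) - ex) / 2)\<bar>" by (simp add: abs_mult)
  also have "\<dots> \<le> 2 * 1 * \<bar>((ex - d) - ex) / 2\<bar>"
   by (intro mult_mono abs_sin_x_le_abs_x) auto
  finally show ?thesis by simp
 qed
 moreover have "\<bar>d\<bar> \<le> 2 * \<theta>" using e0 e1 unfolding d_def by linarith
 ultimately have "\<delta> / 2 \<le> \<bar>cos (ex - d)\<bar>" using \<theta> \<delta> by linarith
 moreover have "0 \<le> \<delta> / 2" using \<theta> e1 by linarith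
 ultimately have "(\<delta>/2)\<^sup>2 \<le> \<bar>cos (ex - d)\<bar>\<^sup>2" by (intro power_mono)
 then show ?thesis unfolding eq by simp
qed

lemma set_integral_ge_shells:
 fixes f :: "'a \<Rightarrow> real"
 assumes f: "set_integrable M S f"
  and neg: "\<And>x. x \<in> S \<Longrightarrow> - (u * W x) \<le> f x" "\<And>x. 0 \<le> W x" "0 \<le> u"
   "(\<integral>\<^sup>+x\<in>S. ennreal (W x) \<partial>M) \<le> ennreal U" "0 \<le> U"
  and I: "finite I" "\<And>k. k \<in> I \<Longrightarrow> A k \<in> sets M" "\<And>k. k \<in> I \<Longrightarrow> A k \<subseteq> S"
   "\<And>k j x. k \<in> I \<Longrightarrow> j \<in> I \<Longrightarrow> x \<in> A k \<Longrightarrow> x \<in> A j \<Longrightarrow> k = j"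
   "\<And>k x. k \<in> I \<Longrightarrow> x \<in> A k \<Longrightarrow> b k \<le> f x"
   "\<And>k. k \<in> I \<Longrightarrow> ennreal (l k) \<le> ennreal (b k) * emeasure M (A k)" "\<And>k. k \<in> I \<Longrightarrow> 0 \<le> l k"
 shows "(\<Sum>k\<in>I. l k) - u * U \<le> (LINT x:S|M. f x)"
 unfolding set_lebesgue_integral_def
proof (rule integral_lower_bound)
 show "integrable M (\<lambda>x. indicator S x *\<^sub>R f x)" using f by (simp add: set_integrable_def)
 show "AE x in M. ennreal (- (indicator S x *\<^sub>R f x)) \<le> ennreal u * (ennreal (W x) * indicator S x)"
 proof (rule AE_I2)
  fix x
  show "ennreal (- (indicator S x *\<^sub>R f x)) \<le> ennreal u * (ennreal (W x) * indicator S x)"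
  proof (cases "x \<in> S")
   case True
   have "ennreal (- f x) \<le> ennreal (u * W x)" using neg(1)[OF True] by (intro ennreal_leI) linarith
   then show ?thesis using True neg(2,3) by (simp add: ennreal_mult)
  qed simp
 qed
 have "(\<integral>\<^sup>+x. ennreal u * (ennreal (W x) * indicator S x) \<partial>M) \<le> ennreal u * (\<integral>\<^sup>+x\<in>S. ennreal (W x) \<partial>M)"
 proof (cases "u = 0")
  case False
  then have u: "0 < u" using neg(3) by simp
  show ?thesis
  proof -
   have "(\<integral>\<^sup>+x. ennreal u * (ennreal (W x) * indicator S x) \<partial>M) = (SUP g \<in> {g. simple_function M g \<and> g \<le> (\<lambda>x. ennreal u * (ennreal (W x) * indicator S x))}. integral\<^sup>S M g)"
    by (simp add: nn_integral_def)
   also have "\<dots> \<le> ennreal u * (\<integral>\<^sup>+x\<in>S. ennreal (W x) \<partial>M)"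
   proof (rule SUP_least, clarify)
    fix g assume g: "simple_function M g" "g \<le> (\<lambda>x. ennreal u * (ennreal (W x) * indicator S x))"
    define g' where "g' x = ennreal (1/u) * g x" for x
    have uu: "ennreal u * ennreal (1/u) = 1" using u by (simp add: ennreal_mult[symmetric])
    have g': "simple_function M g'" unfolding g'_def using g(1) by (intro simple_function_mult) auto
    have "g' x \<le> ennreal (W x) * indicator S x" for x
    proof -
     have "g' x \<le> ennreal (1/u) * (ennreal u * (ennreal (W x) * indicator S x))"
      unfolding g'_def using g(2) by (intro mult_left_mono) (auto simp: le_fun_def)
     also have "\<dots> = (ennreal u * ennreal (1/u)) * (ennreal (W x) * indicator S x)" by (simp only: ac_simps)
     finally show ?thesis unfolding uu by simp
    qed
    then have "integral\<^sup>S M g' \<le> (\<integral>\<^sup>+x\<in>S. ennreal (W x) \<partial>M)"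
     unfolding nn_integral_def using g' by (intro SUP_upper) (auto simp: le_fun_def)
    then have "ennreal u * integral\<^sup>S M g' \<le> ennreal u * (\<integral>\<^sup>+x\<in>S. ennreal (W x) \<partial>M)" by (rule mult_left_mono) simp
    moreover have "ennreal u * integral\<^sup>S M g' = integral\<^sup>S M g"
    proof -
     have "integral\<^sup>S M g' = ennreal (1/u) * integral\<^sup>S M g" unfolding g'_def by (rule simple_integral_mult[OF g(1)])
     then show ?thesis using uu by (simp add: mult.assoc[symmetric])
    qed
    ultimately show "integral\<^sup>S M g \<le> ennreal u * (\<integral>\<^sup>+x\<in>S. ennreal (W x) \<partial>M)" by simp
   qed
   finally show ?thesis .
  qed
 qed simp
 also have "\<dots> \<le> ennreal u * ennreal U" using neg(4) by (rule mult_left_mono) simp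
 also have "\<dots> = ennreal (u * U)" using neg by (simp add: ennreal_mult)
 finally show "(\<integral>\<^sup>+x. ennreal u * (ennreal (W x) * indicator S x) \<partial>M) \<le> ennreal (u * U)" .
 show "0 \<le> u * U" using neg by simp
 show "AE x in M. (\<Sum>k\<in>I. ennreal (b k) * indicator (A k) x) \<le> ennreal (indicator S x *\<^sub>R f x)"
 proof (rule AE_I2)
  fix x
  show "(\<Sum>k\<in>I. ennreal (b k) * indicator (A k) x) \<le> ennreal (indicator S x *\<^sub>R f x)"
  proof (cases "\<exists>k\<in>I. x \<in> A k")
   case True
   then obtain k where k: "k \<in> I" "x \<in> A k" by blast
   have "(\<Sum>j\<in>I. ennreal (b j) * indicator (A j) x) = ennreal (b k) * indicator (A k) x"
   proof (rule sum.remove[OF I(1) k(1), THEN trans])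
    have "(\<Sum>j\<in>I - {k}. ennreal (b j) * indicator (A j) x) = 0"
     using I(4)[OF k(1) _ k(2)] by (intro sum.neutral) (auto simp: indicator_def)
    then show "ennreal (b k) * indicator (A k) x + (\<Sum>j\<in>I - {k}. ennreal (b j) * indicator (A j) x) = ennreal (b k) * indicator (A k) x" by simp
   qed
   also have "\<dots> \<le> ennreal (f x)" using k I(5)[OF k] by (simp add: ennreal_leI)
   finally show ?thesis using k I(3)[OF k(1)] by auto
  next
   case False
   then have "(\<Sum>k\<in>I. ennreal (b k) * indicator (A k) x) = 0" by (intro sum.neutral) auto
   then show ?thesis by simp
  qed
 qed
 have "ennreal (\<Sum>k\<in>I. l k) = (\<Sum>k\<in>I. ennreal (l k))" using I by (intro sum_ennreal[symmetric]) auto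
 also have "\<dots> \<le> (\<Sum>k\<in>I. ennreal (b k) * emeasure M (A k))" using I by (intro sum_mono) auto
 also have "\<dots> = (\<integral>\<^sup>+x. (\<Sum>k\<in>I. ennreal (b k) * indicator (A k) x) \<partial>M)"
  using I(2) by (subst nn_integral_sum) (auto simp: nn_integral_cmult_indicator intro!: sum.cong)
 finally show "ennreal (\<Sum>k\<in>I. l k) \<le> (\<integral>\<^sup>+x. (\<Sum>k\<in>I. ennreal (b k) * indicator (A k) x) \<partial>M)" .
qed

text \<open>Up to constants \<open>w(x) w(y)\<close> and \<open>w(p1) (w(x) + w(y))\<close> agree, since the larger of \<open>|x|\<close> and \<open>|y|\<close> is comparable
to \<open>|p1|\<close>: gain and loss are measured by the same weight.\<close>

lemma wt_resonant_compare:
 assumes a: "1 \<le> a" and s: "0 \<le> s" and x: "x \<in> resonant_set a p p1" and pp1: "norm p \<le> norm p1"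
 shows "wt s x * wt s (p + p1 - x) \<le> 2 powr s * (wt s p1 * (wt s x + wt s (p + p1 - x)))"
  and "2 powr (-s) / 2 * (wt s p1 * (wt s x + wt s (p + p1 - x))) \<le> wt s x * wt s (p + p1 - x)"
proof -
 define y where "y = p + p1 - x"
 define q where "q = norm p1"
 have "q / 2 \<le> norm x \<or> q / 2 \<le> norm y"
 proof (rule ccontr)
  assume "\<not> ?thesis"
  then have lt: "norm x < q / 2" "norm y < q / 2" by auto
  then have q0: "0 < q" using norm_ge_zero[of x] by linarith
  have "norm x powr a + norm y powr a < (q/2) powr a + (q/2) powr a"
   using lt a by (intro add_strict_mono powr_less_mono2) auto
  also have "\<dots> = 2 * ((1/2) powr a * q powr a)" by (simp add: powr_divide)
  also have "\<dots> \<le> 2 * ((1/2) powr 1 * q powr a)"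
   using a by (intro mult_left_mono mult_right_mono powr_mono') auto
  also have "\<dots> = q powr a" by simp
  also have "\<dots> \<le> norm p powr a + norm p1 powr a" by (simp add: q_def)
  finally show False using x by (simp add: resonant_set_sum y_def)
 qed
 then have "wt s x \<le> 2 powr s * wt s p1 \<or> wt s y \<le> 2 powr s * wt s p1"
  using wt_compare[OF s, of 2 p1 x] wt_compare[OF s, of 2 p1 y] by (auto simp: q_def)
 then show "wt s x * wt s (p + p1 - x) \<le> 2 powr s * (wt s p1 * (wt s x + wt s (p + p1 - x)))"
  unfolding y_def[symmetric]
 proof
  assume "wt s x \<le> 2 powr s * wt s p1"
  then have "wt s x * wt s y \<le> (2 powr s * wt s p1) * wt s y" by (rule mult_right_mono) simp
  also have "\<dots> \<le> (2 powr s * wt s p1) * (wt s x + wt s y)" by (intro mult_left_mono) auto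
  finally show "wt s x * wt s y \<le> 2 powr s * (wt s p1 * (wt s x + wt s y))" by (simp add: mult.assoc)
 next
  assume "wt s y \<le> 2 powr s * wt s p1"
  then have "wt s x * wt s y \<le> wt s x * (2 powr s * wt s p1)" by (rule mult_left_mono) simp
  also have "\<dots> \<le> (wt s x + wt s y) * (2 powr s * wt s p1)" by (intro mult_right_mono) auto
  finally show "wt s x * wt s y \<le> 2 powr s * (wt s p1 * (wt s x + wt s y))" by (simp add: ac_simps)
 qed
 have nb: "norm x \<le> 2 * q" "norm y \<le> 2 * q"
  using resonant_norm_le[OF a x pp1 order_refl] by (auto simp: q_def y_def)
 then have "wt s p1 \<le> 2 powr s * wt s x" "wt s p1 \<le> 2 powr s * wt s y"
  using wt_compare[OF s, of 2 x p1] wt_compare[OF s, of 2 y p1] by (auto simp: q_def)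
 then have "2 powr (-s) * wt s p1 \<le> 2 powr (-s) * (2 powr s * wt s x)" "2 powr (-s) * wt s p1 \<le> 2 powr (-s) * (2 powr s * wt s y)"
  by (auto intro!: mult_left_mono)
 moreover have "2 powr (-s) * 2 powr s = (1::real)" by (simp add: powr_add[symmetric])
 ultimately have c: "2 powr (-s) * wt s p1 \<le> wt s x" "2 powr (-s) * wt s p1 \<le> wt s y" by (auto simp: mult.assoc[symmetric])
 have "(2 powr (-s) * wt s p1) * wt s y \<le> wt s x * wt s y" using c(1) by (rule mult_right_mono) simp
 moreover have "wt s x * (2 powr (-s) * wt s p1) \<le> wt s x * wt s y" using c(2) by (rule mult_left_mono) simp
 ultimately have "((2 powr (-s) * wt s p1) * wt s y + wt s x * (2 powr (-s) * wt s p1)) / 2 \<le> (wt s x * wt s y + wt s x * wt s y) / 2"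
  by (intro divide_right_mono add_mono) auto
 moreover have "2 powr (-s) / 2 * (wt s p1 * (wt s x + wt s y)) = ((2 powr (-s) * wt s p1) * wt s y + wt s x * (2 powr (-s) * wt s p1)) / 2"
  by (simp add: field_simps)
 ultimately show "2 powr (-s) / 2 * (wt s p1 * (wt s x + wt s (p + p1 - x))) \<le> wt s x * wt s (p + p1 - x)"
  unfolding y_def[symmetric] by (simp only: field_sum_of_halves add_divide_distrib)
qed

text \<open>On the shells where \<open>f(p1)\<close> nearly vanishes only \<open>f(p) f(x) f(y)\<close> remains.  It is bounded below for \<open>|x|\<close> in
the set of large measure where \<open>sin\<close> and \<open>cos\<close> of \<open>|x|^a\<close> are both away from zero, and every dyadic shell of
\<open>x\<close> contributes.  The two alternatives in the hypothesis come from the smallest and from the largest shell.\<close>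

lemma inner_integral_ge_inverse_cube:
 fixes a \<beta> s :: real
 assumes a: "1 \<le> a" and \<beta>: "0 \<le> \<beta>" and s: "0 \<le> s" and cond: "s \<le> 4*\<beta> + 4 - a \<or> 2 * s \<le> 6*\<beta> + 6 - a"
 obtains \<epsilon> \<theta> c q0 where "0 < \<epsilon>" "0 < \<theta>" "\<theta> \<le> 1/16" "0 < c" "1 \<le> q0"
  "\<And>p p1 n g. \<lbrakk>\<bar>norm p powr a - pi / 2\<bar> \<le> \<theta>; \<bar>norm p1 powr a - pi * real n\<bar> \<le> \<theta>; p \<bullet> p1 \<le> 0; q0 \<le> norm p1;
    \<And>x. \<bar>g x - wt s x * (sin (norm x powr a))\<^sup>2\<bar> \<le> \<epsilon> * wt s x;
    set_integrable hausdorff2 (resonant_set a p p1) (density a \<beta> g p p1)\<rbrakk>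
   \<Longrightarrow> c * norm p1 powr (-3) \<le> inner_integral a \<beta> g p p1"
proof -
 define e where "e = 2*\<beta> + 2 - s"
 define gm where "gm = 4*\<beta> - s + 1 - a"
 obtain L1 C1 where L1: "2 \<le> L1" and C1: "0 < C1" and up: "\<And>(p::real^3) p1. \<lbrakk>L1 * norm p \<le> norm p1; 1 \<le> norm p1\<rbrakk> \<Longrightarrow>
  (\<integral>\<^sup>+x\<in>resonant_set a p p1. ennreal (loss_weight a \<beta> s p p1 x) \<partial>hausdorff2) \<le>
   ennreal (C1 * norm p1 powr gm *
    (\<Sum>k\<in>{k::nat. 2 ^ k \<le> 4 * norm p1 \<and> (\<exists>x\<in>resonant_set a p p1. min (norm x) (norm (p + p1 - x)) \<le> 2 ^ k)}. 2 powr (k * e)))"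
  unfolding e_def gm_def by (rule loss_weight_integral_upper[OF a \<beta> s]) blast
 obtain L2 c2 where L2: "5 \<le> L2" and c2: "0 < c2" and low: "\<And>p p1 r T. \<lbrakk>p \<bullet> p1 \<le> 0; 1 \<le> norm p; L2 * norm p \<le> r; L2 * r \<le> norm p1; T \<in> sets borel; T \<subseteq> {r..2*r}\<rbrakk> \<Longrightarrow>
  \<exists>m\<ge>0. (\<forall>x\<in>resonant_set a p p1. norm x \<in> T \<longrightarrow> m \<le> loss_weight a \<beta> s p p1 x) \<and>
   ennreal (c2 * norm p1 powr gm * r powr (2*\<beta> - s + 1)) * emeasure lborel T
    \<le> ennreal m * emeasure hausdorff2 {x \<in> resonant_set a p p1. norm x \<in> T}"
  unfolding gm_def by (rule loss_weight_shell_lower[OF a \<beta> s]) blast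
 obtain k1 where k1: "2 * L2 \<le> 2 ^ k1" using real_arch_pow[of 2 "2 * L2"] by (auto intro: less_imp_le)
 obtain c0 where c0: "8 * L2 \<le> 2 ^ c0" using real_arch_pow[of 2 "8 * L2"] by (auto intro: less_imp_le)
 obtain C3 where C3: "1 \<le> C3" "\<And>K. k1 \<le> K \<Longrightarrow> (\<Sum>k\<le>K + c0. 2 powr (k * e)) \<le> C3 * (\<Sum>k=k1..K. 2 powr (k * e))"
  using dyadic_sum_compare[where i = k1 and c = c0 and e = e] by blast
 define \<delta> where "\<delta> = sqrt (1 / (32 * a))"
 have d2: "\<delta>\<^sup>2 = 1 / (32 * a)" using a by (simp add: \<delta>_def)
 have d0: "0 < \<delta>" using a by (simp add: \<delta>_def)
 have d1: "\<delta>\<^sup>2 \<le> 1" unfolding d2 using a by simp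
 define \<kappa> where "\<kappa> = (4 powr (-s) / 2) * (\<delta>\<^sup>2 / 8)\<^sup>2 * (2 powr (-s) / 2)"
 have kp: "0 < \<kappa>" using d0 by (simp add: \<kappa>_def)
 define B where "B = 16 + 4 * 2 powr s"
 have B0: "0 < B" by (simp add: B_def add_pos_pos)
 define \<epsilon> where "\<epsilon> = Min {\<delta>\<^sup>2 / 8, 1/4, \<kappa> / 32, \<kappa> * c2 / (32 * a * B * C1 * C3)}"
 have e0: "0 < \<epsilon>" using d0 kp c2 a B0 C1 C3(1) by (simp add: \<epsilon>_def)
 have eb: "\<epsilon> \<le> \<delta>\<^sup>2 / 8" "\<epsilon> \<le> 1/4" "\<epsilon> \<le> \<kappa> / 32" "\<epsilon> \<le> \<kappa> * c2 / (32 * a * B * C1 * C3)"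
  unfolding \<epsilon>_def by (intro Min_le; simp)+
 \<comment> \<open>the perturbation of the datum spoils at most half of the lower bound, on all levels together\<close>
 have ebig: "B * \<epsilon> * (C1 * C3) \<le> \<kappa> / 4 * (c2 / (8 * a))"
 proof -
  have "0 < 32 * a * B * C1 * C3" using a B0 C1 C3(1) by simp
  then have "\<epsilon> * (32 * a * B * C1 * C3) \<le> \<kappa> * c2" using eb(4) by (simp add: pos_le_divide_eq)
  then show ?thesis using a by (simp add: field_simps)
 qed
 define \<theta> where "\<theta> = Min {1/16, \<delta>/4, sqrt \<epsilon>}"
 have t0: "0 < \<theta>" using d0 e0 by (simp add: \<theta>_def)
 have tb: "\<theta> \<le> 1/16" "\<theta> \<le> \<delta>/4" "\<theta> \<le> sqrt \<epsilon>" unfolding \<theta>_def by (intro Min_le; simp)+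
 have t2: "\<theta>\<^sup>2 \<le> \<epsilon>"
 proof -
  have "\<theta>\<^sup>2 \<le> (sqrt \<epsilon>)\<^sup>2" using tb(3) t0 by (intro power_mono) auto
  then show ?thesis using e0 by simp
 qed
 define c5 where "c5 = min (2 powr (k1 * e)) ((2 * L2) powr (- \<bar>e\<bar>))"
 have c50: "0 < c5" using L2 by (simp add: c5_def)
 define c where "c = \<kappa> / 4 * (c2 / (8 * a)) * c5"
 have cp: "0 < c" using kp c2 a c50 by (simp add: c_def)
 define q0 where "q0 = max (L1 * 2) (L2 * 2 ^ k1)"
 have q01: "1 \<le> q0" using L1 by (simp add: q0_def)
 show ?thesis
 proof (rule that[OF e0 t0 tb(1) cp q01])
  fix p p1 :: "real^3" and n g
  assume ep: "\<bar>norm p powr a - pi / 2\<bar> \<le> \<theta>" and e1: "\<bar>norm p1 powr a - pi * real n\<bar> \<le> \<theta>" and pp: "p \<bullet> p1 \<le> 0" and q: "q0 \<le> norm p1"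
   and g: "\<And>x. \<bar>g x - wt s x * (sin (norm x powr a))\<^sup>2\<bar> \<le> \<epsilon> * wt s x"
   and int: "set_integrable hausdorff2 (resonant_set a p p1) (density a \<beta> g p p1)"
  have pi3: "3 < pi" "pi < 3.5" using pi_gt3 pi_less_4 pi_approx by auto
  have pn: "1 \<le> norm p" "norm p \<le> 2"
  proof -
   have lo: "1 \<le> norm p powr a" and hi: "norm p powr a \<le> 2" using ep tb(1) pi3 by linarith+
   show "1 \<le> norm p"
   proof (rule ccontr)
    assume "\<not> 1 \<le> norm p"
    then have "norm p powr a < 1 powr a" using a by (intro powr_less_mono2) auto
    then show False using lo by simp
   qed
   show "norm p \<le> 2"
   proof (rule ccontr)
    assume "\<not> norm p \<le> 2"
    then have "2 powr a < norm p powr a" using a by (intro powr_less_mono2) auto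
    moreover have "2 powr 1 \<le> 2 powr a" using a by (intro powr_mono) auto
    ultimately show False using hi by simp
   qed
  qed
  define Q where "Q = norm p1"
  have Q1: "1 \<le> Q" using q q01 by (simp add: Q_def)
  have "L1 * norm p \<le> L1 * 2" using pn L1 by (intro mult_left_mono) auto
  then have pL1: "L1 * norm p \<le> norm p1" using q by (simp add: q0_def)
  have pp1: "norm p \<le> norm p1" using pL1 L1 pn mult_right_mono[of 1 L1 "norm p"] by linarith
  have "2 ^ k1 \<le> Q / L2" using q L2 by (simp add: q0_def Q_def field_simps)
  from dyadic_floor[OF this] obtain K where K: "k1 \<le> K" "2 ^ K \<le> Q / L2" "Q / L2 < 2 ^ Suc K" by blast
  have KQ: "L2 * 2 ^ K \<le> Q" "Q < L2 * 2 ^ Suc K" using K L2 by (auto simp: field_simps)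
  define S where "S = resonant_set a p p1"
  define W where "W = loss_weight a \<beta> s p p1"
  define Sig where "Sig = (\<Sum>k=k1..K. 2 powr (k * e))"
  have Sig0: "0 \<le> Sig" by (simp add: Sig_def sum_nonneg)
  have w1: "wt s z \<le> 1" for z by (rule wt_le_1[OF s])
  have gb: "- (\<epsilon> * wt s z) \<le> g z" "g z \<le> 2 * wt s z" "\<bar>g z\<bar> \<le> 2 * wt s z" for z
  proof -
   have "0 \<le> wt s z * (sin (norm z powr a))\<^sup>2" "wt s z * (sin (norm z powr a))\<^sup>2 \<le> wt s z * 1"
    by (auto intro!: mult_left_mono simp: abs_square_le_1)
   moreover have "\<epsilon> * wt s z \<le> 1 * wt s z" using eb(2) by (intro mult_right_mono) auto
   ultimately show "- (\<epsilon> * wt s z) \<le> g z" "g z \<le> 2 * wt s z" "\<bar>g z\<bar> \<le> 2 * wt s z" using g[of z] by linarith+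
  qed
  have g1: "\<bar>g p1\<bar> \<le> 2 * \<epsilon> * wt s p1"
  proof -
   have "(sin (norm p1 powr a))\<^sup>2 \<le> \<epsilon>" using sin_squared_near_multiple[OF e1] t2 by linarith
   then have "wt s p1 * (sin (norm p1 powr a))\<^sup>2 \<le> wt s p1 * \<epsilon>" by (rule mult_left_mono) simp
   moreover have "0 \<le> wt s p1 * (sin (norm p1 powr a))\<^sup>2" by simp
   moreover have "wt s p1 * \<epsilon> = \<epsilon> * wt s p1" by (rule mult.commute)
   ultimately have "\<bar>g p1\<bar> \<le> \<epsilon> * wt s p1 + \<epsilon> * wt s p1" using g[of p1] by linarith
   then show ?thesis by simp
  qed
  have gp: "4 powr (-s) / 2 \<le> g p" "g p \<le> 2"
  proof -
   have "(cos (norm p powr a))\<^sup>2 \<le> \<theta>\<^sup>2"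
   proof -
    have "cos (norm p powr a) = - sin (norm p powr a - pi/2)" by (simp add: sin_diff)
    moreover have "\<bar>sin (norm p powr a - pi/2)\<bar> \<le> \<bar>\<theta>\<bar>" using abs_sin_x_le_abs_x[of "norm p powr a - pi/2"] ep by linarith
    ultimately show ?thesis by (simp add: abs_le_square_iff)
   qed
   then have "3/4 \<le> (sin (norm p powr a))\<^sup>2" using t2 eb(2) sin_cos_squared_add[of "norm p powr a"] by linarith
   then have "wt s p * (3/4) \<le> wt s p * (sin (norm p powr a))\<^sup>2" by (rule mult_left_mono) simp
   moreover have "\<epsilon> * wt s p \<le> 1/4 * wt s p" using eb(2) by (intro mult_right_mono) auto
   ultimately have "wt s p / 2 \<le> g p" using g[of p] by linarith
   moreover have "japanese p \<le> 2 * 2" using pn by (intro japanese_le) auto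
   then have "4 powr (-s) \<le> wt s p" using s by (intro wt_ge) auto
   ultimately show "4 powr (-s) / 2 \<le> g p" by linarith
   show "g p \<le> 2" using gb(2)[of p] w1[of p] by linarith
  qed
  have gp0: "0 \<le> g p" using gp(1) by (rule order_trans[rotated]) simp
  have small: "- (16 * \<epsilon> * (wt s p1 * (wt s x + wt s (p + p1 - x)))) \<le> g p1 * g x * g (p + p1 - x) - g p * g p1 * g x - g p * g p1 * g (p + p1 - x)" for x
   using small_factor_terms[of "wt s p1" "wt s x" "wt s (p + p1 - x)" \<epsilon> "g p" "g p1" "g x" "g (p + p1 - x)"] w1 e0 gp gp0 g1 gb by simp
  have neg: "- (B * \<epsilon> * W x) \<le> density a \<beta> g p p1 x" if x: "x \<in> S" for x
  proof -
   have x': "x \<in> resonant_set a p p1" using x by (simp add: S_def)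
   have "- (2 * \<epsilon> * (wt s x * wt s (p + p1 - x))) \<le> g x * g (p + p1 - x)"
    by (rule product_ge_neg) (use e0 gb in auto)
   moreover have "2 * \<epsilon> * (wt s x * wt s (p + p1 - x)) \<le> 2 * \<epsilon> * (2 powr s * (wt s p1 * (wt s x + wt s (p + p1 - x))))"
    using wt_resonant_compare(1)[OF a s x' pp1] e0 by (intro mult_left_mono) auto
   ultimately have "- (2 * \<epsilon> * (2 powr s * (wt s p1 * (wt s x + wt s (p + p1 - x))))) \<le> g x * g (p + p1 - x)" by linarith
   then have "g p * (- (2 * \<epsilon> * (2 powr s * (wt s p1 * (wt s x + wt s (p + p1 - x)))))) \<le> g p * (g x * g (p + p1 - x))"
    using gp0 by (rule mult_left_mono)
   moreover have "g p * (2 * \<epsilon> * (2 powr s * (wt s p1 * (wt s x + wt s (p + p1 - x))))) \<le> 2 * (2 * \<epsilon> * (2 powr s * (wt s p1 * (wt s x + wt s (p + p1 - x)))))"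
    using gp e0 by (intro mult_right_mono mult_nonneg_nonneg) (auto intro!: add_nonneg_nonneg)
   ultimately have "- (4 * 2 powr s * \<epsilon> * (wt s p1 * (wt s x + wt s (p + p1 - x)))) \<le> g p * g x * g (p + p1 - x)" by (simp add: algebra_simps)
   then have "(- (B * \<epsilon>)) * (wt s p1 * (wt s x + wt s (p + p1 - x))) \<le>
    g p1 * g x * g (p + p1 - x) + g p * g x * g (p + p1 - x) - g p * g p1 * g x - g p * g p1 * g (p + p1 - x)"
    using small[of x] unfolding B_def by (simp add: algebra_simps)
   from density_ge_loss_weight[OF this, of a \<beta>] show ?thesis by (simp add: W_def)
  qed
  define T where "T k = {\<rho> \<in> {2^k..<2*2^k}. 1 / (8 * a) \<le> (sin (2 * \<rho> powr a))\<^sup>2}" for k :: nat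
  define A where "A k = {x \<in> resonant_set a p p1. norm x \<in> T k}" for k
  have TB: "T k \<in> sets borel" for k unfolding T_def by measurable
  have pos: "\<kappa> / 2 * W x \<le> density a \<beta> g p p1 x" if x: "x \<in> A k" for x k
  proof -
   have x': "x \<in> resonant_set a p p1" and xT: "1 / (8 * a) \<le> (sin (2 * norm x powr a))\<^sup>2" using x by (auto simp: A_def T_def)
   define ex where "ex = norm x powr a"
   have "(sin (2 * ex))\<^sup>2 = 4 * ((sin ex)\<^sup>2 * (cos ex)\<^sup>2)" by (simp add: sin_double power_mult_distrib)
   then have sc: "\<delta>\<^sup>2 \<le> (sin ex)\<^sup>2 * (cos ex)\<^sup>2" using xT unfolding d2 ex_def by (simp add: field_simps)
   have "(sin ex)\<^sup>2 * (cos ex)\<^sup>2 \<le> (sin ex)\<^sup>2 * 1" "(sin ex)\<^sup>2 * (cos ex)\<^sup>2 \<le> 1 * (cos ex)\<^sup>2"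
    by (intro mult_left_mono mult_right_mono; simp add: abs_square_le_1)+
   then have sx: "\<delta>\<^sup>2 \<le> (sin ex)\<^sup>2" and cx: "\<delta>\<^sup>2 \<le> (cos ex)\<^sup>2" using sc by linarith+
   have "\<bar>\<delta>\<bar> \<le> \<bar>cos ex\<bar>" using cx by (simp add: abs_le_square_iff)
   then have "\<delta> \<le> \<bar>cos ex\<bar>" using d0 by simp
   from phase_shift[OF e1 ep _ this] tb(2) have "(\<delta>/2)\<^sup>2 \<le> (sin (norm p powr a + norm p1 powr a - ex))\<^sup>2" by simp
   moreover have "norm p powr a + norm p1 powr a - ex = norm (p + p1 - x) powr a"
    using x' by (simp add: resonant_set_sum ex_def)
   ultimately have sy: "\<delta>\<^sup>2 / 4 \<le> (sin (norm (p + p1 - x) powr a))\<^sup>2" by (simp add: power_divide)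
   have gz: "\<delta>\<^sup>2 / 8 * wt s z \<le> g z" if "\<delta>\<^sup>2 / 4 \<le> (sin (norm z powr a))\<^sup>2" for z
   proof -
    have "wt s z * (\<delta>\<^sup>2 / 4) \<le> wt s z * (sin (norm z powr a))\<^sup>2" using that by (rule mult_left_mono) simp
    moreover have "\<epsilon> * wt s z \<le> \<delta>\<^sup>2 / 8 * wt s z" using eb(1) by (intro mult_right_mono) auto
    moreover have "wt s z * (\<delta>\<^sup>2 / 4) = 2 * (\<delta>\<^sup>2 / 8 * wt s z)" by simp
    ultimately show ?thesis using g[of z] by linarith
   qed
   have gx: "\<delta>\<^sup>2 / 8 * wt s x \<le> g x"
   proof (rule gz)
    show "\<delta>\<^sup>2 / 4 \<le> (sin (norm x powr a))\<^sup>2" using sx zero_le_power2[of \<delta>] unfolding ex_def by linarith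
   qed
   have gy: "\<delta>\<^sup>2 / 8 * wt s (p + p1 - x) \<le> g (p + p1 - x)" using sy by (rule gz)
   have h1: "(4 powr (-s) / 2) * ((\<delta>\<^sup>2 / 8 * wt s x) * (\<delta>\<^sup>2 / 8 * wt s (p + p1 - x))) \<le> g p * (g x * g (p + p1 - x))"
    by (rule mult_mono[OF gp(1) mult_mono[OF gx gy]])
      (use gx gp0 in \<open>auto intro!: mult_nonneg_nonneg intro: order_trans[OF _ gx]\<close>)
   have h2: "(4 powr (-s) / 2) * ((\<delta>\<^sup>2 / 8 * wt s x) * (\<delta>\<^sup>2 / 8 * wt s (p + p1 - x))) = (4 powr (-s) / 2) * (\<delta>\<^sup>2 / 8)\<^sup>2 * (wt s x * wt s (p + p1 - x))"
    by (simp add: power2_eq_square)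
   have "\<kappa> * (wt s p1 * (wt s x + wt s (p + p1 - x))) = (4 powr (-s) / 2) * (\<delta>\<^sup>2 / 8)\<^sup>2 * (2 powr (-s) / 2 * (wt s p1 * (wt s x + wt s (p + p1 - x))))"
    by (simp only: \<kappa>_def mult.assoc)
   also have "\<dots> \<le> (4 powr (-s) / 2) * (\<delta>\<^sup>2 / 8)\<^sup>2 * (wt s x * wt s (p + p1 - x))"
    by (rule mult_left_mono[OF wt_resonant_compare(2)[OF a s x' pp1]]) simp
   also have "\<dots> \<le> g p * (g x * g (p + p1 - x))" using h1 unfolding h2 .
   also have "\<dots> = g p * g x * g (p + p1 - x)" by (rule mult.assoc[symmetric])
   finally have "\<kappa> * (wt s p1 * (wt s x + wt s (p + p1 - x))) \<le> g p * g x * g (p + p1 - x)" .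
   moreover have "16 * \<epsilon> * (wt s p1 * (wt s x + wt s (p + p1 - x))) \<le> \<kappa> / 2 * (wt s p1 * (wt s x + wt s (p + p1 - x)))"
    using eb(3) by (intro mult_right_mono mult_nonneg_nonneg add_nonneg_nonneg) auto
   ultimately have "\<kappa> / 2 * (wt s p1 * (wt s x + wt s (p + p1 - x))) \<le>
    g p1 * g x * g (p + p1 - x) + g p * g x * g (p + p1 - x) - g p * g p1 * g x - g p * g p1 * g (p + p1 - x)"
    using small[of x] by linarith
   from density_ge_loss_weight[OF this, of a \<beta>] show ?thesis by (simp add: W_def)
  qed
  have exm: "\<exists>m\<ge>0. (\<forall>x\<in>A k. m \<le> W x) \<and> ennreal (c2 / (8 * a) * Q powr gm * 2 powr (k * e)) \<le> ennreal m * emeasure hausdorff2 (A k)" if k: "k \<in> {k1..K}" for k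
  proof -
   have "(2::real) ^ k1 \<le> 2 ^ k" using k by (intro power_increasing) auto
   moreover have "L2 * norm p \<le> L2 * 2" using pn L2 by (intro mult_left_mono) auto
   moreover have "L2 * 2 ^ k \<le> L2 * 2 ^ K" using L2 k by (intro mult_left_mono power_increasing) auto
   ultimately have h: "L2 * norm p \<le> 2 ^ k" "L2 * 2 ^ k \<le> norm p1" using k1 KQ(1) unfolding Q_def by linarith+
   have Tsub: "T k \<subseteq> {2^k..2*2^k}" by (auto simp: T_def)
   from low[OF pp pn(1) h TB Tsub] obtain m where m: "0 \<le> m" "\<And>x. x \<in> resonant_set a p p1 \<Longrightarrow> norm x \<in> T k \<Longrightarrow> m \<le> W x"
    "ennreal (c2 * Q powr gm * (2 ^ k) powr (2*\<beta> - s + 1)) * emeasure lborel (T k) \<le> ennreal m * emeasure hausdorff2 (A k)"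
    unfolding A_def W_def Q_def by blast
   have "ennreal (c2 / (8 * a) * Q powr gm * 2 powr (k * e)) = ennreal (c2 * Q powr gm * (2 ^ k) powr (2*\<beta> - s + 1)) * ennreal (2 ^ k / (8 * a))"
   proof -
    have "(2::real) ^ k = 2 powr k" by (simp add: powr_realpow)
    then have "((2::real) ^ k) powr (2*\<beta> - s + 1) * 2 ^ k = 2 powr (k * e)"
     by (simp only: powr_powr powr_add[symmetric]) (simp add: e_def algebra_simps)
    then have eq: "c2 / (8 * a) * Q powr gm * 2 powr (k * e) = (c2 * Q powr gm * (2 ^ k) powr (2*\<beta> - s + 1)) * (2 ^ k / (8 * a))" by (simp add: ac_simps)
    show ?thesis unfolding eq by (rule ennreal_mult) (use c2 a in auto)
   qed
   also have "\<dots> \<le> ennreal (c2 * Q powr gm * (2 ^ k) powr (2*\<beta> - s + 1)) * emeasure lborel (T k)"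
    unfolding T_def by (intro mult_left_mono oscillating_shell_measure a) auto
   also have "\<dots> \<le> ennreal m * emeasure hausdorff2 (A k)" by (rule m(3))
   finally show ?thesis using m(1,2) by (auto simp: A_def)
  qed
  then obtain m where m: "\<And>k. k \<in> {k1..K} \<Longrightarrow> 0 \<le> m k" "\<And>k x. k \<in> {k1..K} \<Longrightarrow> x \<in> A k \<Longrightarrow> m k \<le> W x"
   "\<And>k. k \<in> {k1..K} \<Longrightarrow> ennreal (c2 / (8 * a) * Q powr gm * 2 powr (k * e)) \<le> ennreal (m k) * emeasure hausdorff2 (A k)"
   by metis
  have AB: "A k \<in> sets hausdorff2" for k
  proof -
   have "norm -` T k \<inter> space borel \<in> sets (borel :: (real^3) measure)" by (rule measurable_sets[OF _ TB]) simp
   moreover have "A k = resonant_set a p p1 \<inter> (norm -` T k \<inter> space borel)" by (auto simp: A_def)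
   ultimately show ?thesis using closed_resonant_set[OF a] by (simp add: borel_closed sets.Int)
  qed
  have U: "(\<integral>\<^sup>+x\<in>S. ennreal (W x) \<partial>hausdorff2) \<le> ennreal (C1 * Q powr gm * (C3 * Sig))"
  proof -
   have "(\<Sum>k\<in>{k::nat. 2 ^ k \<le> 4 * norm p1 \<and> (\<exists>x\<in>resonant_set a p p1. min (norm x) (norm (p + p1 - x)) \<le> 2 ^ k)}. 2 powr (k * e)) \<le> (\<Sum>k\<le>K + c0. 2 powr (k * e))"
   proof (rule sum_mono2)
    show "{k::nat. 2 ^ k \<le> 4 * norm p1 \<and> (\<exists>x\<in>resonant_set a p p1. min (norm x) (norm (p + p1 - x)) \<le> 2 ^ k)} \<subseteq> {..K + c0}"
    proof
     fix k assume "k \<in> {k::nat. 2 ^ k \<le> 4 * norm p1 \<and> (\<exists>x\<in>resonant_set a p p1. min (norm x) (norm (p + p1 - x)) \<le> 2 ^ k)}"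
     then have "2 ^ k \<le> 4 * Q" by (simp add: Q_def)
     also have "\<dots> < 8 * L2 * 2 ^ K" using KQ(2) by simp
     also have "\<dots> \<le> 2 ^ c0 * 2 ^ K" using c0 by (intro mult_right_mono) auto
     also have "\<dots> = (2::real) ^ (K + c0)" by (simp add: power_add)
     finally have "(2::real) ^ k < 2 ^ (K + c0)" .
     then show "k \<in> {..K + c0}" by simp
    qed
   qed auto
   also have "\<dots> \<le> C3 * Sig" unfolding Sig_def by (rule C3(2)[OF K(1)])
   finally have "C1 * norm p1 powr gm * (\<Sum>k\<in>{k::nat. 2 ^ k \<le> 4 * norm p1 \<and> (\<exists>x\<in>resonant_set a p p1. min (norm x) (norm (p + p1 - x)) \<le> 2 ^ k)}. 2 powr (k * e))
     \<le> C1 * Q powr gm * (C3 * Sig)" unfolding Q_def using C1 by (intro mult_left_mono) auto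
   then show ?thesis unfolding S_def W_def
    using up[OF pL1] Q1 by (auto simp: Q_def intro: order_trans ennreal_leI)
  qed
  have main: "(\<Sum>k=k1..K. \<kappa> / 2 * (c2 / (8 * a) * Q powr gm * 2 powr (k * e))) - B * \<epsilon> * (C1 * Q powr gm * (C3 * Sig)) \<le> (LINT x:S|hausdorff2. density a \<beta> g p p1 x)"
  proof (rule set_integral_ge_shells[where W = W and A = A and b = "\<lambda>k. \<kappa> / 2 * m k"])
   show "set_integrable hausdorff2 S (density a \<beta> g p p1)" using int by (simp add: S_def)
   show "k = j" if "k \<in> {k1..K}" "j \<in> {k1..K}" "x \<in> A k" "x \<in> A j" for k j x
   proof -
    have le: "k \<le> j" if "x \<in> A k" "x \<in> A j" for k j
    proof -
     have "(2::real) ^ k < 2 ^ Suc j" using that by (auto simp: A_def T_def intro: le_less_trans)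
     then have "k < Suc j" by (subst (asm) power_strict_increasing_iff) auto
     then show ?thesis by simp
    qed
    show ?thesis using le[of k j] le[of j k] that by simp
   qed
   show "\<kappa> / 2 * m k \<le> density a \<beta> g p p1 x" if "k \<in> {k1..K}" "x \<in> A k" for k x
   proof -
    have "\<kappa> / 2 * m k \<le> \<kappa> / 2 * W x" using m(2)[OF that] kp by (intro mult_left_mono) auto
    then show ?thesis using pos[OF that(2)] by linarith
   qed
   show "ennreal (\<kappa> / 2 * (c2 / (8 * a) * Q powr gm * 2 powr (k * e))) \<le> ennreal (\<kappa> / 2 * m k) * emeasure hausdorff2 (A k)" if "k \<in> {k1..K}" for k
   proof -
    have "ennreal (\<kappa> / 2) * ennreal (c2 / (8 * a) * Q powr gm * 2 powr (k * e)) \<le> ennreal (\<kappa> / 2) * (ennreal (m k) * emeasure hausdorff2 (A k))"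
     by (rule mult_left_mono[OF m(3)[OF that]]) simp
    moreover have "ennreal (\<kappa> / 2) * ennreal (c2 / (8 * a) * Q powr gm * 2 powr (k * e)) = ennreal (\<kappa> / 2 * (c2 / (8 * a) * Q powr gm * 2 powr (k * e)))"
     using kp c2 a by (intro ennreal_mult[symmetric]) auto
    moreover have "ennreal (\<kappa> / 2) * (ennreal (m k) * emeasure hausdorff2 (A k)) = ennreal (\<kappa> / 2 * m k) * emeasure hausdorff2 (A k)"
     using kp m(1)[OF that] by (subst ennreal_mult) (auto simp: mult.assoc)
    ultimately show ?thesis by simp
   qed
   show "0 \<le> B * \<epsilon>" using B0 e0 by simp
   show "0 \<le> C1 * Q powr gm * (C3 * Sig)" using C1 C3(1) Sig0 by simp
  qed (use neg U AB kp c2 a in \<open>auto simp: W_def A_def S_def\<close>)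
  have "(\<Sum>k=k1..K. \<kappa> / 2 * (c2 / (8 * a) * Q powr gm * 2 powr (k * e))) = \<kappa> / 2 * (c2 / (8 * a)) * Q powr gm * Sig"
   unfolding Sig_def sum_distrib_left by (intro sum.cong) (auto simp: ac_simps)
  moreover have "B * \<epsilon> * (C1 * C3) * (Q powr gm * Sig) \<le> \<kappa> / 4 * (c2 / (8 * a)) * (Q powr gm * Sig)"
   using ebig Sig0 by (intro mult_right_mono) auto
  ultimately have "\<kappa> / 4 * (c2 / (8 * a)) * (Q powr gm * Sig) \<le> (LINT x:S|hausdorff2. density a \<beta> g p p1 x)"
   using main by (simp add: algebra_simps)
  moreover have "c5 * Q powr (-3) \<le> Q powr gm * Sig"
  proof (cases "s \<le> 4*\<beta> + 4 - a")
   case True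
   have "c5 \<le> Sig" unfolding c5_def Sig_def using K(1)
    by (intro order_trans[OF min.cobounded1] member_le_sum) auto
   moreover have "Q powr (-3) \<le> Q powr gm" using True Q1 by (intro powr_mono) (auto simp: gm_def)
   ultimately have "Q powr (-3) * c5 \<le> Q powr gm * Sig" using c50 by (intro mult_mono) auto
   then show ?thesis by (simp add: mult.commute)
  next
   case False
   then have ee: "0 \<le> e" "-3 \<le> gm + e" using cond by (auto simp: e_def gm_def)
   have "c5 * Q powr e \<le> (2 * L2) powr (- e) * Q powr e" unfolding c5_def using ee by (intro mult_right_mono) auto
   also have "\<dots> = (Q / (2 * L2)) powr e" using L2 Q1 by (simp add: powr_divide powr_minus_divide)
   also have "\<dots> \<le> (2 ^ K) powr e" using KQ(2) L2 Q1 ee by (intro powr_mono2) (auto simp: field_simps)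
   also have "\<dots> = 2 powr (K * e)" by (simp add: powr_realpow[symmetric] powr_powr)
   also have "\<dots> \<le> Sig" unfolding Sig_def using K(1) by (intro member_le_sum) auto
   finally have s1: "c5 * Q powr e \<le> Sig" .
   have "c5 * Q powr (-3) \<le> c5 * Q powr (gm + e)" using ee Q1 c50 by (intro mult_left_mono powr_mono) auto
   also have "\<dots> = Q powr gm * (c5 * Q powr e)" by (simp add: powr_add)
   also have "\<dots> \<le> Q powr gm * Sig" using s1 by (intro mult_left_mono) auto
   finally show ?thesis .
  qed
  then have "\<kappa> / 4 * (c2 / (8 * a)) * (c5 * Q powr (-3)) \<le> \<kappa> / 4 * (c2 / (8 * a)) * (Q powr gm * Sig)"
   using kp c2 a by (intro mult_left_mono) auto
  ultimately show "c * norm p1 powr (-3) \<le> inner_integral a \<beta> g p p1"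
   unfolding c_def inner_integral_def S_def Q_def by (simp add: mult.assoc)
 qed
qed

text \<open>Reflection in the origin.\<close>

lemma half_space_volume:
 fixes H :: "(real^3) set"
 assumes HB: "H \<in> sets borel" and sym: "\<And>q. q \<in> H \<Longrightarrow> - q \<in> H"
 shows "emeasure lborel H \<le> 2 * emeasure lborel (H \<inter> {q. p \<bullet> q \<le> 0})"
proof -
 define N where "N = H \<inter> {q. p \<bullet> q \<le> 0}"
 have "closed {q. p \<bullet> q \<le> 0}" by (intro closed_Collect_le continuous_intros)
 then have NB: "N \<in> sets borel" unfolding N_def using HB by (auto intro!: sets.Int[OF HB] borel_closed)
 define N' where "N' = (\<lambda>q. (-1) *\<^sub>R q + 0) ` N"
 have N': "N' = uminus -` N" unfolding N'_def by (auto simp: image_iff) (metis minus_minus)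
 have NB': "N' \<in> sets borel"
 proof -
  have "uminus -` N \<inter> space borel \<in> sets (borel :: (real^3) measure)"
   by (rule measurable_sets[OF _ NB]) simp
  then show ?thesis unfolding N' by simp
 qed
 have refl: "emeasure lborel N' = emeasure lborel N"
 proof -
  have "emeasure lebesgue N' = emeasure lebesgue N"
   unfolding N'_def using emeasure_lebesgue_affine[of "-1" 0 N] by simp
  then show ?thesis using NB NB' by simp
 qed
 have "H \<subseteq> N \<union> N'" unfolding N' using sym by (auto simp: N_def)
 then have "emeasure lborel H \<le> emeasure lborel (N \<union> N')"
  using NB NB' by (intro emeasure_mono) auto
 also have "\<dots> \<le> emeasure lborel N + emeasure lborel N'"
  using NB NB' by (intro emeasure_subadditive) auto
 finally show ?thesis unfolding refl N_def by (simp add: mult_2)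
qed

text \<open>The shell has radius of order \<open>n^(1/a)\<close> and the quantity \<open>|q|^a\<close> varies by \<open>2\<theta>\<close> in it.\<close>

lemma shell_volume_ge:
 fixes a \<theta> :: real and n :: nat and p :: "real^3"
 assumes a: "1 \<le> a" and \<theta>: "0 < \<theta>" "\<theta> \<le> 1/16" and n: "1 \<le> n"
 shows "ennreal (min 1 (3/a) * unit_ball_vol 3 * \<theta> / (16 * n)) \<le>
  ennreal ((pi * n + \<theta>) powr (-3/a)) * emeasure lborel {q. \<bar>norm q powr a - pi * n\<bar> \<le> \<theta> \<and> p \<bullet> q \<le> 0}"
proof -
 define lo hi where "lo = pi * n - \<theta>" and "hi = pi * n + \<theta>"
 have pn: "3 * 1 \<le> pi * n" using pi_gt3 n by (intro mult_mono) auto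
 have lo0: "0 < lo" and hi0: "0 < hi" and lohi: "lo < hi" using pn \<theta> by (auto simp: lo_def hi_def)
 define H where "H = {q :: real^3. \<bar>norm q powr a - pi * n\<bar> \<le> \<theta>}"
 define N where "N = {q :: real^3. \<bar>norm q powr a - pi * n\<bar> \<le> \<theta> \<and> p \<bullet> q \<le> 0}"
 have "continuous_on UNIV (\<lambda>q::real^3. norm q powr a)" using a by (intro continuous_intros) auto
 then have HB: "closed H" unfolding H_def
  by (intro closed_Collect_le continuous_on_rabs continuous_on_diff continuous_on_const)
 have NH: "N = H \<inter> {q. p \<bullet> q \<le> 0}" by (auto simp: N_def H_def)
 have HN: "emeasure lborel H \<le> 2 * emeasure lborel N"
  unfolding NH by (rule half_space_volume[OF borel_closed[OF HB]]) (simp add: H_def)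
 define v where "v = unit_ball_vol 3"
 have v0: "0 \<le> v" by (simp add: v_def)
 have "emeasure lborel (cball 0 (hi powr (1/a)) - ball (0::real^3) (lo powr (1/a))) =
   emeasure lborel (cball (0::real^3) (hi powr (1/a))) - emeasure lborel (ball (0::real^3) (lo powr (1/a)))"
 proof (rule emeasure_Diff)
  have "lo powr (1/a) \<le> hi powr (1/a)" using lo0 lohi a by (intro powr_mono2) auto
  then show "ball (0::real^3) (lo powr (1/a)) \<subseteq> cball 0 (hi powr (1/a))" by (auto simp: dist_norm)
 qed (auto simp: emeasure_ball)
 also have "\<dots> = ennreal (v * hi powr (3/a)) - ennreal (v * lo powr (3/a))"
 proof -
  have "(x powr (1/a)) ^ 3 = x powr (3/a)" if "0 < x" for x :: real
   using that by (simp add: powr_realpow[symmetric] powr_powr)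
  then show ?thesis using lo0 hi0 by (simp add: emeasure_ball emeasure_cball v_def)
 qed
 also have "\<dots> = ennreal (v * hi powr (3/a) - v * lo powr (3/a))"
  using v0 by (intro ennreal_minus) auto
 finally have vol: "emeasure lborel (cball 0 (hi powr (1/a)) - ball (0::real^3) (lo powr (1/a))) = ennreal (v * hi powr (3/a) - v * lo powr (3/a))" .
 have sub: "cball 0 (hi powr (1/a)) - ball (0::real^3) (lo powr (1/a)) \<subseteq> H"
 proof
  fix q :: "real^3" assume q: "q \<in> cball 0 (hi powr (1/a)) - ball 0 (lo powr (1/a))"
  have "norm q powr a \<le> (hi powr (1/a)) powr a" using q a by (intro powr_mono2) auto
  moreover have "(lo powr (1/a)) powr a \<le> norm q powr a" using q a by (intro powr_mono2) auto
  ultimately have "lo \<le> norm q powr a" "norm q powr a \<le> hi" using lo0 hi0 a by (auto simp: powr_powr)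
  then show "q \<in> H" by (auto simp: H_def lo_def hi_def abs_le_iff)
 qed
 have "ennreal (v * hi powr (3/a) - v * lo powr (3/a)) \<le> emeasure lborel H"
  unfolding vol[symmetric] using HB by (intro emeasure_mono sub) (auto simp: borel_closed)
 then have HH: "ennreal (v * hi powr (3/a) - v * lo powr (3/a)) \<le> 2 * emeasure lborel N" by (rule order_trans[OF _ HN])
 define b where "b = 3 / a"
 have b0: "0 < b" using a by (simp add: b_def)
 define u where "u = lo / hi"
 have u: "0 < u" "u < 1" using lo0 hi0 lohi by (auto simp: u_def)
 have ub: "u powr b \<le> 1 - min 1 b * (1 - u)"
 proof (cases "1 \<le> b")
  case True
  have "u powr b \<le> u powr 1" using u True by (intro powr_mono') auto
  then show ?thesis using True u by simp
 next
  case False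
  have "u powr b * 1 powr (1 - b) \<le> b * u + (1 - b) * 1" using u False b0 by (intro Youngs_inequality_0) auto
  then show ?thesis using False by (simp add: algebra_simps)
 qed
 have tt: "\<theta> / (2 * n) \<le> 1 - u"
 proof -
  have "1 - u = 2 * \<theta> / hi" using hi0 by (simp add: u_def lo_def hi_def field_simps)
  moreover have "hi \<le> 4 * n"
  proof -
   have "pi * n \<le> 3.5 * n" using pi_approx by (intro mult_right_mono) auto
   moreover have "1 \<le> real n" using n by simp
   ultimately show ?thesis using \<theta> unfolding hi_def by linarith
  qed
  then have "2 * \<theta> / (4 * n) \<le> 2 * \<theta> / hi" using \<theta> hi0 n by (intro divide_left_mono) auto
  ultimately show ?thesis by simp
 qed
 have "min 1 b * (\<theta> / (2 * n)) \<le> min 1 b * (1 - u)" using tt b0 by (intro mult_left_mono) auto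
 then have "min 1 b * (\<theta> / (2 * n)) \<le> 1 - u powr b" using ub by linarith
 then have "v * (min 1 b * (\<theta> / (2 * n))) \<le> v * (1 - u powr b)" using v0 by (rule mult_left_mono)
 also have "\<dots> = hi powr (-b) * (v * hi powr b - v * lo powr b)"
  using hi0 lo0 by (simp add: u_def powr_divide powr_minus field_simps)
 finally have "min 1 b * v * \<theta> / (16 * n) \<le> hi powr (-b) * (v * hi powr b - v * lo powr b) / 2"
 proof -
  assume h: "v * (min 1 b * (\<theta> / (2 * n))) \<le> hi powr (-b) * (v * hi powr b - v * lo powr b)"
  have "min 1 b * v * \<theta> / (16 * n) \<le> v * (min 1 b * (\<theta> / (2 * n))) / 2"
   using v0 b0 \<theta> n by (simp add: field_simps)
  then show ?thesis by (rule order_trans[OF _ divide_right_mono[OF h]]) simp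
 qed
 then have "ennreal (min 1 b * v * \<theta> / (16 * n)) \<le> ennreal (hi powr (-b) * (v * hi powr b - v * lo powr b) / 2)" by (rule ennreal_leI)
 also have "hi powr (-b) * (v * hi powr b - v * lo powr b) / 2 = (hi powr (-b) / 2) * (v * hi powr b - v * lo powr b)" by simp
 also have "ennreal \<dots> = ennreal (hi powr (-b) / 2) * ennreal (v * hi powr b - v * lo powr b)"
  using v0 lo0 lohi b0 by (intro ennreal_mult) (auto intro!: mult_left_mono powr_mono2)
 also have "\<dots> \<le> ennreal (hi powr (-b) / 2) * (2 * emeasure lborel N)"
  using HH unfolding b_def by (intro mult_left_mono) auto
 also have "\<dots> = ennreal (hi powr (-b)) * emeasure lborel N"
 proof -
  have "ennreal (hi powr (-b) / 2) * 2 = ennreal (hi powr (-b))"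
   by (simp add: ennreal_mult[symmetric] flip: ennreal_numeral)
  then show ?thesis by (simp add: mult.assoc[symmetric])
 qed
 finally show ?thesis unfolding b_def v_def hi_def N_def by simp
qed

text \<open>The shells have volume of order \<open>n^(3/a - 1)\<close>, the lower bound on them is of order \<open>n^(-3/a)\<close>: their
contributions form a harmonic series.\<close>

lemma collision_undefined:
 fixes a \<beta> s :: real
 assumes a: "1 \<le> a" and \<beta>: "0 \<le> \<beta>" and s: "0 \<le> s" and cond: "s \<le> 4*\<beta> + 4 - a \<or> 2 * s \<le> 6*\<beta> + 6 - a"
 obtains f0 \<epsilon> c r where "f0 \<in> Linf s" "0 < \<epsilon>" "0 < r"
  "\<And>p g. p \<in> ball c r \<Longrightarrow> (\<And>x. \<bar>g x - f0 x\<bar> \<le> \<epsilon> * wt s x) \<Longrightarrow> \<not> collision_defined a \<beta> g p"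
proof (rule inner_integral_ge_inverse_cube[OF assms])
 fix \<epsilon> \<theta> c q0 :: real
 assume e0: "0 < \<epsilon>" and \<theta>: "0 < \<theta>" "\<theta> \<le> 1/16" and c: "0 < c" and q0: "1 \<le> q0"
  and inner: "\<And>p p1 n g. \<lbrakk>\<bar>norm p powr a - pi / 2\<bar> \<le> \<theta>; \<bar>norm p1 powr a - pi * real n\<bar> \<le> \<theta>; p \<bullet> p1 \<le> 0; q0 \<le> norm p1;
    \<And>x. \<bar>g x - wt s x * (sin (norm x powr a))\<^sup>2\<bar> \<le> \<epsilon> * wt s x;
    set_integrable hausdorff2 (resonant_set a p p1) (density a \<beta> g p p1)\<rbrakk>
   \<Longrightarrow> c * norm p1 powr (-3) \<le> inner_integral a \<beta> g p p1"
 define f0 where "f0 x = wt s x * (sin (norm x powr a))\<^sup>2" for x :: "real^3"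
 have contE: "continuous_on UNIV (\<lambda>q::real^3. norm q powr a)" using a by (intro continuous_intros) auto
 have f0L: "f0 \<in> Linf s"
 proof -
  have "continuous_on UNIV f0" unfolding f0_def
   by (intro continuous_on_mult continuous_on_power continuous_on_sin continuous_on_wt contE)
  moreover have "japanese x powr s * \<bar>f0 x\<bar> \<le> 1" for x
  proof -
   have "japanese x powr s * \<bar>f0 x\<bar> = (japanese x powr s * wt s x) * (sin (norm x powr a))\<^sup>2"
    by (simp add: f0_def abs_mult)
   also have "japanese x powr s * wt s x = 1" by (simp add: wt_def powr_add[symmetric])
   finally show ?thesis by (simp add: abs_square_le_1)
  qed
  ultimately show ?thesis by (auto simp: Linf_def intro!: bdd_aboveI[of _ 1])
 qed
 define V where "V = {p :: real^3. \<bar>norm p powr a - pi / 2\<bar> < \<theta>}"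
 have "open V" unfolding V_def
  by (intro open_Collect_less continuous_on_rabs continuous_on_diff continuous_on_const contE)
 moreover have "((pi/2) powr (1/a)) *\<^sub>R (axis 1 1 :: real^3) \<in> V"
  using \<theta> a by (simp add: V_def norm_axis_1 powr_powr)
 ultimately obtain r where r: "0 < r" "ball (((pi/2) powr (1/a)) *\<^sub>R (axis 1 1 :: real^3)) r \<subseteq> V"
  using open_contains_ball by blast
 show thesis
 proof (rule that[OF f0L e0 r(1)])
  fix p g
  assume "p \<in> ball (((pi/2) powr (1/a)) *\<^sub>R (axis 1 1 :: real^3)) r" and g: "\<And>x. \<bar>g x - f0 x\<bar> \<le> \<epsilon> * wt s x"
  then have p: "\<bar>norm p powr a - pi / 2\<bar> \<le> \<theta>" using r(2) by (auto simp: V_def)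
  show "\<not> collision_defined a \<beta> g p"
  proof
   assume "collision_defined a \<beta> g p"
   then have ae: "AE p1 in lebesgue. set_integrable hausdorff2 (resonant_set a p p1) (density a \<beta> g p p1)"
    and int: "integrable lebesgue (inner_integral a \<beta> g p)" by (auto simp: collision_defined_def)
   have fin: "(\<integral>\<^sup>+p1. ennreal (inner_integral a \<beta> g p p1) \<partial>lebesgue) \<noteq> top"
    using int unfolding real_integrable_def by simp
   define N where "N n = {q. \<bar>norm q powr a - pi * real n\<bar> \<le> \<theta> \<and> p \<bullet> q \<le> 0}" for n
   have NB: "N n \<in> sets borel" for n
   proof -
    have "closed {q :: real^3. \<bar>norm q powr a - pi * real n\<bar> \<le> \<theta>}"
     by (intro closed_Collect_le continuous_on_rabs continuous_on_diff continuous_on_const contE)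
    moreover have "closed {q. p \<bullet> q \<le> 0}" by (intro closed_Collect_le continuous_intros)
    ultimately have "closed ({q. \<bar>norm q powr a - pi * real n\<bar> \<le> \<theta>} \<inter> {q. p \<bullet> q \<le> 0})" by (rule closed_Int)
    moreover have "N n = {q. \<bar>norm q powr a - pi * real n\<bar> \<le> \<theta>} \<inter> {q. p \<bullet> q \<le> 0}" by (auto simp: N_def)
    ultimately show ?thesis by (simp add: borel_closed)
   qed
   obtain n0 :: nat where n0: "q0 powr a + 1 < real n0" using reals_Archimedean2 by blast
   have n01: "1 \<le> n0" using n0 powr_ge_zero[of q0 a] by (cases n0) auto
   have big: "q0 \<le> norm q" if "q \<in> N n" "n0 \<le> n" for q n
   proof (rule ccontr)
    assume "\<not> q0 \<le> norm q"
    then have "norm q powr a \<le> q0 powr a" using a by (intro powr_mono2) auto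
    moreover have "1 * real n \<le> pi * real n" using pi_gt3 by (intro mult_right_mono) auto
    moreover have "real n0 \<le> real n" using that by simp
    ultimately show False using that(1) n0 \<theta> by (auto simp: N_def abs_le_iff)
   qed
   define h where "h n = (pi * real n + \<theta>) powr (-3/a)" for n
   have disj: "m = n" if "q \<in> N m" "q \<in> N n" for q m n
   proof (rule ccontr)
    assume "m \<noteq> n"
    then have "1 \<le> \<bar>real m - real n\<bar>" by linarith
    then have "pi * 1 \<le> pi * \<bar>real m - real n\<bar>" by (intro mult_left_mono) auto
    also have "\<dots> = \<bar>pi * real m - pi * real n\<bar>" by (simp add: right_diff_distrib[symmetric] abs_mult)
    also have "\<dots> \<le> 2 * \<theta>" using that by (auto simp: N_def)
    finally show False using \<theta> pi_gt3 by linarith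
   qed
   have pt: "AE p1 in lebesgue. (\<Sum>n\<in>{n0..M}. ennreal (c * h n) * indicator (N n) p1) \<le> ennreal (inner_integral a \<beta> g p p1)" for M
    using ae
   proof eventually_elim
    case (elim p1)
    show ?case
    proof (cases "\<exists>n\<in>{n0..M}. p1 \<in> N n")
     case True
     then obtain n where n: "n \<in> {n0..M}" "p1 \<in> N n" by blast
     have "(\<Sum>j\<in>{n0..M}. ennreal (c * h j) * indicator (N j) p1) = ennreal (c * h n) * indicator (N n) p1"
     proof (rule sum.remove[OF _ n(1), THEN trans])
      have "(\<Sum>j\<in>{n0..M} - {n}. ennreal (c * h j) * indicator (N j) p1) = 0"
       using disj[OF n(2)] by (intro sum.neutral) (auto simp: indicator_def)
      then show "ennreal (c * h n) * indicator (N n) p1 + (\<Sum>j\<in>{n0..M} - {n}. ennreal (c * h j) * indicator (N j) p1) = ennreal (c * h n) * indicator (N n) p1" by simp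
     qed simp
     also have "\<dots> = ennreal (c * h n)" using n by simp
     also have "\<dots> \<le> ennreal (inner_integral a \<beta> g p p1)"
     proof (rule ennreal_leI)
      have q: "q0 \<le> norm p1" using big n by auto
      have "c * norm p1 powr (-3) \<le> inner_integral a \<beta> g p p1"
      proof (rule inner[OF p _ _ q _ elim])
       show "\<bar>norm p1 powr a - pi * real n\<bar> \<le> \<theta>" "p \<bullet> p1 \<le> 0" using n(2) by (auto simp: N_def)
       show "\<bar>g x - wt s x * (sin (norm x powr a))\<^sup>2\<bar> \<le> \<epsilon> * wt s x" for x using g[of x] by (simp add: f0_def)
      qed
      moreover have "h n \<le> norm p1 powr (-3)"
      proof -
       have "norm p1 powr a \<le> pi * real n + \<theta>" using n(2) by (auto simp: N_def abs_le_iff)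
       moreover have "0 < norm p1 powr a" using q q0 by auto
       ultimately have "h n \<le> (norm p1 powr a) powr (-3/a)" unfolding h_def using a by (intro powr_mono2') auto
       also have "\<dots> = norm p1 powr (-3)" using a by (simp add: powr_powr)
       finally show ?thesis .
      qed
      then have "c * h n \<le> c * norm p1 powr (-3)" using c by (intro mult_left_mono) auto
      ultimately show "c * h n \<le> inner_integral a \<beta> g p p1" by linarith
     qed
     finally show ?thesis .
    next
     case False
     then have "(\<Sum>n\<in>{n0..M}. ennreal (c * h n) * indicator (N n) p1) = 0" by (intro sum.neutral) auto
     then show ?thesis by simp
    qed
   qed
   define d where "d = c * (min 1 (3/a) * unit_ball_vol 3 * \<theta> / 16)"
   have "0 < unit_ball_vol 3" by (rule unit_ball_vol_pos) simp
   then have d0: "0 < d" unfolding d_def using c \<theta> a by simp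
   have part: "ennreal (\<Sum>n\<in>{n0..M}. d * inverse (real n)) \<le> (\<integral>\<^sup>+p1. ennreal (inner_integral a \<beta> g p p1) \<partial>lebesgue)" for M
   proof -
    have "ennreal (\<Sum>n\<in>{n0..M}. d * inverse (real n)) = (\<Sum>n\<in>{n0..M}. ennreal (d * inverse (real n)))"
     using d0 by (intro sum_ennreal[symmetric]) auto
    also have "\<dots> \<le> (\<Sum>n\<in>{n0..M}. ennreal (c * h n) * emeasure lebesgue (N n))"
    proof (rule sum_mono)
     fix n assume "n \<in> {n0..M}"
     then have n: "1 \<le> n" using n01 by auto
     have "ennreal (d * inverse (real n)) = ennreal c * ennreal (min 1 (3/a) * unit_ball_vol 3 * \<theta> / (16 * n))"
      using c \<theta> a by (subst ennreal_mult[symmetric]) (auto simp: d_def field_simps)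
     also have "\<dots> \<le> ennreal c * (ennreal (h n) * emeasure lborel (N n))"
      unfolding h_def N_def by (intro mult_left_mono shell_volume_ge[OF a \<theta> n]) auto
     also have "\<dots> = ennreal (c * h n) * emeasure lebesgue (N n)"
      using c NB by (simp add: ennreal_mult h_def mult.assoc)
     finally show "ennreal (d * inverse (real n)) \<le> ennreal (c * h n) * emeasure lebesgue (N n)" .
    qed
    also have "\<dots> = (\<integral>\<^sup>+p1. (\<Sum>n\<in>{n0..M}. ennreal (c * h n) * indicator (N n) p1) \<partial>lebesgue)"
    proof -
     have NL: "N n \<in> sets lebesgue" for n using NB by (intro sets_completionI_sets) simp
     show ?thesis using NL by (subst nn_integral_sum) (auto simp: nn_integral_cmult_indicator intro!: sum.cong)
    qed
    also have "\<dots> \<le> (\<integral>\<^sup>+p1. ennreal (inner_integral a \<beta> g p p1) \<partial>lebesgue)" by (rule nn_integral_mono_AE[OF pt])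
    finally show ?thesis .
   qed
   define B where "B = enn2real (\<integral>\<^sup>+p1. ennreal (inner_integral a \<beta> g p p1) \<partial>lebesgue)"
   have le: "(\<Sum>n\<in>{n0..M}. d * inverse (real n)) \<le> B" for M
   proof -
    have "0 \<le> (\<Sum>n\<in>{n0..M}. d * inverse (real n))" using d0 by (intro sum_nonneg) auto
    moreover have "enn2real (ennreal (\<Sum>n\<in>{n0..M}. d * inverse (real n))) \<le> B"
     unfolding B_def using part[of M] fin by (intro enn2real_mono) (auto simp: less_top)
    ultimately show ?thesis by simp
   qed
   have "summable (\<lambda>k. d * inverse (real (k + n0)))"
   proof (rule bounded_imp_summable)
    fix M
    have "(\<Sum>k\<le>M. d * inverse (real (k + n0))) = (\<Sum>n\<in>{n0..n0 + M}. d * inverse (real n))"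
     by (rule sum.reindex_bij_witness[of _ "\<lambda>n. n - n0" "\<lambda>k. k + n0"]) auto
    then show "(\<Sum>k\<le>M. d * inverse (real (k + n0))) \<le> B" using le by simp
   qed (use d0 in auto)
   then have "summable (\<lambda>k. d * inverse (real k))" using summable_iff_shift[of "\<lambda>k. d * inverse (real k)" n0] by simp
   then have "summable (\<lambda>k. inverse (real k))" using d0 by (simp add: summable_cmult_iff)
   then show False using not_summable_harmonic[where 'a = real] by simp
  qed
 qed
qed

section \<open>Large momenta: volume of the resonant region\<close>

lemma powr_comparable:
 fixes r z e :: real
 assumes "0 < r" "3/4 * r \<le> z" "z \<le> 3 * r"
 shows "min ((3/4) powr e) (3 powr e) * r powr e \<le> z powr e"
proof (cases "0 \<le> e")
 case True
 have "min ((3/4) powr e) (3 powr e) * r powr e \<le> (3/4) powr e * r powr e" by (intro mult_right_mono) auto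
 also have "\<dots> = (3/4 * r) powr e" using assms by (subst powr_mult) auto
 also have "\<dots> \<le> z powr e" using assms True by (intro powr_mono2) auto
 finally show ?thesis .
next
 case False
 have "min ((3/4) powr e) (3 powr e) * r powr e \<le> 3 powr e * r powr e" by (intro mult_right_mono) auto
 also have "\<dots> = (3 * r) powr e" using assms by (simp add: powr_mult)
 also have "\<dots> \<le> z powr e" using assms False by (intro powr_mono2') auto
 finally show ?thesis .
qed

lemma emeasure_translate:
 fixes v :: "real^3"
 assumes "A \<in> sets borel" shows "emeasure lborel ((\<lambda>q. q - v) -` A) = emeasure lborel A"
proof -
 have "emeasure lborel A = emeasure (distr lborel borel ((+) (- v))) A" by (simp add: lborel_distr_plus)
 also have "\<dots> = emeasure lborel ((+) (- v) -` A)" using assms by (subst emeasure_distr) auto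
 also have "(+) (- v) -` A = (\<lambda>q. q - v) -` A" by auto
 finally show ?thesis by simp
qed

text \<open>The derivative in the direction of \<open>p\<close> is a difference of fluxes at two points that differ by \<open>p\<close>.\<close>

lemma energy_increment_ge:
 fixes a :: real
 assumes a: "1 < a"
 obtains \<kappa> where "0 < \<kappa>" "\<And>(p::real^3) q r t. \<lbrakk>0 < r; p \<noteq> 0; 4 * norm p \<le> r; r \<le> norm q; norm q \<le> 2 * r; 0 \<le> t; t \<le> r / 4\<rbrakk> \<Longrightarrow>
  \<kappa> * r powr (a - 2) * norm p * t \<le> (norm (p + (q + t *\<^sub>R sgn p)) powr a - norm (q + t *\<^sub>R sgn p) powr a) - (norm (p + q) powr a - norm q powr a)"
proof
 define \<mu> where "\<mu> = min (1/2) (a - 1)"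
 define m where "m = min ((3/4) powr (a - 2)) (3 powr (a - 2))"
 have mu: "0 < \<mu>" "0 < m" using a by (auto simp: \<mu>_def m_def)
 show "0 < a * (\<mu> * m)" using mu a by simp
 fix p q :: "real^3" and r t :: real
 assume r: "0 < r" "p \<noteq> 0" "4 * norm p \<le> r" "r \<le> norm q" "norm q \<le> 2 * r" and t: "0 \<le> t" "t \<le> r / 4"
 define G where "G u = norm (p + (q + u *\<^sub>R sgn p)) powr a - norm (q + u *\<^sub>R sgn p) powr a" for u
 have R: "0 < norm p" using r by simp
 have inc: "a * (\<mu> * m) * r powr (a - 2) * norm p * (t - 0) \<le> G t - G 0"
 proof (cases "t = 0")
  case False
  have D: "\<exists>D. (G has_real_derivative D) (at u) \<and> a * (\<mu> * m) * r powr (a - 2) * norm p \<le> D" if u: "0 \<le> u" "u \<le> t" for u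
  proof -
   define y x where "y = q + u *\<^sub>R sgn p" and "x = p + y"
   have n1: "norm (u *\<^sub>R sgn p) \<le> r / 4" using u t R by (simp add: norm_sgn)
   have "norm q \<le> norm y + norm (u *\<^sub>R sgn p)" using norm_triangle_ineq4[of y "u *\<^sub>R sgn p"] by (simp add: y_def)
   moreover have "norm y \<le> norm q + norm (u *\<^sub>R sgn p)" unfolding y_def by (rule norm_triangle_ineq)
   moreover have "norm y \<le> norm x + norm p" using norm_triangle_ineq4[of x p] by (simp add: x_def)
   moreover have "norm x \<le> norm p + norm y" unfolding x_def by (rule norm_triangle_ineq)
   ultimately have b: "3/4 * r \<le> norm y" "norm y \<le> 3 * r" "norm x \<le> 3 * r" "0 < norm x" "0 < norm y"
    using n1 r by linarith+
   then have nz: "x \<noteq> 0" "y \<noteq> 0" by auto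
   have der: "((\<lambda>u. norm (w + u *\<^sub>R sgn p) powr a) has_real_derivative (a *\<^sub>R flux a (w + u *\<^sub>R sgn p)) \<bullet> sgn p) (at u)"
    if "w + u *\<^sub>R sgn p \<noteq> 0" for w
   proof -
    have "((\<lambda>x. norm x powr a) has_derivative (\<lambda>h. h \<bullet> (a *\<^sub>R flux a (w + u *\<^sub>R sgn p)))) (at (w + u *\<^sub>R sgn p))"
     using GDERIV_norm_powr[OF that, of a] unfolding gderiv_def .
    moreover have "((\<lambda>u. w + u *\<^sub>R sgn p) has_derivative (\<lambda>h. h *\<^sub>R sgn p)) (at u)" by (auto intro!: derivative_eq_intros)
    ultimately have "((\<lambda>u. norm (w + u *\<^sub>R sgn p) powr a) has_derivative (\<lambda>h. (h *\<^sub>R sgn p) \<bullet> (a *\<^sub>R flux a (w + u *\<^sub>R sgn p)))) (at u)"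
     using has_derivative_compose by blast
    moreover have "(\<lambda>h. (h *\<^sub>R sgn p) \<bullet> (a *\<^sub>R flux a (w + u *\<^sub>R sgn p))) = (*) ((a *\<^sub>R flux a (w + u *\<^sub>R sgn p)) \<bullet> sgn p)"
     by (rule ext) (simp add: inner_commute mult.commute mult.left_commute)
    ultimately show ?thesis by (simp only: has_field_derivative_def)
   qed
   have "(G has_real_derivative (a *\<^sub>R flux a ((p + q) + u *\<^sub>R sgn p)) \<bullet> sgn p - (a *\<^sub>R flux a (q + u *\<^sub>R sgn p)) \<bullet> sgn p) (at u)"
    unfolding G_def add.assoc[symmetric] using nz by (intro DERIV_diff der) (auto simp: x_def y_def add.assoc)
   then have DG: "(G has_real_derivative a * ((flux a x - flux a y) \<bullet> sgn p)) (at u)"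
    by (simp add: x_def y_def add.assoc inner_diff_left right_diff_distrib)
   have "m * r powr (a - 2) \<le> max (norm x) (norm y) powr (a - 2)"
    unfolding m_def by (rule powr_comparable) (use b r in auto)
   then have "\<mu> * (m * r powr (a - 2)) * (norm p)\<^sup>2 \<le> \<mu> * max (norm x) (norm y) powr (a - 2) * (norm p)\<^sup>2"
    using mu by (intro mult_right_mono mult_left_mono) auto
   also have "\<dots> \<le> (flux a x - flux a y) \<bullet> p"
    using flux_strongly_monotone[OF a nz] by (simp add: x_def \<mu>_def)
   also have "\<dots> = norm p * ((flux a x - flux a y) \<bullet> sgn p)" using R by (simp add: sgn_div_norm)
   finally have "norm p * (\<mu> * (m * r powr (a - 2)) * norm p) \<le> norm p * ((flux a x - flux a y) \<bullet> sgn p)"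
    by (simp add: power2_eq_square ac_simps)
   then have "\<mu> * (m * r powr (a - 2)) * norm p \<le> (flux a x - flux a y) \<bullet> sgn p" using R by (simp only: mult_le_cancel_left_pos)
   then have "a * (\<mu> * (m * r powr (a - 2)) * norm p) \<le> a * ((flux a x - flux a y) \<bullet> sgn p)" using a by (intro mult_left_mono) auto
   then show ?thesis using DG by (auto simp: mult.assoc)
  qed
  have "\<exists>z. 0 < z \<and> z < t \<and> (\<exists>D. G t - G 0 = (t - 0) * D \<and> a * (\<mu> * m) * r powr (a - 2) * norm p \<le> D)"
  proof -
   obtain D where D': "\<And>u. 0 \<le> u \<Longrightarrow> u \<le> t \<Longrightarrow> (G has_real_derivative D u) (at u)" "\<And>u. 0 \<le> u \<Longrightarrow> u \<le> t \<Longrightarrow> a * (\<mu> * m) * r powr (a - 2) * norm p \<le> D u"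
    using choice[of "\<lambda>u D. 0 \<le> u \<longrightarrow> u \<le> t \<longrightarrow> (G has_real_derivative D) (at u) \<and> a * (\<mu> * m) * r powr (a - 2) * norm p \<le> D"] D by blast
   have "\<exists>z. 0 < z \<and> z < t \<and> G t - G 0 = (t - 0) * D z"
    using False t D'(1) by (intro MVT2) auto
   then obtain z where "0 < z" "z < t" "G t - G 0 = (t - 0) * D z" by blast
   then show ?thesis using D'(2)[of z] by (intro exI[of _ z]) auto
  qed
  then obtain z D where "G t - G 0 = (t - 0) * D" "a * (\<mu> * m) * r powr (a - 2) * norm p \<le> D" by blast
  then have "a * (\<mu> * m) * r powr (a - 2) * norm p * t \<le> D * t" "G t - G 0 = D * t" using t by (auto intro: mult_right_mono)
  then show ?thesis by simp
 qed simp
 then show "a * (\<mu> * m) * r powr (a - 2) * norm p * t \<le> (norm (p + (q + t *\<^sub>R sgn p)) powr a - norm (q + t *\<^sub>R sgn p) powr a) - (norm (p + q) powr a - norm q powr a)"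
  by (simp add: G_def)
qed

lemma closed_energy_slab:
 assumes "1 \<le> a"
 shows "closed {q::real^3. r \<le> norm q \<and> norm q \<le> r' \<and> \<bar>norm (p + q) powr a - norm q powr a - E\<bar> \<le> w}"
proof -
 have c: "continuous_on UNIV (\<lambda>q::real^3. norm q powr a)" using assms by (intro continuous_intros) auto
 have "continuous_on UNIV (\<lambda>q::real^3. norm (p + q) powr a)"
  by (rule continuous_on_compose2[OF c]) (auto intro!: continuous_intros)
 then have "closed {q::real^3. \<bar>norm (p + q) powr a - norm q powr a - E\<bar> \<le> w}"
  using c by (intro closed_Collect_le continuous_on_rabs continuous_on_diff continuous_on_const) auto
 moreover have "closed {q::real^3. r \<le> norm q}" "closed {q::real^3. norm q \<le> r'}" by (intro closed_Collect_le continuous_intros)+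
 ultimately have "closed ({q::real^3. r \<le> norm q} \<inter> ({q. norm q \<le> r'} \<inter> {q. \<bar>norm (p + q) powr a - norm q powr a - E\<bar> \<le> w}))" by (intro closed_Int)
 then show ?thesis by (simp add: Collect_conj_eq)
qed

text \<open>Since the energy difference increases at a definite rate in the direction of \<open>p\<close>, sufficiently many
translates of the slab by multiples of \<open>\<tau>\<close> in this direction are disjoint.  All of them are contained in
a ball of radius \<open>3r\<close>.\<close>

lemma energy_slab_volume:
 fixes a D :: real
 assumes a: "1 < a" and D: "0 < D"
 obtains C where "0 < C" "\<And>(p::real^3) r h E. \<lbrakk>0 < h; 0 < r; p \<noteq> 0; 4 * norm p \<le> r\<rbrakk> \<Longrightarrow>
  emeasure lborel {q. r \<le> norm q \<and> norm q \<le> 2 * r \<and> \<bar>norm (p + q) powr a - norm q powr a - E\<bar> \<le> D * h * r powr (a - 1)}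
   \<le> ennreal (C * r ^ 3 * (h / norm p))"
proof (rule energy_increment_ge[OF a])
 fix \<kappa> assume k: "0 < \<kappa>" and inc: "\<And>(p::real^3) q r t. \<lbrakk>0 < r; p \<noteq> 0; 4 * norm p \<le> r; r \<le> norm q; norm q \<le> 2 * r; 0 \<le> t; t \<le> r / 4\<rbrakk> \<Longrightarrow>
  \<kappa> * r powr (a - 2) * norm p * t \<le> (norm (p + (q + t *\<^sub>R sgn p)) powr a - norm (q + t *\<^sub>R sgn p) powr a) - (norm (p + q) powr a - norm q powr a)"
 define v where "v = unit_ball_vol 3"
 have v0: "0 < v" unfolding v_def by (rule unit_ball_vol_pos) simp
 show thesis
 proof (rule that)
  show "0 < 27 * v * (12 * D / \<kappa>)" using v0 D k by simp
  fix p :: "real^3" and r h E :: real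
  assume A: "0 < h" "0 < r" "p \<noteq> 0" "4 * norm p \<le> r"
  define S where "S = {q. r \<le> norm q \<and> norm q \<le> 2 * r \<and> \<bar>norm (p + q) powr a - norm q powr a - E\<bar> \<le> D * h * r powr (a - 1)}"
  have SB: "S \<in> sets borel" unfolding S_def using closed_energy_slab[of a] a by (intro borel_closed) auto
  have R: "0 < norm p" using A by simp
  define \<tau> where "\<tau> = 3 * D * h * r / (\<kappa> * norm p)"
  define X where "X = \<kappa> * norm p / (12 * D * h)"
  have X0: "0 < X" "0 < \<tau>" using k R D A by (auto simp: X_def \<tau>_def)
  have Xt: "X * \<tau> = r / 4" using k R D A by (simp add: X_def \<tau>_def field_simps)
  \<comment> \<open>the number of translates that fit into a displacement of length \<open>r/4\<close>\<close>
  define N where "N = Suc (nat \<lfloor>X\<rfloor>)"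
  have NX: "X \<le> real N" "real N - 1 \<le> X" using X0 unfolding N_def by linarith+
  define Z where "Z i = (\<lambda>q. q - (real i * \<tau>) *\<^sub>R sgn p) -` S" for i :: nat
  have step: False if q: "q \<in> S" "q + (real n * \<tau>) *\<^sub>R sgn p \<in> S" and n: "1 \<le> n" "n < N" for q n
  proof -
   have "real n \<le> X" using n NX by linarith
   then have "real n * \<tau> \<le> X * \<tau>" using X0 by (intro mult_right_mono) auto
   then have t: "0 \<le> real n * \<tau>" "real n * \<tau> \<le> r / 4" using X0 Xt by auto
   have "1 * \<tau> \<le> real n * \<tau>" using n X0 by (intro mult_right_mono) auto
   then have "\<kappa> * r powr (a - 2) * norm p * \<tau> \<le> \<kappa> * r powr (a - 2) * norm p * (real n * \<tau>)" using k by (intro mult_left_mono) auto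
   also have "\<dots> \<le> (norm (p + (q + (real n * \<tau>) *\<^sub>R sgn p)) powr a - norm (q + (real n * \<tau>) *\<^sub>R sgn p) powr a) - (norm (p + q) powr a - norm q powr a)"
    using q(1) t A by (intro inc) (auto simp: S_def)
   also have "\<dots> \<le> 2 * (D * h * r powr (a - 1))"
   proof -
    have "\<And>g1 g2 w::real. \<bar>g1 - E\<bar> \<le> w \<Longrightarrow> \<bar>g2 - E\<bar> \<le> w \<Longrightarrow> g1 - g2 \<le> 2 * w" by linarith
    then show ?thesis using q unfolding S_def by blast
   qed
   finally have le: "\<kappa> * r powr (a - 2) * norm p * \<tau> \<le> 2 * (D * h * r powr (a - 1))" .
   have "\<kappa> * r powr (a - 2) * norm p * \<tau> = 3 * (D * h * (r powr (a - 2) * r))" using k R by (simp add: \<tau>_def)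
   also have "r powr (a - 2) * r = r powr (a - 1)" using A powr_add[of r "a - 2" 1] by simp
   finally have "3 * (D * h * r powr (a - 1)) \<le> 2 * (D * h * r powr (a - 1))" using le by simp
   moreover have "0 < D * h * r powr (a - 1)" using D A by simp
   ultimately show False by linarith
  qed
  have disj: "disjoint_family_on Z {..<N}"
  proof -
   have "False" if "i < j" "j < N" "z \<in> Z i" "z \<in> Z j" for i j z
   proof (rule step[of "z - (real j * \<tau>) *\<^sub>R sgn p" "j - i"])
    show "z - (real j * \<tau>) *\<^sub>R sgn p \<in> S" using that by (simp add: Z_def)
    have "z - (real j * \<tau>) *\<^sub>R sgn p + (real (j - i) * \<tau>) *\<^sub>R sgn p = z - (real i * \<tau>) *\<^sub>R sgn p"
     using that by (simp add: of_nat_diff algebra_simps)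
    moreover have "z - (real i * \<tau>) *\<^sub>R sgn p \<in> S" using that by (simp add: Z_def)
    ultimately show "z - (real j * \<tau>) *\<^sub>R sgn p + (real (j - i) * \<tau>) *\<^sub>R sgn p \<in> S" by (simp only:)
   qed (use that in auto)
   then show ?thesis unfolding disjoint_family_on_def by (metis IntE equals0I lessThan_iff linorder_neqE_nat)
  qed
  have ZB: "Z i \<in> sets lborel" for i
  proof -
   have "(\<lambda>q. q - (real i * \<tau>) *\<^sub>R sgn p) \<in> borel_measurable borel" by simp
   from measurable_sets[OF this SB] show ?thesis by (simp add: Z_def)
  qed
  have "ennreal (real N) * emeasure lborel S = (\<Sum>i<N. emeasure lborel (Z i))"
   unfolding Z_def emeasure_translate[OF SB] by (simp add: ennreal_of_nat_eq_real_of_nat)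
  also have "\<dots> = emeasure lborel (\<Union>i<N. Z i)" using ZB disj by (intro sum_emeasure) auto
  also have "\<dots> \<le> emeasure lborel (cball (0::real^3) (3 * r))"
  proof (rule emeasure_mono)
   show "(\<Union>i<N. Z i) \<subseteq> cball 0 (3 * r)"
   proof
    fix z assume "z \<in> (\<Union>i<N. Z i)"
    then obtain i where i: "i < N" "z \<in> Z i" by blast
    have "real i \<le> X" using i NX by linarith
    then have "real i * \<tau> \<le> X * \<tau>" using X0 by (intro mult_right_mono) auto
    then have "norm ((real i * \<tau>) *\<^sub>R sgn p) \<le> r / 4" using X0 Xt R by (simp add: norm_sgn)
    moreover have "norm (z - (real i * \<tau>) *\<^sub>R sgn p) \<le> 2 * r" using i by (simp add: Z_def S_def)
    moreover have "norm z \<le> norm (z - (real i * \<tau>) *\<^sub>R sgn p) + norm ((real i * \<tau>) *\<^sub>R sgn p)"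
     using norm_triangle_ineq[of "z - (real i * \<tau>) *\<^sub>R sgn p" "(real i * \<tau>) *\<^sub>R sgn p"] by simp
    ultimately have "norm z \<le> 3 * r" using A by linarith
    then show "z \<in> cball 0 (3 * r)" by simp
   qed
  qed simp
  also have "\<dots> = ennreal (27 * v * r ^ 3)" using A by (simp add: emeasure_cball v_def power_mult_distrib power3_eq_cube ac_simps)
  finally have "ennreal X * emeasure lborel S \<le> ennreal (27 * v * r ^ 3)"
   using NX by (elim order_trans[rotated]) (auto intro!: mult_right_mono ennreal_leI)
  then have "ennreal (1 / X) * (ennreal X * emeasure lborel S) \<le> ennreal (1 / X) * ennreal (27 * v * r ^ 3)" by (rule mult_left_mono) simp
  also have "ennreal (1 / X) * (ennreal X * emeasure lborel S) = emeasure lborel S"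
  proof -
   have "ennreal (1 / X) * ennreal X = 1" using X0 by (subst ennreal_mult[symmetric]) auto
   then show ?thesis by (simp add: mult.assoc[symmetric])
  qed
  also have "ennreal (1 / X) * ennreal (27 * v * r ^ 3) = ennreal (27 * v * (12 * D / \<kappa>) * r ^ 3 * (h / norm p))"
   using X0 v0 A k D by (subst ennreal_mult[symmetric]) (auto simp: X_def field_simps power3_eq_cube)
  finally show "emeasure lborel {q. r \<le> norm q \<and> norm q \<le> 2 * r \<and> \<bar>norm (p + q) powr a - norm q powr a - E\<bar> \<le> D * h * r powr (a - 1)}
   \<le> ennreal (27 * v * (12 * D / \<kappa>) * r ^ 3 * (h / norm p))" unfolding S_def .
 qed
qed

lemma norm_powr_diff_le:
 fixes u v :: "real^3"
 assumes "1 \<le> a" shows "norm u powr a - norm v powr a \<le> a * norm u powr (a - 1) * norm (u - v)"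
proof (cases "u = 0")
 case False
 have "norm u powr a + a * (flux a u \<bullet> (v - u)) \<le> norm v powr a" by (rule norm_powr_above_tangent[OF assms False])
 moreover have "- (flux a u \<bullet> (v - u)) \<le> norm u powr (a - 1) * norm (u - v)"
  using inner_flux_le[OF False, of a "u - v"] by (simp add: inner_diff_right)
 then have "a * (- (flux a u \<bullet> (v - u))) \<le> a * (norm u powr (a - 1) * norm (u - v))" using assms by (intro mult_left_mono) auto
 ultimately show ?thesis by (simp add: mult.assoc)
qed simp

text \<open>If one of the outgoing momenta is small, then the incoming energies nearly add up to the energy of
\<open>p + p1\<close>; this confines \<open>p1\<close> to a slab.\<close>

lemma energy_defect_le:
 fixes p p1 x :: "real^3"
 assumes a: "1 \<le> a" and x: "x \<in> resonant_set a p p1" and p: "norm p \<le> norm p1"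
  and h: "min (norm x) (norm (p + p1 - x)) \<le> h" "h \<le> 4 * norm p1"
 shows "\<bar>norm (p + p1) powr a - norm p1 powr a - norm p powr a\<bar> \<le> (a + 1) * 4 powr (a - 1) * h * norm p1 powr (a - 1)"
proof -
 have main: "\<bar>norm (p + p1) powr a - norm p1 powr a - norm p powr a\<bar> \<le> (a + 1) * 4 powr (a - 1) * h * norm p1 powr (a - 1)"
  if x: "x \<in> resonant_set a p p1" and xh: "norm x \<le> h" for x
 proof -
  define Q where "Q = norm p1"
  have h0: "0 \<le> h" "0 \<le> Q" using order_trans[OF norm_ge_zero xh] by (auto simp: Q_def)
  define W where "W = h * (4 * Q) powr (a - 1)"
  have yl: "norm (p + p1 - x) \<le> 4 * Q" using resonant_norm_le(2)[OF a x p order_refl] h0(2) unfolding Q_def by linarith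
  have ul: "norm (p + p1) \<le> 4 * Q" using norm_triangle_ineq[of p p1] p h0(2) unfolding Q_def by linarith
  have "norm (p + p1) powr a - norm (p + p1 - x) powr a \<le> a * norm (p + p1) powr (a - 1) * norm x"
   using norm_powr_diff_le[OF a, of "p + p1" "p + p1 - x"] by simp
  also have "\<dots> \<le> a * (4 * Q) powr (a - 1) * h" using a ul xh by (intro mult_mono mult_left_mono powr_mono2) auto
  finally have 1: "norm (p + p1) powr a - norm (p + p1 - x) powr a \<le> a * W" by (simp add: W_def ac_simps)
  have "norm (p + p1 - x) powr a - norm (p + p1) powr a \<le> a * norm (p + p1 - x) powr (a - 1) * norm x"
   using norm_powr_diff_le[OF a, of "p + p1 - x" "p + p1"] by simp
  also have "\<dots> \<le> a * (4 * Q) powr (a - 1) * h" using a yl xh by (intro mult_mono mult_left_mono powr_mono2) auto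
  finally have 2: "norm (p + p1 - x) powr a - norm (p + p1) powr a \<le> a * W" by (simp add: W_def ac_simps)
  have 3: "norm x powr a \<le> W"
  proof (cases "x = 0")
   case False
   have "norm x powr a = norm x * norm x powr (a - 1)" using False powr_add[of "norm x" 1 "a - 1"] by simp
   also have "\<dots> \<le> h * (4 * Q) powr (a - 1)" using a xh h h0 by (intro mult_mono powr_mono2) (auto simp: Q_def)
   finally show ?thesis by (simp add: W_def)
  qed (use h0 in \<open>simp add: W_def\<close>)
  have "norm x powr a + norm (p + p1 - x) powr a = norm p powr a + norm p1 powr a" using x by (simp add: resonant_set_sum)
  then have "\<bar>norm (p + p1) powr a - norm p1 powr a - norm p powr a\<bar> \<le> a * W + W"
   using 1 2 3 powr_ge_zero[of "norm x" a] by linarith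
  also have "\<dots> = (a + 1) * 4 powr (a - 1) * h * norm p1 powr (a - 1)"
   using h0 by (simp add: W_def Q_def powr_mult algebra_simps)
  finally show ?thesis .
 qed
 consider "norm x \<le> h" | "norm (p + p1 - x) \<le> h" using h(1) by linarith
 then show ?thesis by cases (use main x resonant_set_reflect in blast)+
qed

text \<open>The exponent \<open>\<sigma>\<close> interpolates between the trivial volume of a ball and that of the slab.  For \<open>a = 1\<close> the
energy difference is not strictly increasing and only \<open>\<sigma> = 0\<close> is possible.\<close>

lemma energy_slab_volume_interpolated:
 fixes a D \<sigma> :: real
 assumes a: "1 \<le> a" and D: "0 < D" and \<sigma>: "0 \<le> \<sigma>" "\<sigma> \<le> 1" "a = 1 \<Longrightarrow> \<sigma> = 0"
 obtains C where "0 < C" "\<And>(p::real^3) r h E. \<lbrakk>0 < h; 0 < r; p \<noteq> 0; 4 * norm p \<le> r\<rbrakk> \<Longrightarrow>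
  emeasure lborel {q. r \<le> norm q \<and> norm q \<le> 2 * r \<and> \<bar>norm (p + q) powr a - norm q powr a - E\<bar> \<le> D * h * r powr (a - 1)}
   \<le> ennreal (C * r ^ 3 * (h / norm p) powr \<sigma>)"
proof -
 define v where "v = 8 * unit_ball_vol 3"
 have v0: "0 < v" unfolding v_def using unit_ball_vol_pos[of 3] by simp
 have triv: "emeasure lborel {q::real^3. r \<le> norm q \<and> norm q \<le> 2 * r \<and> P q} \<le> ennreal (v * r ^ 3)" if "0 < r" for r P
 proof -
  have "emeasure lborel {q::real^3. r \<le> norm q \<and> norm q \<le> 2 * r \<and> P q} \<le> emeasure lborel (cball (0::real^3) (2 * r))"
   by (intro emeasure_mono) auto
  also have "\<dots> = ennreal (v * r ^ 3)" using that by (simp add: emeasure_cball v_def power_mult_distrib power3_eq_cube ac_simps)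
  finally show ?thesis .
 qed
 show thesis
 proof (cases "a = 1")
  case True
  show thesis by (rule that[OF v0]) (use triv \<sigma>(3)[OF True] in auto)
 next
  case False
  then have a1: "1 < a" using a by simp
  show thesis
  proof (rule energy_slab_volume[OF a1 D])
   fix C assume C: "0 < C" and slab: "\<And>(p::real^3) r h E. \<lbrakk>0 < h; 0 < r; p \<noteq> 0; 4 * norm p \<le> r\<rbrakk> \<Longrightarrow>
  emeasure lborel {q. r \<le> norm q \<and> norm q \<le> 2 * r \<and> \<bar>norm (p + q) powr a - norm q powr a - E\<bar> \<le> D * h * r powr (a - 1)}
   \<le> ennreal (C * r ^ 3 * (h / norm p))"
   show thesis
   proof (rule that[of "C + v"])
    show "0 < C + v" using C v0 by simp
    fix p :: "real^3" and r h E :: real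
    assume A: "0 < h" "0 < r" "p \<noteq> 0" "4 * norm p \<le> r"
    define t where "t = h / norm p"
    have t0: "0 < t" using A by (simp add: t_def)
    define m where "m = emeasure lborel {q. r \<le> norm q \<and> norm q \<le> 2 * r \<and> \<bar>norm (p + q) powr a - norm q powr a - E\<bar> \<le> D * h * r powr (a - 1)}"
    have "m \<le> ennreal ((C + v) * r ^ 3 * t powr \<sigma>)"
    proof (cases "t \<le> 1")
     case True
     have "m \<le> ennreal (C * r ^ 3 * t)" unfolding m_def t_def by (rule slab[OF A])
     also have "\<dots> \<le> ennreal ((C + v) * r ^ 3 * t powr \<sigma>)"
     proof (intro ennreal_leI mult_mono mult_right_mono)
      show "t \<le> t powr \<sigma>" using powr_mono'[of \<sigma> 1 t] \<sigma> t0 True by simp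
     qed (use C v0 A t0 in auto)
     finally show ?thesis .
    next
     case False
     have "m \<le> ennreal (v * r ^ 3 * 1)" unfolding m_def using triv[OF A(2)] by simp
     also have "\<dots> \<le> ennreal ((C + v) * r ^ 3 * t powr \<sigma>)"
      by (intro ennreal_leI mult_mono mult_right_mono) (use C v0 A t0 False \<sigma> in \<open>auto intro: ge_one_powr_ge_zero\<close>)
     finally show ?thesis .
    qed
    then show "emeasure lborel {q. r \<le> norm q \<and> norm q \<le> 2 * r \<and> \<bar>norm (p + q) powr a - norm q powr a - E\<bar> \<le> D * h * r powr (a - 1)}
   \<le> ennreal ((C + v) * r ^ 3 * (h / norm p) powr \<sigma>)" unfolding m_def t_def .
   qed
  qed
 qed
qed

lemma dyadic_geometric_le:
 fixes \<kappa> :: real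
 assumes "0 < \<kappa>" shows "(\<Sum>k\<le>n. 2 powr (real k * \<kappa>)) \<le> 1 / (1 - 2 powr (-\<kappa>)) * 2 powr (real n * \<kappa>)"
proof -
 define A where "A = 1 / (1 - 2 powr (-\<kappa>))"
 have l: "2 powr (-\<kappa>) < 1" using assms powr_less_mono[of "-\<kappa>" 0 2] by simp
 have A: "A = A * 2 powr (-\<kappa>) + 1"
 proof -
  have "A * (1 - 2 powr (-\<kappa>)) = 1" using l assms by (simp add: A_def)
  then show ?thesis by (simp add: algebra_simps)
 qed
 have A1: "1 \<le> A" using l unfolding A_def by (simp add: field_simps)
 have "(\<Sum>k\<le>n. 2 powr (real k * \<kappa>)) \<le> A * 2 powr (real n * \<kappa>)"
 proof (induction n)
  case (Suc n)
  have "2 powr (real n * \<kappa>) = 2 powr (-\<kappa>) * 2 powr (real (Suc n) * \<kappa>)"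
   unfolding powr_add[symmetric] by (simp add: algebra_simps)
  then have "A * 2 powr (real n * \<kappa>) + 2 powr (real (Suc n) * \<kappa>) = (A * 2 powr (-\<kappa>) + 1) * 2 powr (real (Suc n) * \<kappa>)"
   by (simp add: algebra_simps)
  then have "A * 2 powr (real n * \<kappa>) + 2 powr (real (Suc n) * \<kappa>) = A * 2 powr (real (Suc n) * \<kappa>)" using A by simp
  then show ?case using Suc by simp
 qed (use A1 in simp)
 then show ?thesis by (simp add: A_def)
qed

text \<open>Sum over the dyadic sizes \<open>2^j\<close> of \<open>p1\<close> and \<open>2^k\<close> of the smaller outgoing momentum.  The exponent \<open>\<kappa>\<close> absorbs the
sum over \<open>k \<le> j + 3\<close>, and the upper bound on it makes the series in \<open>j\<close> converge geometrically.\<close>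

lemma far_loss_bound:
 fixes a \<beta> s \<kappa> \<sigma> :: real
 assumes a: "1 \<le> a" and \<beta>: "0 \<le> \<beta>" and s: "0 \<le> s"
  and \<kappa>: "0 < \<kappa>" "2*\<beta> + 2 - s + \<sigma> \<le> \<kappa>" "\<kappa> < s + a - 4*\<beta> - 4" and \<sigma>: "0 \<le> \<sigma>" "\<sigma> \<le> 1" "a = 1 \<Longrightarrow> \<sigma> = 0"
 obtains \<Lambda> C where "8 \<le> \<Lambda>" "0 < C" "\<And>p::real^3. 1 \<le> norm p \<Longrightarrow> \<exists>B\<in>borel_measurable borel.
  (\<forall>p1. \<Lambda> * norm p \<le> norm p1 \<longrightarrow> (\<integral>\<^sup>+x\<in>resonant_set a p p1. ennreal (loss_weight a \<beta> s p p1 x) \<partial>hausdorff2) \<le> B p1) \<and>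
  (\<integral>\<^sup>+p1. B p1 \<partial>lborel) \<le> ennreal (C * norm p powr (4*\<beta> + 4 - s - a + \<kappa> - \<sigma>))"
proof (rule loss_weight_integral_upper[OF a \<beta> s])
 fix L C1 :: real
 assume L: "2 \<le> L" and C1: "0 < C1" and up: "\<And>(p::real^3) p1. \<lbrakk>L * norm p \<le> norm p1; 1 \<le> norm p1\<rbrakk> \<Longrightarrow>
  (\<integral>\<^sup>+x\<in>resonant_set a p p1. ennreal (loss_weight a \<beta> s p p1 x) \<partial>hausdorff2) \<le>
   ennreal (C1 * norm p1 powr (4*\<beta> - s + 1 - a) *
    (\<Sum>k\<in>{k::nat. 2 ^ k \<le> 4 * norm p1 \<and> (\<exists>x\<in>resonant_set a p p1. min (norm x) (norm (p + p1 - x)) \<le> 2 ^ k)}. 2 powr (k * (2*\<beta> + 2 - s))))"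
 define e where "e = 2*\<beta> + 2 - s"
 define \<gamma> where "\<gamma> = 4*\<beta> - s + 1 - a"
 define \<delta> where "\<delta> = s + a - 4*\<beta> - 4 - \<kappa>"
 have d0: "0 < \<delta>" using \<kappa> by (simp add: \<delta>_def)
 define D where "D = (a + 1) * 4 powr (a - 1) * 2 powr (a - 1)"
 have D: "0 < D" using a by (simp add: D_def)
 define g where "g = 2 powr \<bar>\<gamma>\<bar>"
 have g1: "0 < g" by (simp add: g_def)
 show thesis
 proof (rule energy_slab_volume_interpolated[OF a D \<sigma>])
  fix C2 assume C2: "0 < C2" and vol: "\<And>(p::real^3) r h E. \<lbrakk>0 < h; 0 < r; p \<noteq> 0; 4 * norm p \<le> r\<rbrakk> \<Longrightarrow>
  emeasure lborel {q. r \<le> norm q \<and> norm q \<le> 2 * r \<and> \<bar>norm (p + q) powr a - norm q powr a - E\<bar> \<le> D * h * r powr (a - 1)}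
   \<le> ennreal (C2 * r ^ 3 * (h / norm p) powr \<sigma>)"
  define A0 where "A0 = 1 / (1 - 2 powr (-\<kappa>))"
  have A0: "0 < A0" using \<kappa> powr_less_mono[of "-\<kappa>" 0 2] by (simp add: A0_def)
  define x where "x = 2 powr (-\<delta>)"
  have x: "0 < x" "x < 1" using d0 powr_less_mono[of "-\<delta>" 0 2] by (auto simp: x_def)
  define K where "K = C1 * g * C2 * A0 * 2 powr (3 * \<kappa>)"
  have K: "0 < K" using C1 g1 C2 A0 by (simp add: K_def)
  show thesis
  proof (rule that[of "max L 8" "K / (1 - x)"])
   show "8 \<le> max L 8" by simp
   show "0 < K / (1 - x)" using K x by simp
   fix p :: "real^3" assume p1': "1 \<le> norm p"
   define R where "R = norm p"
   have R: "1 \<le> R" "p \<noteq> 0" using p1' by (auto simp: R_def)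
   define S where "S j k = {q. 2 ^ j \<le> norm q \<and> norm q \<le> 2 * 2 ^ j \<and> \<bar>norm (p + q) powr a - norm q powr a - norm p powr a\<bar> \<le> D * 2 ^ k * (2 ^ j) powr (a - 1)}" for j k :: nat
   define c where "c j k = C1 * (g * (2 ^ j) powr \<gamma>) * 2 powr (k * e)" for j k :: nat
   have c0: "0 \<le> c j k" for j k using C1 g1 by (simp add: c_def)
   define T where "T j q = (if 4 * R \<le> 2 ^ j then \<Sum>k\<le>j+3. ennreal (c j k) * indicator (S j k) q else 0)" for j q
   define B where "B q = (\<Sum>j. T j q)" for q
   have SB: "S j k \<in> sets borel" for j k unfolding S_def by (rule borel_closed[OF closed_energy_slab[OF a]])
   have TB: "T j \<in> borel_measurable borel" for j
   proof (cases "4 * R \<le> 2 ^ j")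
    case True
    then have "T j = (\<lambda>q. \<Sum>k\<le>j+3. ennreal (c j k) * indicator (S j k) q)" unfolding T_def by auto
    then show ?thesis
     by (simp only:) (intro borel_measurable_sum borel_measurable_times_ennreal borel_measurable_const borel_measurable_indicator SB)
   next
    case False
    then have "T j = (\<lambda>q. 0)" unfolding T_def by auto
    then show ?thesis by simp
   qed
   have BB: "B \<in> borel_measurable borel" unfolding B_def using TB by measurable
   show "\<exists>B\<in>borel_measurable borel.
  (\<forall>p1. max L 8 * norm p \<le> norm p1 \<longrightarrow> (\<integral>\<^sup>+x\<in>resonant_set a p p1. ennreal (loss_weight a \<beta> s p p1 x) \<partial>hausdorff2) \<le> B p1) \<and>
  (\<integral>\<^sup>+p1. B p1 \<partial>lborel) \<le> ennreal (K / (1 - x) * norm p powr (4*\<beta> + 4 - s - a + \<kappa> - \<sigma>))"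
   proof (rule bexI[OF _ BB], intro conjI allI impI)
    fix p1 :: "real^3" assume far: "max L 8 * norm p \<le> norm p1"
    define Q where "Q = norm p1"
    have "L * R \<le> max L 8 * R" "8 * R \<le> max L 8 * R" using R by (auto intro!: mult_right_mono)
    then have Q: "L * R \<le> Q" "8 * R \<le> Q" using far by (auto simp: Q_def R_def)
    have Q1: "1 \<le> Q" using Q R by linarith
    have "2 ^ 0 \<le> Q" using Q1 by simp
    from dyadic_floor[OF this] obtain j where j: "2 ^ j \<le> Q" "Q < 2 ^ Suc j" by blast
    define Ks where "Ks = {k::nat. 2 ^ k \<le> 4 * norm p1 \<and> (\<exists>x\<in>resonant_set a p p1. min (norm x) (norm (p + p1 - x)) \<le> 2 ^ k)}"
    have KsS: "k \<le> j + 3 \<and> p1 \<in> S j k" if k: "k \<in> Ks" for k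
    proof
     have "2 ^ k \<le> 4 * Q" using k by (simp add: Ks_def Q_def)
     then have "(2::real) ^ k < 2 ^ (j + 3)" using j by (simp add: power_add)
     then show "k \<le> j + 3" by simp
     obtain z where z: "z \<in> resonant_set a p p1" "min (norm z) (norm (p + p1 - z)) \<le> 2 ^ k" "2 ^ k \<le> 4 * norm p1"
      using k by (auto simp: Ks_def)
     have "\<bar>norm (p + p1) powr a - norm p1 powr a - norm p powr a\<bar> \<le> (a + 1) * 4 powr (a - 1) * 2 ^ k * norm p1 powr (a - 1)"
      using Q R by (intro energy_defect_le[OF a z(1) _ z(2,3)]) (auto simp: Q_def R_def)
     also have "\<dots> \<le> (a + 1) * 4 powr (a - 1) * 2 ^ k * (2 * 2 ^ j) powr (a - 1)"
      using j a by (intro mult_left_mono powr_mono2) (auto simp: Q_def)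
     also have "\<dots> = D * 2 ^ k * (2 ^ j) powr (a - 1)" by (simp add: D_def powr_mult)
     finally show "p1 \<in> S j k" using j by (simp add: S_def Q_def)
    qed
    have gam: "Q powr \<gamma> \<le> g * (2 ^ j) powr \<gamma>"
    proof (cases "0 \<le> \<gamma>")
     case True
     have "Q powr \<gamma> \<le> (2 * 2 ^ j) powr \<gamma>" using j Q1 True by (intro powr_mono2) auto
     then show ?thesis using True by (simp add: g_def powr_mult)
    next
     case False
     have "Q powr \<gamma> \<le> (2 ^ j) powr \<gamma>" using j Q1 False by (intro powr_mono2') auto
     also have "\<dots> \<le> g * (2 ^ j) powr \<gamma>" using powr_mono[of 0 "\<bar>\<gamma>\<bar>" 2] by (simp add: g_def)
     finally show ?thesis .
    qed
    have "(\<integral>\<^sup>+x\<in>resonant_set a p p1. ennreal (loss_weight a \<beta> s p p1 x) \<partial>hausdorff2) \<le> ennreal (C1 * Q powr \<gamma> * (\<Sum>k\<in>Ks. 2 powr (k * e)))"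
     using up[of p p1] Q Q1 by (simp add: Q_def R_def \<gamma>_def Ks_def e_def)
    also have "\<dots> \<le> ennreal (\<Sum>k\<in>Ks. c j k)"
     unfolding c_def sum_distrib_left[symmetric] using gam C1 by (intro ennreal_leI mult_right_mono mult_left_mono sum_nonneg) auto
    also have "\<dots> = (\<Sum>k\<in>Ks. ennreal (c j k))" using c0 by (intro sum_ennreal[symmetric]) auto
    also have "\<dots> = (\<Sum>k\<in>Ks. ennreal (c j k) * indicator (S j k) p1)" using KsS by (intro sum.cong) auto
    also have "\<dots> \<le> (\<Sum>k\<le>j+3. ennreal (c j k) * indicator (S j k) p1)"
     using KsS by (intro sum_mono2) auto
    also have "\<dots> = T j p1" using j Q by (simp add: T_def)
    also have "\<dots> = (\<Sum>i\<in>{j}. T i p1)" by simp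
    also have "\<dots> \<le> B p1" unfolding B_def by (intro sum_le_suminf) auto
    finally show "(\<integral>\<^sup>+x\<in>resonant_set a p p1. ennreal (loss_weight a \<beta> s p p1 x) \<partial>hausdorff2) \<le> B p1" .
   next
    have "2 ^ 0 \<le> 4 * R" using R by simp
    from dyadic_floor[OF this] obtain J where J: "2 ^ J \<le> 4 * R" "4 * R < 2 ^ Suc J" by blast
    have Tj: "(\<integral>\<^sup>+q. T j q \<partial>lborel) \<le> ennreal (K * R powr (-\<sigma>) * (if J \<le> j then x ^ j else 0))" for j
    proof (cases "4 * R \<le> 2 ^ j")
     case False then show ?thesis by (simp add: T_def)
    next
     case True
     then have "(2::real) ^ J \<le> 2 ^ j" using J by linarith
     then have Jj: "J \<le> j" by simp
     have tm: "ennreal (c j k) * emeasure lborel (S j k) \<le> ennreal (C1 * g * C2 * R powr (-\<sigma>) * (2 ^ j) powr (\<gamma> + 3) * 2 powr (k * \<kappa>))" for k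
     proof -
      have "ennreal (c j k) * emeasure lborel (S j k) \<le> ennreal (c j k) * ennreal (C2 * (2 ^ j) ^ 3 * (2 ^ k / R) powr \<sigma>)"
       unfolding S_def R_def using True R by (intro mult_left_mono vol) (auto simp: R_def)
      also have "\<dots> = ennreal (c j k * (C2 * (2 ^ j) ^ 3 * (2 ^ k / R) powr \<sigma>))" using c0 C2 by (subst ennreal_mult) auto
      also have "c j k * (C2 * (2 ^ j) ^ 3 * (2 ^ k / R) powr \<sigma>) = C1 * g * C2 * R powr (-\<sigma>) * ((2 ^ j) powr \<gamma> * (2 ^ j) ^ 3) * (2 powr (k * e) * (2 ^ k) powr \<sigma>)"
       using R by (simp add: c_def powr_divide powr_minus_divide)
      also have "((2::real) ^ j) powr \<gamma> * (2 ^ j) ^ 3 = (2 ^ j) powr (\<gamma> + 3)"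
       by (subst powr_add) (simp add: powr_numeral)
      also have "2 powr (k * e) * (2 ^ k) powr \<sigma> = 2 powr (k * (e + \<sigma>))"
      proof -
       have "(2::real) ^ k = 2 powr k" by (simp add: powr_realpow)
       then show ?thesis by (simp add: powr_powr powr_add[symmetric] algebra_simps)
      qed
      also have "ennreal (C1 * g * C2 * R powr (-\<sigma>) * (2 ^ j) powr (\<gamma> + 3) * 2 powr (k * (e + \<sigma>))) \<le> ennreal (C1 * g * C2 * R powr (-\<sigma>) * (2 ^ j) powr (\<gamma> + 3) * 2 powr (k * \<kappa>))"
       using C1 g1 C2 \<kappa>(2) by (intro ennreal_leI mult_left_mono powr_mono) (auto simp: e_def)
      finally show ?thesis .
     qed
     have "(\<integral>\<^sup>+q. T j q \<partial>lborel) = (\<Sum>k\<le>j+3. ennreal (c j k) * emeasure lborel (S j k))"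
     proof -
      have "(\<integral>\<^sup>+q. T j q \<partial>lborel) = (\<integral>\<^sup>+q. (\<Sum>k\<le>j+3. ennreal (c j k) * indicator (S j k) q) \<partial>lborel)" using True by (simp only: T_def if_True)
      also have "\<dots> = (\<Sum>k\<le>j+3. (\<integral>\<^sup>+q. ennreal (c j k) * indicator (S j k) q \<partial>lborel))"
       by (intro nn_integral_sum) (use SB in \<open>auto intro!: borel_measurable_times_ennreal borel_measurable_indicator\<close>)
      also have "\<dots> = (\<Sum>k\<le>j+3. ennreal (c j k) * emeasure lborel (S j k))"
       by (intro sum.cong refl nn_integral_cmult_indicator) (use SB in auto)
      finally show ?thesis .
     qed
     also have "\<dots> \<le> (\<Sum>k\<le>j+3. ennreal (C1 * g * C2 * R powr (-\<sigma>) * (2 ^ j) powr (\<gamma> + 3) * 2 powr (k * \<kappa>)))"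
      by (intro sum_mono tm)
     also have "\<dots> = ennreal (C1 * g * C2 * R powr (-\<sigma>) * (2 ^ j) powr (\<gamma> + 3) * (\<Sum>k\<le>j+3. 2 powr (k * \<kappa>)))"
      unfolding sum_distrib_left using C1 g1 C2 by (intro sum_ennreal) auto
     also have "\<dots> \<le> ennreal (C1 * g * C2 * R powr (-\<sigma>) * (2 ^ j) powr (\<gamma> + 3) * (A0 * 2 powr (real (j + 3) * \<kappa>)))"
      unfolding A0_def by (intro ennreal_leI mult_left_mono dyadic_geometric_le \<kappa>(1)) (use C1 g1 C2 in auto)
     also have "C1 * g * C2 * R powr (-\<sigma>) * (2 ^ j) powr (\<gamma> + 3) * (A0 * 2 powr (real (j + 3) * \<kappa>)) = K * R powr (-\<sigma>) * x ^ j"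
     proof -
      have "(2 ^ j) powr (\<gamma> + 3) * 2 powr (real (j + 3) * \<kappa>) = 2 powr (3 * \<kappa>) * x ^ j"
      proof -
       have "(2::real) ^ j = 2 powr j" "x ^ j = x powr j" using x by (auto simp: powr_realpow)
       then show ?thesis by (simp add: x_def powr_powr powr_add[symmetric] \<delta>_def \<gamma>_def algebra_simps)
      qed
      then show ?thesis by (simp add: K_def)
     qed
     finally show ?thesis using Jj by simp
    qed
    have "(\<integral>\<^sup>+q. B q \<partial>lborel) = (\<Sum>j. \<integral>\<^sup>+q. T j q \<partial>lborel)" unfolding B_def using TB by (intro nn_integral_suminf) auto
    also have "\<dots> \<le> (\<Sum>j. ennreal (K * R powr (-\<sigma>) * (if J \<le> j then x ^ j else 0)))" by (intro suminf_le Tj) auto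
    also have "\<dots> = ennreal (K * R powr (-\<sigma>) * (x ^ J * (1 / (1 - x))))"
    proof (rule suminf_ennreal_eq)
     show "0 \<le> K * R powr - \<sigma> * (if J \<le> i then x ^ i else 0)" for i using K x by auto
     \<comment> \<open>only levels above \<open>|p|\<close> occur, which produces the decay in \<open>|p|\<close>\<close>
     have "(\<lambda>i. x ^ i) sums (1 / (1 - x))" using x by (intro geometric_sums) auto
     then have "(\<lambda>i. x ^ J * x ^ i) sums (x ^ J * (1 / (1 - x)))" by (rule sums_mult)
     then have "(\<lambda>i. (if J \<le> i + J then x ^ (i + J) else 0)) sums (x ^ J * (1 / (1 - x)))" by (simp add: power_add mult.commute)
     then have "(\<lambda>i. if J \<le> i then x ^ i else 0) sums (x ^ J * (1 / (1 - x)))"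
      by (subst (asm) sums_zero_iff_shift) auto
     then show "(\<lambda>i. K * R powr - \<sigma> * (if J \<le> i then x ^ i else 0)) sums (K * R powr - \<sigma> * (x ^ J * (1 / (1 - x))))" by (rule sums_mult)
    qed
    also have "\<dots> \<le> ennreal (K * R powr (-\<sigma>) * (R powr (-\<delta>) * (1 / (1 - x))))"
    proof -
     have "x ^ J = (2 ^ J) powr (-\<delta>)"
     proof -
      have "(2::real) ^ J = 2 powr J" "x ^ J = x powr J" using x by (auto simp: powr_realpow)
      then show ?thesis by (simp add: x_def powr_powr mult.commute)
     qed
     also have "\<dots> \<le> R powr (-\<delta>)" using J R d0 by (intro powr_mono2') auto
     finally show ?thesis using K x by (intro ennreal_leI mult_left_mono mult_right_mono) auto
    qed
    also have "K * R powr (-\<sigma>) * (R powr (-\<delta>) * (1 / (1 - x))) = K / (1 - x) * (R powr (-\<sigma>) * R powr (-\<delta>))" by simp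
    also have "R powr (-\<sigma>) * R powr (-\<delta>) = R powr (4*\<beta> + 4 - s - a + \<kappa> - \<sigma>)"
     by (simp add: powr_add[symmetric] \<delta>_def algebra_simps)
    finally show "(\<integral>\<^sup>+p1. B p1 \<partial>lborel) \<le> ennreal (K / (1 - x) * norm p powr (4*\<beta> + 4 - s - a + \<kappa> - \<sigma>))" unfolding R_def .
   qed
  qed
 qed
qed

section \<open>Moderate momenta: non-negativity and the main shells\<close>

lemma half_annulus_borel: "{q::real^3. r \<le> norm q \<and> norm q < r' \<and> p \<bullet> q \<le> 0} \<in> sets borel"
proof -
 have "closed {q. p \<bullet> q \<le> 0}" by (intro closed_Collect_le continuous_intros)
 then have "(ball (0::real^3) r' - ball 0 r) \<inter> {q. p \<bullet> q \<le> 0} \<in> sets borel" by (intro sets.Int sets.Diff borel_closed borel_open) auto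
 moreover have "(ball (0::real^3) r' - ball 0 r) \<inter> {q. p \<bullet> q \<le> 0} = {q::real^3. r \<le> norm q \<and> norm q < r' \<and> p \<bullet> q \<le> 0}" by auto
 ultimately show ?thesis by simp
qed

lemma half_annulus_volume:
 fixes p :: "real^3"
 assumes r: "0 < r"
 shows "ennreal (3 * unit_ball_vol 3 * r ^ 3) \<le> emeasure lborel {q. r \<le> norm q \<and> norm q < 2 * r \<and> p \<bullet> q \<le> 0}"
proof -
 define H where "H = ball (0::real^3) (2 * r) - ball 0 r"
 have v0: "0 \<le> unit_ball_vol 3" by simp
 have "emeasure lborel H = emeasure lborel (ball (0::real^3) (2 * r)) - emeasure lborel (ball (0::real^3) r)"
  unfolding H_def using r by (intro emeasure_Diff subset_ball) (auto simp: emeasure_ball)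
 also have "\<dots> = ennreal (unit_ball_vol 3 * (2 * r) ^ 3) - ennreal (unit_ball_vol 3 * r ^ 3)" using r by (simp add: emeasure_ball)
 also have "\<dots> = ennreal (unit_ball_vol 3 * (2 * r) ^ 3 - unit_ball_vol 3 * r ^ 3)" using v0 r by (intro ennreal_minus) auto
 also have "unit_ball_vol 3 * (2 * r) ^ 3 - unit_ball_vol 3 * r ^ 3 = 7 * unit_ball_vol 3 * r ^ 3" by (simp add: power3_eq_cube)
 finally have vol: "emeasure lborel H = ennreal (7 * unit_ball_vol 3 * r ^ 3)" .
 have "ennreal (2 * (3 * unit_ball_vol 3 * r ^ 3)) \<le> emeasure lborel H" unfolding vol using v0 r by (intro ennreal_leI) auto
 also have "\<dots> \<le> 2 * emeasure lborel (H \<inter> {q. p \<bullet> q \<le> 0})" by (rule half_space_volume) (auto simp: H_def)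
 also have "H \<inter> {q. p \<bullet> q \<le> 0} = {q. r \<le> norm q \<and> norm q < 2 * r \<and> p \<bullet> q \<le> 0}" by (auto simp: H_def)
 finally have "ennreal (1/2) * ennreal (2 * (3 * unit_ball_vol 3 * r ^ 3)) \<le> ennreal (1/2) * (2 * emeasure lborel {q. r \<le> norm q \<and> norm q < 2 * r \<and> p \<bullet> q \<le> 0})" by (rule mult_left_mono) simp
 also have "\<dots> = emeasure lborel {q. r \<le> norm q \<and> norm q < 2 * r \<and> p \<bullet> q \<le> 0}"
 proof -
  have "ennreal (1/2) * ennreal 2 = ennreal 1" by (subst ennreal_mult[symmetric]) auto
  then have "ennreal (1/2) * 2 = 1" by (simp only: ennreal_numeral ennreal_1)
  then show ?thesis by (simp add: mult.assoc[symmetric])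
 qed
 also have "ennreal (1/2) * ennreal (2 * (3 * unit_ball_vol 3 * r ^ 3)) = ennreal (3 * unit_ball_vol 3 * r ^ 3)"
  using v0 r by (subst ennreal_mult[symmetric]) auto
 finally show ?thesis .
qed

lemma lacunary_less:
 fixes P :: "nat \<Rightarrow> real"
 assumes "\<And>n. 0 \<le> P n" "\<And>n. 4 * P n \<le> P (Suc n)" "k < n"
 shows "4 * P k \<le> P n"
 using assms(3)
proof (induction n)
 case (Suc n)
 show ?case
 proof (cases "k = n")
  case False
  then have "4 * P k \<le> P n" using Suc by simp
  then show ?thesis using assms(1)[of n] assms(2)[of n] by linarith
 qed (use assms(2) in simp)
qed simp

text \<open>An interval of radii \<open>[r, 2r]\<close> contains at most one member of a lacunary sequence, hence a subinterval
of proportional length that stays away from the sequence.\<close>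

lemma lacunary_window:
 fixes P :: "nat \<Rightarrow> real"
 assumes P: "\<And>n. 0 \<le> P n" "\<And>n. 4 * P n \<le> P (Suc n)" and r: "8 \<le> r"
 obtains t1 t2 where "r \<le> t1" "t2 \<le> 2 * r" "t1 + r / 4 \<le> t2" "\<And>n t. t1 \<le> t \<Longrightarrow> t \<le> t2 \<Longrightarrow> 1 \<le> \<bar>t - P n\<bar>"
proof (cases "\<exists>n. r - 1 < P n \<and> P n < 2 * r + 1")
 case False
 have 4: "1 \<le> \<bar>t - P n\<bar>" if "r \<le> t" "t \<le> 2 * r" for n t using False that r by (smt (verit))
 show ?thesis by (rule that[of r "2 * r"]) (use r 4 in auto)
next
 case True
 then obtain n where n: "r - 1 < P n" "P n < 2 * r + 1" by blast
 have oth: "P k < r - 1 \<or> 2 * r + 1 < P k" if "k \<noteq> n" for k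
 proof (cases "k < n")
  case True then have "4 * P k \<le> P n" using lacunary_less[of P k n] P by blast
  then show ?thesis using n r by linarith
 next
  case False
  then have "n < k" using that by simp
  then have "4 * P n \<le> P k" using lacunary_less[of P n k] P by blast
  then show ?thesis using n r by linarith
 qed
 show ?thesis
 proof (cases "P n \<le> 3/2 * r")
  case True
  have "1 \<le> \<bar>t - P k\<bar>" if "3/2 * r + 1 \<le> t" "t \<le> 2 * r" for k t
   using oth[of k] that True r by (cases "k = n") (auto simp: abs_if)
  then show ?thesis by (intro that[of "3/2 * r + 1" "2 * r"]) (use r in auto)
 next
  case False
  have "1 \<le> \<bar>t - P k\<bar>" if "r \<le> t" "t \<le> 3/2 * r - 1" for k t
   using oth[of k] that False r by (cases "k = n") (auto simp: abs_if)
  then show ?thesis by (intro that[of r "3/2 * r - 1"]) (use r in auto)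
 qed
qed

definition collision_balance :: "(real^3 \<Rightarrow> real) \<Rightarrow> real^3 \<Rightarrow> real^3 \<Rightarrow> real^3 \<Rightarrow> real" where
 "collision_balance g p p1 x = g p1 * g x * g (p + p1 - x) + g p * g x * g (p + p1 - x) - g p * g p1 * g x - g p * g p1 * g (p + p1 - x)"

definition kernel :: "real \<Rightarrow> real^3 \<Rightarrow> real^3 \<Rightarrow> real^3 \<Rightarrow> real" where
 "kernel \<beta> p p1 x = rpow (norm p1) (2*\<beta>) * rpow (norm x) (2*\<beta>) * rpow (norm (p + p1 - x)) (2*\<beta>)"

lemma kernel_nonneg [simp]: "0 \<le> kernel \<beta> p p1 x"
 by (simp add: kernel_def)

lemma density_eq: "density a \<beta> g p p1 x = kernel \<beta> p p1 x * collision_balance g p p1 x / norm (gradient (resonance a p p1) x)"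
 by (simp add: density_def integrand_def Let_def collision_balance_def kernel_def)

text \<open>The loss can dominate only where \<open>x\<close> or \<open>y\<close> is within \<open>\<rho>\<close> of \<open>p\<close>, that is, where \<open>x\<close> is within \<open>\<rho>\<close> of \<open>p\<close> or \<open>p1\<close>;
this part of the surface contributes at most a multiple of \<open>\<rho>\<close>.  The set \<open>A\<close> is a part of the surface on
which the density is bounded below; the empty set is a permitted choice.\<close>

lemma inner_integral_ge_off_hole:
 fixes a \<beta> R0 R1 :: real
 assumes a: "1 \<le> a" and \<beta>: "0 \<le> \<beta>" and R0: "0 < R0"
 obtains K where "0 \<le> K" "\<And>p p1 g \<rho> A b l. \<lbrakk>R0 \<le> norm p; norm p \<le> R1; norm p1 \<le> R1; 0 < \<rho>; \<And>z. \<bar>g z\<bar> \<le> 2;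
   set_integrable hausdorff2 (resonant_set a p p1) (density a \<beta> g p p1);
   \<And>x. x \<in> resonant_set a p p1 \<Longrightarrow> x \<notin> cball p \<rho> \<Longrightarrow> p + p1 - x \<notin> cball p \<rho> \<Longrightarrow> 0 \<le> density a \<beta> g p p1 x;
   A \<in> sets borel; A \<subseteq> resonant_set a p p1; \<And>x. x \<in> A \<Longrightarrow> b \<le> density a \<beta> g p p1 x;
   ennreal l \<le> ennreal b * emeasure hausdorff2 A; 0 \<le> l\<rbrakk>
  \<Longrightarrow> l - K * \<rho> \<le> inner_integral a \<beta> g p p1"
proof (rule resonant_near_upper[OF a R0, where ?R1.0 = R1])
 fix C assume C: "0 \<le> C" and up: "\<And>(p::real^3) p1 c \<rho>. \<lbrakk>R0 \<le> norm p; norm p \<le> R1; norm p1 \<le> R1; 0 < \<rho>\<rbrakk> \<Longrightarrow>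
  \<exists>G\<ge>0. (\<forall>x\<in>resonant_set a p p1. x \<noteq> 0 \<longrightarrow> x \<noteq> p + p1 \<longrightarrow>
    inverse (norm (gradient (resonance a p p1) x)) \<le> G) \<and>
   emeasure hausdorff2 (resonant_set a p p1 \<inter> cball c \<rho>) * ennreal G \<le> ennreal (C * \<rho>)"
 define M where "M = rpow (2 * \<bar>R1\<bar>) (2*\<beta>) * rpow (2 * \<bar>R1\<bar>) (2*\<beta>) * rpow (2 * \<bar>R1\<bar>) (2*\<beta>) * 32"
 have M0: "0 \<le> M" by (simp add: M_def)
 show thesis
 proof (rule that[of "M * (2 * C)"])
  show "0 \<le> M * (2 * C)" using M0 C by simp
  fix p p1 g \<rho> A b l
  assume p: "R0 \<le> norm p" "norm p \<le> R1" "norm p1 \<le> R1" "0 < \<rho>" and g: "\<And>z. \<bar>g z\<bar> \<le> 2"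
   and int: "set_integrable hausdorff2 (resonant_set a p p1) (density a \<beta> g p p1)"
   and off: "\<And>x. x \<in> resonant_set a p p1 \<Longrightarrow> x \<notin> cball p \<rho> \<Longrightarrow> p + p1 - x \<notin> cball p \<rho> \<Longrightarrow> 0 \<le> density a \<beta> g p p1 x"
   and A: "A \<in> sets borel" "A \<subseteq> resonant_set a p p1" "\<And>x. x \<in> A \<Longrightarrow> b \<le> density a \<beta> g p p1 x"
    "ennreal l \<le> ennreal b * emeasure hausdorff2 A" "0 \<le> l"
  define S where "S = resonant_set a p p1"
  have SB: "S \<in> sets borel" unfolding S_def using closed_resonant_set[OF a] by (rule borel_closed)
  define Bd where "Bd = cball p \<rho> \<union> cball p1 \<rho>"
  define W where "W x = inverse (norm (gradient (resonance a p p1) x)) * indicator Bd x" for x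
  have neg: "- (M * W x) \<le> density a \<beta> g p p1 x" if x: "x \<in> S" for x
  proof (cases "x \<in> Bd")
   case False
   then have "dist p1 x > \<rho>" by (auto simp: Bd_def)
   moreover have "dist p (p + p1 - x) = dist p1 x" by (simp add: dist_norm norm_minus_commute)
   ultimately show ?thesis using off[of x] x False by (auto simp: S_def W_def Bd_def)
  next
   case True
   have R: "norm p \<le> \<bar>R1\<bar>" "norm p1 \<le> \<bar>R1\<bar>" using p by auto
   have xy: "norm x \<le> 2 * \<bar>R1\<bar>" "norm (p + p1 - x) \<le> 2 * \<bar>R1\<bar>" "norm p1 \<le> 2 * \<bar>R1\<bar>"
    using resonant_norm_le[OF a _ R] x R by (auto simp: S_def)
   have k: "kernel \<beta> p p1 x \<le> rpow (2 * \<bar>R1\<bar>) (2*\<beta>) * rpow (2 * \<bar>R1\<bar>) (2*\<beta>) * rpow (2 * \<bar>R1\<bar>) (2*\<beta>)"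
    unfolding kernel_def using xy \<beta> by (intro mult_mono rpow_mono mult_nonneg_nonneg) auto
   have t: "\<bar>g u * g v * g w\<bar> \<le> 8" for u v w
   proof -
    have "\<bar>g u\<bar> * \<bar>g v\<bar> * \<bar>g w\<bar> \<le> 2 * 2 * 2" using g by (intro mult_mono) auto
    then show ?thesis by (simp add: abs_mult)
   qed
   have "\<bar>collision_balance g p p1 x\<bar> \<le> 32" unfolding collision_balance_def
    using t[of p1 x "p + p1 - x"] t[of p x "p + p1 - x"] t[of p p1 x] t[of p p1 "p + p1 - x"] by linarith
   then have "kernel \<beta> p p1 x * \<bar>collision_balance g p p1 x\<bar> \<le> M" unfolding M_def using k by (intro mult_mono) auto
   then have "\<bar>kernel \<beta> p p1 x * collision_balance g p p1 x\<bar> \<le> M" by (simp add: abs_mult)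
   then have "- M \<le> kernel \<beta> p p1 x * collision_balance g p p1 x" by linarith
   then have "- M * inverse (norm (gradient (resonance a p p1) x)) \<le> kernel \<beta> p p1 x * collision_balance g p p1 x * inverse (norm (gradient (resonance a p p1) x))"
    by (rule mult_right_mono) simp
   then show ?thesis using True by (simp add: W_def density_eq divide_inverse)
  qed
  obtain G where G: "0 \<le> G" "\<And>x. x \<in> S \<Longrightarrow> x \<noteq> 0 \<Longrightarrow> x \<noteq> p + p1 \<Longrightarrow> inverse (norm (gradient (resonance a p p1) x)) \<le> G"
   "emeasure hausdorff2 (S \<inter> cball p \<rho>) * ennreal G \<le> ennreal (C * \<rho>)"
   using up[OF p, of p] unfolding S_def by blast
  obtain H where H: "0 \<le> H" "\<And>x. x \<in> S \<Longrightarrow> x \<noteq> 0 \<Longrightarrow> x \<noteq> p + p1 \<Longrightarrow> inverse (norm (gradient (resonance a p p1) x)) \<le> H"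
   "emeasure hausdorff2 (S \<inter> cball p1 \<rho>) * ennreal H \<le> ennreal (C * \<rho>)"
   using up[OF p, of p1] unfolding S_def by blast
  have cB: "S \<inter> cball c \<rho> \<in> sets hausdorff2" for c unfolding sets_hausdorff2 by (rule sets.Int[OF SB borel_closed]) auto
  \<comment> \<open>the bound on the inverse gradient may differ for the two balls\<close>
  have U: "(\<integral>\<^sup>+x\<in>S. ennreal (W x) \<partial>hausdorff2) \<le> ennreal (2 * C * \<rho>)"
  proof -
   have "AE x in hausdorff2. x \<noteq> (0::real^3) \<and> x \<noteq> p + p1"
    using AE_hausdorff2_neq[of "0::real^3"] AE_hausdorff2_neq[of "p + p1"] by eventually_elim simp
   then have "AE x in hausdorff2. ennreal (W x) * indicator S x \<le> ennreal G * indicator (S \<inter> cball p \<rho>) x + ennreal H * indicator (S \<inter> cball p1 \<rho>) x"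
   proof eventually_elim
    case (elim x)
    show ?case
    proof (cases "x \<in> S \<and> x \<in> Bd")
     case True
     then have w: "ennreal (W x) \<le> ennreal G" "ennreal (W x) \<le> ennreal H"
      using G(2)[of x] H(2)[of x] elim by (auto simp: W_def intro: ennreal_leI)
     have "x \<in> cball p \<rho> \<or> x \<in> cball p1 \<rho>" using True by (auto simp: Bd_def)
     then show ?thesis
     proof
      assume "x \<in> cball p \<rho>"
      then show ?thesis using True w(1) by (auto intro: order_trans[OF w(1)] simp: indicator_def)
     next
      assume "x \<in> cball p1 \<rho>"
      then show ?thesis using True w(2) by (auto intro: order_trans[OF w(2)] simp: indicator_def)
     qed
    qed (auto simp: W_def indicator_def)
   qed
   then have "(\<integral>\<^sup>+x\<in>S. ennreal (W x) \<partial>hausdorff2) \<le> (\<integral>\<^sup>+x. ennreal G * indicator (S \<inter> cball p \<rho>) x + ennreal H * indicator (S \<inter> cball p1 \<rho>) x \<partial>hausdorff2)"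
    by (rule nn_integral_mono_AE)
   also have "\<dots> = ennreal G * emeasure hausdorff2 (S \<inter> cball p \<rho>) + ennreal H * emeasure hausdorff2 (S \<inter> cball p1 \<rho>)"
    using cB by (subst nn_integral_add) (auto simp: nn_integral_cmult_indicator)
   also have "\<dots> \<le> ennreal (C * \<rho>) + ennreal (C * \<rho>)" using G(3) H(3) by (intro add_mono) (simp_all add: mult.commute)
   also have "\<dots> = ennreal (2 * C * \<rho>)" using C p by (simp add: ennreal_plus[symmetric] del: ennreal_plus)
   finally show ?thesis .
  qed
  have "(\<Sum>k\<in>{()}. l) - M * (2 * C * \<rho>) \<le> (LINT x:S|hausdorff2. density a \<beta> g p p1 x)"
  proof (rule set_integral_ge_shells[where W = W and A = "\<lambda>_. A" and b = "\<lambda>_. b"])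
   show "set_integrable hausdorff2 S (density a \<beta> g p p1)" using int by (simp add: S_def)
   show "0 \<le> W x" for x by (simp add: W_def)
  qed (use neg U M0 A C p in \<open>auto simp: S_def sets_hausdorff2\<close>)
  then show "l - M * (2 * C) * \<rho> \<le> inner_integral a \<beta> g p p1" by (simp add: inner_integral_def S_def mult.assoc)
 qed
qed

text \<open>Here \<open>p1\<close> is the small incoming momentum; by symmetry the bounds for shells apply with \<open>p\<close> and \<open>p1\<close> exchanged.\<close>

lemma main_shell_lower:
 fixes a \<beta> s :: real
 assumes a: "1 \<le> a" and \<beta>: "0 \<le> \<beta>" and s: "0 \<le> s"
 obtains \<nu> L c where "8 \<le> \<nu>" "4 * \<nu> + 2 \<le> L" "0 < c" "\<And>(p::real^3) p1 g t1 t2. \<lbrakk>p \<bullet> p1 \<le> 0; 1 \<le> norm p1; L * norm p1 \<le> norm p;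
   \<nu> * norm p1 \<le> t1; t1 + \<nu> * norm p1 / 4 \<le> t2; t2 \<le> 2 * (\<nu> * norm p1);
   \<And>x. x \<in> resonant_set a p p1 \<Longrightarrow> t1 \<le> norm x \<Longrightarrow> norm x \<le> t2 \<Longrightarrow> 1/16 * (wt s p1 * wt s x * wt s (p + p1 - x)) \<le> collision_balance g p p1 x\<rbrakk>
  \<Longrightarrow> \<exists>A b. A \<in> sets borel \<and> A \<subseteq> resonant_set a p p1 \<and> (\<forall>x\<in>A. b \<le> density a \<beta> g p p1 x) \<and>
   ennreal (c * norm p1 powr (4*\<beta> - 2 * s + 2) * norm p powr (2*\<beta> - s + 1 - a)) \<le> ennreal b * emeasure hausdorff2 A"
proof (rule resonant_shell_lower[OF a])
 fix L c :: real
 assume L: "1 \<le> L" and c: "0 < c" and low: "\<And>p p1 r T. \<lbrakk>p \<bullet> p1 \<le> 0; p \<noteq> 0; L * norm p \<le> r; L * r \<le> norm p1; T \<in> sets borel; T \<subseteq> {r..2*r}\<rbrakk> \<Longrightarrow>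
  \<exists>G>0. (\<forall>x\<in>resonant_set a p p1. norm x \<in> T \<longrightarrow> x \<noteq> 0 \<and> x \<noteq> p + p1 \<and>
    0 < norm (gradient (resonance a p p1) x) \<and> norm (gradient (resonance a p p1) x) \<le> G) \<and>
   ennreal (c * r * norm p1 powr (1 - a) * G) * emeasure lborel T \<le> emeasure hausdorff2 {x \<in> resonant_set a p p1. norm x \<in> T}"
 define \<nu> where "\<nu> = 8 * L"
 define c0 where "c0 = 2 powr (- (2*\<beta>)) * (1/16) * 2 powr (-s) * (4 * \<nu>) powr (-s) * 4 powr (-s)"
 have nu: "8 \<le> \<nu>" using L by (simp add: \<nu>_def)
 have c00: "0 < c0" unfolding c0_def using nu by simp
 show thesis
 proof (rule that[of \<nu> "4 * \<nu> * L + 2" "c0 * c * \<nu>\<^sup>2 / 4"])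
  show "8 \<le> \<nu>" by (rule nu)
  show "4 * \<nu> + 2 \<le> 4 * \<nu> * L + 2" using nu L by simp
  show "0 < c0 * c * \<nu>\<^sup>2 / 4" using c00 c nu by simp
  fix p p1 :: "real^3" and g t1 t2
  assume h: "p \<bullet> p1 \<le> 0" "1 \<le> norm p1" "(4 * \<nu> * L + 2) * norm p1 \<le> norm p"
   and t: "\<nu> * norm p1 \<le> t1" "t1 + \<nu> * norm p1 / 4 \<le> t2" "t2 \<le> 2 * (\<nu> * norm p1)"
   and bal: "\<And>x. x \<in> resonant_set a p p1 \<Longrightarrow> t1 \<le> norm x \<Longrightarrow> norm x \<le> t2 \<Longrightarrow> 1/16 * (wt s p1 * wt s x * wt s (p + p1 - x)) \<le> collision_balance g p p1 x"
  define q R where "q = norm p1" and "R = norm p"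
  have q1: "1 \<le> q" using h by (simp add: q_def)
  have Rq: "4 * (\<nu> * L * q) + 2 * q \<le> R" using h by (simp add: q_def R_def algebra_simps)
  have nq: "\<nu> * q * 1 \<le> \<nu> * q * L" "1 * q \<le> \<nu> * q" using L nu q1 by (intro mult_left_mono mult_right_mono; simp)+
  have R4: "4 * (\<nu> * q) + 2 * q \<le> R" using Rq nq by (simp add: ac_simps)
  define S where "S = resonant_set a p p1"
  have Lq: "L * q \<le> \<nu> * q" using L q1 by (intro mult_right_mono) (auto simp: \<nu>_def)
  have p10: "p1 \<noteq> 0" using h by auto
  have LR: "L * (\<nu> * q) \<le> R"
  proof -
   have "0 \<le> \<nu> * L * q" using nu L q1 by simp
   then have "\<nu> * L * q \<le> R" using Rq q1 by (simp add: mult.assoc)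
   then show ?thesis by (simp add: ac_simps)
  qed
  have sub: "{t1..t2} \<subseteq> {\<nu> * q..2 * (\<nu> * q)}" using t by (auto simp: q_def)
  obtain G where G: "0 < G" "\<And>x. x \<in> S \<Longrightarrow> norm x \<in> {t1..t2} \<Longrightarrow> 0 < norm (gradient (resonance a p p1) x) \<and> norm (gradient (resonance a p p1) x) \<le> G"
   "ennreal (c * (\<nu> * q) * R powr (1 - a) * G) * emeasure lborel {t1..t2} \<le> emeasure hausdorff2 {x \<in> S. norm x \<in> {t1..t2}}"
  proof -
   have "\<exists>G>0. (\<forall>x\<in>resonant_set a p1 p. norm x \<in> {t1..t2} \<longrightarrow> x \<noteq> 0 \<and> x \<noteq> p1 + p \<and>
    0 < norm (gradient (resonance a p1 p) x) \<and> norm (gradient (resonance a p1 p) x) \<le> G) \<and>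
   ennreal (c * (\<nu> * q) * norm p powr (1 - a) * G) * emeasure lborel {t1..t2} \<le> emeasure hausdorff2 {x \<in> resonant_set a p1 p. norm x \<in> {t1..t2}}"
    using h(1) p10 Lq LR sub by (intro low) (auto simp: q_def R_def inner_commute)
   then show thesis unfolding resonant_set_commute[of a p1 p] resonance_commute[of a p1 p] using that unfolding S_def R_def by blast
  qed
  define A where "A = {x \<in> S. norm x \<in> {t1..t2}}"
  have AB: "A \<in> sets borel"
  proof -
   have "closed {x::real^3. t1 \<le> norm x}" "closed {x::real^3. norm x \<le> t2}" by (intro closed_Collect_le continuous_intros)+
   then have "closed (S \<inter> ({x. t1 \<le> norm x} \<inter> {x. norm x \<le> t2}))" unfolding S_def using closed_resonant_set[OF a] by (intro closed_Int)
   moreover have "S \<inter> ({x. t1 \<le> norm x} \<inter> {x. norm x \<le> t2}) = A" by (auto simp: A_def)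
   ultimately show ?thesis by (auto intro: borel_closed)
  qed
  define b where "b = c0 * q powr (4*\<beta> - 2 * s) * R powr (2*\<beta> - s) / G"
  have R0: "0 < R" using R4 q1 nq by linarith
  have dens: "b \<le> density a \<beta> g p p1 x" if x: "x \<in> A" for x
  proof -
   have xS: "x \<in> resonant_set a p p1" and xt: "t1 \<le> norm x" "norm x \<le> t2" using x by (auto simp: A_def S_def)
   have xn: "\<nu> * q \<le> norm x" "norm x \<le> 2 * (\<nu> * q)" using xt t by (auto simp: q_def)
   have qR: "norm p \<le> R" "norm p1 \<le> R" using R4 q1 nq by (auto simp: R_def q_def)
   have yu: "norm (p + p1 - x) \<le> 2 * R" by (rule resonant_norm_le(2)[OF a xS qR])
   have "norm p \<le> norm (p + p1 - x) + norm (x - p1)" using norm_triangle_ineq[of "p + p1 - x" "x - p1"] by simp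
   moreover have "norm (x - p1) \<le> norm x + norm p1" by (rule norm_triangle_ineq4)
   ultimately have yl: "R / 2 \<le> norm (p + p1 - x)" using xn R4 q1 nq by (simp add: R_def q_def)
   have k: "q powr (2*\<beta>) * q powr (2*\<beta>) * (R / 2) powr (2*\<beta>) \<le> kernel \<beta> p p1 x"
   proof -
    have "rpow q (2*\<beta>) * rpow q (2*\<beta>) * rpow (R / 2) (2*\<beta>) \<le> kernel \<beta> p p1 x"
     unfolding kernel_def using xn nq yl \<beta> q1 R0 by (intro mult_mono rpow_mono mult_nonneg_nonneg) (auto simp: q_def)
    then show ?thesis using q1 R0 by (simp add: rpow_pos)
   qed
   have w1: "(2 * q) powr (-s) \<le> wt s p1" using q1 by (intro wt_ge s japanese_le) (auto simp: q_def)
   have w2: "(2 * (2 * (\<nu> * q))) powr (-s) \<le> wt s x"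
   proof -
    have "1 \<le> 2 * (\<nu> * q)" using nq(2) q1 by linarith
    then show ?thesis by (intro wt_ge s japanese_le xn)
   qed
   have w3: "(2 * (2 * R)) powr (-s) \<le> wt s (p + p1 - x)"
   proof -
    have "1 \<le> 2 * R" using nq(2) q1 R4 by linarith
    then show ?thesis by (intro wt_ge s japanese_le yu)
   qed
   have "1/16 * ((2 * q) powr (-s) * (2 * (2 * (\<nu> * q))) powr (-s) * (2 * (2 * R)) powr (-s)) \<le> 1/16 * (wt s p1 * wt s x * wt s (p + p1 - x))"
    using w1 w2 w3 by (intro mult_left_mono mult_mono) auto
   also have "\<dots> \<le> collision_balance g p p1 x" by (rule bal[OF xS xt])
   finally have N: "1/16 * ((2 * q) powr (-s) * (2 * (2 * (\<nu> * q))) powr (-s) * (2 * (2 * R)) powr (-s)) \<le> collision_balance g p p1 x" .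
   have "(q powr (2*\<beta>) * q powr (2*\<beta>) * (R / 2) powr (2*\<beta>)) * (1/16 * ((2 * q) powr (-s) * (2 * (2 * (\<nu> * q))) powr (-s) * (2 * (2 * R)) powr (-s))) \<le> kernel \<beta> p p1 x * collision_balance g p p1 x"
    using k N by (intro mult_mono) auto
   also have "(q powr (2*\<beta>) * q powr (2*\<beta>) * (R / 2) powr (2*\<beta>)) * (1/16 * ((2 * q) powr (-s) * (2 * (2 * (\<nu> * q))) powr (-s) * (2 * (2 * R)) powr (-s)))
    = c0 * (q powr (2*\<beta>) * q powr (2*\<beta>) * q powr (-s) * q powr (-s)) * (R powr (2*\<beta>) * R powr (-s))"
   proof -
    have "(R / 2) powr (2*\<beta>) = 2 powr (- (2*\<beta>)) * R powr (2*\<beta>)" using R0 by (simp add: powr_divide powr_minus_divide)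
    moreover have "(2 * q) powr (-s) = 2 powr (-s) * q powr (-s)" using q1 by (subst powr_mult) auto
    moreover have "(2 * (2 * (\<nu> * q))) powr (-s) = (4 * \<nu>) powr (-s) * q powr (-s)" using q1 nu by (subst powr_mult[symmetric]) (auto simp: ac_simps)
    moreover have "(2 * (2 * R)) powr (-s) = 4 powr (-s) * R powr (-s)" using R0 by (subst powr_mult[symmetric]) auto
    ultimately show ?thesis by (simp add: c0_def ac_simps)
   qed
   also have "q powr (2*\<beta>) * q powr (2*\<beta>) * q powr (-s) * q powr (-s) = q powr (4*\<beta> - 2 * s)" by (simp add: powr_add[symmetric])
   also have "R powr (2*\<beta>) * R powr (-s) = R powr (2*\<beta> - s)" by (simp add: powr_add[symmetric])
   finally have kb: "c0 * q powr (4*\<beta> - 2 * s) * R powr (2*\<beta> - s) \<le> kernel \<beta> p p1 x * collision_balance g p p1 x" .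
   have gr: "0 < norm (gradient (resonance a p p1) x)" "norm (gradient (resonance a p p1) x) \<le> G" using G(2)[of x] x by (auto simp: A_def)
   show ?thesis unfolding b_def density_eq using kb gr c00 by (intro frac_le) (auto intro: order_trans[OF _ kb])
  qed
  have "ennreal (c0 * c * \<nu>\<^sup>2 / 4 * q powr (4*\<beta> - 2 * s + 2) * R powr (2*\<beta> - s + 1 - a)) \<le> ennreal b * emeasure hausdorff2 A"
  proof -
   have "ennreal (c0 * c * \<nu>\<^sup>2 / 4 * q powr (4*\<beta> - 2 * s + 2) * R powr (2*\<beta> - s + 1 - a)) = ennreal (b * (c * (\<nu> * q) * R powr (1 - a) * G * (\<nu> * q / 4)))"
   proof -
    have "q powr (4*\<beta> - 2 * s + 2) = q powr (4*\<beta> - 2 * s) * q\<^sup>2" using q1 by (subst powr_add) (simp add: powr_numeral)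
    moreover have "R powr (2*\<beta> - s + 1 - a) = R powr (2*\<beta> - s) * R powr (1 - a)"
     unfolding powr_add[symmetric] by (simp add: algebra_simps)
    ultimately show ?thesis using G(1) by (simp add: b_def power2_eq_square ac_simps)
   qed
   also have "\<dots> = ennreal b * (ennreal (c * (\<nu> * q) * R powr (1 - a) * G) * ennreal (\<nu> * q / 4))"
   proof -
    have b0: "0 \<le> b" and x0: "0 \<le> c * (\<nu> * q) * R powr (1 - a) * G" and y0: "0 \<le> \<nu> * q / 4"
     using c00 c nu q1 G(1) by (auto simp: b_def)
    show ?thesis by (simp only: ennreal_mult[OF b0 mult_nonneg_nonneg[OF x0 y0]] ennreal_mult[OF x0 y0])
   qed
   also have "\<dots> \<le> ennreal b * (ennreal (c * (\<nu> * q) * R powr (1 - a) * G) * emeasure lborel {t1..t2})"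
   proof -
    have "t1 \<le> t2" using t nu q1 mult_nonneg_nonneg[of \<nu> "norm p1"] by simp
    then have "ennreal (\<nu> * q / 4) \<le> emeasure lborel {t1..t2}" using t by (auto simp: q_def intro!: ennreal_leI)
    then show ?thesis by (intro mult_left_mono) auto
   qed
   also have "\<dots> \<le> ennreal b * emeasure hausdorff2 A" unfolding A_def by (intro mult_left_mono G(3)) auto
   finally show ?thesis .
  qed
  then show "\<exists>A b. A \<in> sets borel \<and> A \<subseteq> resonant_set a p p1 \<and> (\<forall>x\<in>A. b \<le> density a \<beta> g p p1 x) \<and>
   ennreal (c0 * c * \<nu>\<^sup>2 / 4 * norm p1 powr (4*\<beta> - 2 * s + 2) * norm p powr (2*\<beta> - s + 1 - a)) \<le> ennreal b * emeasure hausdorff2 A"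
   using AB dens unfolding q_def R_def by (intro exI[of _ A] exI[of _ b]) (auto simp: A_def S_def)
 qed
qed

section \<open>Growth at a single momentum\<close>

text \<open>For \<open>e = 2\<beta> + 2 - s\<close> the constraint \<open>e + \<sigma> \<le> \<kappa>\<close> is sharp in the range \<open>-1 < e\<close>, where the far part is then of
the order of the main term at the largest dyadic level; for \<open>e \<le> -1\<close> it is at most of the order of the
main term at the smallest level.\<close>

lemma far_exponents:
 fixes a \<beta> s :: real
 assumes a: "1 \<le> a" and \<beta>: "0 \<le> \<beta>" and conv: "4*\<beta> + 4 - a < s" "6*\<beta> + 6 - a < 2 * s"
 obtains \<kappa> \<sigma> where "0 < \<kappa>" "2*\<beta> + 2 - s + \<sigma> \<le> \<kappa>" "\<kappa> < s + a - 4*\<beta> - 4" "0 \<le> \<sigma>" "\<sigma> \<le> 1" "a = 1 \<Longrightarrow> \<sigma> = 0"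
  "2*\<beta> + 3 - s + \<kappa> - \<sigma> \<le> max 0 (4*\<beta> + 5 - 2 * s)"
proof -
 define e where "e = 2*\<beta> + 2 - s"
 define G where "G = s + a - 4*\<beta> - 4"
 have G: "0 < G" "e < G" using conv by (auto simp: G_def e_def)
 have a1: "e < -1" if "a = 1" using that conv(1) \<beta> by (simp add: e_def)
 consider "0 \<le> e" | "-1 < e" "e < 0" | "e \<le> -1" "a \<noteq> 1" | "a = 1" by linarith
 then show thesis
 proof cases
  case 1
  define t where "t = min 1 ((G - e) / 2)"
  have t: "0 < t" "t \<le> 1" "t < G - e" using G by (auto simp: t_def min_def field_simps)
  show thesis by (rule that[of "e + t" t]) (use 1 t a1 in \<open>auto simp: e_def G_def\<close>)
 next
  case 2
  define k where "k = min (G / 2) (1 + e)"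
  have k: "0 < k" "k \<le> 1 + e" "k < G" using G 2 by (auto simp: k_def)
  show thesis by (rule that[of k "k - e"]) (use 2 k a1 in \<open>auto simp: e_def G_def\<close>)
 next
  case 3
  define k where "k = min (G / 2) 1"
  have k: "0 < k" "k \<le> 1" "k < G" using G by (auto simp: k_def)
  show thesis by (rule that[of k 1]) (use 3 k in \<open>auto simp: e_def G_def\<close>)
 next
  case 4
  define k where "k = min (G / 2) (- e - 1)"
  have k: "0 < k" "k \<le> - e - 1" "k < G" using G a1[OF 4] by (auto simp: k_def)
  show thesis by (rule that[of k 0]) (use k a1[OF 4] in \<open>auto simp: e_def G_def\<close>)
 qed
qed

definition dyadic_sum :: "real \<Rightarrow> real \<Rightarrow> real" where
 "dyadic_sum d t = (\<Sum>j\<in>{j::nat. 2 ^ j \<le> t}. 2 powr (j * d))"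

lemma finite_dyadic: "finite {j::nat. (2::real) ^ j \<le> t}"
proof -
 obtain N where N: "t < 2 ^ N" using real_arch_pow[of 2 t] by auto
 have "{j::nat. (2::real) ^ j \<le> t} \<subseteq> {..N}"
 proof
  fix j :: nat assume "j \<in> {j. (2::real) ^ j \<le> t}"
  then have "(2::real) ^ j \<le> t" by simp
  then have "(2::real) ^ j < 2 ^ N" using N by linarith
  then show "j \<in> {..N}" by simp
 qed
 then show ?thesis by (rule finite_subset) simp
qed

lemma dyadic_sum_nonneg [simp]: "0 \<le> dyadic_sum d t"
 by (simp add: dyadic_sum_def sum_nonneg)

lemma dyadic_sum_ge:
 assumes "(2::real) ^ j \<le> t" shows "2 powr (j * d) \<le> dyadic_sum d t"
 unfolding dyadic_sum_def using assms finite_dyadic by (intro member_le_sum) auto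

lemma dyadic_sum_ge_1: "1 \<le> t \<Longrightarrow> 1 \<le> dyadic_sum d t"
 using dyadic_sum_ge[of 0 t d] by simp

lemma dyadic_sum_ge_powr:
 assumes t: "1 \<le> t" shows "2 powr (- \<bar>d\<bar>) * t powr d \<le> dyadic_sum d t"
proof -
 have "2 ^ 0 \<le> t" using t by simp
 from dyadic_floor[OF this] obtain K where K: "2 ^ K \<le> t" "t < 2 ^ Suc K" by blast
 have eq: "2 powr (K * d) = (2 ^ K) powr d" by (simp add: powr_realpow[symmetric] powr_powr)
 have "2 powr (- \<bar>d\<bar>) * t powr d \<le> 2 powr (K * d)"
 proof (cases "0 \<le> d")
  case True
  have "2 powr (- \<bar>d\<bar>) * t powr d = (t / 2) powr d" using True t by (simp add: powr_divide powr_minus_divide)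
  also have "\<dots> \<le> (2 ^ K) powr d" using K t True by (intro powr_mono2) auto
  finally show ?thesis by (simp add: eq)
 next
  case False
  have "2 powr (- \<bar>d\<bar>) * t powr d \<le> 1 * t powr d" using powr_mono[of "- \<bar>d\<bar>" 0 2] by (intro mult_right_mono) auto
  also have "1 * t powr d \<le> (2 ^ K) powr d" using K t False by (simp add: powr_mono2')
  finally show ?thesis by (simp add: eq)
 qed
 then show ?thesis using dyadic_sum_ge[OF K(1), of d] by linarith
qed

lemma powr_le_dyadic_sum:
 fixes d x L :: real
 assumes x: "x \<le> max 0 d" and L: "1 \<le> L"
 obtains C where "0 < C" "\<And>R. L \<le> R \<Longrightarrow> R powr x \<le> C * dyadic_sum d (R / L)"
proof (cases "x \<le> 0")
 case True
 show thesis
 proof (rule that[of 1])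
  fix R assume R: "L \<le> R"
  have "R powr x \<le> R powr 0" using R L True by (intro powr_mono) auto
  then show "R powr x \<le> 1 * dyadic_sum d (R / L)" using R L dyadic_sum_ge_1[of "R / L" d] by simp
 qed simp
next
 case False
 then have d: "0 < d" "x \<le> d" using x by (auto simp: max_def split: if_splits)
 show thesis
 proof (rule that[of "2 powr d * L powr d"])
  show "0 < 2 powr d * L powr d" using L by simp
  fix R assume R: "L \<le> R"
  have "R powr x \<le> R powr d" using R L d by (intro powr_mono) auto
  also have "\<dots> = 2 powr d * L powr d * (2 powr (- \<bar>d\<bar>) * (R / L) powr d)"
   using d L R by (simp add: powr_divide powr_minus_divide)
  also have "\<dots> \<le> 2 powr d * L powr d * dyadic_sum d (R / L)"
   using R L by (intro mult_left_mono dyadic_sum_ge_powr) auto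
  finally show "R powr x \<le> 2 powr d * L powr d * dyadic_sum d (R / L)" .
 qed
qed

lemma dyadic_sum_0_unbounded: "\<exists>t0\<ge>1. \<forall>t\<ge>t0. M \<le> dyadic_sum 0 t"
proof -
 obtain n :: nat where n: "M \<le> real n" using real_arch_simple by blast
 show ?thesis
 proof (intro exI[of _ "2 ^ n"] conjI allI impI)
  fix t :: real assume t: "2 ^ n \<le> t"
  have "{..n} \<subseteq> {j::nat. (2::real) ^ j \<le> t}"
  proof
   fix j assume "j \<in> {..n}"
   then have "(2::real) ^ j \<le> 2 ^ n" by (intro power_increasing) auto
   then have "(2::real) ^ j \<le> t" using t by linarith
   then show "j \<in> {j. (2::real) ^ j \<le> t}" by simp
  qed
  then have "card {..n} \<le> card {j::nat. (2::real) ^ j \<le> t}" by (intro card_mono finite_dyadic)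
  then show "M \<le> dyadic_sum 0 t" using n by (simp add: dyadic_sum_def)
 qed simp
qed

lemma powr_unbounded:
 fixes x :: real assumes "0 < x" shows "\<exists>t0\<ge>1. \<forall>t\<ge>t0. M \<le> t powr x"
proof (intro exI[of _ "max 1 (\<bar>M\<bar> powr (1/x))"] conjI allI impI)
 fix t :: real assume t: "max 1 (\<bar>M\<bar> powr (1/x)) \<le> t"
 have "M \<le> (\<bar>M\<bar> powr (1/x)) powr x" using assms by (simp add: powr_powr)
 also have "\<dots> \<le> t powr x" using t assms by (intro powr_mono2) auto
 finally show "M \<le> t powr x" .
qed simp

text \<open>In the first case the smallest dyadic level suffices, in the second one the largest; in the third case
all levels contribute equally and their number is of order \<open>log R\<close>.\<close>

lemma main_term_unbounded:
 fixes a \<beta> s L M :: real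
 assumes L: "1 \<le> L" and cond: "\<beta> > (a - 1) / 4 \<or> s < 4 * \<beta> + 3 - a / 2 \<or> (s = 4 * \<beta> + 3 - a / 2 \<and> \<beta> = (a - 1) / 4)"
 shows "\<exists>R0\<ge>L. \<forall>R\<ge>R0. M \<le> R powr (4*\<beta> + 1 - a) * dyadic_sum (4*\<beta> + 5 - 2 * s) (R / L)"
proof -
 define d where "d = 4*\<beta> + 5 - 2 * s"
 consider "0 < 4*\<beta> + 1 - a" | "0 < (4*\<beta> + 1 - a) + d" | "4*\<beta> + 1 - a = 0" "d = 0"
 proof -
  assume A: "0 < 4*\<beta> + 1 - a \<Longrightarrow> thesis" "0 < (4*\<beta> + 1 - a) + d \<Longrightarrow> thesis" "4*\<beta> + 1 - a = 0 \<Longrightarrow> d = 0 \<Longrightarrow> thesis"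
  show thesis using cond
  proof (elim disjE)
   assume "\<beta> > (a - 1) / 4" then show thesis by (intro A(1)) (simp add: field_simps)
  next
   assume "s < 4 * \<beta> + 3 - a / 2" then show thesis by (intro A(2)) (simp add: d_def field_simps)
  next
   assume "s = 4 * \<beta> + 3 - a / 2 \<and> \<beta> = (a - 1) / 4" then show thesis by (intro A(3)) (auto simp: d_def field_simps)
  qed
 qed
 then show ?thesis unfolding d_def[symmetric]
 proof cases
  case 1
  obtain t0 where t0: "1 \<le> t0" "\<And>t. t0 \<le> t \<Longrightarrow> \<bar>M\<bar> \<le> t powr (4*\<beta> + 1 - a)" using powr_unbounded[OF 1, of "\<bar>M\<bar>"] by blast
  have "M \<le> R powr (4*\<beta> + 1 - a) * dyadic_sum d (R / L)" if R: "max t0 L \<le> R" for R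
  proof -
   have "M \<le> R powr (4*\<beta> + 1 - a) * 1" using t0(2)[of R] R by simp
   also have "\<dots> \<le> R powr (4*\<beta> + 1 - a) * dyadic_sum d (R / L)" using R L by (intro mult_left_mono dyadic_sum_ge_1) auto
   finally show ?thesis .
  qed
  then show "\<exists>R0\<ge>L. \<forall>R\<ge>R0. M \<le> R powr (4*\<beta> + 1 - a) * dyadic_sum d (R / L)" by (intro exI[of _ "max t0 L"]) auto
 next
  case 2
  define c where "c = 2 powr (- \<bar>d\<bar>) * L powr (- d)"
  have c: "0 < c" using L by (simp add: c_def)
  obtain t0 where t0: "1 \<le> t0" "\<And>t. t0 \<le> t \<Longrightarrow> M / c \<le> t powr (4*\<beta> + 1 - a + d)" using powr_unbounded[OF 2, of "M / c"] by blast
  have "M \<le> R powr (4*\<beta> + 1 - a) * dyadic_sum d (R / L)" if R: "max t0 L \<le> R" for R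
  proof -
   have "M \<le> c * R powr (4*\<beta> + 1 - a + d)" using t0(2)[of R] R c by (simp add: field_simps)
   also have "\<dots> = R powr (4*\<beta> + 1 - a) * (2 powr (- \<bar>d\<bar>) * (R / L) powr d)"
    using R L by (simp add: c_def powr_add powr_divide powr_minus_divide)
   also have "\<dots> \<le> R powr (4*\<beta> + 1 - a) * dyadic_sum d (R / L)" using R L by (intro mult_left_mono dyadic_sum_ge_powr) auto
   finally show ?thesis .
  qed
  then show "\<exists>R0\<ge>L. \<forall>R\<ge>R0. M \<le> R powr (4*\<beta> + 1 - a) * dyadic_sum d (R / L)" by (intro exI[of _ "max t0 L"]) auto
 next
  case 3
  obtain t0 where t0: "1 \<le> t0" "\<And>t. t0 \<le> t \<Longrightarrow> M \<le> dyadic_sum 0 t" using dyadic_sum_0_unbounded[of M] by blast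
  have "M \<le> R powr (4*\<beta> + 1 - a) * dyadic_sum d (R / L)" if R: "t0 * L \<le> R" for R
  proof -
   have "1 * 1 \<le> t0 * L" using t0 L by (intro mult_mono) auto
   moreover have "t0 \<le> R / L" using R L by (simp add: field_simps)
   ultimately show ?thesis using t0(2)[of "R / L"] 3 R by simp
  qed
  moreover have "L \<le> t0 * L" using t0 L by simp
  ultimately show "\<exists>R0\<ge>L. \<forall>R\<ge>R0. M \<le> R powr (4*\<beta> + 1 - a) * dyadic_sum d (R / L)" by blast
 qed
qed

text \<open>The error \<open>u\<close> near the holes is removed by adding a multiple of the indicator function of a ball, so that
the remaining integrand is negative only for large \<open>p1\<close>.\<close>

lemma collision_lower_assembly:
 fixes l :: "nat \<Rightarrow> real"
 assumes def: "collision_defined a \<beta> g p"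
  and near: "\<And>p1. norm p1 < r \<Longrightarrow> set_integrable hausdorff2 (resonant_set a p p1) (density a \<beta> g p p1) \<Longrightarrow> - u \<le> inner_integral a \<beta> g p p1"
  and u: "0 \<le> u" and r: "0 < r"
  and far: "\<And>p1. r \<le> norm p1 \<Longrightarrow> set_integrable hausdorff2 (resonant_set a p p1) (density a \<beta> g p p1) \<Longrightarrow> ennreal (- inner_integral a \<beta> g p p1) \<le> B p1"
  and B: "B \<in> borel_measurable borel" "(\<integral>\<^sup>+p1. B p1 \<partial>lborel) \<le> ennreal U" "0 \<le> U"
  and J: "finite J" "\<And>j. j \<in> J \<Longrightarrow> 2 * 2 ^ j \<le> r" "\<And>j. j \<in> J \<Longrightarrow> 0 \<le> l j"
  and main: "\<And>j p1. j \<in> J \<Longrightarrow> 2 ^ j \<le> norm p1 \<Longrightarrow> norm p1 < 2 * 2 ^ j \<Longrightarrow> p \<bullet> p1 \<le> 0 \<Longrightarrow>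
    set_integrable hausdorff2 (resonant_set a p p1) (density a \<beta> g p p1) \<Longrightarrow> l j - u \<le> inner_integral a \<beta> g p p1"
 shows "rpow (norm p) (2*\<beta>) * ((\<Sum>j\<in>J. l j * (3 * unit_ball_vol 3 * (2 ^ j) ^ 3)) - U - u * (unit_ball_vol 3 * r ^ 3)) \<le> collision a \<beta> g p"
proof -
 define f where "f = inner_integral a \<beta> g p"
 have ae: "AE p1 in lebesgue. set_integrable hausdorff2 (resonant_set a p p1) (density a \<beta> g p p1)"
  and int: "integrable lebesgue f" using def by (auto simp: collision_defined_def f_def)
 define h where "h p1 = u * indicator (ball (0::real^3) r) p1" for p1
 have fin: "emeasure lborel (ball (0::real^3) r) < \<infinity>" using r by (simp add: emeasure_ball)
 have hint: "integrable lebesgue h" unfolding h_def using fin by (intro integrable_mult_right integrable_real_indicator) auto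
 have hval: "(\<integral>p1. h p1 \<partial>lebesgue) = u * (unit_ball_vol 3 * r ^ 3)"
  unfolding h_def using r by (simp add: measure_def emeasure_ball)
 define H where "H j = {q::real^3. 2 ^ j \<le> norm q \<and> norm q < 2 * 2 ^ j \<and> p \<bullet> q \<le> 0}" for j :: nat
 have HB: "H j \<in> sets borel" for j unfolding H_def by (rule half_annulus_borel)
 have disj: "i = j" if "q \<in> H i" "q \<in> H j" for i j q
 proof -
  have le: "k \<le> m" if "q \<in> H k" "q \<in> H m" for k m
  proof -
   have "(2::real) ^ k < 2 ^ Suc m" using that by (auto simp: H_def intro: le_less_trans)
   then have "k < Suc m" by (subst (asm) power_strict_increasing_iff) auto
   then show ?thesis by simp
  qed
  show ?thesis using le[of i j] le[of j i] that by simp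
 qed
 have "(\<Sum>j\<in>J. l j * (3 * unit_ball_vol 3 * (2 ^ j) ^ 3)) - U \<le> (\<integral>p1. f p1 + h p1 \<partial>lebesgue)"
 proof (rule integral_lower_bound)
  show "integrable lebesgue (\<lambda>p1. f p1 + h p1)" using int hint by simp
  show "AE p1 in lebesgue. ennreal (- (f p1 + h p1)) \<le> B p1" using ae
  proof eventually_elim
   case (elim p1)
   show ?case
   proof (cases "norm p1 < r")
    case True
    then have "- (f p1 + h p1) \<le> 0" using near[OF True elim] by (simp add: f_def h_def)
    then have "ennreal (- (f p1 + h p1)) = 0" by (rule ennreal_neg)
    then show ?thesis by simp
   next
    case False
    then show ?thesis using far[of p1] elim by (simp add: f_def h_def)
   qed
  qed
  have "(\<integral>\<^sup>+p1. B p1 \<partial>lebesgue) = (\<integral>\<^sup>+p1. B p1 \<partial>lborel)" by (rule nn_integral_completion)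
  then show "(\<integral>\<^sup>+p1. B p1 \<partial>lebesgue) \<le> ennreal U" using B(2) by simp
  show "0 \<le> U" by fact
  show "AE p1 in lebesgue. (\<Sum>j\<in>J. ennreal (l j) * indicator (H j) p1) \<le> ennreal (f p1 + h p1)" using ae
  proof eventually_elim
   case (elim p1)
   show ?case
   proof (cases "\<exists>j\<in>J. p1 \<in> H j")
    case True
    then obtain j where j: "j \<in> J" "p1 \<in> H j" by blast
    have "(\<Sum>i\<in>J. ennreal (l i) * indicator (H i) p1) = (\<Sum>i\<in>{j}. ennreal (l i) * indicator (H i) p1)"
    proof (rule sum.mono_neutral_right[OF J(1)])
     show "{j} \<subseteq> J" using j by simp
     show "\<forall>i\<in>J - {j}. ennreal (l i) * indicator (H i) p1 = 0"
     proof
      fix i assume i: "i \<in> J - {j}"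
      have "p1 \<notin> H i"
      proof
       assume "p1 \<in> H i"
       then have "i = j" by (rule disj[OF _ j(2)])
       then show False using i by simp
      qed
      then show "ennreal (l i) * indicator (H i) p1 = 0" by simp
     qed
    qed
    also have "\<dots> = ennreal (l j)" using j by simp
    also have "\<dots> \<le> ennreal (f p1 + h p1)"
    proof (rule ennreal_leI)
     have "l j - u \<le> f p1" unfolding f_def using j elim by (intro main) (auto simp: H_def)
     moreover have "norm p1 < r" using j J(2)[of j] by (auto simp: H_def)
     ultimately show "l j \<le> f p1 + h p1" by (simp add: h_def)
    qed
    finally show ?thesis .
   next
    case False
    then have "(\<Sum>j\<in>J. ennreal (l j) * indicator (H j) p1) = 0" by (intro sum.neutral) auto
    then show ?thesis by simp
   qed
  qed
  have "ennreal (\<Sum>j\<in>J. l j * (3 * unit_ball_vol 3 * (2 ^ j) ^ 3)) = (\<Sum>j\<in>J. ennreal (l j * (3 * unit_ball_vol 3 * (2 ^ j) ^ 3)))"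
   using J(3) by (intro sum_ennreal[symmetric]) auto
  also have "\<dots> \<le> (\<Sum>j\<in>J. ennreal (l j) * emeasure lborel (H j))"
  proof (rule sum_mono)
   fix j assume j: "j \<in> J"
   have "ennreal (l j * (3 * unit_ball_vol 3 * (2 ^ j) ^ 3)) = ennreal (l j) * ennreal (3 * unit_ball_vol 3 * (2 ^ j) ^ 3)"
    using J(3)[OF j] by (intro ennreal_mult) auto
   also have "\<dots> \<le> ennreal (l j) * emeasure lborel (H j)" unfolding H_def by (intro mult_left_mono half_annulus_volume) auto
   finally show "ennreal (l j * (3 * unit_ball_vol 3 * (2 ^ j) ^ 3)) \<le> ennreal (l j) * emeasure lborel (H j)" .
  qed
  also have "\<dots> = (\<Sum>j\<in>J. (\<integral>\<^sup>+p1. ennreal (l j) * indicator (H j) p1 \<partial>lebesgue))"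
   using HB by (intro sum.cong refl) (simp add: nn_integral_cmult_indicator)
  also have "\<dots> = (\<integral>\<^sup>+p1. (\<Sum>j\<in>J. ennreal (l j) * indicator (H j) p1) \<partial>lebesgue)"
   using HB by (intro nn_integral_sum[symmetric]) (auto intro!: borel_measurable_times_ennreal borel_measurable_indicator)
  finally show "ennreal (\<Sum>j\<in>J. l j * (3 * unit_ball_vol 3 * (2 ^ j) ^ 3)) \<le> (\<integral>\<^sup>+p1. (\<Sum>j\<in>J. ennreal (l j) * indicator (H j) p1) \<partial>lebesgue)" .
 qed
 also have "(\<integral>p1. f p1 + h p1 \<partial>lebesgue) = (\<integral>p1. f p1 \<partial>lebesgue) + u * (unit_ball_vol 3 * r ^ 3)"
  using int hint by (simp add: hval)
 finally have "(\<Sum>j\<in>J. l j * (3 * unit_ball_vol 3 * (2 ^ j) ^ 3)) - U - u * (unit_ball_vol 3 * r ^ 3) \<le> (\<integral>p1. f p1 \<partial>lebesgue)" by simp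
 then show ?thesis unfolding collision_def f_def by (intro mult_left_mono) auto
qed

section \<open>Data with shrinking holes\<close>

definition bump :: "(nat \<Rightarrow> real) \<Rightarrow> (nat \<Rightarrow> real) \<Rightarrow> nat \<Rightarrow> real^3 \<Rightarrow> real" where
 "bump P \<rho> n q = max 0 (min 1 (2 - norm (q - P n *\<^sub>R axis 1 1) / \<rho> n))"

text \<open>The factor by which the datum differs from the weight: \<open>\<eta>\<close> in the ball of radius \<open>\<rho> n\<close> around the point with
first coordinate \<open>P n\<close> on the first axis, and 1 outside the balls of twice the radii.  The sum is truncated
where its terms vanish.\<close>

definition profile :: "real \<Rightarrow> (nat \<Rightarrow> real) \<Rightarrow> (nat \<Rightarrow> real) \<Rightarrow> real^3 \<Rightarrow> real" where
 "profile \<eta> P \<rho> q = max \<eta> (1 - (\<Sum>n\<le>nat \<lceil>norm q\<rceil>. bump P \<rho> n q))"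

lemma bump_nonneg [simp]: "0 \<le> bump P \<rho> n q"
 by (simp add: bump_def)

lemma profile_facts:
 fixes P \<rho> :: "nat \<Rightarrow> real"
 assumes P: "\<And>n. real n + 1 \<le> P n" and \<rho>: "\<And>n. 0 < \<rho> n" "\<And>n. \<rho> n \<le> 1/8" and \<eta>: "0 < \<eta>" "\<eta> \<le> 1"
 shows "continuous_on UNIV (profile \<eta> P \<rho>)" "\<eta> \<le> profile \<eta> P \<rho> q" "profile \<eta> P \<rho> q \<le> 1"
  "norm (q - P n *\<^sub>R axis 1 1) \<le> \<rho> n \<Longrightarrow> profile \<eta> P \<rho> q = \<eta>"
  "(\<And>n. 2 * \<rho> n \<le> norm (q - P n *\<^sub>R axis 1 1)) \<Longrightarrow> profile \<eta> P \<rho> q = 1"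
proof -
 have zero: "bump P \<rho> n q = 0" if "2 * \<rho> n \<le> norm (q - P n *\<^sub>R axis 1 1)" for n q
  using that \<rho>(1)[of n] by (simp add: bump_def field_simps)
 have small: "real n < norm q" if "norm (q - P n *\<^sub>R axis 1 1) < 2 * \<rho> n" for n and q :: "real^3"
 proof -
  have "P n = norm (P n *\<^sub>R (axis 1 1 :: real^3))" using P[of n] by (simp add: norm_axis_1)
  also have "\<dots> \<le> norm q + norm (q - P n *\<^sub>R axis 1 1)" using norm_triangle_sub[of "P n *\<^sub>R axis 1 1" q] by (simp only: norm_minus_commute)
  finally show ?thesis using that \<rho>(2)[of n] P[of n] by linarith
 qed
 have eq: "profile \<eta> P \<rho> q = max \<eta> (1 - (\<Sum>n\<le>N. bump P \<rho> n q))" if "norm q \<le> real N" for q N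
 proof -
  have sub: "{..nat \<lceil>norm q\<rceil>} \<subseteq> {..N}" using that by (auto simp: nat_le_iff ceiling_le_iff intro: order_trans)
  have "bump P \<rho> n q = 0" if "n \<in> {..N} - {..nat \<lceil>norm q\<rceil>}" for n
  proof (rule zero, rule ccontr)
   assume "\<not> 2 * \<rho> n \<le> norm (q - P n *\<^sub>R axis 1 1)"
   then have "real n < norm q" by (intro small) simp
   moreover have "nat \<lceil>norm q\<rceil> < n" using that by simp
   ultimately show False by linarith
  qed
  then have "(\<Sum>n\<le>nat \<lceil>norm q\<rceil>. bump P \<rho> n q) = (\<Sum>n\<le>N. bump P \<rho> n q)" using sub by (intro sum.mono_neutral_left) auto
  then show ?thesis by (simp add: profile_def)
 qed
 have bc: "continuous_on UNIV (bump P \<rho> n)" for n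
  unfolding bump_def by (intro continuous_intros) (use \<rho>(1)[of n] in auto)
 show "continuous_on UNIV (profile \<eta> P \<rho>)"
 proof (rule continuous_at_imp_continuous_on, rule ballI)
  fix q0 :: "real^3"
  define N where "N = nat \<lceil>norm q0 + 1\<rceil>"
  have N: "norm q0 + 1 \<le> real N" unfolding N_def by linarith
  have "continuous_on UNIV (\<lambda>q. max \<eta> (1 - (\<Sum>n\<le>N. bump P \<rho> n q)))" by (intro continuous_intros bc)
  then have c: "isCont (\<lambda>q. max \<eta> (1 - (\<Sum>n\<le>N. bump P \<rho> n q))) q0" by (simp add: continuous_on_eq_continuous_at)
  have "\<forall>\<^sub>F q in nhds q0. profile \<eta> P \<rho> q = max \<eta> (1 - (\<Sum>n\<le>N. bump P \<rho> n q))"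
  proof (rule eventually_nhds_in_open[of "ball q0 1", THEN eventually_mono])
   fix q assume "q \<in> ball q0 1"
   then have "norm (q - q0) < 1" by (simp add: dist_norm norm_minus_commute)
   moreover have "norm q \<le> norm q0 + norm (q - q0)" using norm_triangle_ineq[of q0 "q - q0"] by simp
   ultimately show "profile \<eta> P \<rho> q = max \<eta> (1 - (\<Sum>n\<le>N. bump P \<rho> n q))" using N by (intro eq) linarith
  qed auto
  from isCont_cong[OF this] show "isCont (profile \<eta> P \<rho>) q0" using c by simp
 qed
 show "\<eta> \<le> profile \<eta> P \<rho> q" by (simp add: profile_def)
 show "profile \<eta> P \<rho> q \<le> 1" using \<eta> by (simp add: profile_def sum_nonneg)
 show "profile \<eta> P \<rho> q = \<eta>" if h: "norm (q - P n *\<^sub>R axis 1 1) \<le> \<rho> n"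
 proof -
  define N where "N = max n (nat \<lceil>norm q\<rceil>)"
  have "norm q \<le> real (nat \<lceil>norm q\<rceil>)" by linarith
  moreover have "nat \<lceil>norm q\<rceil> \<le> N" unfolding N_def by (rule max.cobounded2)
  ultimately have N: "norm q \<le> real N" by linarith
  have "bump P \<rho> n q = 1" using h \<rho>(1)[of n] by (simp add: bump_def field_simps)
  moreover have "bump P \<rho> n q \<le> (\<Sum>n\<le>N. bump P \<rho> n q)" by (intro member_le_sum) (auto simp: N_def)
  ultimately show ?thesis using eq[OF N] \<eta> by simp
 qed
 show "profile \<eta> P \<rho> q = 1" if "\<And>n. 2 * \<rho> n \<le> norm (q - P n *\<^sub>R axis 1 1)"
  using zero[OF that] \<eta> by (simp add: profile_def)
qed

text \<open>If \<open>p\<close> is in the hole number \<open>n\<close>, then the value at \<open>p\<close> is small compared with that at every \<open>x\<close> of at most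
comparable size outside this hole.  Earlier holes are harmless since the weight at \<open>p\<close> is much smaller
than the weight there by lacunarity; later holes are too far away.\<close>

lemma hole_geometry:
 fixes P \<rho> :: "nat \<Rightarrow> real" and p :: "real^3"
 assumes P: "\<And>n. real n + 1 \<le> P n" "\<And>n. K * P n \<le> P (Suc n)" and \<rho>: "\<And>n. 0 < \<rho> n" "\<And>n. \<rho> n \<le> 1/8"
  and \<eta>: "0 < \<eta>" "\<eta> \<le> 1" and s: "0 < s" and \<Lambda>: "8 \<le> \<Lambda>" "16 * \<eta> * (2 * \<Lambda>) powr s \<le> 1"
  and K: "16 * \<Lambda> \<le> K" "16 * (8 / K) powr s \<le> 1"
  and p: "norm (p - P n *\<^sub>R axis 1 1) \<le> \<rho> n" and g: "\<And>x. \<bar>g x - wt s x * profile \<eta> P \<rho> x\<bar> \<le> \<eta> / 4 * wt s x"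
 shows "0 < g x" "g x \<le> 2 * wt s x" "g p \<le> 2 * \<eta> * wt s p"
  "(\<And>k. 2 * \<rho> k \<le> norm (x - P k *\<^sub>R axis 1 1)) \<Longrightarrow> wt s x / 2 \<le> g x"
  "norm x \<le> 2 * \<Lambda> * norm p \<Longrightarrow> x \<notin> cball p (3 * \<rho> n) \<Longrightarrow> 4 * g p \<le> g x"
  "\<bar>norm p - P n\<bar> \<le> 1/8" "\<bar>norm (x - P k *\<^sub>R axis 1 1)\<bar> < 2 * \<rho> k \<Longrightarrow> \<bar>norm x - P k\<bar> < 1/4"
  "k < n \<Longrightarrow> K * P k \<le> P n" "n < k \<Longrightarrow> K * P n \<le> P k"
proof -
 note pf = profile_facts[of P \<rho> \<eta>, OF P(1) \<rho> \<eta>]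
 have gl: "3/4 * \<eta> * wt s x \<le> g x" for x
 proof -
  have "wt s x * \<eta> \<le> wt s x * profile \<eta> P \<rho> x" using pf(2) by (intro mult_left_mono) auto
  moreover have "3/4 * \<eta> * wt s x = 3/4 * (wt s x * \<eta>)" "\<eta> / 4 * wt s x = (wt s x * \<eta>) / 4" by simp_all
  ultimately show ?thesis using g[of x] unfolding abs_le_iff by linarith
 qed
 have e1: "\<eta> * wt s x \<le> 1 * wt s x" for x using \<eta> by (intro mult_right_mono) auto
 show "0 < g x"
 proof -
  have "0 < \<eta> * wt s x" using \<eta> by (intro mult_pos_pos) auto
  then show ?thesis using gl[of x] by linarith
 qed
 show "g x \<le> 2 * wt s x"
 proof -
  have "wt s x * profile \<eta> P \<rho> x \<le> wt s x * 1" using pf(3) by (intro mult_left_mono) auto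
  then show ?thesis using g[of x] e1[of x] wt_pos(1)[of s x] unfolding abs_le_iff by linarith
 qed
 show gp: "g p \<le> 2 * \<eta> * wt s p"
 proof -
  have "0 \<le> \<eta> * wt s p" using \<eta> by simp
  then show ?thesis using g[of p] unfolding pf(4)[OF p] abs_le_iff by (simp add: algebra_simps)
 qed
 have g4: "wt s x / 2 \<le> g x" if "\<And>k. 2 * \<rho> k \<le> norm (x - P k *\<^sub>R axis 1 1)" for x
  using g[of x] e1[of x] wt_pos(1)[of s x] unfolding pf(5)[OF that] abs_le_iff by linarith
 then show "(\<And>k. 2 * \<rho> k \<le> norm (x - P k *\<^sub>R axis 1 1)) \<Longrightarrow> wt s x / 2 \<le> g x" .
 have nd: "\<bar>norm z - P k\<bar> \<le> norm (z - P k *\<^sub>R axis 1 1)" for z :: "real^3" and k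
 proof -
  have "norm (P k *\<^sub>R (axis 1 1 :: real^3)) = P k" using P(1)[of k] by (simp add: norm_axis_1)
  then show ?thesis using norm_triangle_ineq3[of z "P k *\<^sub>R axis 1 1"] by simp
 qed
 show pn: "\<bar>norm p - P n\<bar> \<le> 1/8" using nd[of p n] p \<rho>(2)[of n] by linarith
 show hk: "\<bar>norm x - P k\<bar> < 1/4" if "\<bar>norm (x - P k *\<^sub>R axis 1 1)\<bar> < 2 * \<rho> k" for x :: "real^3" and k
  using nd[of x k] that \<rho>(2)[of k] by linarith
 have Kl: "K * P k \<le> P m" if "k < m" for k m
  using that
 proof (induction m)
  case (Suc m)
  have "0 \<le> P m" using P(1)[of m] by linarith
  then have "1 * P m \<le> K * P m" using K \<Lambda> by (intro mult_right_mono) auto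
  then show ?case using Suc P(2)[of m] by (cases "k = m") auto
 qed simp
 show "k < n \<Longrightarrow> K * P k \<le> P n" "n < k \<Longrightarrow> K * P n \<le> P k" by (rule Kl; assumption)+
 show "4 * g p \<le> g x" if x: "norm x \<le> 2 * \<Lambda> * norm p" "x \<notin> cball p (3 * \<rho> n)"
 proof (cases "\<forall>k. 2 * \<rho> k \<le> norm (x - P k *\<^sub>R axis 1 1)")
  case True
  have "wt s p \<le> (2 * \<Lambda>) powr s * wt s x" using s \<Lambda> x by (intro wt_compare) auto
  then have "16 * \<eta> * wt s p \<le> 16 * \<eta> * ((2 * \<Lambda>) powr s * wt s x)" using \<eta> by (intro mult_left_mono) auto
  also have "\<dots> = (16 * \<eta> * (2 * \<Lambda>) powr s) * wt s x" by simp
  also have "\<dots> \<le> 1 * wt s x" using \<Lambda> by (intro mult_right_mono) auto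
  finally show ?thesis using g4[of x] True gp by (simp add: mult.assoc)
 next
  case False
  then obtain k where k: "norm (x - P k *\<^sub>R axis 1 1) < 2 * \<rho> k" by (auto simp: not_le)
  have xk: "\<bar>norm x - P k\<bar> < 1/4" using hk[of x k] k by simp
  have Pn1: "1 \<le> P n" "1 \<le> P k" using P(1)[of n] P(1)[of k] by auto
  have "k \<noteq> n"
  proof
   assume "k = n"
   have "norm (p - x) \<le> norm (p - P n *\<^sub>R axis 1 1) + norm (x - P n *\<^sub>R axis 1 1)"
    using norm_triangle_ineq4[of "p - P n *\<^sub>R axis 1 1" "x - P n *\<^sub>R axis 1 1"] by simp
   then have "dist p x \<le> 3 * \<rho> n" using k p \<open>k = n\<close> by (simp add: dist_norm)
   then show False using x by simp
  qed
  moreover have "\<not> n < k"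
  proof
   assume "n < k"
   then have "K * P n \<le> P k" by (rule Kl)
   moreover have "16 * \<Lambda> * P n \<le> K * P n" using K Pn1 by (intro mult_right_mono) auto
   moreover have "norm p \<le> 2 * P n" using pn Pn1 by linarith
   then have "\<Lambda> * norm p \<le> \<Lambda> * (2 * P n)" using \<Lambda> by (intro mult_left_mono) auto
   moreover have "8 * 1 \<le> \<Lambda> * P n" using \<Lambda> Pn1 by (intro mult_mono) auto
   ultimately show False using x xk by (simp add: mult.assoc)
  qed
  ultimately have kn: "k < n" by simp
  have KP: "K * P k \<le> P n" by (rule Kl[OF kn])
  have K0: "0 < K" using K \<Lambda> by linarith
  have "wt s p \<le> (K * P k / 2) powr (-s)"
  proof (rule wt_le)
   show "K * P k / 2 \<le> japanese p" using KP pn Pn1 japanese_ge(2)[of p] by linarith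
  qed (use s K0 Pn1 in auto)
  also have "\<dots> = (8 / K) powr s * (4 * P k) powr (-s)"
  proof -
   have "(K * P k / 2) powr (-s) = ((K / 8) * (4 * P k)) powr (-s)" by simp
   also have "\<dots> = (K / 8) powr (-s) * (4 * P k) powr (-s)" using K0 Pn1 by (subst powr_mult) auto
   also have "(K / 8) powr (-s) = (8 / K) powr s" using K0 by (simp add: powr_divide powr_minus_divide)
   finally show ?thesis .
  qed
  also have "\<dots> \<le> (8 / K) powr s * wt s x"
  proof (intro mult_left_mono wt_ge)
   have "norm x \<le> 2 * P k" "1 \<le> 2 * P k" using xk Pn1 by linarith+
   then have "japanese x \<le> 2 * (2 * P k)" by (rule japanese_le)
   then show "japanese x \<le> 4 * P k" by simp
  qed (use s in auto)
  finally have "16 * \<eta> * wt s p \<le> 16 * \<eta> * ((8 / K) powr s * wt s x)" using \<eta> by (intro mult_left_mono) auto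
  also have "\<dots> = (16 * (8 / K) powr s) * (\<eta> * wt s x)" by simp
  also have "\<dots> \<le> 1 * (\<eta> * wt s x)" using K \<eta> by (intro mult_right_mono) auto
  finally have "16 * (\<eta> * wt s p) \<le> \<eta> * wt s x" by (simp add: mult.assoc)
  moreover have "0 \<le> \<eta> * wt s x" using \<eta> by simp
  moreover have "3/4 * (\<eta> * wt s x) \<le> g x" "g p \<le> 2 * (\<eta> * wt s p)" using gl[of x] gp by (simp_all add: mult.assoc)
  ultimately show ?thesis by linarith
 qed
qed

text \<open>Divided by the product of the four values, the balance is \<open>1/g(p) + 1/g(p1) - 1/g(x) - 1/g(y)\<close>, and the
first term dominates the last two.\<close>

lemma collision_balance_ge:
 assumes "0 < g p" "0 < g p1" "4 * g p \<le> g x" "4 * g p \<le> g (p + p1 - x)"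
 shows "g p1 * g x * g (p + p1 - x) / 2 \<le> collision_balance g p p1 x"
proof -
 have 1: "4 * g p * g (p + p1 - x) \<le> g x * g (p + p1 - x)" using assms by (intro mult_right_mono) auto
 have 2: "g x * (4 * g p) \<le> g x * g (p + p1 - x)" using assms by (intro mult_left_mono) auto
 have 3: "g x * g (p + p1 - x) / 2 \<le> g x * g (p + p1 - x) - g p * g x - g p * g (p + p1 - x)"
 proof -
  have "4 * g p * g (p + p1 - x) = 4 * (g p * g (p + p1 - x))" "g x * (4 * g p) = 4 * (g p * g x)" by simp_all
  then show ?thesis using 1 2 by linarith
 qed
 have "g p1 * (g x * g (p + p1 - x) / 2) \<le> g p1 * (g x * g (p + p1 - x) - g p * g x - g p * g (p + p1 - x))"
  using 3 assms by (intro mult_left_mono) auto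
 moreover have "0 \<le> g p * g x * g (p + p1 - x)" using assms by (intro mult_nonneg_nonneg) auto
 ultimately show ?thesis by (simp add: collision_balance_def algebra_simps)
qed

lemma far_balance_ge:
 fixes p p1 x :: "real^3"
 assumes "\<And>z. 0 < g z" "\<And>z. g z \<le> 2 * wt s z" "g p \<le> 2 * \<eta> * wt s p" "0 < \<eta>"
 shows "- (8 * \<eta> * wt s p) * (wt s p1 * (wt s x + wt s (p + p1 - x))) \<le> collision_balance g p p1 x"
proof -
 have "g p * (g p1 * (g x + g (p + p1 - x))) \<le> (2 * \<eta> * wt s p) * ((2 * wt s p1) * (2 * wt s x + 2 * wt s (p + p1 - x)))"
  using assms(1)[of p] assms(1)[of p1] assms(1)[of x] assms(1)[of "p + p1 - x"] assms(2-4)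
  by (intro mult_mono add_mono mult_nonneg_nonneg add_nonneg_nonneg) (auto intro: less_imp_le)
 moreover have "0 \<le> g p1 * g x * g (p + p1 - x)" "0 \<le> g p * g x * g (p + p1 - x)"
  using assms(1) by (auto intro!: mult_nonneg_nonneg less_imp_le)
 ultimately show ?thesis by (simp add: collision_balance_def algebra_simps)
qed

lemma inner_integral_ge_neg:
 assumes int: "set_integrable hausdorff2 (resonant_set a p p1) (density a \<beta> g p p1)" and c: "0 < c"
  and d: "\<And>x. x \<in> resonant_set a p p1 \<Longrightarrow> - (c * loss_weight a \<beta> s p p1 x) \<le> density a \<beta> g p p1 x"
  and B: "(\<integral>\<^sup>+x\<in>resonant_set a p p1. ennreal (loss_weight a \<beta> s p p1 x) \<partial>hausdorff2) \<le> b"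
 shows "ennreal (- inner_integral a \<beta> g p p1) \<le> ennreal c * b"
proof (cases "b = top")
 case True then show ?thesis using c by (simp add: ennreal_mult_top)
next
 case False
 then have bb: "ennreal (enn2real b) = b" by (simp add: less_top)
 have "(\<Sum>k\<in>({}::unit set). 0) - c * enn2real b \<le> (LINT x:resonant_set a p p1|hausdorff2. density a \<beta> g p p1 x)"
  by (rule set_integral_ge_shells[where W = "loss_weight a \<beta> s p p1"]) (use int d c B bb in auto)
 then have "- inner_integral a \<beta> g p p1 \<le> c * enn2real b" by (simp add: inner_integral_def)
 then have "ennreal (- inner_integral a \<beta> g p p1) \<le> ennreal (c * enn2real b)" by (rule ennreal_leI)
 also have "\<dots> = ennreal c * b" using c bb by (simp add: ennreal_mult)
 finally show ?thesis .
qed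

text \<open>The order of the choices matters: \<open>\<eta>\<close> depends on the constants of the far and of the main part, the
ratio \<open>K\<close> of the lacunary sequence on \<open>\<Lambda>\<close>, and the radius \<open>\<rho> n\<close> on everything, including
\<open>P n\<close>.  The momenta \<open>p1\<close> with \<open>p \<bullet> p1 \<le> 0\<close> avoid all holes, since these are close to the positive first axis.\<close>

lemma collision_growth:
 fixes a \<beta> s :: real
 assumes a: "1 \<le> a" "a \<le> 5" and \<beta>: "0 \<le> \<beta>" and conv: "4*\<beta> + 4 - a < s" "6*\<beta> + 6 - a < 2 * s"
  and cond: "\<beta> > (a - 1) / 4 \<or> s < 4 * \<beta> + 3 - a / 2 \<or> (s = 4 * \<beta> + 3 - a / 2 \<and> \<beta> = (a - 1) / 4)"
 obtains f0 \<epsilon> where "f0 \<in> Linf s" "0 < \<epsilon>" "\<And>M. \<exists>c r. 0 < r \<and> (\<forall>p\<in>ball c r. \<forall>g. (\<forall>x. \<bar>g x - f0 x\<bar> \<le> \<epsilon> * wt s x) \<longrightarrow>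
   collision_defined a \<beta> g p \<longrightarrow> M * wt s p \<le> collision a \<beta> g p)"
proof -
 have s: "0 < s" using conv(2) a \<beta> by linarith
 then have s0: "0 \<le> s" by simp
 define d where "d = 4*\<beta> + 5 - 2 * s"
 define y where "y = 2*\<beta> - s + 1 - a"
 obtain \<kappa> \<sigma> where ks: "0 < \<kappa>" "2*\<beta> + 2 - s + \<sigma> \<le> \<kappa>" "\<kappa> < s + a - 4*\<beta> - 4" "0 \<le> \<sigma>" "\<sigma> \<le> 1" "a = 1 \<Longrightarrow> \<sigma> = 0"
  "2*\<beta> + 3 - s + \<kappa> - \<sigma> \<le> max 0 (4*\<beta> + 5 - 2 * s)"
  by (rule far_exponents[OF a(1) \<beta> conv]) blast
 obtain \<nu> L c where nu: "8 \<le> \<nu>" and L: "4 * \<nu> + 2 \<le> L" and c: "0 < c" and shell: "\<And>(p::real^3) p1 g t1 t2. \<lbrakk>p \<bullet> p1 \<le> 0; 1 \<le> norm p1; L * norm p1 \<le> norm p;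
   \<nu> * norm p1 \<le> t1; t1 + \<nu> * norm p1 / 4 \<le> t2; t2 \<le> 2 * (\<nu> * norm p1);
   \<And>x. x \<in> resonant_set a p p1 \<Longrightarrow> t1 \<le> norm x \<Longrightarrow> norm x \<le> t2 \<Longrightarrow> 1/16 * (wt s p1 * wt s x * wt s (p + p1 - x)) \<le> collision_balance g p p1 x\<rbrakk>
  \<Longrightarrow> \<exists>A b. A \<in> sets borel \<and> A \<subseteq> resonant_set a p p1 \<and> (\<forall>x\<in>A. b \<le> density a \<beta> g p p1 x) \<and>
   ennreal (c * norm p1 powr (4*\<beta> - 2 * s + 2) * norm p powr (2*\<beta> - s + 1 - a)) \<le> ennreal b * emeasure hausdorff2 A"
  by (rule main_shell_lower[OF a(1) \<beta> s0]) blast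
 obtain \<Lambda> C where La: "8 \<le> \<Lambda>" and C: "0 < C" and far: "\<And>p::real^3. 1 \<le> norm p \<Longrightarrow> \<exists>B\<in>borel_measurable borel.
  (\<forall>p1. \<Lambda> * norm p \<le> norm p1 \<longrightarrow> (\<integral>\<^sup>+x\<in>resonant_set a p p1. ennreal (loss_weight a \<beta> s p p1 x) \<partial>hausdorff2) \<le> B p1) \<and>
  (\<integral>\<^sup>+p1. B p1 \<partial>lborel) \<le> ennreal (C * norm p powr (4*\<beta> + 4 - s - a + \<kappa> - \<sigma>))"
 proof (rule far_loss_bound[OF a(1) \<beta> s0 ks(1-6)])
  fix \<Lambda> C :: real
  assume A: "8 \<le> \<Lambda>" "0 < C" "\<And>p::real^3. 1 \<le> norm p \<Longrightarrow> \<exists>B\<in>borel_measurable borel.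
  (\<forall>p1. \<Lambda> * norm p \<le> norm p1 \<longrightarrow> (\<integral>\<^sup>+x\<in>resonant_set a p p1. ennreal (loss_weight a \<beta> s p p1 x) \<partial>hausdorff2) \<le> B p1) \<and>
  (\<integral>\<^sup>+p1. B p1 \<partial>lborel) \<le> ennreal (C * norm p powr (4*\<beta> + 4 - s - a + \<kappa> - \<sigma>))"
  show thesis by (rule that[OF A])
 qed
 \<comment> \<open>the factor 2 accounts for the width of the dyadic shells\<close>
 define L2 where "L2 = 2 * L"
 have L2: "1 \<le> L2" using L nu by (simp add: L2_def)
 obtain C2 where C2: "0 < C2" "\<And>R. L2 \<le> R \<Longrightarrow> R powr (2*\<beta> + 3 - s + \<kappa> - \<sigma>) \<le> C2 * dyadic_sum d (R / L2)"
  by (rule powr_le_dyadic_sum[OF ks(7)[folded d_def] L2]) blast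
 define v where "v = unit_ball_vol 3"
 have v: "0 < v" unfolding v_def by (rule unit_ball_vol_pos) simp
 define xp where "xp = 4*\<beta> - 2 * s + 2"
 define c1 where "c1 = c * 2 powr (- \<bar>xp\<bar>) * (3 * v)"
 have c1: "0 < c1" using c v by (simp add: c1_def)
 define \<eta> where "\<eta> = min 1 (min (1 / (16 * (2 * \<Lambda>) powr s)) (c1 / (32 * C * C2)))"
 have \<eta>: "0 < \<eta>" "\<eta> \<le> 1" using La C C2 c1 by (auto simp: \<eta>_def)
 have \<eta>1: "16 * \<eta> * (2 * \<Lambda>) powr s \<le> 1"
 proof -
  have p0: "0 < (2 * \<Lambda>) powr s" using La by simp
  have "\<eta> \<le> 1 / (16 * (2 * \<Lambda>) powr s)" by (simp add: \<eta>_def)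
  then have "\<eta> * (16 * (2 * \<Lambda>) powr s) \<le> 1 / (16 * (2 * \<Lambda>) powr s) * (16 * (2 * \<Lambda>) powr s)" using p0 by (intro mult_right_mono) auto
  then show ?thesis using p0 by (simp add: mult.commute mult.left_commute)
 qed
 \<comment> \<open>the far part costs at most a quarter of the main part\<close>
 have \<eta>2: "8 * \<eta> * C * C2 \<le> c1 / 4"
 proof -
  have "\<eta> \<le> c1 / (32 * C * C2)" by (simp add: \<eta>_def)
  then have "\<eta> * (8 * C * C2) \<le> c1 / (32 * C * C2) * (8 * C * C2)" using C C2 by (intro mult_right_mono) auto
  also have "\<dots> = c1 / 4" using C C2 by simp
  finally show ?thesis by (simp add: ac_simps)
 qed
 define K where "K = max (16 * \<Lambda>) (8 * 16 powr (1 / s))"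
 have K: "16 * \<Lambda> \<le> K" "16 * (8 / K) powr s \<le> 1"
 proof -
  show "16 * \<Lambda> \<le> K" by (simp add: K_def)
  have K0: "0 < K" using La by (simp add: K_def)
  have "8 / K \<le> 16 powr (- (1 / s))"
  proof -
   have "8 * 16 powr (1 / s) \<le> K" by (simp add: K_def)
   then have "8 * 16 powr (1 / s) / (K * 16 powr (1/s)) \<le> K / (K * 16 powr (1/s))" using K0 by (intro divide_right_mono) auto
   then show ?thesis using K0 by (simp add: powr_minus_divide)
  qed
  then have "(8 / K) powr s \<le> (16 powr (- (1 / s))) powr s" using s K0 by (intro powr_mono2) auto
  also have "\<dots> = 1 / 16" unfolding powr_powr using s by simp
  finally show "16 * (8 / K) powr s \<le> 1" by simp
 qed
 have K1: "128 \<le> K" using K(1) La by linarith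
 define P where "P n = K ^ Suc n" for n :: nat
 have PK: "K * P n \<le> P (Suc n)" for n by (simp add: P_def)
 have P128: "128 * (real n + 1) \<le> P n" for n
 proof (induction n)
  case (Suc n)
  have "128 * (128 * (real n + 1)) \<le> K * P n" using Suc K1 by (intro mult_mono) auto
  then show ?case using PK[of n] by simp
 qed (use K1 in \<open>simp add: P_def\<close>)
 have P1: "real n + 1 \<le> P n" for n using P128[of n] by simp
 have P0: "0 \<le> P n" for n using P1[of n] by linarith
 have P4: "4 * P n \<le> P (Suc n)" for n
 proof -
  have "4 * P n \<le> K * P n" using K1 P0 by (intro mult_right_mono) auto
  then show ?thesis using PK[of n] by linarith
 qed
 define near where "near R1 k \<longleftrightarrow> (\<forall>p p1 g \<rho> A b l. 1 \<le> norm p \<longrightarrow> norm p \<le> R1 \<longrightarrow> norm p1 \<le> R1 \<longrightarrow> 0 < \<rho> \<longrightarrow> (\<forall>z. \<bar>g z\<bar> \<le> 2) \<longrightarrow>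
   set_integrable hausdorff2 (resonant_set a p p1) (density a \<beta> g p p1) \<longrightarrow>
   (\<forall>x\<in>resonant_set a p p1. x \<notin> cball p \<rho> \<longrightarrow> p + p1 - x \<notin> cball p \<rho> \<longrightarrow> 0 \<le> density a \<beta> g p p1 x) \<longrightarrow>
   A \<in> sets borel \<longrightarrow> A \<subseteq> resonant_set a p p1 \<longrightarrow> (\<forall>x\<in>A. b \<le> density a \<beta> g p p1 x) \<longrightarrow>
   ennreal l \<le> ennreal b * emeasure hausdorff2 A \<longrightarrow> 0 \<le> l \<longrightarrow> l - k * \<rho> \<le> inner_integral a \<beta> g p p1)" for R1 k
 have nearE: "\<exists>k\<ge>0. near R1 k" for R1
 proof (rule inner_integral_ge_off_hole[OF a(1) \<beta>, where ?R0.0 = 1 and ?R1.0 = R1])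
  fix k assume k0: "0 \<le> k" and kI: "\<And>p p1 g \<rho> A b l. \<lbrakk>1 \<le> norm p; norm p \<le> R1; norm p1 \<le> R1; 0 < \<rho>; \<And>z. \<bar>g z\<bar> \<le> 2;
   set_integrable hausdorff2 (resonant_set a p p1) (density a \<beta> g p p1);
   \<And>x. x \<in> resonant_set a p p1 \<Longrightarrow> x \<notin> cball p \<rho> \<Longrightarrow> p + p1 - x \<notin> cball p \<rho> \<Longrightarrow> 0 \<le> density a \<beta> g p p1 x;
   A \<in> sets borel; A \<subseteq> resonant_set a p p1; \<And>x. x \<in> A \<Longrightarrow> b \<le> density a \<beta> g p p1 x;
   ennreal l \<le> ennreal b * emeasure hausdorff2 A; 0 \<le> l\<rbrakk>
  \<Longrightarrow> l - k * \<rho> \<le> inner_integral a \<beta> g p p1"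
  show "\<exists>k\<ge>0. near R1 k"
  proof (intro exI[of _ k] conjI k0)
   show "near R1 k" unfolding near_def
   proof (intro allI impI)
    fix p p1 :: "real^3" and g \<rho> A b l
    assume h: "1 \<le> norm p" "norm p \<le> R1" "norm p1 \<le> R1" "0 < \<rho>" "\<forall>z. \<bar>g z\<bar> \<le> 2"
     "set_integrable hausdorff2 (resonant_set a p p1) (density a \<beta> g p p1)"
     "\<forall>x\<in>resonant_set a p p1. x \<notin> cball p \<rho> \<longrightarrow> p + p1 - x \<notin> cball p \<rho> \<longrightarrow> 0 \<le> density a \<beta> g p p1 x"
     "A \<in> sets borel" "A \<subseteq> resonant_set a p p1" "\<forall>x\<in>A. b \<le> density a \<beta> g p p1 x"
     "ennreal l \<le> ennreal b * emeasure hausdorff2 A" "0 \<le> l"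
    show "l - k * \<rho> \<le> inner_integral a \<beta> g p p1"
     by (rule kI[OF h(1-4) _ h(6) _ h(8,9) _ h(11,12)]) (use h(5,7,10) in blast)+
   qed
  qed
 qed simp
 obtain kk where kk: "\<And>n. 0 \<le> kk n" "\<And>n. near (\<Lambda> * (P n + 1)) (kk n)"
  using choice[of "\<lambda>n k. 0 \<le> k \<and> near (\<Lambda> * (P n + 1)) k"] nearE by blast
 \<comment> \<open>a lower bound for a quarter of the main term that depends only on the hole, not on the point in it\<close>
 define \<tau> where "\<tau> n = c1 / 4 * (2 * P n) powr (- \<bar>y\<bar>)" for n
 define Z where "Z n = kk n * 3 * (v * (\<Lambda> * (P n + 1)) ^ 3)" for n
 define \<rho> where "\<rho> n = min (1/8) (\<tau> n / (Z n + 1))" for n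
 have \<tau>: "0 < \<tau> n" for n using c1 P1[of n] by (simp add: \<tau>_def)
 have Z0: "0 \<le> Z n" for n using kk(1) v La P0[of n] by (simp add: Z_def)
 have \<rho>: "0 < \<rho> n" "\<rho> n \<le> 1/8" for n
 proof -
  show "0 < \<rho> n" using \<tau>[of n] Z0[of n] by (auto simp: \<rho>_def)
  show "\<rho> n \<le> 1/8" unfolding \<rho>_def by (rule min.cobounded1)
 qed
 have \<rho>Z: "Z n * \<rho> n \<le> \<tau> n" for n
 proof -
  have "Z n * \<rho> n \<le> Z n * (\<tau> n / (Z n + 1))" using Z0 by (intro mult_left_mono) (simp_all add: \<rho>_def)
  also have "\<dots> \<le> \<tau> n" using Z0[of n] \<tau>[of n] by (simp add: field_simps)
  finally show ?thesis .
 qed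
 define f0 where "f0 x = wt s x * profile \<eta> P \<rho> x" for x
 note pf = profile_facts[of P \<rho> \<eta>, OF P1 \<rho> \<eta>]
 have f0L: "f0 \<in> Linf s"
 proof -
  have "continuous_on UNIV f0" unfolding f0_def by (intro continuous_on_mult continuous_on_wt pf(1))
  moreover have "japanese x powr s * \<bar>f0 x\<bar> \<le> 1" for x
  proof -
   have "japanese x powr s * \<bar>f0 x\<bar> = (japanese x powr s * wt s x) * \<bar>profile \<eta> P \<rho> x\<bar>"
    by (simp add: f0_def abs_mult)
   also have "japanese x powr s * wt s x = 1" by (simp add: wt_def powr_add[symmetric])
   finally show ?thesis using pf(2)[of x] pf(3)[of x] \<eta> by simp
  qed
  ultimately show ?thesis by (auto simp: Linf_def intro!: bdd_aboveI[of _ 1])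
 qed
 have growth: "c1 / 2 * (R powr (4*\<beta> + 1 - a) * dyadic_sum d (R / L2)) * wt s p \<le> collision a \<beta> g p"
  if p: "norm (p - P n *\<^sub>R axis 1 1) \<le> \<rho> n" and g: "\<And>x. \<bar>g x - f0 x\<bar> \<le> \<eta> / 4 * wt s x" and def: "collision_defined a \<beta> g p"
   and R: "R = norm p" and RL: "L2 \<le> R" for p n g R
 proof -
  note geo = hole_geometry[of P K \<rho> \<eta> s \<Lambda> p n g, OF P1 PK \<rho> \<eta> s La \<eta>1 K p, unfolded f0_def[symmetric], OF g]
  have Rn: "\<bar>R - P n\<bar> \<le> 1/8" using geo(6) by (simp add: R)
  have P128n: "128 \<le> P k" for k
  proof -
   have "128 * 1 \<le> 128 * (real k + 1)" by (intro mult_left_mono) auto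
   also have "\<dots> \<le> P k" by (rule P128)
   finally show ?thesis by simp
  qed
  have R100: "100 \<le> R" using Rn P128n[of n] by linarith
  have g2: "\<bar>g z\<bar> \<le> 2" for z using geo(1)[of z] geo(2)[of z] wt_le_1[OF s0, of z] by linarith
  define r where "r = \<Lambda> * R"
  have r0: "0 < r" and rP: "r \<le> \<Lambda> * (P n + 1)" and Rr: "R \<le> r"
  proof -
   show "0 < r" using La R100 by (simp add: r_def)
   show "r \<le> \<Lambda> * (P n + 1)" unfolding r_def using La Rn by (intro mult_left_mono; linarith)
   have "1 * R \<le> \<Lambda> * R" using La R100 by (intro mult_right_mono) auto
   then show "R \<le> r" by (simp add: r_def)
  qed
  define u where "u = kk n * (3 * \<rho> n)"
  have u0: "0 \<le> u" using kk(1)[of n] \<rho>(1)[of n] by (simp add: u_def)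
  have nonneg: "0 \<le> density a \<beta> g p p1 x" if "norm p1 \<le> r" "x \<in> resonant_set a p p1" "x \<notin> cball p (3 * \<rho> n)" "p + p1 - x \<notin> cball p (3 * \<rho> n)" for p1 x
  proof -
   have "norm p \<le> r" using Rr R by simp
   then have "norm x \<le> 2 * r" "norm (p + p1 - x) \<le> 2 * r" using resonant_norm_le[OF a(1) that(2) _ that(1)] by auto
   then have "4 * g p \<le> g x" "4 * g p \<le> g (p + p1 - x)" using that by (auto intro!: geo(5) simp: r_def R mult.assoc)
   then have "g p1 * g x * g (p + p1 - x) / 2 \<le> collision_balance g p p1 x" using geo(1) by (intro collision_balance_ge)
   moreover have "0 \<le> g p1 * g x * g (p + p1 - x) / 2" using geo(1) by (auto intro!: mult_nonneg_nonneg less_imp_le)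
   ultimately have "0 \<le> collision_balance g p p1 x" by linarith
   then show ?thesis by (simp add: density_eq)
  qed
  have nearI: "l - u \<le> inner_integral a \<beta> g p p1" if "norm p1 \<le> r" "set_integrable hausdorff2 (resonant_set a p p1) (density a \<beta> g p p1)"
   "A \<in> sets borel" "A \<subseteq> resonant_set a p p1" "\<forall>x\<in>A. b \<le> density a \<beta> g p p1 x" "ennreal l \<le> ennreal b * emeasure hausdorff2 A" "0 \<le> l" for p1 A b l
  proof -
   have "l - kk n * (3 * \<rho> n) \<le> inner_integral a \<beta> g p p1"
   proof (rule kk(2)[of n, unfolded near_def, rule_format])
    show "1 \<le> norm p" "norm p \<le> \<Lambda> * (P n + 1)" "norm p1 \<le> \<Lambda> * (P n + 1)" using R R100 Rr rP that(1) by auto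
    show "0 < 3 * \<rho> n" using \<rho>(1)[of n] by simp
   qed (use that g2 nonneg in auto)
   then show ?thesis by (simp add: u_def)
  qed
  have near: "- u \<le> inner_integral a \<beta> g p p1" if "norm p1 < r" "set_integrable hausdorff2 (resonant_set a p p1) (density a \<beta> g p p1)" for p1
   using nearI[of p1 "{}" 0 0] that by simp
  have p11: "1 \<le> norm p" using R R100 by simp
  from far[OF p11] obtain B where B: "B \<in> borel_measurable borel"
   "\<And>p1. \<Lambda> * norm p \<le> norm p1 \<Longrightarrow> (\<integral>\<^sup>+x\<in>resonant_set a p p1. ennreal (loss_weight a \<beta> s p p1 x) \<partial>hausdorff2) \<le> B p1"
   "(\<integral>\<^sup>+p1. B p1 \<partial>lborel) \<le> ennreal (C * R powr (4*\<beta> + 4 - s - a + \<kappa> - \<sigma>))" unfolding R by blast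
  define h where "h = 8 * \<eta> * wt s p"
  have h0: "0 < h" using \<eta> by (simp add: h_def)
  have farI: "ennreal (- inner_integral a \<beta> g p p1) \<le> ennreal h * B p1"
   if "r \<le> norm p1" "set_integrable hausdorff2 (resonant_set a p p1) (density a \<beta> g p p1)" for p1
  proof (rule inner_integral_ge_neg[OF that(2) h0])
   show "(\<integral>\<^sup>+x\<in>resonant_set a p p1. ennreal (loss_weight a \<beta> s p p1 x) \<partial>hausdorff2) \<le> B p1" using that(1) by (intro B(2)) (simp add: r_def R)
   show "- (h * loss_weight a \<beta> s p p1 x) \<le> density a \<beta> g p p1 x" for x
    using density_ge_loss_weight[of "- h" s p1 x p g a \<beta>] far_balance_ge[OF geo(1) geo(2) geo(3) \<eta>(1), of p1 x]
    by (simp add: h_def collision_balance_def)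
  qed
  define J where "J = {j::nat. 2 ^ j \<le> R / L2}"
  have Jfin: "finite J" unfolding J_def by (rule finite_dyadic)
  have JR: "L * (2 * 2 ^ j) \<le> R" if "j \<in> J" for j
  proof -
   have "2 ^ j * L2 \<le> R / L2 * L2" using that L2 by (intro mult_right_mono) (auto simp: J_def)
   then show ?thesis using L2 by (simp add: L2_def ac_simps)
  qed
  define l where "l j = c * (2 powr (- \<bar>xp\<bar>) * (2 ^ j) powr xp) * R powr y" for j :: nat
  have l0: "0 \<le> l j" for j using c by (simp add: l_def)
  have Jr: "2 * 2 ^ j \<le> r" if "j \<in> J" for j
  proof -
   have "1 * (2 * 2 ^ j) \<le> L * (2 * 2 ^ j)" using L nu by (intro mult_right_mono) auto
   then show ?thesis using JR[OF that] Rr by linarith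
  qed
  have main: "l j - u \<le> inner_integral a \<beta> g p p1"
   if j: "j \<in> J" and p1: "2 ^ j \<le> norm p1" "norm p1 < 2 * 2 ^ j" and op: "p \<bullet> p1 \<le> 0"
    and int: "set_integrable hausdorff2 (resonant_set a p p1) (density a \<beta> g p p1)" for j p1
  proof -
   define q where "q = norm p1"
   have q1: "1 \<le> q" unfolding q_def by (rule order_trans[OF _ p1(1)]) simp
   have LqR: "L * q \<le> R"
   proof -
    have "L * q \<le> L * (2 * 2 ^ j)" using p1 L nu by (intro mult_left_mono) (auto simp: q_def)
    then show ?thesis using JR[OF j] by linarith
   qed
   have nq: "8 * q \<le> \<nu> * q" "(4 * \<nu> + 2) * q \<le> L * q" using nu L q1 by (intro mult_right_mono; simp)+
   have R4: "4 * (\<nu> * q) + 2 * q \<le> R" using nq(2) LqR by (simp add: algebra_simps)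
   have "8 \<le> \<nu> * q" using nq q1 by linarith
   from lacunary_window[of P, OF P0 P4 this] obtain t1 t2 where t: "\<nu> * q \<le> t1" "t2 \<le> 2 * (\<nu> * q)" "t1 + \<nu> * q / 4 \<le> t2"
    and win: "\<And>n t. t1 \<le> t \<Longrightarrow> t \<le> t2 \<Longrightarrow> 1 \<le> \<bar>t - P n\<bar>" by blast
   have bal: "1/16 * (wt s p1 * wt s x * wt s (p + p1 - x)) \<le> collision_balance g p p1 x"
    if x: "x \<in> resonant_set a p p1" "t1 \<le> norm x" "norm x \<le> t2" for x
   proof -
    define yy where "yy = p + p1 - x"
    have "p + p1 - yy \<in> resonant_set a p p1" using x by (simp add: yy_def)
    have qR: "norm p \<le> R" "norm p1 \<le> R" using R4 nq q1 by (auto simp: R q_def)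
    have yu: "norm yy \<le> 2 * R" unfolding yy_def by (rule resonant_norm_le(2)[OF a(1) x(1) qR])
    have yl: "R / 2 \<le> norm yy"
    proof -
     have "norm p \<le> norm yy + norm (x - p1)" using norm_triangle_ineq[of "p + p1 - x" "x - p1"] by (simp add: yy_def)
     moreover have "norm (x - p1) \<le> norm x + norm p1" by (rule norm_triangle_ineq4)
     ultimately show ?thesis using x t R4 nq q1 by (simp add: R q_def)
    qed
    have xl: "norm x \<le> R / 2" using x t R4 nq q1 by simp
    have xp1: "1 \<le> norm (p - yy)"
    proof -
     have "norm x \<le> norm (x - p1) + norm p1" using norm_triangle_ineq[of "x - p1" p1] by simp
     moreover have "p - yy = x - p1" by (simp add: yy_def)
     ultimately show ?thesis using x t nq q1 by (simp add: q_def)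
    qed
    have hx: "2 * \<rho> k \<le> norm (x - P k *\<^sub>R axis 1 1)" for k
    proof (rule ccontr)
     assume "\<not> ?thesis"
     then have "\<bar>norm x - P k\<bar> < 1/4" by (intro geo(7)) simp
     then show False using win[of "norm x" k] x by linarith
    qed
    have hy: "2 * \<rho> k \<le> norm (yy - P k *\<^sub>R axis 1 1)" for k
    proof (rule ccontr)
     assume n: "\<not> ?thesis"
     then have yk: "\<bar>norm yy - P k\<bar> < 1/4" by (intro geo(7)) simp
     consider "k < n" | "n < k" | "k = n" by linarith
     then show False
     proof cases
      case 1
      have "128 * P k \<le> K * P k" using K1 P0 by (intro mult_right_mono) auto
      then show False using geo(8)[OF 1] yk yl Rn R100 by linarith
     next
      case 2
      have "128 * P n \<le> K * P n" using K1 P0 by (intro mult_right_mono) auto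
      then show False using geo(9)[OF 2] yk yu Rn R100 by linarith
     next
      case 3
      have "norm (p - yy) \<le> norm (p - P n *\<^sub>R axis 1 1) + norm (yy - P n *\<^sub>R axis 1 1)"
       using norm_triangle_ineq4[of "p - P n *\<^sub>R axis 1 1" "yy - P n *\<^sub>R axis 1 1"] by simp
      then show False using n 3 p xp1 \<rho>(2)[of n] by simp
     qed
    qed
    have h1: "2 * \<rho> k \<le> norm (p1 - P k *\<^sub>R axis 1 1)" for k
    proof (rule ccontr)
     assume n: "\<not> ?thesis"
     define w w1 where "w = p - P n *\<^sub>R axis 1 1" and "w1 = p1 - P k *\<^sub>R axis 1 1"
     have w: "norm w \<le> 1/8" "norm w1 \<le> 1/4" using p n \<rho>(2)[of n] \<rho>(2)[of k] by (auto simp: w_def w1_def)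
     define E where "E = (axis 1 1 :: real^3)"
     have E: "norm E = 1" "E \<bullet> E = 1" by (auto simp: E_def norm_axis_1 inner_axis_axis)
     have "p = w + P n *\<^sub>R E" "p1 = w1 + P k *\<^sub>R E" by (auto simp: w_def w1_def E_def)
     then have "p \<bullet> p1 = w \<bullet> w1 + P k * (w \<bullet> E) + P n * (E \<bullet> w1) + P n * P k"
      using E by (simp add: inner_add_left inner_add_right distrib_left mult.commute)
     moreover have "\<bar>w \<bullet> w1\<bar> \<le> 1" using Cauchy_Schwarz_ineq2[of w w1] w mult_mono[of "norm w" "1/8" "norm w1" "1/4"] by simp
     moreover have "- (P k * (w \<bullet> E)) \<le> P k / 8"
      unfolding mult_minus_right[symmetric] divide_inverse using Cauchy_Schwarz_ineq2[of w E] w E P0 by (intro mult_left_mono) (auto simp: abs_le_iff)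
     moreover have "- (P n * (E \<bullet> w1)) \<le> P n / 4"
      unfolding mult_minus_right[symmetric] divide_inverse using Cauchy_Schwarz_ineq2[of E w1] w E P0 by (intro mult_left_mono) (auto simp: abs_le_iff)
     moreover have "128 * P k \<le> P n * P k" "P n * 128 \<le> P n * P k"
      using P128n P0 by (auto intro!: mult_right_mono mult_left_mono)
     moreover have "128 \<le> P k" "128 \<le> P n" using P128n by auto
     ultimately show False using op by linarith
    qed
    have gl: "wt s p1 / 2 \<le> g p1" "wt s x / 2 \<le> g x" "wt s yy / 2 \<le> g yy" using geo(4)[OF h1] geo(4)[OF hx] geo(4)[OF hy] by auto
    have "8 * R \<le> \<Lambda> * R" using La R100 by (intro mult_right_mono) auto
    then have LR: "norm x \<le> 2 * \<Lambda> * norm p" "norm yy \<le> 2 * \<Lambda> * norm p" using xl yu R R100 by (simp_all add: mult.assoc)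
    have "norm p \<le> norm (p - x) + norm x" using norm_triangle_ineq[of "p - x" x] by simp
    then have "x \<notin> cball p (3 * \<rho> n)" "yy \<notin> cball p (3 * \<rho> n)"
     using xl R100 xp1 R \<rho>(2)[of n] by (auto simp: dist_norm)
    then have "4 * g p \<le> g x" "4 * g p \<le> g yy" using geo(5) LR by auto
    then have "g p1 * g x * g yy / 2 \<le> collision_balance g p p1 x" unfolding yy_def using geo(1) by (intro collision_balance_ge)
    moreover have "(wt s p1 / 2) * (wt s x / 2) * (wt s yy / 2) \<le> g p1 * g x * g yy"
     using gl geo(1) by (intro mult_mono mult_nonneg_nonneg) (auto intro: less_imp_le)
    ultimately show ?thesis by (simp add: yy_def)
   qed
   have "\<exists>A b. A \<in> sets borel \<and> A \<subseteq> resonant_set a p p1 \<and> (\<forall>x\<in>A. b \<le> density a \<beta> g p p1 x) \<and>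
    ennreal (c * q powr xp * R powr y) \<le> ennreal b * emeasure hausdorff2 A"
    unfolding q_def R xp_def y_def
   proof (rule shell[OF op])
    show "1 \<le> norm p1" "L * norm p1 \<le> norm p" using q1 LqR by (simp_all add: q_def R)
    show "\<nu> * norm p1 \<le> t1" "t1 + \<nu> * norm p1 / 4 \<le> t2" "t2 \<le> 2 * (\<nu> * norm p1)" using t by (simp_all add: q_def)
   qed (rule bal)
   then obtain A b where A: "A \<in> sets borel" "A \<subseteq> resonant_set a p p1" "\<forall>x\<in>A. b \<le> density a \<beta> g p p1 x"
    "ennreal (c * q powr xp * R powr y) \<le> ennreal b * emeasure hausdorff2 A"
    by blast
   have "2 powr (- \<bar>xp\<bar>) * (2 ^ j) powr xp \<le> q powr xp"
   proof (cases "0 \<le> xp")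
    case True
    have "2 powr (- \<bar>xp\<bar>) * (2 ^ j) powr xp \<le> 1 * (2 ^ j) powr xp" using powr_mono[of "- \<bar>xp\<bar>" 0 2] by (intro mult_right_mono) auto
    also have "\<dots> \<le> q powr xp" using p1 True by (simp add: q_def powr_mono2)
    finally show ?thesis .
   next
    case False
    have "2 powr (- \<bar>xp\<bar>) * (2 ^ j) powr xp = (2 * 2 ^ j) powr xp" using False by (subst powr_mult) auto
    also have "\<dots> \<le> q powr xp" using p1 False q1 by (intro powr_mono2') (auto simp: q_def)
    finally show ?thesis .
   qed
   then have "l j \<le> c * q powr xp * R powr y" unfolding l_def using c by (intro mult_right_mono mult_left_mono) auto
   then have "ennreal (l j) \<le> ennreal (c * q powr xp * R powr y)" by (rule ennreal_leI)
   then have "ennreal (l j) \<le> ennreal b * emeasure hausdorff2 A" using A(4) by (rule order_trans)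
   moreover have "norm p1 \<le> r" using p1 Jr[OF j] by linarith
   ultimately show ?thesis using int A l0 by (intro nearI) auto
  qed
  define U where "U = h * (C * R powr (4*\<beta> + 4 - s - a + \<kappa> - \<sigma>))"
  define D where "D = dyadic_sum d (R / L2)"
  have D1: "1 \<le> D" unfolding D_def using RL L2 by (intro dyadic_sum_ge_1) simp
  have R0: "0 < R" using R100 by simp
  have BU: "(\<integral>\<^sup>+p1. ennreal h * B p1 \<partial>lborel) \<le> ennreal U"
  proof -
   have "(\<integral>\<^sup>+p1. ennreal h * B p1 \<partial>lborel) = ennreal h * (\<integral>\<^sup>+p1. B p1 \<partial>lborel)" using B(1) by (intro nn_integral_cmult) simp
   also have "\<dots> \<le> ennreal h * ennreal (C * R powr (4*\<beta> + 4 - s - a + \<kappa> - \<sigma>))" by (intro mult_left_mono B(3)) simp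
   also have "\<dots> = ennreal U" unfolding U_def using h0 C by (intro ennreal_mult[symmetric]) auto
   finally show ?thesis .
  qed
  have "rpow (norm p) (2*\<beta>) * ((\<Sum>j\<in>J. l j * (3 * unit_ball_vol 3 * (2 ^ j) ^ 3)) - U - u * (unit_ball_vol 3 * r ^ 3)) \<le> collision a \<beta> g p"
  proof (rule collision_lower_assembly[OF def near u0 r0 farI _ BU _ Jfin Jr l0 main])
   show "(\<lambda>p1. ennreal h * B p1) \<in> borel_measurable borel" using B(1) by measurable
   show "0 \<le> U" using h0 C by (simp add: U_def)
  qed
  moreover have "(\<Sum>j\<in>J. l j * (3 * unit_ball_vol 3 * (2 ^ j) ^ 3)) = c1 * R powr y * D"
  proof -
   have "l j * (3 * unit_ball_vol 3 * (2 ^ j) ^ 3) = c1 * R powr y * 2 powr (j * d)" for j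
   proof -
    have "((2::real) ^ j) powr xp * (2 ^ j) ^ 3 = (2 ^ j) powr (xp + 3)" by (subst powr_add) (simp add: powr_numeral)
    also have "\<dots> = (2 powr j) powr (xp + 3)" by (simp add: powr_realpow)
    also have "\<dots> = 2 powr (j * d)" by (simp add: powr_powr xp_def d_def algebra_simps)
    finally have e: "((2::real) ^ j) powr xp * (2 ^ j) ^ 3 = 2 powr (j * d)" .
    have "l j * (3 * unit_ball_vol 3 * (2 ^ j) ^ 3) = c1 * R powr y * (((2::real) ^ j) powr xp * (2 ^ j) ^ 3)"
     by (simp add: l_def c1_def v_def)
    then show ?thesis unfolding e .
   qed
   then show ?thesis by (simp add: D_def dyadic_sum_def J_def sum_distrib_left)
  qed
  moreover have "U \<le> c1 / 4 * R powr y * D"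
  proof -
   have "wt s p \<le> R powr (-s)" using s0 R0 japanese_ge(2)[of p] by (intro wt_le) (auto simp: R)
   then have "U \<le> (8 * \<eta> * R powr (-s)) * (C * R powr (4*\<beta> + 4 - s - a + \<kappa> - \<sigma>))"
    unfolding U_def h_def using \<eta> C by (intro mult_right_mono mult_left_mono) auto
   also have "\<dots> = 8 * \<eta> * C * (R powr (-s) * R powr (4*\<beta> + 4 - s - a + \<kappa> - \<sigma>))" by simp
   also have "R powr (-s) * R powr (4*\<beta> + 4 - s - a + \<kappa> - \<sigma>) = R powr y * R powr (2*\<beta> + 3 - s + \<kappa> - \<sigma>)"
    unfolding powr_add[symmetric] by (simp add: y_def algebra_simps)
   also have "8 * \<eta> * C * (R powr y * R powr (2*\<beta> + 3 - s + \<kappa> - \<sigma>)) \<le> 8 * \<eta> * C * (R powr y * (C2 * D))"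
    unfolding D_def using \<eta> C RL by (intro mult_left_mono C2(2)) auto
   also have "\<dots> = (8 * \<eta> * C * C2) * (R powr y * D)" by simp
   also have "\<dots> \<le> c1 / 4 * (R powr y * D)" using \<eta>2 D1 by (intro mult_right_mono) auto
   finally show ?thesis by (simp add: mult.assoc)
  qed
  moreover have "u * (unit_ball_vol 3 * r ^ 3) \<le> c1 / 4 * R powr y * D"
  proof -
   have "u * (v * r ^ 3) \<le> u * (v * (\<Lambda> * (P n + 1)) ^ 3)" using u0 v rP r0 by (intro mult_left_mono power_mono) auto
   also have "\<dots> = Z n * \<rho> n" by (simp add: u_def Z_def)
   also have "\<dots> \<le> \<tau> n" by (rule \<rho>Z)
   also have "\<dots> \<le> c1 / 4 * (R powr y * 1)"
   proof -
    have "(2 * P n) powr (- \<bar>y\<bar>) \<le> R powr (- \<bar>y\<bar>)" using Rn R100 by (intro powr_mono2'; linarith)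
    also have "\<dots> \<le> R powr y" using R100 by (intro powr_mono) auto
    finally show ?thesis unfolding \<tau>_def using c1 by (intro mult_left_mono) auto
   qed
   also have "\<dots> \<le> c1 / 4 * (R powr y * D)" using c1 D1 by (intro mult_left_mono) auto
   finally show ?thesis by (simp add: v_def mult.assoc)
  qed
  ultimately have "R powr (2*\<beta>) * (c1 / 2 * R powr y * D) \<le> collision a \<beta> g p"
  proof -
   assume A: "rpow (norm p) (2*\<beta>) * ((\<Sum>j\<in>J. l j * (3 * unit_ball_vol 3 * (2 ^ j) ^ 3)) - U - u * (unit_ball_vol 3 * r ^ 3)) \<le> collision a \<beta> g p"
    "(\<Sum>j\<in>J. l j * (3 * unit_ball_vol 3 * (2 ^ j) ^ 3)) = c1 * R powr y * D"
    "U \<le> c1 / 4 * R powr y * D" "u * (unit_ball_vol 3 * r ^ 3) \<le> c1 / 4 * R powr y * D"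
   define X where "X = R powr y * D"
   have "c1 / 2 * X \<le> c1 * X - U - u * (unit_ball_vol 3 * r ^ 3)"
   proof -
    have "U \<le> (c1 * X) / 4" "u * (unit_ball_vol 3 * r ^ 3) \<le> (c1 * X) / 4" "c1 / 2 * X = (c1 * X) / 2"
     using A(3,4) by (simp_all add: X_def mult.assoc)
    then show ?thesis by linarith
   qed
   then have "R powr (2*\<beta>) * (c1 / 2 * X) \<le> R powr (2*\<beta>) * (c1 * X - U - u * (unit_ball_vol 3 * r ^ 3))" by (rule mult_left_mono) simp
   also have "\<dots> \<le> collision a \<beta> g p"
   proof -
    have rp: "rpow (norm p) (2*\<beta>) = R powr (2*\<beta>)" unfolding R[symmetric] by (rule rpow_pos[OF R0])
    have X: "c1 * R powr y * D = c1 * X" by (simp add: X_def)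
    show ?thesis using A(1) unfolding A(2) rp X .
   qed
   finally show ?thesis by (simp add: X_def mult.assoc)
  qed
  moreover have "c1 / 2 * (R powr (4*\<beta> + 1 - a) * D) * wt s p \<le> R powr (2*\<beta>) * (c1 / 2 * R powr y * D)"
  proof -
   have "wt s p \<le> R powr (-s)" using s0 R0 japanese_ge(2)[of p] by (intro wt_le) (auto simp: R)
   then have "c1 / 2 * (R powr (4*\<beta> + 1 - a) * D) * wt s p \<le> c1 / 2 * (R powr (4*\<beta> + 1 - a) * D) * R powr (-s)"
    using c1 D1 by (intro mult_left_mono) auto
   also have "\<dots> = c1 / 2 * D * (R powr (4*\<beta> + 1 - a) * R powr (-s))" by simp
   also have "R powr (4*\<beta> + 1 - a) * R powr (-s) = R powr (2*\<beta>) * R powr y"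
    unfolding powr_add[symmetric] by (simp add: y_def algebra_simps)
   also have "c1 / 2 * D * (R powr (2*\<beta>) * R powr y) = R powr (2*\<beta>) * (c1 / 2 * R powr y * D)" by simp
   finally show ?thesis .
  qed
  ultimately show ?thesis unfolding D_def by linarith
 qed
 show thesis
 proof (rule that[OF f0L, of "\<eta> / 4"])
  show "0 < \<eta> / 4" using \<eta> by simp
  fix M
  obtain R0 where R0: "L2 \<le> R0" "\<And>R. R0 \<le> R \<Longrightarrow> 2 * M / c1 \<le> R powr (4*\<beta> + 1 - a) * dyadic_sum d (R / L2)"
   using main_term_unbounded[OF L2 cond, of "2 * M / c1"] unfolding d_def by blast
  obtain n :: nat where n: "R0 + 1 \<le> real n" using real_arch_simple by blast
  show "\<exists>c r. 0 < r \<and> (\<forall>p\<in>ball c r. \<forall>g. (\<forall>x. \<bar>g x - f0 x\<bar> \<le> \<eta> / 4 * wt s x) \<longrightarrow>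
   collision_defined a \<beta> g p \<longrightarrow> M * wt s p \<le> collision a \<beta> g p)"
  proof (intro exI[of _ "P n *\<^sub>R axis 1 1"] exI[of _ "\<rho> n"] conjI ballI allI impI)
   show "0 < \<rho> n" by (rule \<rho>)
   fix p g assume p: "p \<in> ball (P n *\<^sub>R axis 1 1) (\<rho> n)" and g: "\<forall>x. \<bar>g x - f0 x\<bar> \<le> \<eta> / 4 * wt s x" and def: "collision_defined a \<beta> g p"
   have pn: "norm (p - P n *\<^sub>R axis 1 1) \<le> \<rho> n" using p by (simp add: dist_norm norm_minus_commute)
   have "P n = norm (P n *\<^sub>R (axis 1 1 :: real^3))" using P0[of n] by (simp add: norm_axis_1)
   also have "\<dots> \<le> norm p + norm (P n *\<^sub>R axis 1 1 - p)" by (rule norm_triangle_sub)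
   finally have "P n \<le> norm p + 1/8" using pn \<rho>(2)[of n] by (simp add: norm_minus_commute)
   then have R: "R0 \<le> norm p" using n P1[of n] by linarith
   have "M * wt s p = c1 / 2 * (2 * M / c1) * wt s p" using c1 by simp
   also have "\<dots> \<le> c1 / 2 * (norm p powr (4*\<beta> + 1 - a) * dyadic_sum d (norm p / L2)) * wt s p"
    using R0(2)[OF R] c1 by (intro mult_right_mono mult_left_mono) auto
   also have "\<dots> \<le> collision a \<beta> g p" using g R R0(1) by (intro growth[OF pn _ def refl]) auto
   finally show "M * wt s p \<le> collision a \<beta> g p" .
  qed
 qed
qed

section \<open>Non-existence of solutions\<close>

lemma Linf_norm_pointwise:
 assumes "f \<in> Linf s" "h \<in> Linf s" "Linf_norm s (\<lambda>x. f x - h x) \<le> e"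
 shows "\<bar>f x - h x\<bar> \<le> e * wt s x"
proof -
 obtain A where A: "\<And>x. japanese x powr s * \<bar>f x\<bar> \<le> A" using assms(1) by (auto simp: Linf_def bdd_above_def)
 obtain B where B: "\<And>x. japanese x powr s * \<bar>h x\<bar> \<le> B" using assms(2) by (auto simp: Linf_def bdd_above_def)
 have "japanese x powr s * \<bar>f x - h x\<bar> \<le> A + B" for x
 proof -
  have "japanese x powr s * \<bar>f x - h x\<bar> \<le> japanese x powr s * (\<bar>f x\<bar> + \<bar>h x\<bar>)" by (intro mult_left_mono) auto
  then show ?thesis using A[of x] B[of x] by (simp add: distrib_left)
 qed
 then have "bdd_above (range (\<lambda>x. japanese x powr s * \<bar>f x - h x\<bar>))" by (auto intro!: bdd_aboveI[of _ "A + B"])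
 then have "japanese x powr s * \<bar>f x - h x\<bar> \<le> Linf_norm s (\<lambda>x. f x - h x)"
  unfolding Linf_norm_def by (intro cSUP_upper) auto
 then have "japanese x powr s * \<bar>f x - h x\<bar> \<le> e" using assms(3) by linarith
 then have "wt s x * (japanese x powr s * \<bar>f x - h x\<bar>) \<le> wt s x * e" by (intro mult_left_mono) auto
 moreover have "wt s x * japanese x powr s = 1" by (simp add: wt_def powr_add[symmetric])
 ultimately show ?thesis by (simp add: mult.assoc[symmetric] mult.commute)
qed

text \<open>Continuity at time \<open>0\<close> in the weighted norm keeps the solution \<open>\<epsilon>\<close>-close to the datum for a while.  The
hypothesis also covers data near which the collision integral does not exist at all.\<close>

lemma no_strong_solution:
 assumes f0: "f0 \<in> Linf s" and e: "0 < \<epsilon>"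
  and grow: "\<And>M. \<exists>c r. 0 < r \<and> (\<forall>p\<in>ball c r. \<forall>g. (\<forall>x. \<bar>g x - f0 x\<bar> \<le> \<epsilon> * wt s x) \<longrightarrow>
   collision_defined a \<beta> g p \<longrightarrow> M * wt s p \<le> collision a \<beta> g p)"
  and T: "0 < T" and sol: "strong_solution a \<beta> s T f0 f" "f 0 = f0"
 shows False
proof -
 have fL: "f \<in> C_Linf T s" using sol by (simp add: strong_solution_def)
 have fu: "f u \<in> Linf s" if "u \<in> {0..T}" for u using fL that by (simp add: C_Linf_def)
 have "((\<lambda>u. Linf_norm s (\<lambda>x. f u x - f 0 x)) \<longlongrightarrow> 0) (at 0 within {0..T})" using fL T by (simp add: C_Linf_def)
 then have "\<forall>\<^sub>F u in at 0 within {0..T}. dist (Linf_norm s (\<lambda>x. f u x - f 0 x)) 0 < \<epsilon>" using e by (rule tendstoD)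
 then obtain d where d: "0 < d" "\<And>u. u \<in> {0..T} \<Longrightarrow> u \<noteq> 0 \<Longrightarrow> dist u 0 < d \<Longrightarrow> dist (Linf_norm s (\<lambda>x. f u x - f 0 x)) 0 < \<epsilon>"
  unfolding eventually_at by blast
 define t where "t = min T (d / 2)"
 have t: "0 < t" "t \<le> T" "t < d" using T d by (auto simp: t_def)
 have close: "\<bar>f u x - f0 x\<bar> \<le> \<epsilon> * wt s x" if u: "u \<in> {0..t}" for u x
 proof (cases "u = 0")
  case True then show ?thesis using sol(2) e by simp
 next
  case False
  then have "dist (Linf_norm s (\<lambda>x. f u x - f 0 x)) 0 < \<epsilon>" using u t by (intro d(2)) (auto simp: dist_real_def)
  then have "Linf_norm s (\<lambda>x. f u x - f0 x) \<le> \<epsilon>" using sol(2) by (simp add: dist_real_def)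
  then show ?thesis using u t by (intro Linf_norm_pointwise f0 fu) auto
 qed
 obtain c r where r: "0 < r" and gr: "\<And>p g. p \<in> ball c r \<Longrightarrow> (\<And>x. \<bar>g x - f0 x\<bar> \<le> \<epsilon> * wt s x) \<Longrightarrow>
   collision_defined a \<beta> g p \<Longrightarrow> 2 * \<epsilon> / t * wt s p \<le> collision a \<beta> g p"
  using grow[of "2 * \<epsilon> / t"] by blast
 define Good where "Good p \<longleftrightarrow> (AE \<tau>\<in>{0..t} in lebesgue. collision_defined a \<beta> (f \<tau>) p) \<and>
    set_integrable lebesgue {0..t} (\<lambda>\<tau>. collision a \<beta> (f \<tau>) p) \<and>
    f t p = f0 p + (LINT \<tau>:{0..t}|lebesgue. collision a \<beta> (f \<tau>) p)" for p
 have AE: "AE p in lebesgue. Good p" using sol(1) t unfolding strong_solution_def Good_def by simp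
 have ex: "\<exists>p\<in>ball c r. Good p" if "\<not> (AE p in lebesgue. p \<notin> ball c r)"
 proof (rule contrapos_np[OF that])
  assume n: "\<not> (\<exists>p\<in>ball c r. Good p)"
  from AE show "AE p in lebesgue. p \<notin> ball c r" by eventually_elim (use n in blast)
 qed
 have "\<exists>p\<in>ball c r. Good p"
 proof (rule ex, rule notI)
  assume "AE p in lebesgue. p \<notin> ball c r"
  then have "ball c r \<in> null_sets lebesgue" by (subst AE_iff_null_sets) auto
  then have "emeasure lborel (ball c r) = 0" by auto
  then show False using r unit_ball_vol_pos[of 3] by (simp add: emeasure_ball)
 qed
 then obtain p where p: "p \<in> ball c r" "Good p" by blast
 have "AE \<tau>\<in>{0..t} in lebesgue. 2 * \<epsilon> / t * wt s p \<le> collision a \<beta> (f \<tau>) p"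
 proof -
  have "AE \<tau>\<in>{0..t} in lebesgue. collision_defined a \<beta> (f \<tau>) p" using p(2) by (simp add: Good_def)
  then show ?thesis
  proof eventually_elim
   case (elim \<tau>)
   show ?case
   proof
    assume "\<tau> \<in> {0..t}"
    then show "2 * \<epsilon> / t * wt s p \<le> collision a \<beta> (f \<tau>) p" using elim close by (intro gr p) auto
   qed
  qed
 qed
 moreover have "set_integrable lebesgue {0..t} (\<lambda>\<tau>::real. 2 * \<epsilon> / t * wt s p)"
  unfolding set_integrable_def by (intro integrable_scaleR_left integrable_real_indicator) (auto simp: emeasure_lborel_Icc_eq)
 ultimately have "(LINT \<tau>:{0..t}|lebesgue. 2 * \<epsilon> / t * wt s p) \<le> (LINT \<tau>:{0..t}|lebesgue. collision a \<beta> (f \<tau>) p)"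
  using p(2) by (intro set_integral_mono_AE) (auto simp: Good_def)
 moreover have "(LINT \<tau>:{0..t}|lebesgue. 2 * \<epsilon> / t * wt s p) = 2 * \<epsilon> * wt s p"
  using t by (simp add: set_lebesgue_integral_def)
 moreover have "f t p = f0 p + (LINT \<tau>:{0..t}|lebesgue. collision a \<beta> (f \<tau>) p)" using p(2) by (simp add: Good_def)
 moreover have "\<bar>f t p - f0 p\<bar> \<le> \<epsilon> * wt s p" using t by (intro close) auto
 moreover have "0 < \<epsilon> * wt s p" using e by simp
 ultimately show False by linarith
qed

theorem theorem5p1:
 fixes a \<beta> s :: real
 assumes "1 \<le> a" and "a \<le> 5" and "0 \<le> \<beta>" and "\<beta> \<le> 1" and "0 \<le> s"
  and "\<beta> > (a - 1) / 4
    \<or> s < 4 * \<beta> + 3 - a / 2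
    \<or> (s = 4 * \<beta> + 3 - a / 2 \<and> \<beta> = (a - 1) / 4)"
 shows "\<exists>f0 \<in> Linf s. \<not> (\<exists>T>0. \<exists>f. strong_solution a \<beta> s T f0 f \<and> f 0 = f0)"
proof -
 have "\<exists>f0 \<epsilon>. f0 \<in> Linf s \<and> 0 < \<epsilon> \<and> (\<forall>M. \<exists>c r. 0 < r \<and> (\<forall>p\<in>ball c r. \<forall>g. (\<forall>x. \<bar>g x - f0 x\<bar> \<le> \<epsilon> * wt s x) \<longrightarrow>
   collision_defined a \<beta> g p \<longrightarrow> M * wt s p \<le> collision a \<beta> g p))"
 proof (cases "s \<le> 4*\<beta> + 4 - a \<or> 2 * s \<le> 6*\<beta> + 6 - a")
  case True
  show ?thesis
  proof (rule collision_undefined[OF assms(1,3,5) True])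
   fix f0 \<epsilon> c r
   assume A: "f0 \<in> Linf s" "0 < \<epsilon>" "0 < r" "\<And>p g. p \<in> ball c r \<Longrightarrow> (\<And>x. \<bar>g x - f0 x\<bar> \<le> \<epsilon> * wt s x) \<Longrightarrow> \<not> collision_defined a \<beta> g p"
   show ?thesis
    by (intro exI[of _ f0] exI[of _ \<epsilon>] conjI allI exI[of _ c] exI[of _ r] A(1-3) ballI impI) (use A(4) in blast)
  qed
 next
  case False
  then have conv: "4*\<beta> + 4 - a < s" "6*\<beta> + 6 - a < 2 * s" by auto
  show ?thesis
  proof (rule collision_growth[OF assms(1-3) conv assms(6)])
   fix f0 \<epsilon>
   assume A: "f0 \<in> Linf s" "0 < \<epsilon>" "\<And>M. \<exists>c r. 0 < r \<and> (\<forall>p\<in>ball c r. \<forall>g. (\<forall>x. \<bar>g x - f0 x\<bar> \<le> \<epsilon> * wt s x) \<longrightarrow>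
   collision_defined a \<beta> g p \<longrightarrow> M * wt s p \<le> collision a \<beta> g p)"
   show ?thesis by (intro exI[of _ f0] exI[of _ \<epsilon>] conjI allI A)
  qed
 qed
 then obtain f0 \<epsilon> where A: "f0 \<in> Linf s" "0 < \<epsilon>" "\<And>M. \<exists>c r. 0 < r \<and> (\<forall>p\<in>ball c r. \<forall>g. (\<forall>x. \<bar>g x - f0 x\<bar> \<le> \<epsilon> * wt s x) \<longrightarrow>
   collision_defined a \<beta> g p \<longrightarrow> M * wt s p \<le> collision a \<beta> g p)" by blast
 show ?thesis
 proof (rule bexI[OF _ A(1)], rule notI)
  assume "\<exists>T>0. \<exists>f. strong_solution a \<beta> s T f0 f \<and> f 0 = f0"
  then obtain T f where "0 < T" "strong_solution a \<beta> s T f0 f" "f 0 = f0" by blast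
  then show False by (rule no_strong_solution[OF A])
 qed
qed

end
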